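(* Let $y\in Y$ be the solution of the state equation for a control in $U_{ad}$ and let $y_h\in I_hv\oplus\mathring Y^h$ be a solution of the discrete state equation for a control in $U^h_{ad}$. Let $\varphi$ solve the adjoint equation $$-\operatorname{div}(A[y]\nabla\varphi)=y-y_d\ \text{ in }\Omega,\qquad\varphi=0\ \text{ on }\partial\Omega,$$ and let $\varphi_h\in\mathring Y^h$ solve the discrete adjoint equation $$\int_\Omega\nabla z_h^TA[y_h]\nabla\varphi_h=\int_\Omega(y_h-y_d)z_h\quad\text{for all }z_h\in\mathring Y^h .$$ Then there exists a constant $C>0$, independent of $h$, such that $$|\varphi-\varphi_h|_{W^1_2(\Omega)}\le C\big(h\,\|\varphi\|_{W^2_2(\Omega)}+|y-y_h|_{W^1_\infty(\Omega)}\big).$$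
   Context: Let $n=2$, $\Omega\subset\mathbb{R}^2$ open and bounded with $C^{1,1}$ boundary, and fix a finite $p>n$. $\mathring{W}^1_r(\Omega)$ is the subspace of $W^1_r(\Omega)$ of functions with zero trace; $|w|_{W^1_r(\Omega)}=\|\nabla w\|_{L^r(\Omega)}$. The boundary datum $v\in W^2_p(\Omega)$ is fixed; $\mathcal{Q}(y)=(1+|\nabla y|^2)^{1/2}$; $Y:=\{y\in W^2_p(\Omega): y-v\in\mathring W^1_\infty(\Omega)\}$; $y_d\in L^2(\Omega)$; $A[y]=\frac{1}{\mathcal{Q}(y)}\big(I-\frac{\nabla y\nabla y^T}{\mathcal{Q}(y)^2}\big)$. The state equation for a control $u$ is $-\operatorname{div}(\nabla y/\mathcal{Q}(y))=u$ in $\Omega$, $y\in Y$. $U_3\subset L^p(\Omega)$ is an open set containing $0$ on which the control-to-state map $\mathcal{S}:U_3\to Y$ (unique, twice continuously Fréchet differentiable) giving the solution $y=\mathcal{S}(u)$ is defined. Fix $B_1>1$ and $\mathbb{B}:=\{y\in Y:\|y\|_{W^2_p(\Omega)}\le B_1\}$; $C_S$ is the embedding constant of $W^2_p(\Omega)$ into $W^1_\infty(\Omega)$. For $y\in\mathbb{B}$, $T(y)=\tilde y\in Y$ solves $-(\mathcal{Q}(y)^2I-\nabla y\nabla y^T):D^2\tilde y=u\mathcal{Q}(y)^3$ in $\Omega$. $C_\Omega,B_2,B_3>0$ are fixed constants such that, whenever (a) $C_\Omega(\|v\|_{W^2_p}+B_2\|u\|_{L^p})\le B_1$ and (b) $B_3(2\|u\|_{L^p}+\|v\|_{W^2_p})<1$,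 $T$ is a contraction of $\mathbb{B}$ into itself and the solution $y\in\mathbb{B}$ of the state equation satisfies $C_S\|y\|_{W^2_p(\Omega)}\le \frac{1}{B_1(1+C_S^2B_1^2)^{1/2}}$. $U:=\{u\in L^p(\Omega):\text{(a) and (b) hold}\}\cap U_3$. $U_{ad}:=\{u\in L^2(\Omega):\|u\|_{L^p(\Omega)}\le\theta\}$, where $\theta>0$ is chosen such that $U_{ad}\subset U$. Discretization: $\mathcal{T}$ is a geometrically conforming, quasi-uniform triangulation with $\overline\Omega=\cup_{K\in\mathcal{T}}K$, $K$ closed triangles, mesh size $h$; $Y^h=\{y_h\in C^0(\overline\Omega):y_h|_K\in\mathbb{P}_1(K),K\in\mathcal{T}\}$; $\mathring Y^h=Y^h\cap\mathring W^1_\infty(\Omega)$; $U^h_{ad}=Y^h\cap U_{ad}$; $I_h$ is the Lagrange (or, for less regular functions, Scott–Zhang) interpolation operator onto $Y^h$, with $|w-I_hw|_{W^1_r(\Omega)}\le Ch|w|_{W^2_r(\Omega)}$ for $w\in W^2_r(\Omega)$, $1\le r\le\infty$. The discrete state equation for $u_h\in U^h_{ad}$ is $\int_\Omega\frac{\nabla y_h}{\mathcal{Q}(y_h)}\cdot\nabla z_h=\int_\Omega u_hz_h$ for all $z_h\in\mathring Y^h$, $y_h\in I_hv\oplus\mathring Y^h$; for small $h$ its solution exists, is unique and satisfies $\|\nabla y_h\|_{L^\infty(\Omega)}\le3C_SB_1$.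
   Formalization: No nonempty bounded domain with C^{1,1} boundary is a finite union of closed triangles, so the boundary is only assumed Lipschitz and C^{1,1} off finitely many corners; φ is taken in W^2_2(Ω), and the estimate is stated for the small h for which the discrete state facts hold. *)

theory Defs
  imports "HOL-Analysis.Analysis"
begin

text \<open>
  Functions on an open set \<open>\<Omega>\<close> are total functions on the plane of which only the values on
  \<open>\<Omega>\<close> (or on its closure) matter. Elements of Lebesgue and Sobolev spaces are functions, not
  classes, so the norms below are seminorms, and uniqueness is stated almost everywhere.
\<close>

type_synonym plane = "real ^ 2"

section \<open>Lebesgue spaces\<close>

definition Lspace :: "ennreal \<Rightarrow> plane set \<Rightarrow> (plane \<Rightarrow> 'b::euclidean_space) set" where
  "Lspace r \<Omega> = {f \<in> borel_measurable (lebesgue_on \<Omega>).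
     if r = \<infinity> then \<exists>M. AE x in lebesgue_on \<Omega>. norm (f x) \<le> M
     else integrable (lebesgue_on \<Omega>) (\<lambda>x. norm (f x) powr enn2real r)}"

text \<open>As usual for real-valued integrals, the value is meaningful only for members of the space.\<close>

definition Lnorm :: "ennreal \<Rightarrow> plane set \<Rightarrow> (plane \<Rightarrow> 'b::euclidean_space) \<Rightarrow> real" where
  "Lnorm r \<Omega> f =
     (if r = \<infinity> then Inf {M. 0 \<le> M \<and> (AE x in lebesgue_on \<Omega>. norm (f x) \<le> M)}
      else (LINT x|lebesgue_on \<Omega>. norm (f x) powr enn2real r) powr (1 / enn2real r))"

section \<open>Weak derivatives\<close>

definition grad :: "(plane \<Rightarrow> real) \<Rightarrow> plane \<Rightarrow> plane" where
  "grad f x = (\<chi> i. frechet_derivative f (at x) (axis i 1))"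

primrec Ck :: "nat \<Rightarrow> (plane \<Rightarrow> real) \<Rightarrow> bool" where
  "Ck 0 f \<longleftrightarrow> continuous_on UNIV f"
| "Ck (Suc k) f \<longleftrightarrow> f differentiable_on UNIV \<and> (\<forall>i. Ck k (\<lambda>x. grad f x $ i))"

definition test_functions :: "plane set \<Rightarrow> (plane \<Rightarrow> real) set" where
  "test_functions \<Omega> = {\<psi>. (\<forall>k. Ck k \<psi>) \<and> (\<exists>K. compact K \<and> K \<subseteq> \<Omega> \<and> (\<forall>x. x \<notin> K \<longrightarrow> \<psi> x = 0))}"

definition locally_integrable :: "plane set \<Rightarrow> (plane \<Rightarrow> 'b::euclidean_space) \<Rightarrow> bool" where
  "locally_integrable \<Omega> f \<longleftrightarrow> (\<forall>K. compact K \<and> K \<subseteq> \<Omega> \<longrightarrow> integrable (lebesgue_on K) f)"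

definition is_weak_grad :: "plane set \<Rightarrow> (plane \<Rightarrow> real) \<Rightarrow> (plane \<Rightarrow> plane) \<Rightarrow> bool" where
  "is_weak_grad \<Omega> w g \<longleftrightarrow> locally_integrable \<Omega> w \<and> locally_integrable \<Omega> g \<and>
     (\<forall>\<psi>\<in>test_functions \<Omega>.
        (LINT x|lebesgue_on \<Omega>. w x *\<^sub>R grad \<psi> x) = - (LINT x|lebesgue_on \<Omega>. \<psi> x *\<^sub>R g x))"

text \<open>The weak gradient is determined almost everywhere; some version of it is chosen.\<close>

definition wgrad :: "plane set \<Rightarrow> (plane \<Rightarrow> real) \<Rightarrow> plane \<Rightarrow> plane" where
  "wgrad \<Omega> w = (SOME g. is_weak_grad \<Omega> w g)"

definition whess :: "plane set \<Rightarrow> (plane \<Rightarrow> real) \<Rightarrow> plane \<Rightarrow> real ^ 2 ^ 2" where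
  "whess \<Omega> w x = (\<chi> i. wgrad \<Omega> (\<lambda>z. wgrad \<Omega> w z $ i) x)"

section \<open>Sobolev spaces\<close>

definition W1 :: "ennreal \<Rightarrow> plane set \<Rightarrow> (plane \<Rightarrow> real) set" where
  "W1 r \<Omega> = {w \<in> Lspace r \<Omega>. (\<exists>g. is_weak_grad \<Omega> w g) \<and> wgrad \<Omega> w \<in> Lspace r \<Omega>}"

definition W2 :: "ennreal \<Rightarrow> plane set \<Rightarrow> (plane \<Rightarrow> real) set" where
  "W2 r \<Omega> = {w \<in> W1 r \<Omega>. \<forall>i. (\<lambda>x. wgrad \<Omega> w x $ i) \<in> W1 r \<Omega>}"

definition seminorm_W1 :: "ennreal \<Rightarrow> plane set \<Rightarrow> (plane \<Rightarrow> real) \<Rightarrow> real" where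
  "seminorm_W1 r \<Omega> w = Lnorm r \<Omega> (wgrad \<Omega> w)"

definition seminorm_W2 :: "ennreal \<Rightarrow> plane set \<Rightarrow> (plane \<Rightarrow> real) \<Rightarrow> real" where
  "seminorm_W2 r \<Omega> w = Lnorm r \<Omega> (whess \<Omega> w)"

text \<open>Full norms are sums of the norms of the derivatives of each order.\<close>

definition norm_W1 :: "ennreal \<Rightarrow> plane set \<Rightarrow> (plane \<Rightarrow> real) \<Rightarrow> real" where
  "norm_W1 r \<Omega> w = Lnorm r \<Omega> w + seminorm_W1 r \<Omega> w"

definition norm_W2 :: "ennreal \<Rightarrow> plane set \<Rightarrow> (plane \<Rightarrow> real) \<Rightarrow> real" where
  "norm_W2 r \<Omega> w = norm_W1 r \<Omega> w + seminorm_W2 r \<Omega> w"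

text \<open>
  Sets of vanishing one-dimensional Hausdorff measure. For null sets the bound on the diameters
  of the covering sets in the definition of that measure may be omitted.
\<close>

definition H1_null :: "plane set \<Rightarrow> bool" where
  "H1_null A \<longleftrightarrow> (\<forall>\<epsilon>>0. \<exists>C :: nat \<Rightarrow> plane set. A \<subseteq> (\<Union>i. C i) \<and> (\<forall>i. bounded (C i)) \<and>
     summable (\<lambda>i. diameter (C i)) \<and> (\<Sum>i. diameter (C i)) < \<epsilon>)"

text \<open>
  On a bounded Lipschitz domain the trace of a function in \<open>W1 1 \<Omega>\<close>, hence in every
  \<open>W1 r \<Omega>\<close>, has at almost every boundary point \<open>x\<close> (for the one-dimensional Hausdorff measure)
  the value \<open>c\<close> for which the mean of \<open>\<bar>w - c\<bar>\<close> over \<open>\<Omega> \<inter> ball x \<rho>\<close> tends to zero.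
  For a function that is continuous up to the boundary this is its boundary value.
\<close>

definition has_trace_at :: "plane set \<Rightarrow> (plane \<Rightarrow> real) \<Rightarrow> plane \<Rightarrow> real \<Rightarrow> bool" where
  "has_trace_at \<Omega> w x c \<longleftrightarrow>
     ((\<lambda>\<rho>. (LINT z|lebesgue_on (\<Omega> \<inter> ball x \<rho>). \<bar>w z - c\<bar>) / measure lebesgue (\<Omega> \<inter> ball x \<rho>))
        \<longlongrightarrow> 0) (at_right 0)"

definition zero_trace :: "plane set \<Rightarrow> (plane \<Rightarrow> real) \<Rightarrow> bool" where
  "zero_trace \<Omega> w \<longleftrightarrow> H1_null {x \<in> frontier \<Omega>. \<not> has_trace_at \<Omega> w x 0}"

definition W1_0 :: "ennreal \<Rightarrow> plane set \<Rightarrow> (plane \<Rightarrow> real) set" where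
  "W1_0 r \<Omega> = {w \<in> W1 r \<Omega>. zero_trace \<Omega> w}"

section \<open>Regularity of the boundary\<close>

text \<open>
  Near \<open>x\<close>, in the orthonormal coordinates given by \<open>R\<close>, the set is the part of the plane
  strictly above the graph of a function with property \<open>P\<close>.
\<close>

definition graph_boundary_at :: "((real \<Rightarrow> real) \<Rightarrow> bool) \<Rightarrow> plane set \<Rightarrow> plane \<Rightarrow> bool" where
  "graph_boundary_at P \<Omega> x \<longleftrightarrow>
     (\<exists>(R :: real ^ 2 ^ 2) \<rho> \<gamma>. orthogonal_matrix R \<and> 0 < \<rho> \<and> P \<gamma> \<and>
        (\<forall>z\<in>ball x \<rho>. z \<in> \<Omega> \<longleftrightarrow> \<gamma> ((R *v (z - x)) $ 1) < (R *v (z - x)) $ 2))"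

definition lipschitz_fun :: "(real \<Rightarrow> real) \<Rightarrow> bool" where
  "lipschitz_fun \<gamma> \<longleftrightarrow> (\<exists>L. L-lipschitz_on UNIV \<gamma>)"

definition C11_fun :: "(real \<Rightarrow> real) \<Rightarrow> bool" where
  "C11_fun \<gamma> \<longleftrightarrow> (\<exists>\<gamma>'. (\<forall>t. (\<gamma> has_real_derivative \<gamma>' t) (at t)) \<and> lipschitz_fun \<gamma>')"

text \<open>
  A set whose closure is a finite union of triangles has corners. The boundary is therefore
  required to be of class C11 away from a finite set \<open>E\<close> of corners, and Lipschitz at all points;
  \<open>C11_boundary_off {} \<Omega>\<close> says that \<open>\<Omega>\<close> has a C11 boundary.
\<close>

definition C11_boundary_off :: "plane set \<Rightarrow> plane set \<Rightarrow> bool" where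
  "C11_boundary_off E \<Omega> \<longleftrightarrow>
     (\<forall>x\<in>frontier \<Omega>. graph_boundary_at lipschitz_fun \<Omega> x) \<and>
     (\<forall>x\<in>frontier \<Omega> - E. graph_boundary_at C11_fun \<Omega> x)"

section \<open>The state and adjoint equations\<close>

definition Qf :: "plane set \<Rightarrow> (plane \<Rightarrow> real) \<Rightarrow> plane \<Rightarrow> real" where
  "Qf \<Omega> y x = sqrt (1 + (norm (wgrad \<Omega> y x))\<^sup>2)"

definition outer :: "plane \<Rightarrow> real ^ 2 ^ 2" where
  "outer g = (\<chi> i j. g $ i * g $ j)"

definition Amat :: "plane set \<Rightarrow> (plane \<Rightarrow> real) \<Rightarrow> plane \<Rightarrow> real ^ 2 ^ 2" where
  "Amat \<Omega> y x =
     (1 / Qf \<Omega> y x) *\<^sub>R (mat 1 - (1 / (Qf \<Omega> y x)\<^sup>2) *\<^sub>R outer (wgrad \<Omega> y x))"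

text \<open>
  The weak form of \<open>- div F = g\<close> in \<open>\<Omega>\<close>. For square integrable \<open>F\<close> and \<open>g\<close> it makes no
  difference whether one tests with \<open>W1_0 2 \<Omega>\<close> or with the smooth functions of compact support.
\<close>

definition neg_div_eq :: "plane set \<Rightarrow> (plane \<Rightarrow> plane) \<Rightarrow> (plane \<Rightarrow> real) \<Rightarrow> bool" where
  "neg_div_eq \<Omega> F g \<longleftrightarrow>
     (\<forall>z\<in>W1_0 2 \<Omega>. (LINT x|lebesgue_on \<Omega>. F x \<bullet> wgrad \<Omega> z x) = (LINT x|lebesgue_on \<Omega>. g x * z x))"

definition state_space :: "real \<Rightarrow> plane set \<Rightarrow> (plane \<Rightarrow> real) \<Rightarrow> (plane \<Rightarrow> real) set" where
  "state_space p \<Omega> v = {y \<in> W2 (ennreal p) \<Omega>. (\<lambda>x. y x - v x) \<in> W1_0 \<infinity> \<Omega>}"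

definition state_eq ::
  "real \<Rightarrow> plane set \<Rightarrow> (plane \<Rightarrow> real) \<Rightarrow> (plane \<Rightarrow> real) \<Rightarrow> (plane \<Rightarrow> real) \<Rightarrow> bool" where
  "state_eq p \<Omega> v u y \<longleftrightarrow>
     y \<in> state_space p \<Omega> v \<and> neg_div_eq \<Omega> (\<lambda>x. (1 / Qf \<Omega> y x) *\<^sub>R wgrad \<Omega> y x) u"

definition adjoint_eq ::
  "plane set \<Rightarrow> (plane \<Rightarrow> real) \<Rightarrow> (plane \<Rightarrow> real) \<Rightarrow> (plane \<Rightarrow> real) \<Rightarrow> bool" where
  "adjoint_eq \<Omega> yd y \<phi> \<longleftrightarrow>
     \<phi> \<in> W2 2 \<Omega> \<and> \<phi> \<in> W1_0 2 \<Omega> \<and>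
     neg_div_eq \<Omega> (\<lambda>x. Amat \<Omega> y x *v wgrad \<Omega> \<phi> x) (\<lambda>x. y x - yd x)"

section \<open>The fixed point map and the control-to-state map\<close>

definition state_ball ::
  "real \<Rightarrow> plane set \<Rightarrow> (plane \<Rightarrow> real) \<Rightarrow> real \<Rightarrow> (plane \<Rightarrow> real) set" where
  "state_ball p \<Omega> v B1 = {y \<in> state_space p \<Omega> v. norm_W2 (ennreal p) \<Omega> y \<le> B1}"

text \<open>
  \<open>linearized_eq p \<Omega> v u y yt\<close> says that \<open>yt\<close> is the value at \<open>y\<close> of the fixed point map for the
  control \<open>u\<close>. The inner product of matrices is the Frobenius product.
\<close>

definition linearized_eq ::
  "real \<Rightarrow> plane set \<Rightarrow> (plane \<Rightarrow> real) \<Rightarrow> (plane \<Rightarrow> real) \<Rightarrow> (plane \<Rightarrow> real) \<Rightarrow> (plane \<Rightarrow> real) \<Rightarrow> bool"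
  where
  "linearized_eq p \<Omega> v u y yt \<longleftrightarrow> yt \<in> state_space p \<Omega> v \<and>
     (AE x in lebesgue_on \<Omega>.
        - (((Qf \<Omega> y x)\<^sup>2 *\<^sub>R mat 1 - outer (wgrad \<Omega> y x)) \<bullet> whess \<Omega> yt x) = u x * (Qf \<Omega> y x) ^ 3)"

definition is_contraction_on_ball ::
  "real \<Rightarrow> plane set \<Rightarrow> (plane \<Rightarrow> real) \<Rightarrow> (plane \<Rightarrow> real) \<Rightarrow> real \<Rightarrow> bool" where
  "is_contraction_on_ball p \<Omega> v u B1 \<longleftrightarrow>
     (\<exists>T \<kappa>. \<kappa> < 1 \<and>
        (\<forall>y\<in>state_ball p \<Omega> v B1. T y \<in> state_ball p \<Omega> v B1 \<and> linearized_eq p \<Omega> v u y (T y) \<and>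
           (\<forall>yt. linearized_eq p \<Omega> v u y yt \<longrightarrow> (AE x in lebesgue_on \<Omega>. yt x = T y x))) \<and>
        (\<forall>y1\<in>state_ball p \<Omega> v B1. \<forall>y2\<in>state_ball p \<Omega> v B1.
           norm_W2 (ennreal p) \<Omega> (\<lambda>x. T y1 x - T y2 x)
             \<le> \<kappa> * norm_W2 (ennreal p) \<Omega> (\<lambda>x. y1 x - y2 x)))"

definition small_data ::
  "real \<Rightarrow> plane set \<Rightarrow> (plane \<Rightarrow> real) \<Rightarrow> real \<Rightarrow> real \<Rightarrow> real \<Rightarrow> real \<Rightarrow> (plane \<Rightarrow> real) set" where
  "small_data p \<Omega> v B1 C\<^sub>\<Omega> B2 B3 = {u \<in> Lspace (ennreal p) \<Omega>.
     C\<^sub>\<Omega> * (norm_W2 (ennreal p) \<Omega> v + B2 * Lnorm (ennreal p) \<Omega> u) \<le> B1 \<and>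
     B3 * (2 * Lnorm (ennreal p) \<Omega> u + norm_W2 (ennreal p) \<Omega> v) < 1}"

definition admissible_controls :: "real \<Rightarrow> plane set \<Rightarrow> real \<Rightarrow> (plane \<Rightarrow> real) set" where
  "admissible_controls p \<Omega> \<theta> =
     {u \<in> Lspace 2 \<Omega>. u \<in> Lspace (ennreal p) \<Omega> \<and> Lnorm (ennreal p) \<Omega> u \<le> \<theta>}"

definition open_in_Lspace :: "ennreal \<Rightarrow> plane set \<Rightarrow> (plane \<Rightarrow> real) set \<Rightarrow> bool" where
  "open_in_Lspace r \<Omega> U \<longleftrightarrow> U \<subseteq> Lspace r \<Omega> \<and>
     (\<forall>u\<in>U. \<exists>\<epsilon>>0. \<forall>w\<in>Lspace r \<Omega>. Lnorm r \<Omega> (\<lambda>x. w x - u x) < \<epsilon> \<longrightarrow> w \<in> U)"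

text \<open>
  Bounded linear maps and twice continuous Frechet differentiability, for spaces \<open>X\<close> and \<open>Y\<close> of
  functions with seminorms \<open>nX\<close> and \<open>nY\<close>. The map \<open>S\<close> is defined on an open subset \<open>U\<close> of \<open>X\<close> and
  takes values in a translate of \<open>Y\<close>.
\<close>

definition bounded_linear_between ::
  "(plane \<Rightarrow> real) set \<Rightarrow> ((plane \<Rightarrow> real) \<Rightarrow> real) \<Rightarrow> (plane \<Rightarrow> real) set \<Rightarrow> ((plane \<Rightarrow> real) \<Rightarrow> real) \<Rightarrow>
   ((plane \<Rightarrow> real) \<Rightarrow> plane \<Rightarrow> real) \<Rightarrow> bool" where
  "bounded_linear_between X nX Y nY L \<longleftrightarrow>
     (\<forall>f\<in>X. L f \<in> Y) \<and>
     (\<forall>f\<in>X. \<forall>g\<in>X. \<forall>a b. nY (\<lambda>x. L (\<lambda>z. a * f z + b * g z) x - (a * L f x + b * L g x)) = 0) \<and>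
     (\<exists>M. \<forall>f\<in>X. nY (L f) \<le> M * nX f)"

definition twice_cont_frechet_differentiable ::
  "(plane \<Rightarrow> real) set \<Rightarrow> ((plane \<Rightarrow> real) \<Rightarrow> real) \<Rightarrow> (plane \<Rightarrow> real) set \<Rightarrow> ((plane \<Rightarrow> real) \<Rightarrow> real) \<Rightarrow>
   (plane \<Rightarrow> real) set \<Rightarrow> ((plane \<Rightarrow> real) \<Rightarrow> plane \<Rightarrow> real) \<Rightarrow> bool" where
  "twice_cont_frechet_differentiable X nX Y nY U S \<longleftrightarrow>
     (\<exists>D D2.
        (\<forall>u\<in>U. bounded_linear_between X nX Y nY (D u) \<and>
           (\<forall>\<epsilon>>0. \<exists>\<delta>>0. \<forall>w\<in>X. nX w < \<delta> \<longrightarrow>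
              nY (\<lambda>x. S (\<lambda>z. u z + w z) x - S u x - D u w x) \<le> \<epsilon> * nX w)) \<and>
        (\<forall>u\<in>U. (\<forall>w\<in>X. bounded_linear_between X nX Y nY (D2 u w)) \<and>
           (\<forall>f\<in>X. bounded_linear_between X nX Y nY (\<lambda>w. D2 u w f)) \<and>
           (\<exists>M. \<forall>w\<in>X. \<forall>f\<in>X. nY (D2 u w f) \<le> M * nX w * nX f) \<and>
           (\<forall>\<epsilon>>0. \<exists>\<delta>>0. \<forall>w\<in>X. nX w < \<delta> \<longrightarrow> (\<forall>f\<in>X.
              nY (\<lambda>x. D (\<lambda>z. u z + w z) f x - D u f x - D2 u w f x) \<le> \<epsilon> * nX w * nX f)) \<and>
           (\<forall>\<epsilon>>0. \<exists>\<delta>>0. \<forall>u'\<in>U. nX (\<lambda>z. u' z - u z) < \<delta> \<longrightarrow> (\<forall>w\<in>X. \<forall>f\<in>X.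
              nY (\<lambda>x. D2 u' w f x - D2 u w f x) \<le> \<epsilon> * nX w * nX f))))"

definition is_control_to_state_map ::
  "real \<Rightarrow> plane set \<Rightarrow> (plane \<Rightarrow> real) \<Rightarrow> (plane \<Rightarrow> real) set \<Rightarrow> ((plane \<Rightarrow> real) \<Rightarrow> plane \<Rightarrow> real) \<Rightarrow> bool"
  where
  "is_control_to_state_map p \<Omega> v U3 S \<longleftrightarrow>
     (\<forall>u\<in>U3. state_eq p \<Omega> v u (S u) \<and>
        (\<forall>y. state_eq p \<Omega> v u y \<longrightarrow> (AE x in lebesgue_on \<Omega>. y x = S u x))) \<and>
     twice_cont_frechet_differentiable
       (Lspace (ennreal p) \<Omega>) (Lnorm (ennreal p) \<Omega>)
       (W2 (ennreal p) \<Omega> \<inter> W1_0 \<infinity> \<Omega>) (norm_W2 (ennreal p) \<Omega>) U3 S"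

section \<open>Triangulations and the discrete problems\<close>

definition triangulation_of :: "plane set \<Rightarrow> plane set set \<Rightarrow> bool" where
  "triangulation_of \<Omega> \<T> \<longleftrightarrow> triangulation \<T> \<and> (\<forall>K\<in>\<T>. 2 simplex K) \<and> \<Union>\<T> = closure \<Omega>"

definition mesh_size :: "plane set set \<Rightarrow> real" where
  "mesh_size \<T> = Max (diameter ` \<T>)"

definition quasi_uniform :: "plane set set set \<Rightarrow> bool" where
  "quasi_uniform \<TT> \<longleftrightarrow> (\<exists>\<sigma>>0. \<forall>\<T>\<in>\<TT>. \<forall>K\<in>\<T>. \<exists>c. cball c (\<sigma> * mesh_size \<T>) \<subseteq> K)"

definition Yh :: "plane set \<Rightarrow> plane set set \<Rightarrow> (plane \<Rightarrow> real) set" where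
  "Yh \<Omega> \<T> = {q. continuous_on (closure \<Omega>) q \<and> (\<forall>K\<in>\<T>. \<exists>a b. \<forall>x\<in>K. q x = a + b \<bullet> x)}"

definition Yh_0 :: "plane set \<Rightarrow> plane set set \<Rightarrow> (plane \<Rightarrow> real) set" where
  "Yh_0 \<Omega> \<T> = Yh \<Omega> \<T> \<inter> W1_0 \<infinity> \<Omega>"

text \<open>
  The Lagrange interpolant takes nodal values of the representative that is continuous up to the
  boundary. In the plane every function in \<open>W2 r \<Omega>\<close> with \<open>1 \<le> r\<close> has one.
\<close>

definition lagrange_interp :: "plane set \<Rightarrow> plane set set \<Rightarrow> (plane \<Rightarrow> real) \<Rightarrow> plane \<Rightarrow> real" where
  "lagrange_interp \<Omega> \<T> w = (SOME q. q \<in> Yh \<Omega> \<T> \<and>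
     (\<exists>w'. continuous_on (closure \<Omega>) w' \<and> (AE x in lebesgue_on \<Omega>. w' x = w x) \<and>
        (\<forall>K\<in>\<T>. \<forall>a. a extreme_point_of K \<longrightarrow> q a = w' a)))"

definition discrete_state_eq ::
  "plane set \<Rightarrow> plane set set \<Rightarrow> (plane \<Rightarrow> real) \<Rightarrow> (plane \<Rightarrow> real) \<Rightarrow> (plane \<Rightarrow> real) \<Rightarrow> bool" where
  "discrete_state_eq \<Omega> \<T> v u\<^sub>h y\<^sub>h \<longleftrightarrow>
     (\<lambda>x. y\<^sub>h x - lagrange_interp \<Omega> \<T> v x) \<in> Yh_0 \<Omega> \<T> \<and>
     (\<forall>z\<in>Yh_0 \<Omega> \<T>.
        (LINT x|lebesgue_on \<Omega>. ((1 / Qf \<Omega> y\<^sub>h x) *\<^sub>R wgrad \<Omega> y\<^sub>h x) \<bullet> wgrad \<Omega> z x)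
          = (LINT x|lebesgue_on \<Omega>. u\<^sub>h x * z x))"

definition discrete_adjoint_eq ::
  "plane set \<Rightarrow> plane set set \<Rightarrow> (plane \<Rightarrow> real) \<Rightarrow> (plane \<Rightarrow> real) \<Rightarrow> (plane \<Rightarrow> real) \<Rightarrow> bool" where
  "discrete_adjoint_eq \<Omega> \<T> yd y\<^sub>h \<phi>\<^sub>h \<longleftrightarrow>
     \<phi>\<^sub>h \<in> Yh_0 \<Omega> \<T> \<and>
     (\<forall>z\<in>Yh_0 \<Omega> \<T>.
        (LINT x|lebesgue_on \<Omega>. wgrad \<Omega> z x \<bullet> (Amat \<Omega> y\<^sub>h x *v wgrad \<Omega> \<phi>\<^sub>h x))
          = (LINT x|lebesgue_on \<Omega>. (y\<^sub>h x - yd x) * z x))"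

end

theory Submission
  imports Defs
begin

text \<open>
  Let \<open>P\<close> be the nodal interpolant of \<open>\<phi>\<close>. The coefficient matrix \<open>A[y\<^sub>h]\<close> is uniformly coercive because
  the gradients of the discrete states are bounded, so testing both adjoint equations with the
  discrete function \<open>P - \<phi>\<^sub>h\<close> bounds \<open>|P - \<phi>\<^sub>h|\<close> by the interpolation error, by
  \<open>\<parallel>A[y] - A[y\<^sub>h]\<parallel> |\<phi>|\<close> and, through the Poincare inequality for discrete functions, by \<open>\<parallel>y - y\<^sub>h\<parallel>\<close>.
  Here \<open>A\<close> is Lipschitz in the gradient, and \<open>|\<phi>|\<close> is bounded by data up to the interpolation error
  by testing the adjoint equation with \<open>P\<close>, which avoids the Poincare inequality for \<open>\<phi>\<close> itself.

  The functions \<open>y\<close> and \<open>\<phi>\<close> are only given almost everywhere, and their traces by integral means, whereas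
  interpolation refers to point values. An integral representation over a small cone (a parallelogram)
  shows that a function with integrable second derivatives has a representative that is continuous up
  to a Lipschitz boundary. Hence \<open>P\<close> vanishes on the boundary, and \<open>y - y\<^sub>h\<close> vanishes at the boundary
  vertices, so that its supremum is bounded by its Lipschitz constant.
\<close>

section \<open>Smooth functions of one variable\<close>

text \<open>Weak derivatives are known only through test functions, so \<open>w\<close> cannot
  simply be integrated along lines: the one-variable identity behind the representation is proved
  for test functions and transposed by Fubini. For the representation and for uniqueness of weak
  gradients, tensor products \<open>F (\<alpha> \<bullet> x) * G (\<beta> \<bullet> x)\<close>
  suffice, so that smoothness stays a matter of one variable. Each direction of the parallelogram is
  integrated once, which produces bounded kernels; against these, integrability of the mixed
  derivative is enough for continuity.

  \<open>wgrad\<close> is a choice, hence linear only almost everywhere, and each algebraic step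
  with gradients passes through uniqueness.

  Once |\<phi>| is replaced by data plus interpolation error, its product with the coefficient error
  is quadratic in the errors. The factor from \<open>y - y_h\<close> is kept as an error next to the
  data and bounded by a constant next to the interpolation error. All states obey gradient bounds in
  terms of \<open>C\<^sub>S * B1\<close>, which makes the constant independent of the
  controls.\<close>

primrec diff_k :: "nat \<Rightarrow> (real \<Rightarrow> real) \<Rightarrow> bool" where
  "diff_k 0 F \<longleftrightarrow> continuous_on UNIV F"
| "diff_k (Suc k) F \<longleftrightarrow> (\<exists>F'. (\<forall>x. (F has_real_derivative F' x) (at x)) \<and> diff_k k F')"

definition smooth1 :: "(real \<Rightarrow> real) \<Rightarrow> bool" where
  "smooth1 F \<longleftrightarrow> (\<forall>k. diff_k k F)"

lemma diff_k_SucD: "diff_k (Suc k) F \<Longrightarrow> diff_k k F"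
proof (induction k arbitrary: F)
  case 0
  then show ?case unfolding diff_k.simps
    by (elim exE conjE) (rule DERIV_continuous_on, rule has_field_derivative_at_within, erule allE)
next
  case (Suc k)
  then obtain F' where F': "\<forall>x. (F has_real_derivative F' x) (at x)" "diff_k (Suc k) F'"
    by (metis diff_k.simps(2))
  then show ?case using Suc.IH[of F'] by auto
qed

text \<open>Each order of differentiability comes with its own derivative; uniqueness of derivatives
  makes all of them one function.\<close>

lemma smooth1_deriv:
  assumes "smooth1 F"
  obtains F' where "\<And>x. (F has_real_derivative F' x) (at x)" "smooth1 F'"
proof -
  obtain F' where F': "\<forall>x. (F has_real_derivative F' x) (at x)"
    using assms unfolding smooth1_def by (metis diff_k.simps(2))
  have "diff_k k F'" for k
  proof -
    obtain G where "\<forall>x. (F has_real_derivative G x) (at x)" "diff_k k G"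
      using assms unfolding smooth1_def by (metis diff_k.simps(2))
    moreover have "G = F'" using calculation F' DERIV_unique by blast
    ultimately show ?thesis by simp
  qed
  then show ?thesis using that F' unfolding smooth1_def by blast
qed

lemma smooth1I_deriv:
  assumes "\<And>x. (F has_real_derivative F' x) (at x)" "smooth1 F'"
  shows "smooth1 F"
  unfolding smooth1_def
proof
  fix k
  have "diff_k (Suc k) F" using assms unfolding smooth1_def by auto
  then show "diff_k k F" by (rule diff_k_SucD)
qed

lemma smooth1_continuous: "smooth1 F \<Longrightarrow> continuous_on A F"
  unfolding smooth1_def by (metis diff_k.simps(1) continuous_on_subset subset_UNIV)

lemma diff_k_affine_comp: "diff_k k F \<Longrightarrow> diff_k k (\<lambda>x. F (c * x + d))"
proof (induction k arbitrary: F)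
  case 0
  then show ?case
    by (auto intro!: continuous_on_compose2[where f="\<lambda>x. c * x + d" and g=F and t=UNIV] continuous_intros)
next
  case (Suc k)
  then obtain F' where F': "\<forall>x. (F has_real_derivative F' x) (at x)" "diff_k k F'" by auto
  \<comment> \<open>The chain rule leaves the constant factor \<open>c\<close>, so closure under
    constant multiples is proved on the side.\<close>
  have sc: "diff_k k G \<Longrightarrow> diff_k k (\<lambda>x. c * G x)" for G
  proof (induction k arbitrary: G)
    case (Suc k)
    then obtain G' where "\<forall>x. (G has_real_derivative G' x) (at x)" "diff_k k G'" by auto
    then show ?case using Suc.IH[of G'] DERIV_cmult[of G] by (auto intro!: exI[where x="\<lambda>x. c * G' x"])
  qed (auto intro!: continuous_intros)
  have "((\<lambda>x. F (c * x + d)) has_real_derivative c * F' (c * x + d)) (at x)" for x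
  proof -
    have "((\<lambda>x. c * x + d) has_real_derivative c) (at x)" by (auto intro!: derivative_eq_intros)
    from DERIV_chain'[OF this F'(1)[rule_format]] show ?thesis by (simp add: mult.commute)
  qed
  then show ?case using sc[OF Suc.IH[OF F'(2)]]
    by (auto intro!: exI[where x="\<lambda>x. c * F' (c * x + d)"])
qed

lemma diff_k_add: "diff_k k F \<Longrightarrow> diff_k k G \<Longrightarrow> diff_k k (\<lambda>x. F x + G x)"
proof (induction k arbitrary: F G)
  case (Suc k)
  then obtain F' G' where "\<forall>x. (F has_real_derivative F' x) (at x)" "diff_k k F'"
      "\<forall>x. (G has_real_derivative G' x) (at x)" "diff_k k G'" by auto
  then show ?case
    using Suc.IH[of F' G'] DERIV_add[of F _ _ _ G] by (auto intro!: exI[where x="\<lambda>x. F' x + G' x"])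
qed (auto intro!: continuous_intros)

text \<open>The product rule differentiates one factor at a time; the undifferentiated factor is
  lowered to the same order by \<open>diff_k_SucD\<close>.\<close>

lemma diff_k_mult: "diff_k k F \<Longrightarrow> diff_k k G \<Longrightarrow> diff_k k (\<lambda>x. F x * G x)"
proof (induction k arbitrary: F G)
  case (Suc k)
  then obtain F' G' where d: "\<forall>x. (F has_real_derivative F' x) (at x)" "diff_k k F'"
      "\<forall>x. (G has_real_derivative G' x) (at x)" "diff_k k G'" by auto
  have "((\<lambda>x. F x * G x) has_real_derivative F' x * G x + F x * G' x) (at x)" for x
    using d by (auto intro!: derivative_eq_intros)
  moreover have "diff_k k (\<lambda>x. F' x * G x + F x * G' x)"
    by (intro diff_k_add Suc.IH d diff_k_SucD[OF Suc.prems(1)] diff_k_SucD[OF Suc.prems(2)])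
  ultimately show ?case by (auto intro!: exI[where x="\<lambda>x. F' x * G x + F x * G' x"])
qed (auto intro!: continuous_intros)

lemma diff_k_const: "diff_k k (\<lambda>x. c)"
  by (induction k arbitrary: c) (auto intro!: exI[where x="\<lambda>_. 0"])

lemma smooth1_affine_comp: "smooth1 F \<Longrightarrow> smooth1 (\<lambda>x. F (c * x + d))"
  unfolding smooth1_def by (blast intro: diff_k_affine_comp)

lemma smooth1_add: "smooth1 F \<Longrightarrow> smooth1 G \<Longrightarrow> smooth1 (\<lambda>x. F x + G x)"
  unfolding smooth1_def by (blast intro: diff_k_add)

lemma smooth1_mult: "smooth1 F \<Longrightarrow> smooth1 G \<Longrightarrow> smooth1 (\<lambda>x. F x * G x)"
  unfolding smooth1_def by (blast intro: diff_k_mult)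

lemma smooth1_const: "smooth1 (\<lambda>x. c)"
  unfolding smooth1_def by (blast intro: diff_k_const)

lemma smooth1_diff: "smooth1 F \<Longrightarrow> smooth1 G \<Longrightarrow> smooth1 (\<lambda>x. F x - G x)"
  using smooth1_add[of F "\<lambda>x. (-1) * G x"] smooth1_mult[OF smooth1_const[of "-1"], of G] by simp

lemma smooth1_shift: "smooth1 F \<Longrightarrow> smooth1 (\<lambda>x. F (x - r))"
  using smooth1_affine_comp[of F 1 "-r"] by simp

lemma smooth1_divide: "smooth1 F \<Longrightarrow> smooth1 (\<lambda>x. F x / r)"
  using smooth1_mult[OF smooth1_const[of "1/r"], of F] by simp

text \<open>For \<open>q = 1\<close> this is the classical function exp (-1/t), flat at 0. The
  polynomial in 1/t makes the family closed under differentiation, so that smoothness follows by one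
  induction for all \<open>q\<close> together.\<close>

definition flat_fun :: "real poly \<Rightarrow> real \<Rightarrow> real" where
  "flat_fun q t = (if t > 0 then poly q (1 / t) * exp (- (1 / t)) else 0)"

lemma poly_exp_tendsto_0:
  fixes q :: "real poly"
  shows "((\<lambda>u. poly q u * exp (- u)) \<longlongrightarrow> 0) at_top"
proof (induction q)
  case 0
  then show ?case by simp
next
  case (pCons a q)
  have "((\<lambda>u. poly r (u::real) * exp (- u)) \<longlongrightarrow> 0) at_top" for r
  proof -
    have "((\<lambda>u. \<Sum>i\<le>degree r. coeff r i * (u ^ i / exp u)) \<longlongrightarrow> (\<Sum>i\<le>degree r. coeff r i * 0)) at_top"
      by (intro tendsto_intros tendsto_power_div_exp_0)
    then show ?thesis
      by (simp add: poly_altdef sum_distrib_right exp_minus divide_inverse mult.assoc)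
  qed
  then show ?case .
qed

lemma flat_fun_tendsto_0: "(flat_fun q \<longlongrightarrow> 0) (at_right 0)"
proof -
  have "((\<lambda>t. poly q (inverse t) * exp (- inverse t)) \<longlongrightarrow> 0) (at_right 0)"
    by (rule filterlim_compose[OF poly_exp_tendsto_0 filterlim_inverse_at_top_right])
  then show ?thesis
    by (rule Lim_transform_eventually)
      (auto simp: flat_fun_def inverse_eq_divide eventually_at_right_less intro!: eventually_at_rightI[of 0 1])
qed

text \<open>With u = 1/t, the derivative of q(u) exp (-u) with respect to t is u^2 (q - q')(u) exp
  (-u), and \<open>[:0, 0, 1:]\<close> is the factor u^2. At 0 the difference quotient is again a
  member of the family and tends to 0.\<close>

lemma flat_fun_has_derivative:
  "(flat_fun q has_real_derivative flat_fun (([:0, 0, 1:]) * (q - pderiv q)) t) (at t)"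
proof -
  consider "t > 0" | "t < 0" | "t = 0" by linarith
  then show ?thesis
  proof cases
    case 1
    have d: "((\<lambda>t. 1 / t) has_real_derivative - (1 / t\<^sup>2)) (at t)"
      using 1 by (auto intro!: derivative_eq_intros simp: power2_eq_square)
    have "((\<lambda>t. poly q (1 / t) * exp (- (1 / t))) has_real_derivative
        (poly (pderiv q) (1 / t) * - (1 / t\<^sup>2)) * exp (- (1 / t)) + (exp (- (1 / t)) * - (- (1 / t\<^sup>2))) * poly q (1 / t)) (at t)"
      by (intro DERIV_mult DERIV_chain'[OF d poly_DERIV] DERIV_fun_exp DERIV_minus d)
    moreover have "(poly (pderiv q) (1 / t) * - (1 / t\<^sup>2)) * exp (- (1 / t)) + (exp (- (1 / t)) * - (- (1 / t\<^sup>2))) * poly q (1 / t)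
        = flat_fun ([:0, 0, 1:] * (q - pderiv q)) t"
      using 1 by (simp add: flat_fun_def power2_eq_square algebra_simps)
    ultimately have "((\<lambda>t. poly q (1 / t) * exp (- (1 / t))) has_real_derivative
        flat_fun ([:0, 0, 1:] * (q - pderiv q)) t) (at t)" by simp
    then show ?thesis
      by (rule has_field_derivative_transform_within_open[where S="{0<..}"]) (use 1 in \<open>auto simp: flat_fun_def\<close>)
  next
    case 2
    have "((\<lambda>t. 0) has_real_derivative 0) (at t)" by simp
    then have "(flat_fun q has_real_derivative 0) (at t)"
      by (rule has_field_derivative_transform_within_open[where S="{..<0}"]) (use 2 in \<open>auto simp: flat_fun_def\<close>)
    then show ?thesis using 2 by (simp add: flat_fun_def)
  next
    case 3
    have eq: "(flat_fun q (0 + h) - flat_fun q 0) / h = flat_fun (q * [:0, 1:]) h" for h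
      by (simp add: flat_fun_def)
    have "(flat_fun (q * [:0, 1:]) \<longlongrightarrow> 0) (at_left 0)"
      by (rule Lim_transform_eventually[OF tendsto_const])
        (auto simp: flat_fun_def intro!: eventually_at_leftI[of "-1"])
    then have "(flat_fun (q * [:0, 1:]) \<longlongrightarrow> 0) (at 0)"
      using flat_fun_tendsto_0 by (auto simp: filterlim_split_at_real)
    then have "(flat_fun q has_real_derivative 0) (at 0)"
      unfolding DERIV_def eq .
    then show ?thesis using 3 by (simp add: flat_fun_def)
  qed
qed

lemma smooth1_flat_fun: "smooth1 (flat_fun q)"
  unfolding smooth1_def
proof
  fix k show "diff_k k (flat_fun q)"
  proof (induction k arbitrary: q)
    case 0
    show ?case
      unfolding diff_k.simps
      by (rule DERIV_continuous_on, rule has_field_derivative_at_within, rule flat_fun_has_derivative)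
  next
    case (Suc k)
    then show ?case unfolding diff_k.simps using flat_fun_has_derivative by blast
  qed
qed

subsection \<open>Test functions\<close>

definition test1 :: "real \<Rightarrow> real \<Rightarrow> (real \<Rightarrow> real) \<Rightarrow> bool" where
  "test1 a b F \<longleftrightarrow> smooth1 F \<and> (\<forall>x. x \<notin> {a..b} \<longrightarrow> F x = 0)"

text \<open>As \<open>n\<close> grows, these functions increase to the indicator function of the open interval.\<close>

definition bump :: "nat \<Rightarrow> real \<Rightarrow> real \<Rightarrow> real \<Rightarrow> real" where
  "bump n a b x = flat_fun 1 (real (Suc n) * (x - a)) * flat_fun 1 (real (Suc n) * (b - x))"

lemma flat_fun_nonpos: "t \<le> 0 \<Longrightarrow> flat_fun q t = 0"
  by (simp add: flat_fun_def)

lemma bump_test1: "test1 a b (bump n a b)"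
proof -
  have "smooth1 (\<lambda>x. flat_fun 1 (real (Suc n) * x + (- real (Suc n) * a)) *
                     flat_fun 1 ((- real (Suc n)) * x + real (Suc n) * b))"
    by (intro smooth1_mult smooth1_affine_comp smooth1_flat_fun)
  then have "smooth1 (bump n a b)"
    unfolding bump_def by (simp add: algebra_simps)
  moreover have "bump n a b x = 0" if "x \<notin> {a..b}" for x
  proof -
    have "real (Suc n) * (x - a) \<le> 0 \<or> real (Suc n) * (b - x) \<le> 0"
      using that by (auto simp: mult_le_0_iff)
    then show ?thesis unfolding bump_def
      by (elim disjE) (simp_all only: flat_fun_nonpos mult_zero_left mult_zero_right)
  qed
  ultimately show ?thesis unfolding test1_def by blast
qed

lemma flat_fun_1_bounds: "0 \<le> flat_fun 1 t" "flat_fun 1 t \<le> 1"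
  by (auto simp: flat_fun_def)

lemma bump_bounds: "0 \<le> bump n a b x" "bump n a b x \<le> 1"
  unfolding bump_def by (auto intro!: mult_nonneg_nonneg mult_le_one flat_fun_1_bounds)

lemma bump_pos: "a < x \<Longrightarrow> x < b \<Longrightarrow> 0 < bump n a b x"
  unfolding bump_def flat_fun_def by simp

text \<open>For positive \<open>t\<close> the value is exp (-1 / ((n + 1) t)), whose exponent tends
  to 0.\<close>

lemma flat_fun_scaled_tendsto: "(\<lambda>n. flat_fun 1 (real (Suc n) * t)) \<longlonglongrightarrow> (if t > 0 then 1 else 0)"
proof (cases "t > 0")
  case True
  have "(\<lambda>n. exp (- (inverse t * inverse (real (Suc n))))) \<longlonglongrightarrow> exp (- (inverse t * 0))"
    by (intro tendsto_intros LIMSEQ_inverse_real_of_nat)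
  moreover have "flat_fun 1 (real (Suc n) * t) = exp (- (inverse t * inverse (real (Suc n))))" for n
    unfolding flat_fun_def using True by (simp add: inverse_eq_divide del: of_nat_Suc)
  ultimately show ?thesis using True by simp
next
  case False
  then have "real (Suc n) * t \<le> 0" for n by (simp add: mult_le_0_iff)
  then have "flat_fun 1 (real (Suc n) * t) = 0" for n by (rule flat_fun_nonpos)
  then show ?thesis using False by simp
qed

lemma bump_tendsto: "(\<lambda>n. bump n a b x) \<longlonglongrightarrow> indicator {a<..<b} x"
proof -
  have "(\<lambda>n. bump n a b x) \<longlonglongrightarrow> (if x - a > 0 then 1 else 0) * (if b - x > 0 then 1 else 0)"
    unfolding bump_def by (intro tendsto_mult flat_fun_scaled_tendsto)
  then show ?thesis by (auto simp: indicator_def split: if_splits)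
qed

lemma test1_deriv:
  assumes "test1 a b F"
  obtains F' where "\<And>x. (F has_real_derivative F' x) (at x)" "test1 a b F'"
proof -
  obtain F' where F': "\<And>x. (F has_real_derivative F' x) (at x)" "smooth1 F'"
    using assms smooth1_deriv unfolding test1_def by metis
  have "F' x = 0" if "x \<notin> {a..b}" for x
  proof -
    have "((\<lambda>x. 0) has_real_derivative 0) (at x)" by simp
    then have "(F has_real_derivative 0) (at x)"
      by (rule has_field_derivative_transform_within_open[where S="- {a..b}"])
        (use that assms in \<open>auto simp: test1_def open_Compl\<close>)
    then show ?thesis using F'(1) DERIV_unique by blast
  qed
  then show ?thesis using that F' unfolding test1_def by blast
qed

section \<open>Antiderivatives and translates of test functions\<close>

lemma antiderivative:
  fixes F :: "real \<Rightarrow> real"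
  assumes c: "continuous_on UNIV F" and z: "\<And>x. x < a \<Longrightarrow> F x = 0"
  obtains G where "\<And>x. (G has_real_derivative F x) (at x)" "\<And>x. x \<le> a \<Longrightarrow> G x = 0"
proof
  define G where "G = (\<lambda>x. integral {a..x} F)"
  have cs: "continuous_on A F" for A using c continuous_on_subset by blast
  then have int: "F integrable_on {u..v}" for u v by (rule integrable_continuous_interval)
  \<comment> \<open>Continuity from the left adds the point \<open>a\<close> itself to the region
    where \<open>F\<close> is known to vanish.\<close>
  have Fa: "F x = 0" if "x \<le> a" for x
  proof -
    have "continuous (at_left a) F"
      using c by (simp add: continuous_at_imp_continuous_at_within continuous_on_eq_continuous_at)
    then have "(F \<longlongrightarrow> F a) (at_left a)" by (simp add: continuous_within)
    moreover have "(F \<longlongrightarrow> 0) (at_left a)"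
      by (rule Lim_transform_eventually[OF tendsto_const])
        (auto simp: z intro!: eventually_at_leftI[of "a-1"])
    ultimately have "F a = 0" using tendsto_unique trivial_limit_at_left_real by blast
    then show ?thesis using that z by (cases "x = a") auto
  qed
  have Gz: "G x = 0" if "x \<le> a" for x unfolding G_def using that
    by (cases "x = a") auto
  \<comment> \<open>The base point may be moved to the left of both \<open>a\<close> and
    \<open>x\<close>, so that \<open>x\<close> becomes an interior point of the interval of
    integration and the derivative there is two-sided.\<close>
  have "G x = integral {u..x} F" if "u \<le> a" "u \<le> x" for u x
  proof (cases "a \<le> x")
    case True
    have "integral {u..x} F = integral {u..a} F + integral {a..x} F"
      using True that int by (simp add: Henstock_Kurzweil_Integration.integral_combine)
    moreover have "integral {u..a} F = integral {u..a} (\<lambda>_. 0)"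
      by (rule integral_cong) (use Fa in auto)
    ultimately show ?thesis by (simp add: G_def)
  next
    case False
    have "integral {u..x} F = integral {u..x} (\<lambda>_. 0)"
      by (rule integral_cong) (use False Fa in auto)
    then show ?thesis using Gz False by simp
  qed
  note G_eq = this
  show "(G has_real_derivative F x) (at x)" for x
  proof -
    define u v where "u = min a x - 1" and "v = x + 1"
    have "((\<lambda>t. integral {u..t} F) has_real_derivative F x) (at x within {u..v})"
      by (rule integral_has_real_derivative[OF cs]) (auto simp: u_def v_def)
    then have "((\<lambda>t. integral {u..t} F) has_real_derivative F x) (at x)"
      by (subst (asm) at_within_Icc_at) (auto simp: u_def v_def)
    then show ?thesis
      by (rule has_field_derivative_transform_within_open[where S="{u<..}"])
        (auto simp: u_def intro!: G_eq[symmetric])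
  qed
  show "\<And>x. x \<le> a \<Longrightarrow> G x = 0" by (rule Gz)
qed

lemma DERIV_zero_ge_constant:
  fixes H :: "real \<Rightarrow> real"
  assumes "\<And>x. x \<ge> b \<Longrightarrow> (H has_real_derivative 0) (at x)" "x \<ge> b"
  shows "H x = H b"
proof (cases "x = b")
  case False
  have "\<exists>z. b < z \<and> z < x \<and> H x - H b = (x - b) * 0"
    by (rule MVT2) (use assms False in auto)
  then show ?thesis by auto
qed simp

text \<open>To the right of \<open>b\<close> the function \<open>G\<close> is constant, but in
  general not zero; subtracting a translate cancels the constant and restores compact
  support.\<close>

lemma antideriv_difference_test1:
  assumes F: "test1 a b F" and ab: "a \<le> b" and r: "0 \<le> r"
    and G: "\<And>x. (G has_real_derivative F x) (at x)" "\<And>x. x \<le> a \<Longrightarrow> G x = 0"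
  shows "test1 a (b + r) (\<lambda>x. G x - G (x - r))"
proof -
  have sG: "smooth1 G" using G F smooth1I_deriv unfolding test1_def by blast
  have Fb: "F x = 0" if "x > b" for x using F that by (auto simp: test1_def)
  have "G x = G (x - r)" if "x > b + r" for x
  proof (cases "r = 0")
    case False
    then have "\<exists>z. x - r < z \<and> z < x \<and> G x - G (x - r) = (x - (x - r)) * F z"
      using r by (intro MVT2) (auto intro: G)
    then show ?thesis using Fb that r False by force
  qed simp
  then show ?thesis
    unfolding test1_def using sG G(2) r
    by (auto intro!: smooth1_diff smooth1_shift)
qed

text \<open>
  Decomposition \<open>F = M + N'\<close> into smooth functions of compact support, where \<open>M\<close> and \<open>N\<close> are the
  convolutions of \<open>F\<close> with the kernels \<open>1 / r\<close> and \<open>1 - s / r\<close> on \<open>{0..r}\<close>. It is dual to the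
  representation of \<open>w x\<close> as the integral of \<open>- ((1 - s / r) * w (x + s))'\<close> over \<open>{0..r}\<close>.
\<close>

lemma averaging_decomposition:
  assumes F: "test1 a b F" and ab: "a \<le> b" and r: "0 < r"
  obtains M N N' where "test1 a (b + r) M" "test1 a (b + r) N" 
    "\<And>x. (N has_real_derivative N' x) (at x)"
    "\<And>x. F x = M x + N' x"
    "\<And>s. ((\<lambda>x. (1 / r) * F x) has_integral M s) {s - r..s}"
    "\<And>s. ((\<lambda>x. (1 - (s - x) / r) * F x) has_integral N s) {s - r..s}"
proof -
  have cF: "continuous_on UNIV F" using F smooth1_continuous unfolding test1_def by blast
  obtain G where G: "\<And>x. (G has_real_derivative F x) (at x)" "\<And>x. x \<le> a \<Longrightarrow> G x = 0"
    using antiderivative[OF cF, of a] F unfolding test1_def by (metis atLeastAtMost_iff not_le)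
  have sG: "smooth1 G" using G F smooth1I_deriv unfolding test1_def by blast
  obtain H where H: "\<And>x. (H has_real_derivative G x) (at x)" "\<And>x. x \<le> a \<Longrightarrow> H x = 0"
    using antiderivative[OF smooth1_continuous[OF sG], of a] G(2) by (metis less_imp_le)
  have sH: "smooth1 H" using H sG smooth1I_deriv by blast
  \<comment> \<open>Integrating the two kernels by parts against \<open>F\<close> gives these
    expressions in the successive antiderivatives \<open>G\<close> and \<open>H\<close>.\<close>
  define M where "M = (\<lambda>x. (G x - G (x - r)) / r)"
  define N where "N = (\<lambda>x. G x - (H x - H (x - r)) / r)"
  define N' where "N' = (\<lambda>x. F x - (G x - G (x - r)) / r)"
  have tM: "test1 a (b + r) M"
    using antideriv_difference_test1[OF F ab less_imp_le[OF r] G] smooth1_divide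
    unfolding test1_def M_def by auto
  have dN: "(N has_real_derivative N' x) (at x)" for x
  proof -
    have "((\<lambda>x. x - r) has_real_derivative 1) (at x)" by (auto intro!: derivative_eq_intros)
    from DERIV_chain'[OF this H(1)] have "((\<lambda>x. H (x - r)) has_real_derivative G (x - r)) (at x)" by simp
    from DERIV_diff[OF G(1) DERIV_cdivide[OF DERIV_diff[OF H(1) this]]]
    show ?thesis unfolding N_def N'_def .
  qed
  have Gc: "G x = G b" if "x \<ge> b" for x
  proof (rule DERIV_zero_ge_constant[OF _ that])
    have "F x = 0" if "x \<ge> b" for x
    proof (cases "x = b")
      case True
      have "(F \<longlongrightarrow> F b) (at_right b)"
        using cF by (simp add: continuous_on_eq_continuous_at continuous_at_imp_continuous_at_within flip: continuous_within)
      moreover have "(F \<longlongrightarrow> 0) (at_right b)"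
        by (rule Lim_transform_eventually[OF tendsto_const])
          (use F in \<open>auto simp: test1_def intro!: eventually_at_rightI[of b "b+1"]\<close>)
      ultimately show ?thesis using tendsto_unique True trivial_limit_at_right_real by blast
    qed (use that F in \<open>auto simp: test1_def\<close>)
    then show "x \<ge> b \<Longrightarrow> (G has_real_derivative 0) (at x)" for x using G(1)[of x] by simp
  qed
  \<comment> \<open>To the right of \<open>b + r\<close> the mean of \<open>G\<close> over a window
    of length \<open>r\<close> equals the constant value of \<open>G\<close>, so the two parts of
    \<open>N\<close> cancel.\<close>
  have "N x = 0" if "x > b + r" for x
  proof -
    have "\<exists>z. x - r < z \<and> z < x \<and> H x - H (x - r) = (x - (x - r)) * G z"
      using r by (intro MVT2) (auto intro: H)
    then obtain z where z: "x - r < z" "H x - H (x - r) = r * G z" by auto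
    have "G z = G b" by (rule Gc) (use z that in simp)
    moreover have "G x = G b" by (rule Gc) (use r that in simp)
    ultimately show ?thesis unfolding N_def using z r by simp
  qed
  then have tN: "test1 a (b + r) N"
    unfolding test1_def using r G(2) H(2)
    by (auto simp: N_def intro!: smooth1_diff smooth1_divide smooth1_shift sG sH)
  have iM: "((\<lambda>x. (1 / r) * F x) has_integral M s) {s - r..s}" for s
  proof -
    have "(F has_integral G s - G (s - r)) {s - r..s}"
      using r by (intro fundamental_theorem_of_calculus)
        (auto intro: G has_field_derivative_at_within simp flip: has_real_derivative_iff_has_vector_derivative)
    from has_integral_mult_right[OF this, of "1/r"] show ?thesis by (simp add: M_def)
  qed
  have iN: "((\<lambda>x. (1 - (s - x) / r) * F x) has_integral N s) {s - r..s}" for s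
  proof -
    have d: "((\<lambda>x. (1 - (s - x) / r) * G x - H x / r) has_real_derivative (1 - (s - x) / r) * F x) (at x)" for x
      using r by (auto intro!: derivative_eq_intros G H simp: field_simps)
    have "((\<lambda>x. (1 - (s - x) / r) * F x) has_integral
        ((1 - (s - s) / r) * G s - H s / r) - ((1 - (s - (s - r)) / r) * G (s - r) - H (s - r) / r)) {s - r..s}"
      using r by (intro fundamental_theorem_of_calculus)
        (auto intro: d has_field_derivative_at_within simp flip: has_real_derivative_iff_has_vector_derivative)
    moreover have "((1 - (s - s) / r) * G s - H s / r) - ((1 - (s - (s - r)) / r) * G (s - r) - H (s - r) / r) = N s"
      using r by (simp add: N_def diff_divide_distrib)
    ultimately show ?thesis by (simp only:)
  qed
  show ?thesis
    by (rule that[OF tM tN dN _ iM iN]) (simp add: M_def N'_def)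
qed


subsection \<open>Tensor products as test functions in the plane\<close>

lemma has_derivative_grad:
  assumes "f differentiable (at x)"
  shows "(f has_derivative (\<lambda>v. grad f x \<bullet> v)) (at x)"
proof -
  define D where "D = frechet_derivative f (at x)"
  have D: "(f has_derivative D) (at x)"
    using assms unfolding D_def by (simp add: frechet_derivative_works)
  then have lin: "linear D" by (rule has_derivative_linear)
  have "D v = grad f x \<bullet> v" for v
  proof -
    have "D v = D (\<Sum>i\<in>UNIV. v $ i *\<^sub>R axis i 1)"
      by (metis scalar_mult_eq_scaleR basis_expansion)
    also have "\<dots> = (\<Sum>i\<in>UNIV. v $ i * D (axis i 1))"
      using lin by (simp add: linear_sum linear_scale)
    also have "\<dots> = grad f x \<bullet> v"
      by (simp add: grad_def D_def inner_vec_def mult.commute)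
    finally show ?thesis .
  qed
  then have "D = (\<lambda>v. grad f x \<bullet> v)" by (rule ext)
  then show ?thesis using D by simp
qed

lemma grad_eqI:
  assumes "(f has_derivative (\<lambda>v. u \<bullet> v)) (at x)"
  shows "grad f x = u"
proof -
  have "frechet_derivative f (at x) = (\<lambda>v. u \<bullet> v)"
    using assms by (metis frechet_derivative_at)
  then show ?thesis by (simp add: grad_def vec_eq_iff inner_axis)
qed

lemma Ck_differentiable: "Ck (Suc k) f \<Longrightarrow> f differentiable (at x)"
  by (simp add: differentiable_on_def)

lemma Ck_lincomb: "Ck k f \<Longrightarrow> Ck k g \<Longrightarrow> Ck k (\<lambda>x. c * f x + d * g x)"
proof (induction k arbitrary: f g)
  case 0
  then show ?case by (auto intro!: continuous_intros)
next
  case (Suc k)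
  have D: "((\<lambda>x. c * f x + d * g x) has_derivative (\<lambda>v. (c *\<^sub>R grad f x + d *\<^sub>R grad g x) \<bullet> v)) (at x)" for x
    using has_derivative_grad[OF Ck_differentiable[OF Suc.prems(1)], of x]
      has_derivative_grad[OF Ck_differentiable[OF Suc.prems(2)], of x]
    by (auto intro!: derivative_eq_intros simp: inner_add_left)
  then have "(\<lambda>x. c * f x + d * g x) differentiable_on UNIV"
    by (auto simp: differentiable_on_def differentiable_def)
  moreover have "grad (\<lambda>x. c * f x + d * g x) x $ i = c * grad f x $ i + d * grad g x $ i" for x i
    using grad_eqI[OF D] by simp
  ultimately show ?case using Suc by simp
qed

lemma has_derivative_comp_inner:
  assumes "(F has_real_derivative d) (at (\<alpha> \<bullet> x))"
  shows "((\<lambda>x. F (\<alpha> \<bullet> x)) has_derivative (\<lambda>v. (\<alpha> \<bullet> v) * d)) (at x)"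
proof -
  have "((\<lambda>x. \<alpha> \<bullet> x) has_derivative (\<lambda>v. \<alpha> \<bullet> v)) (at x)"
    by (rule has_derivative_inner_right[OF has_derivative_ident])
  from has_derivative_compose[OF this assms[unfolded has_field_derivative_def]]
  show ?thesis by (simp add: mult.commute)
qed

lemma has_derivative_tensor:
  fixes \<alpha> \<beta> :: plane
  assumes F: "\<And>x. (F has_real_derivative F' x) (at x)" and G: "\<And>x. (G has_real_derivative G' x) (at x)"
  shows "((\<lambda>x. F (\<alpha> \<bullet> x) * G (\<beta> \<bullet> x)) has_derivative
    (\<lambda>v. ((F' (\<alpha> \<bullet> x) * G (\<beta> \<bullet> x)) *\<^sub>R \<alpha> + (F (\<alpha> \<bullet> x) * G' (\<beta> \<bullet> x)) *\<^sub>R \<beta>) \<bullet> v)) (at x)"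
proof -
  note 1 = has_derivative_comp_inner[OF F, of \<alpha>] and 2 = has_derivative_comp_inner[OF G, of \<beta>]
  show ?thesis
    using has_derivative_mult[OF 1 2] by (simp add: algebra_simps inner_add_left)
qed

lemma Ck_tensor:
  fixes \<alpha> \<beta> :: plane
  shows "diff_k k F \<Longrightarrow> diff_k k G \<Longrightarrow> Ck k (\<lambda>x. F (\<alpha> \<bullet> x) * G (\<beta> \<bullet> x))"
proof (induction k arbitrary: F G)
  case 0
  then have F: "continuous_on UNIV F" and G: "continuous_on UNIV G" by auto
  show ?case unfolding Ck.simps
    by (intro continuous_intros continuous_on_compose2[OF F] continuous_on_compose2[OF G]) auto
next
  case (Suc k)
  obtain F' where F': "\<And>x. (F has_real_derivative F' x) (at x)" "diff_k k F'"
    using Suc.prems(1) by auto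
  obtain G' where G': "\<And>x. (G has_real_derivative G' x) (at x)" "diff_k k G'"
    using Suc.prems(2) by auto
  note D = has_derivative_tensor[of F F' G G' \<alpha> \<beta>, OF F'(1) G'(1)]
  have "(\<lambda>x. F (\<alpha> \<bullet> x) * G (\<beta> \<bullet> x)) differentiable_on UNIV"
    unfolding differentiable_on_def differentiable_def using D by blast
  moreover have "Ck k (\<lambda>x. \<alpha> $ i * (F' (\<alpha> \<bullet> x) * G (\<beta> \<bullet> x)) + \<beta> $ i * (F (\<alpha> \<bullet> x) * G' (\<beta> \<bullet> x)))" for i
    by (intro Ck_lincomb Suc.IH F' G' diff_k_SucD[OF Suc.prems(1)] diff_k_SucD[OF Suc.prems(2)])
  moreover have "grad (\<lambda>x. F (\<alpha> \<bullet> x) * G (\<beta> \<bullet> x)) x $ i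
      = \<alpha> $ i * (F' (\<alpha> \<bullet> x) * G (\<beta> \<bullet> x)) + \<beta> $ i * (F (\<alpha> \<bullet> x) * G' (\<beta> \<bullet> x))" for x i
    using grad_eqI[OF D] by simp
  ultimately show ?case by simp
qed

text \<open>The support lies in the parallelogram that is the image of the coordinate rectangle, a
  compact set; a point outside it has coordinates outside the rectangle, where one factor
  vanishes.\<close>

lemma tensor_test_function:
  fixes \<alpha> \<beta> u v :: plane
  assumes dual: "\<And>x. x = (\<alpha> \<bullet> x) *\<^sub>R u + (\<beta> \<bullet> x) *\<^sub>R v"
    and F: "test1 a b F" and G: "test1 c d G"
    and sub: "(\<lambda>(s, t). s *\<^sub>R u + t *\<^sub>R v) ` ({a..b} \<times> {c..d}) \<subseteq> \<Omega>"
  shows "(\<lambda>x. F (\<alpha> \<bullet> x) * G (\<beta> \<bullet> x)) \<in> test_functions \<Omega>"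
proof -
  let ?K = "(\<lambda>(s, t). s *\<^sub>R u + t *\<^sub>R v) ` ({a..b} \<times> {c..d})"
  have "Ck k (\<lambda>x. F (\<alpha> \<bullet> x) * G (\<beta> \<bullet> x))" for k
    using F G Ck_tensor unfolding test1_def smooth1_def by blast
  moreover have "compact ?K"
    by (intro compact_continuous_image compact_Times compact_Icc)
      (auto simp: case_prod_unfold intro!: continuous_intros)
  moreover have "F (\<alpha> \<bullet> x) * G (\<beta> \<bullet> x) = 0" if "x \<notin> ?K" for x
  proof -
    have "(\<alpha> \<bullet> x, \<beta> \<bullet> x) \<notin> {a..b} \<times> {c..d}"
      using that dual[of x] by (metis (no_types, lifting) case_prod_conv image_eqI)
    then show ?thesis using F G by (auto simp: test1_def)
  qed
  ultimately show ?thesis using sub unfolding test_functions_def by blast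
qed

section \<open>Weak derivatives against tensor products on the product of two lines\<close>

lemma integrable_mult_bounded:
  fixes f g :: "'a \<Rightarrow> real"
  assumes "integrable M f" "g \<in> borel_measurable M" "\<And>x. x \<in> space M \<Longrightarrow> \<bar>g x\<bar> \<le> B"
  shows "integrable M (\<lambda>x. f x * g x)"
proof (rule Bochner_Integration.integrable_bound)
  show "integrable M (\<lambda>x. B * \<bar>f x\<bar>)" using assms(1) by auto
  show "(\<lambda>x. f x * g x) \<in> borel_measurable M" using assms by auto
  show "AE x in M. norm (f x * g x) \<le> norm (B * \<bar>f x\<bar>)"
  proof (rule AE_I2)
    fix x assume "x \<in> space M"
    from assms(3)[OF this] show "norm (f x * g x) \<le> norm (B * \<bar>f x\<bar>)"
      by (simp add: abs_mult mult.commute[of "\<bar>f x\<bar>"] mult_right_mono)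
  qed
qed

lemma test1_measurable [measurable]: "test1 a b F \<Longrightarrow> F \<in> borel_measurable borel"
  unfolding test1_def by (intro borel_measurable_continuous_onI smooth1_continuous) auto

lemma test1_bounded:
  assumes "test1 a b F"
  obtains B where "B \<ge> 0" "\<And>x. \<bar>F x\<bar> \<le> B"
proof -
  have "compact (F ` {a..b})"
    using assms smooth1_continuous by (intro compact_continuous_image) (auto simp: test1_def)
  then obtain B where "\<forall>x\<in>F ` {a..b}. norm x \<le> B"
    using compact_imp_bounded bounded_iff by blast
  then have "\<bar>F x\<bar> \<le> max B 0" for x
    using assms by (cases "x \<in> {a..b}") (auto simp: test1_def le_max_iff_disj)
  then show ?thesis using that[of "max B 0"] by auto
qed

lemma tensor_measurable:
  assumes "test1 a b F" "test1 c d G"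
  shows "(\<lambda>z :: real \<times> real. F (fst z) * G (snd z)) \<in> borel_measurable borel"
proof -
  have [measurable]: "F \<in> borel_measurable borel" "G \<in> borel_measurable borel"
    using assms test1_measurable by auto
  show ?thesis unfolding borel_prod[symmetric] by measurable
qed

lemma tensor_bounded:
  assumes "test1 a b F" "test1 c d G"
  obtains B where "\<And>z :: real \<times> real. \<bar>F (fst z) * G (snd z)\<bar> \<le> B"
proof -
  obtain B B' where "B \<ge> 0" "\<And>x. \<bar>F x\<bar> \<le> B" "B' \<ge> 0" "\<And>x. \<bar>G x\<bar> \<le> B'"
    using test1_bounded assms by metis
  then have "\<bar>F (fst z) * G (snd z)\<bar> \<le> B * B'" for z
    unfolding abs_mult by (intro mult_mono) auto
  then show ?thesis by (rule that)
qed

lemma integrable_mult_tensor: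
  fixes J :: "real \<times> real \<Rightarrow> real"
  assumes "integrable lborel J" "test1 a b F" "test1 c d G"
  shows "integrable lborel (\<lambda>z. J z * (F (fst z) * G (snd z)))"
proof -
  obtain B where "\<And>z :: real \<times> real. \<bar>F (fst z) * G (snd z)\<bar> \<le> B"
    using tensor_bounded assms by metis
  then show ?thesis using assms(1) tensor_measurable[OF assms(2,3)] by (intro integrable_mult_bounded) auto
qed

lemma integrable_indicator_Times:
  "integrable lborel (indicat_real ({a..b} \<times> {c..d :: real}))" for a b :: real
proof -
  have "cbox (a, c) (b, d) = {a..b} \<times> {c..d}" by (simp add: cbox_Pair_eq)
  moreover have "integrable lborel (indicat_real (cbox (a, c) (b, d)))"
    using emeasure_bounded_finite[OF bounded_cbox] by (intro integrable_real_indicator) auto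
  ultimately show ?thesis by simp
qed

lemma box_sets [measurable]:
  "{a..b :: real} \<times> {c..d :: real} \<in> sets borel" "{a<..<b :: real} \<times> {c<..<d :: real} \<in> sets borel"
  unfolding borel_prod[symmetric] by auto

lemma integrable_tensor:
  assumes "test1 a b F" "test1 c d G"
  shows "integrable lborel (\<lambda>z. F (fst z) * G (snd z))"
proof -
  have "integrable lborel (\<lambda>z. indicat_real ({a..b} \<times> {c..d}) z * (F (fst z) * G (snd z)))"
    by (rule integrable_mult_tensor[OF integrable_indicator_Times assms])
  moreover have "indicat_real ({a..b} \<times> {c..d}) z * (F (fst z) * G (snd z)) = F (fst z) * G (snd z)" for z
    using assms by (auto simp: indicator_def test1_def mem_Times_iff)
  ultimately show ?thesis by simp
qed

subsection \<open>The fundamental lemma of the calculus of variations\<close>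

text \<open>Open boxes are stable under intersection and generate the Borel sets, so vanishing
  integrals pass from boxes to all Borel sets by Dynkin's argument. The assumption on the integral
  over the whole plane is what complements require.\<close>

lemma AE_zero_of_box_integrals:
  fixes J :: "real \<times> real \<Rightarrow> real"
  assumes J: "integrable lborel J"
    and z: "\<And>a b c d. (\<integral>z. indicator ({a<..<b} \<times> {c<..<d}) z * J z \<partial>lborel) = 0"
    and t: "(\<integral>z. J z \<partial>lborel) = 0"
  shows "AE z in lborel. J z = 0"
proof (rule density_unique_real[OF J, of "\<lambda>_. 0"])
  fix A assume A: "A \<in> sets (lborel :: (real \<times> real) measure)"
  have box_pair: "box x y = {fst x<..<fst y} \<times> {snd x<..<snd y}" for x y :: "real \<times> real"
    by (cases x; cases y) (auto simp: box_def Basis_prod_def mem_Times_iff)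
  define G where "G = range (\<lambda>(x, y). box x y :: (real \<times> real) set)"
  have si: "B \<in> sets lborel \<Longrightarrow> set_integrable lborel B J" for B
    unfolding set_integrable_def by (rule integrable_mult_indicator[OF _ J])
  have "Int_stable G"
    unfolding Int_stable_def
  proof (intro ballI)
    fix A B assume "A \<in> G" "B \<in> G"
    then obtain x y x' y' where "A = box x y" "B = box x' y'" by (auto simp: G_def)
    then have "A \<inter> B = box (max (fst x) (fst x'), max (snd x) (snd x')) (min (fst y) (fst y'), min (snd y) (snd y'))"
      by (auto simp: box_pair)
    then show "A \<inter> B \<in> G" unfolding G_def by auto
  qed
  moreover have "G \<subseteq> Pow UNIV" by simp
  moreover have "A \<in> sigma_sets UNIV G"
    using A unfolding G_def by (simp add: borel_eq_box)
  ultimately have "(\<integral>x\<in>A. J x \<partial>lborel) = 0"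
  proof (induction rule: sigma_sets_induct_disjoint)
    case (basic A)
    then obtain x y where "A = box x y" by (auto simp: G_def)
    then show ?case using z by (simp add: set_lebesgue_integral_def box_pair)
  next
    case empty
    show ?case by (simp add: set_lebesgue_integral_def)
  next
    case (compl A)
    have A: "A \<in> sets lborel" using compl(1) unfolding G_def by (simp add: borel_eq_box)
    have "(\<integral>x\<in>A. J x \<partial>lborel) + (\<integral>x\<in>UNIV - A. J x \<partial>lborel) = (\<integral>x\<in>A \<union> (UNIV - A). J x \<partial>lborel)"
      using A J by (intro set_integral_Un[symmetric])
        (auto intro!: si)
    also have "\<dots> = 0" using t by (simp add: set_lebesgue_integral_def)
    finally show ?case using compl(2) by simp
  next
    case (union A)
    have "A i \<in> sets lborel" for i using union(2) unfolding G_def by (auto simp: borel_eq_box)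
    then have "(\<integral>x\<in>(\<Union>i. A i). J x \<partial>lborel) = (\<Sum>i. (\<integral>x\<in>A i. J x \<partial>lborel))"
      using union(1) J by (intro lebesgue_integral_countable_add)
        (auto simp: disjoint_family_on_def intro!: si)
    then show ?case using union(3) by simp
  qed
  then show "(\<integral>x\<in>A. J x \<partial>lborel) = (\<integral>x\<in>A. 0 \<partial>lborel)"
    by (simp add: set_lebesgue_integral_def)
qed auto

lemma box_in_open:
  fixes V :: "(real \<times> real) set"
  assumes "open V" "(s, t) \<in> V"
  obtains e where "e > 0" "{s-e..s+e} \<times> {t-e..t+e} \<subseteq> V"
proof -
  obtain A B where AB: "open A" "open B" "(s, t) \<in> A \<times> B" "A \<times> B \<subseteq> V"
    using open_prod_elim[OF assms] by metis
  obtain e1 where e1: "e1 > 0" "cball s e1 \<subseteq> A" using AB open_contains_cball by blast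
  obtain e2 where e2: "e2 > 0" "cball t e2 \<subseteq> B" using AB open_contains_cball by blast
  have "{s - min e1 e2..s + min e1 e2} \<times> {t - min e1 e2..t + min e1 e2} \<subseteq> V"
    using e1 e2 AB(4) by (force simp: cball_eq_atLeastAtMost)
  then show ?thesis using that[of "min e1 e2"] e1 e2 by auto
qed

text \<open>Products of bumps converge boundedly to the indicator of an open rectangle, so the
  integrals of \<open>J\<close> over rectangles inside \<open>V\<close> vanish. This determines
  \<open>J\<close> locally, and countably many rectangles exhaust \<open>V\<close>.\<close>

lemma tensor_fundamental_lemma:
  fixes J :: "real \<times> real \<Rightarrow> real"
  assumes V: "open V"
    and J: "\<And>a b c d. {a..b} \<times> {c..d} \<subseteq> V \<Longrightarrow>
              integrable lborel (\<lambda>z. indicator ({a..b} \<times> {c..d}) z * J z)"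
    and zero: "\<And>a b c d F G. test1 a b F \<Longrightarrow> test1 c d G \<Longrightarrow> {a..b} \<times> {c..d} \<subseteq> V \<Longrightarrow>
              (\<integral>z. J z * (F (fst z) * G (snd z)) \<partial>lborel) = 0"
  shows "AE z in lborel. z \<in> V \<longrightarrow> J z = 0"
proof -
  have box0: "(\<integral>z. indicator ({a<..<b} \<times> {c<..<d}) z * J z \<partial>lborel) = 0"
    if sub: "{a..b} \<times> {c..d} \<subseteq> V" for a b c d
  proof -
    let ?s = "\<lambda>n z. J z * (bump n a b (fst z) * bump n c d (snd z))"
    \<comment> \<open>\<open>J\<close> need not be integrable on the plane; cutting it off at the
      closed rectangle changes nothing against these test functions and supplies the dominating
      function.\<close>
    let ?J = "\<lambda>z. indicator ({a..b} \<times> {c..d}) z * J z"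
    have eq: "?s n z = ?J z * (bump n a b (fst z) * bump n c d (snd z))" for n z
      using bump_test1[of a b n] bump_test1[of c d n]
      by (auto simp: indicator_def test1_def mem_Times_iff)
    have i: "integrable lborel (?s n)" for n
      unfolding eq by (intro integrable_mult_tensor[OF J[OF sub] bump_test1 bump_test1])
    have "(\<lambda>n. \<integral>z. ?s n z \<partial>lborel) \<longlonglongrightarrow> (\<integral>z. indicator ({a<..<b} \<times> {c<..<d}) z * ?J z \<partial>lborel)"
    proof (rule integral_dominated_convergence[where w="\<lambda>z. \<bar>?J z\<bar>"])
      show "(\<lambda>z. indicator ({a<..<b} \<times> {c<..<d}) z * ?J z) \<in> borel_measurable lborel"
        by (rule borel_measurable_times[OF borel_measurable_indicator borel_measurable_integrable[OF J[OF sub]]]) simp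
      show "?s n \<in> borel_measurable lborel" for n using i by auto
      show "integrable lborel (\<lambda>z. \<bar>?J z\<bar>)" using J[OF sub] by auto
      show "AE z in lborel. (\<lambda>n. ?s n z) \<longlonglongrightarrow> indicator ({a<..<b} \<times> {c<..<d}) z * ?J z"
      proof (rule AE_I2)
        fix z
        have "(\<lambda>n. ?J z * (bump n a b (fst z) * bump n c d (snd z))) \<longlonglongrightarrow>
            ?J z * (indicator {a<..<b} (fst z) * indicator {c<..<d} (snd z))"
          by (intro tendsto_intros bump_tendsto)
        then show "(\<lambda>n. ?s n z) \<longlonglongrightarrow> indicator ({a<..<b} \<times> {c<..<d}) z * ?J z"
          unfolding eq by (simp add: indicator_times mult.commute)
      qed
      show "AE z in lborel. norm (?s n z) \<le> \<bar>?J z\<bar>" for n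
        unfolding eq by (intro AE_I2)
          (simp add: abs_mult bump_bounds mult_left_le mult_le_one)
    qed
    moreover have "(\<integral>z. ?s n z \<partial>lborel) = 0" for n
      by (rule zero[OF bump_test1 bump_test1 sub])
    ultimately have "(\<integral>z. indicator ({a<..<b} \<times> {c<..<d}) z * ?J z \<partial>lborel) = 0"
      by (simp add: LIMSEQ_const_iff)
    moreover have "indicator ({a<..<b} \<times> {c<..<d}) z * ?J z = indicator ({a<..<b} \<times> {c<..<d}) z * J z" for z
      by (auto simp: indicator_def)
    ultimately show ?thesis by simp
  qed
  have local: "AE z in lborel. z \<in> {a<..<b} \<times> {c<..<d} \<longrightarrow> J z = 0"
    if sub: "{a..b} \<times> {c..d} \<subseteq> V" for a b c d
  proof -
    let ?B = "{a<..<b} \<times> {c<..<d}"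
    let ?J = "\<lambda>z. indicator ?B z * J z"
    have "(\<lambda>z. indicator ?B z *\<^sub>R (indicator ({a..b} \<times> {c..d}) z * J z)) = ?J"
      by (auto simp: indicator_def fun_eq_iff)
    then have i: "integrable lborel ?J"
      using integrable_mult_indicator[OF _ J[OF sub], of ?B] by (simp only:) auto
    have "AE z in lborel. ?J z = 0"
    proof (rule AE_zero_of_box_integrals[OF i])
      show "(\<integral>z. ?J z \<partial>lborel) = 0" by (rule box0[OF sub])
      fix a' b' c' d'
      \<comment> \<open>Every box is intersected with the fixed rectangle, so that only boxes whose
        closures lie in \<open>V\<close> have to be tested.\<close>
      have "(\<integral>z. indicator ({max a a'<..<min b b'} \<times> {max c c'<..<min d d'}) z * J z \<partial>lborel) = 0"
        by (rule box0) (use sub in auto)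
      moreover have "indicator ({max a a'<..<min b b'} \<times> {max c c'<..<min d d'}) z * J z
          = indicator ({a'<..<b'} \<times> {c'<..<d'}) z * ?J z" for z
        by (auto simp: indicator_def)
      ultimately show "(\<integral>z. indicator ({a'<..<b'} \<times> {c'<..<d'}) z * ?J z \<partial>lborel) = 0" by simp
    qed
    then show ?thesis by eventually_elim (auto simp: indicator_def)
  qed
  \<comment> \<open>Rational corners keep the cover countable, so the exceptional sets add up to a
    null set.\<close>
  define Q where "Q = {(a, b, c, d). {a, b, c, d} \<subseteq> \<rat> \<and> {a..b} \<times> {c..d} \<subseteq> V}"
  have "countable Q"
    by (rule countable_subset[of _ "\<rat> \<times> \<rat> \<times> \<rat> \<times> \<rat>"])
      (auto simp: Q_def intro!: countable_SIGMA countable_rat)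
  then have "AE z in lborel. \<forall>(a, b, c, d)\<in>Q. z \<in> {a<..<b} \<times> {c<..<d} \<longrightarrow> J z = 0"
    by (subst AE_ball_countable) (auto simp: Q_def intro!: local)
  then show ?thesis
  proof eventually_elim
    case (elim z)
    show ?case
    proof
      assume "z \<in> V"
      obtain s t where z: "z = (s, t)" by (cases z)
      obtain e where e: "e > 0" "{s-e..s+e} \<times> {t-e..t+e} \<subseteq> V"
        using box_in_open V \<open>z \<in> V\<close> z by metis
      obtain a b c d where r: "a \<in> \<rat>" "b \<in> \<rat>" "c \<in> \<rat>" "d \<in> \<rat>"
        "s - e < a" "a < s" "s < b" "b < s + e" "t - e < c" "c < t" "t < d" "d < t + e"
        using Rats_dense_in_real[of "s-e" s] Rats_dense_in_real[of s "s+e"]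
          Rats_dense_in_real[of "t-e" t] Rats_dense_in_real[of t "t+e"] e(1) by auto
      moreover have "{a..b} \<times> {c..d} \<subseteq> {s-e..s+e} \<times> {t-e..t+e}" using r by auto
      ultimately have "(a, b, c, d) \<in> Q" using e(2) unfolding Q_def by auto
      then show "J z = 0" using elim r z by auto
    qed
  qed
qed

text \<open>A weak partial derivative, tested only with products of one-variable functions. The
  integrals may range over the whole plane because the test functions vanish off a rectangle in
  \<open>V\<close>; the values of \<open>W\<close> and \<open>g\<close> off \<open>V\<close> are
  invisible.\<close>

definition pd1 :: "(real \<times> real) set \<Rightarrow> (real \<times> real \<Rightarrow> real) \<Rightarrow> (real \<times> real \<Rightarrow> real) \<Rightarrow> bool" where
  "pd1 V W g \<longleftrightarrow> (\<forall>a b c d F F' G. test1 a b F \<longrightarrow> (\<forall>x. (F has_real_derivative F' x) (at x)) \<longrightarrow>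
     test1 c d G \<longrightarrow> {a..b} \<times> {c..d} \<subseteq> V \<longrightarrow>
     (\<integral>z. W z * (F' (fst z) * G (snd z)) \<partial>lborel) = - (\<integral>z. g z * (F (fst z) * G (snd z)) \<partial>lborel))"

definition pd2 :: "(real \<times> real) set \<Rightarrow> (real \<times> real \<Rightarrow> real) \<Rightarrow> (real \<times> real \<Rightarrow> real) \<Rightarrow> bool" where
  "pd2 V W g \<longleftrightarrow> (\<forall>a b c d F G G'. test1 a b F \<longrightarrow> (\<forall>x. (G has_real_derivative G' x) (at x)) \<longrightarrow>
     test1 c d G \<longrightarrow> {a..b} \<times> {c..d} \<subseteq> V \<longrightarrow>
     (\<integral>z. W z * (F (fst z) * G' (snd z)) \<partial>lborel) = - (\<integral>z. g z * (F (fst z) * G (snd z)) \<partial>lborel))"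

lemma pd1D:
  assumes "pd1 V W g" "test1 a b F" "\<And>x. (F has_real_derivative F' x) (at x)" "test1 c d G" "{a..b} \<times> {c..d} \<subseteq> V"
  shows "(\<integral>z. W z * (F' (fst z) * G (snd z)) \<partial>lborel) = - (\<integral>z. g z * (F (fst z) * G (snd z)) \<partial>lborel)"
  using assms unfolding pd1_def by meson

lemma pd2D:
  assumes "pd2 V W g" "test1 a b F" "\<And>x. (G has_real_derivative G' x) (at x)" "test1 c d G" "{a..b} \<times> {c..d} \<subseteq> V"
  shows "(\<integral>z. W z * (F (fst z) * G' (snd z)) \<partial>lborel) = - (\<integral>z. g z * (F (fst z) * G (snd z)) \<partial>lborel)"
  using assms unfolding pd2_def by meson

section \<open>Translations, and monotonicity from the sign of a weak derivative\<close>

lemma integrable_lborel_shift: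
  fixes f :: "'a::euclidean_space \<Rightarrow> real"
  assumes "integrable lborel f"
  shows "integrable lborel (\<lambda>x. f (c + x))"
proof -
  have "integrable (distr lborel borel ((+) c)) f" using assms by (simp add: lborel_distr_plus)
  then show ?thesis using borel_measurable_integrable[OF assms] by (subst (asm) integrable_distr_eq) auto
qed

lemma integral_lborel_shift:
  fixes f :: "'a::euclidean_space \<Rightarrow> real"
  assumes "f \<in> borel_measurable borel"
  shows "(\<integral>x. f (c + x) \<partial>lborel) = (\<integral>x. f x \<partial>lborel)"
proof -
  have "(\<integral>x. f x \<partial>lborel) = (\<integral>x. f x \<partial>distr lborel borel ((+) c))" by (simp add: lborel_distr_plus)
  also have "\<dots> = (\<integral>x. f (c + x) \<partial>lborel)"
    using assms by (subst integral_distr) auto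
  finally show ?thesis by simp
qed

text \<open>A shift of a test function in the first variable differs from it by a derivative.\<close>

lemma pd1_nonpos_imp_decreasing:
  assumes V: "open V" and W: "integrable lborel W" "continuous_on V W"
    and g: "integrable lborel g" "pd1 V W g" "AE z in lborel. z \<in> V \<longrightarrow> g z \<le> 0"
    and seg: "\<And>x. s \<le> x \<Longrightarrow> x \<le> s' \<Longrightarrow> (x, t) \<in> V" and ss': "s \<le> s'"
  shows "W (s', t) \<le> W (s, t)"
proof (rule ccontr)
  assume neg: "\<not> W (s', t) \<le> W (s, t)"
  define h where "h = s' - s"
  have h: "0 \<le> h" using ss' by (simp add: h_def)
  have "compact ({s..s'} \<times> {t})" by (intro compact_Times compact_Icc) simp
  moreover have "{s..s'} \<times> {t} \<subseteq> V" using seg by auto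
  ultimately obtain e where e: "e > 0" "(\<Union>z\<in>{s..s'} \<times> {t}. ball z e) \<subseteq> V"
    using compact_subset_open_imp_ball_epsilon_subset[OF _ V] by metis
  \<comment> \<open>A closed rectangle around the whole segment still lies in \<open>V\<close>; it
    will contain the support of the test function that joins \<open>F\<close> to its
    translate.\<close>
  have tube: "(x, y) \<in> V" if "s - e/3 \<le> x" "x \<le> s' + e/3" "t - e/3 \<le> y" "y \<le> t + e/3" for x y
  proof -
    define c where "c = max s (min s' x)"
    have c: "c \<in> {s..s'}" "\<bar>c - x\<bar> \<le> e/3"
      using that ss' e(1) by (auto simp: c_def max_def min_def abs_le_iff)
    have "dist (c, t) (x, y) \<le> \<bar>c - x\<bar> + \<bar>t - y\<bar>"
      unfolding dist_Pair_Pair dist_real_def using sqrt_sum_squares_le_sum_abs[of "\<bar>c - x\<bar>" "\<bar>t - y\<bar>"] by simp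
    also have "\<dots> < e"
    proof -
      have "\<bar>t - y\<bar> \<le> e/3" using that by linarith
      then show ?thesis using c(2) e(1) by linarith
    qed
    finally have "(x, y) \<in> ball (c, t) e" by simp
    then show ?thesis using c(1) e(2) by blast
  qed
  \<comment> \<open>The increment of \<open>W\<close> over the length of the segment. By assumption
    it is positive at \<open>(s, t)\<close>, and by continuity on a small square.\<close>
  define D where "D = (\<lambda>z. W ((h, 0) + z) - W z)"
  have V2: "open (V \<inter> (\<lambda>z. (h, 0) + z) -` V)"
    using V by (intro open_Int continuous_open_vimage continuous_intros)
  have "continuous_on (V \<inter> (\<lambda>z. (h, 0) + z) -` V) D"
    unfolding D_def
    by (intro continuous_intros continuous_on_subset[OF W(2)] continuous_on_compose2[OF W(2)]) auto
  moreover have st: "(s, t) \<in> V \<inter> (\<lambda>z. (h, 0) + z) -` V"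
    using seg ss' by (auto simp: h_def)
  ultimately have "isCont D (s, t)" using V2 continuous_on_eq_continuous_at by blast
  moreover have "D (s, t) > 0" using neg by (auto simp: D_def h_def)
  ultimately have "eventually (\<lambda>z. D z > 0) (at (s, t))"
    by (auto simp: isCont_def intro: order_tendstoD)
  then obtain k where k: "k > 0" "\<And>z. dist z (s, t) < k \<Longrightarrow> D z > 0"
    using \<open>D (s, t) > 0\<close> unfolding eventually_at by (metis UNIV_I)
  define d where "d = min (e/3) (k/3)"
  have d: "d > 0" "d \<le> e/3" "d < k/2" using e k by (auto simp: d_def)
  have Dpos: "D (x, y) > 0" if "\<bar>x - s\<bar> \<le> d" "\<bar>y - t\<bar> \<le> d" for x y
  proof -
    have "dist (x, y) (s, t) \<le> \<bar>x - s\<bar> + \<bar>y - t\<bar>"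
      unfolding dist_Pair_Pair dist_real_def using sqrt_sum_squares_le_sum_abs[of "\<bar>x - s\<bar>" "\<bar>y - t\<bar>"] by simp
    then have "dist (x, y) (s, t) < k" using that d by linarith
    then show ?thesis by (rule k)
  qed
  define F G where "F = bump 0 (s - d) (s + d)" and "G = bump 0 (t - d) (t + d)"
  have tF: "test1 (s - d) (s + d) F" and tG: "test1 (t - d) (t + d) G"
    unfolding F_def G_def by (rule bump_test1)+
  have F0: "F x \<ge> 0" and G0: "G x \<ge> 0" for x by (simp_all add: F_def G_def bump_bounds)
  obtain A where A: "\<And>x. (A has_real_derivative F x) (at x)" "\<And>x. x \<le> s - d \<Longrightarrow> A x = 0"
    using antiderivative[of F "s - d"] tF smooth1_continuous unfolding test1_def
    by (metis atLeastAtMost_iff not_le)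
  \<comment> \<open>The derivative of \<open>H\<close> is the difference of \<open>F\<close> and its
    translate by \<open>h\<close>. Since \<open>F\<close> is nonnegative, \<open>A\<close> is
    nondecreasing and \<open>H\<close> is nonnegative, so the sign of \<open>g\<close> can be
    used.\<close>
  define H where "H = (\<lambda>x. A x - A (x - h))"
  have tH: "test1 (s - d) (s + d + h) H"
    unfolding H_def using antideriv_difference_test1[OF tF _ h A] d by simp
  have dH: "(H has_real_derivative F x - F (x - h)) (at x)" for x
  proof -
    have "((\<lambda>x. x - h) has_real_derivative 1) (at x)" by (auto intro!: derivative_eq_intros)
    from DERIV_chain'[OF this A(1)] have "((\<lambda>x. A (x - h)) has_real_derivative F (x - h)) (at x)" by simp
    from DERIV_diff[OF A(1) this] show ?thesis unfolding H_def .
  qed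
  have H0: "H x \<ge> 0" for x
  proof -
    have "A (x - h) \<le> A x"
      by (rule DERIV_nonneg_imp_nondecreasing) (use h A F0 in auto)
    then show ?thesis by (simp add: H_def)
  qed
  have sub: "{s - d..s + d + h} \<times> {t - d..t + d} \<subseteq> V" using tube d by (auto simp: h_def)
  have Ws: "integrable lborel (\<lambda>z. W ((h, 0) + z))" by (rule integrable_lborel_shift[OF W(1)])
  have tFs: "test1 (s - d + h) (s + d + h) (\<lambda>x. F (x - h))"
    using tF by (auto simp: test1_def smooth1_shift)
  have "(\<integral>z. D z * (F (fst z) * G (snd z)) \<partial>lborel)
      = (\<integral>z. W ((h, 0) + z) * (F (fst z) * G (snd z)) \<partial>lborel) - (\<integral>z. W z * (F (fst z) * G (snd z)) \<partial>lborel)"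
    unfolding D_def left_diff_distrib
    by (intro Bochner_Integration.integral_diff integrable_mult_tensor[OF Ws tF tG] integrable_mult_tensor[OF W(1) tF tG])
  also have "(\<integral>z. W ((h, 0) + z) * (F (fst z) * G (snd z)) \<partial>lborel)
      = (\<integral>z. W z * (F (fst z - h) * G (snd z)) \<partial>lborel)"
    using integral_lborel_shift[of "\<lambda>z. W z * (F (fst z - h) * G (snd z))" "(h, 0)"]
      borel_measurable_integrable[OF integrable_mult_tensor[OF W(1) tFs tG]] by simp
  also have "(\<integral>z. W z * (F (fst z - h) * G (snd z)) \<partial>lborel) - (\<integral>z. W z * (F (fst z) * G (snd z)) \<partial>lborel)
      = - (\<integral>z. W z * ((F (fst z) - F (fst z - h)) * G (snd z)) \<partial>lborel)"
    using Bochner_Integration.integral_diff[OF integrable_mult_tensor[OF W(1) tF tG] integrable_mult_tensor[OF W(1) tFs tG]]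
    by (simp add: algebra_simps)
  also have "(\<integral>z. W z * ((F (fst z) - F (fst z - h)) * G (snd z)) \<partial>lborel)
      = - (\<integral>z. g z * (H (fst z) * G (snd z)) \<partial>lborel)"
    by (rule pd1D[OF g(2) tH dH tG sub])
  also have "- (- (\<integral>z. g z * (H (fst z) * G (snd z)) \<partial>lborel)) \<le> 0"
  proof -
    have "AE z in lborel. g z * (H (fst z) * G (snd z)) \<le> 0"
      using g(3)
    proof eventually_elim
      case (elim z)
      show ?case
      proof (cases "z \<in> V")
        case True
        then show ?thesis using elim H0 G0 by (simp add: mult_nonpos_nonneg)
      next
        case False
        then have "\<not> (fst z \<in> {s - d..s + d + h} \<and> snd z \<in> {t - d..t + d})"
          using sub by (metis mem_Times_iff subsetD)
        then have "H (fst z) * G (snd z) = 0" using tH tG by (auto simp: test1_def)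
        then show ?thesis by (simp only: mult_zero_right)
      qed
    qed
    then have "0 \<le> (\<integral>z. - (g z * (H (fst z) * G (snd z))) \<partial>lborel)"
      by (intro integral_nonneg_AE) simp
    then show ?thesis by simp
  qed
  finally have le0: "(\<integral>z. D z * (F (fst z) * G (snd z)) \<partial>lborel) \<le> 0" .
  have iD: "integrable lborel (\<lambda>z. D z * (F (fst z) * G (snd z)))"
    unfolding D_def by (intro integrable_mult_tensor[OF _ tF tG] Bochner_Integration.integrable_diff Ws W(1))
  have nn: "D z * (F (fst z) * G (snd z)) \<ge> 0" for z
  proof (cases "\<bar>fst z - s\<bar> \<le> d \<and> \<bar>snd z - t\<bar> \<le> d")
    case True
    then show ?thesis using Dpos[of "fst z" "snd z"] F0 G0 by simp
  next
    case False
    then have "F (fst z) * G (snd z) = 0" using tF tG by (auto simp: test1_def abs_le_iff)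
    then show ?thesis by (simp only: mult_zero_right)
  qed
  \<comment> \<open>A nonnegative integrand with nonpositive integral vanishes almost everywhere,
    yet \<open>D\<close>, \<open>F\<close> and \<open>G\<close> are all positive on an open square
    around \<open>(s, t)\<close>: the contradiction.\<close>
  have "(\<integral>z. D z * (F (fst z) * G (snd z)) \<partial>lborel) = 0"
    using le0 integral_nonneg_AE[of "\<lambda>z. D z * (F (fst z) * G (snd z))" lborel] nn by force
  then have "AE z in lborel. D z * (F (fst z) * G (snd z)) = 0"
    using integral_nonneg_eq_0_iff_AE[OF iD] nn by simp
  then have "AE z in lborel. z \<notin> {s - d<..<s + d} \<times> {t - d<..<t + d}"
  proof eventually_elim
    case (elim z)
    show ?case
    proof
      assume z: "z \<in> {s - d<..<s + d} \<times> {t - d<..<t + d}"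
      then have "F (fst z) > 0" "G (snd z) > 0" unfolding F_def G_def by (auto intro!: bump_pos)
      moreover have "D z > 0" using Dpos[of "fst z" "snd z"] z by auto
      ultimately show False using elim by simp
    qed
  qed
  then have "AE z in lebesgue. z \<notin> {s - d<..<s + d} \<times> {t - d<..<t + d}" by (rule AE_completion)
  then have "negligible ({s - d<..<s + d} \<times> {t - d<..<t + d})"
    unfolding eventually_ae_filter_negligible using negligible_subset by auto
  moreover have "open ({s - d<..<s + d} \<times> {t - d<..<t + d})" by (intro open_Times) auto
  moreover have "(s, t) \<in> {s - d<..<s + d} \<times> {t - d<..<t + d}" using d by auto
  ultimately show False using open_not_negligible by blast
qed

subsection \<open>Second order: a continuous representative\<close>

definition kerM :: "real \<Rightarrow> real \<Rightarrow> real" where "kerM r s = indicator {0..r} s * (1 / r)"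
definition kerN :: "real \<Rightarrow> real \<Rightarrow> real" where "kerN r s = indicator {0..r} s * (1 - s / r)"

text \<open>With z = x + (s, t) this is the integral of J (x + (s, t)) p(s) q(t). For kernels
  supported in \<open>{0..r}\<close> the value at \<open>x\<close> therefore uses \<open>J\<close>
  only on the square with lower left corner \<open>x\<close> and side \<open>r\<close>.\<close>

definition conv2 :: "(real \<Rightarrow> real) \<Rightarrow> (real \<Rightarrow> real) \<Rightarrow> (real \<times> real \<Rightarrow> real) \<Rightarrow> real \<times> real \<Rightarrow> real" where
  "conv2 p q J x = (\<integral>z. J z * (p (fst z - fst x) * q (snd z - snd x)) \<partial>lborel)"

text \<open>The kernels jump at the ends of their supports. Boundedness and finitely many
  discontinuities are what dominated convergence can tolerate, since the lines through the jumps are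
  null sets in the plane.\<close>

definition good_ker :: "(real \<Rightarrow> real) \<Rightarrow> bool" where
  "good_ker p \<longleftrightarrow> p \<in> borel_measurable borel \<and> (\<exists>B. \<forall>x. \<bar>p x\<bar> \<le> B) \<and> (\<exists>S. finite S \<and> (\<forall>x. x \<notin> S \<longrightarrow> isCont p x))"

lemma good_ker_indicator:
  assumes "continuous_on UNIV f"
  shows "good_ker (\<lambda>s. indicator {0..r} s * f s)"
  unfolding good_ker_def
proof (intro conjI)
  have [measurable]: "f \<in> borel_measurable borel" using assms by (rule borel_measurable_continuous_onI)
  show "(\<lambda>s. indicator {0..r} s * f s) \<in> borel_measurable borel" by measurable
  have "compact (f ` {0..r})"
    using assms continuous_on_subset by (intro compact_continuous_image) auto
  then obtain B where B: "\<forall>x\<in>f ` {0..r}. norm x \<le> B"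
    using compact_imp_bounded bounded_iff by blast
  have "\<bar>indicator {0..r} s * f s\<bar> \<le> max B 0" for s
    using B by (auto simp: indicator_def le_max_iff_disj)
  then show "\<exists>B. \<forall>s. \<bar>indicator {0..r} s * f s\<bar> \<le> B" by blast
  have "isCont (\<lambda>s. indicator {0..r} s * f s) x" if x: "x \<notin> {0, r}" for x
  proof (cases "x \<in> {0<..<r}")
    case True
    have "isCont f x" using assms by (simp add: continuous_on_eq_continuous_at)
    moreover have "eventually (\<lambda>s. indicator {0..r} s * f s = f s) (nhds x)"
      by (rule eventually_nhds_in_open[THEN eventually_mono, of "{0<..<r}"]) (use True in auto)
    ultimately show ?thesis by (subst isCont_cong)
  next
    case False
    have "eventually (\<lambda>s. indicator {0..r} s * f s = 0) (nhds x)"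
      by (rule eventually_nhds_in_open[THEN eventually_mono, of "- {0..r}"])
        (use False x in \<open>auto simp: open_Compl\<close>)
    then show ?thesis by (subst isCont_cong[where g="\<lambda>_. 0"]) auto
  qed
  then show "\<exists>S. finite S \<and> (\<forall>x. x \<notin> S \<longrightarrow> isCont (\<lambda>s. indicator {0..r} s * f s) x)"
    by (intro exI[of _ "{0, r}"]) auto
qed

lemma good_kerM: "good_ker (kerM r)"
  unfolding kerM_def[abs_def] by (intro good_ker_indicator continuous_intros)

lemma good_kerN: "good_ker (kerN r)"
  unfolding kerN_def[abs_def] divide_inverse by (intro good_ker_indicator continuous_intros)

lemma ker_pair_measurable:
  assumes "good_ker p" "good_ker q"
  shows "(\<lambda>\<zeta> :: real \<times> real. p (fst \<zeta>) * q (snd \<zeta>)) \<in> borel_measurable borel"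
proof -
  have [measurable]: "p \<in> borel_measurable borel" "q \<in> borel_measurable borel"
    using assms by (auto simp: good_ker_def)
  show ?thesis unfolding borel_prod[symmetric] by measurable
qed

lemma ker_pair_bounded:
  assumes "good_ker p" "good_ker q"
  obtains B where "\<And>s t. \<bar>p s * q t\<bar> \<le> B"
proof -
  obtain B B' where "\<And>x. \<bar>p x\<bar> \<le> B" "\<And>x. \<bar>q x\<bar> \<le> B'"
    using assms unfolding good_ker_def by metis
  then have "\<bar>p s * q t\<bar> \<le> B * B'" for s t
    unfolding abs_mult by (intro mult_mono) (auto intro: order_trans[OF abs_ge_zero])
  then show ?thesis by (rule that)
qed

lemma AE_lborel_fst_snd:
  fixes S T :: "real set"
  assumes "finite S" "finite T"
  shows "AE z in lborel. fst z \<notin> S \<and> snd z \<notin> T"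
proof -
  have "S \<times> UNIV \<in> null_sets (lborel \<Otimes>\<^sub>M (lborel :: real measure))"
    using assms(1) finite_imp_null_set_lborel by (intro lborel.times_in_null_sets1) auto
  moreover have "UNIV \<times> T \<in> null_sets ((lborel :: real measure) \<Otimes>\<^sub>M lborel)"
    using assms(2) finite_imp_null_set_lborel by (intro lborel.times_in_null_sets2) auto
  ultimately have "S \<times> UNIV \<union> UNIV \<times> T \<in> null_sets (lborel :: (real \<times> real) measure)"
    unfolding lborel_prod by auto
  from AE_not_in[OF this] show ?thesis by (auto simp: mem_Times_iff)
qed

text \<open>Off finitely many horizontal and vertical lines the translated kernels converge, and a
  multiple of |J| dominates. Continuity thus comes from the kernel, while \<open>J\<close> is merely
  integrable.\<close>

lemma conv2_continuous:
  assumes J: "integrable lborel J" and p: "good_ker p" and q: "good_ker q"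
  shows "continuous_on UNIV (conv2 p q J)"
proof -
  obtain B where B: "\<And>s t. \<bar>p s * q t\<bar> \<le> B" using ker_pair_bounded[OF p q] by metis
  obtain S T where ST: "finite S" "\<And>x. x \<notin> S \<Longrightarrow> isCont p x" "finite T" "\<And>x. x \<notin> T \<Longrightarrow> isCont q x"
    using p q unfolding good_ker_def by metis
  have meas: "(\<lambda>z. p (fst z - fst x) * q (snd z - snd x)) \<in> borel_measurable borel" for x :: "real \<times> real"
    using measurable_compose[OF _ ker_pair_measurable[OF p q], of "\<lambda>z. z - x" borel] by simp
  have "(\<lambda>n. conv2 p q J (X n)) \<longlonglongrightarrow> conv2 p q J x" if X: "X \<longlonglongrightarrow> x" for X x
    unfolding conv2_def
  proof (rule integral_dominated_convergence[where w="\<lambda>z. B * \<bar>J z\<bar>"])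
    show "(\<lambda>z. J z * (p (fst z - fst x) * q (snd z - snd x))) \<in> borel_measurable lborel" for x
      using J meas[of x] by auto
    show "(\<lambda>z. J z * (p (fst z - fst (X n)) * q (snd z - snd (X n)))) \<in> borel_measurable lborel" for n
      using J meas[of "X n"] by auto
    show "integrable lborel (\<lambda>z. B * \<bar>J z\<bar>)" using J by auto
    show "AE z in lborel. norm (J z * (p (fst z - fst (X n)) * q (snd z - snd (X n)))) \<le> B * \<bar>J z\<bar>" for n
      using mult_right_mono[OF B abs_ge_zero] by (intro AE_I2) (simp add: abs_mult mult.commute mult.left_commute)
    have "AE z in lborel. fst z \<notin> (\<lambda>s. s + fst x) ` S \<and> snd z \<notin> (\<lambda>s. s + snd x) ` T"
      using ST by (intro AE_lborel_fst_snd) auto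
    then show "AE z in lborel. (\<lambda>n. J z * (p (fst z - fst (X n)) * q (snd z - snd (X n))))
        \<longlonglongrightarrow> J z * (p (fst z - fst x) * q (snd z - snd x))"
    proof eventually_elim
      case (elim z)
      then have "fst z - fst x \<notin> S" "snd z - snd x \<notin> T" by (auto simp: image_iff)
      then have c: "isCont p (fst z - fst x)" "isCont q (snd z - snd x)" using ST by auto
      have l: "(\<lambda>n. fst z - fst (X n)) \<longlonglongrightarrow> fst z - fst x" "(\<lambda>n. snd z - snd (X n)) \<longlonglongrightarrow> snd z - snd x"
        using X by (auto intro!: tendsto_intros)
      show ?case
        by (intro tendsto_mult tendsto_const isCont_tendsto_compose[OF c(1) l(1)] isCont_tendsto_compose[OF c(2) l(2)])
    qed
  qed
  then show ?thesis by (simp add: continuous_on_sequentially comp_def)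
qed

lemma integrable_pair_mult:
  fixes f :: "'a::euclidean_space \<Rightarrow> real" and g :: "'b::euclidean_space \<Rightarrow> real"
  assumes f: "integrable lborel f" and g: "integrable lborel g"
  shows "integrable (lborel \<Otimes>\<^sub>M lborel) (\<lambda>z. f (fst z) * g (snd z))"
proof (rule lborel_pair.Fubini_integrable)
  have [measurable]: "f \<in> borel_measurable lborel" "g \<in> borel_measurable lborel" using f g by auto
  show "(\<lambda>z. f (fst z) * g (snd z)) \<in> borel_measurable (lborel \<Otimes>\<^sub>M lborel)" by measurable
  show "integrable lborel (\<lambda>x. \<integral>y. norm (f (fst (x, y)) * g (snd (x, y))) \<partial>lborel)"
    using f g by (simp add: abs_mult)
  show "AE x in lborel. integrable lborel (\<lambda>y. f (fst (x, y)) * g (snd (x, y)))"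
    using g by simp
qed

lemma integral_tensor:
  fixes f g :: "real \<Rightarrow> real"
  assumes "integrable lborel f" "integrable lborel g"
  shows "(\<integral>z. f (fst z) * g (snd z) \<partial>lborel) = (\<integral>x. f x \<partial>lborel) * (\<integral>y. g y \<partial>lborel)"
  using lborel_pair.integral_fst'[OF integrable_pair_mult[OF assms]] by (simp add: lborel_prod)

text \<open>Fubini: the kernel acts either on the test function or on \<open>J\<close>. It is
  bounded, so integrability on the product space is that of \<open>J z * \<psi> x\<close>.\<close>

lemma conv2_swap:
  assumes J: "integrable lborel J" and \<psi>: "integrable lborel \<psi>" and p: "good_ker p" and q: "good_ker q"
  shows "(\<integral>z. J z * (\<integral>x. (p (fst z - fst x) * q (snd z - snd x)) * \<psi> x \<partial>lborel) \<partial>lborel)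
      = (\<integral>x. \<psi> x * conv2 p q J x \<partial>lborel)" (is "?L = ?R")
    and "integrable lborel (\<lambda>x. \<psi> x * conv2 p q J x)"
proof -
  let ?f = "\<lambda>z x. (J z * \<psi> x) * (p (fst z - fst x) * q (snd z - snd x))"
  obtain B where B: "\<And>s t. \<bar>p s * q t\<bar> \<le> B" using ker_pair_bounded[OF p q] by metis
  have d: "(\<lambda>w :: (real \<times> real) \<times> (real \<times> real). fst w - snd w) \<in> measurable (lborel \<Otimes>\<^sub>M lborel) borel"
    unfolding lborel_prod by (auto intro!: borel_measurable_continuous_onI continuous_intros)
  have m: "(\<lambda>w. p (fst (fst w) - fst (snd w)) * q (snd (fst w) - snd (snd w))) \<in> borel_measurable (lborel \<Otimes>\<^sub>M lborel)"
    using measurable_compose[OF d ker_pair_measurable[OF p q]] by simp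
  have i: "integrable (lborel \<Otimes>\<^sub>M lborel) (case_prod ?f)"
    using integrable_mult_bounded[OF integrable_pair_mult[OF J \<psi>] m B]
    by (simp add: case_prod_unfold)
  have "?L = (\<integral>z. (\<integral>x. ?f z x \<partial>lborel) \<partial>lborel)"
    by (simp add: mult_ac flip: integral_mult_right_zero)
  also have "\<dots> = (\<integral>x. (\<integral>z. ?f z x \<partial>lborel) \<partial>lborel)"
    by (rule lborel_pair.Fubini_integral[OF i, symmetric])
  also have "\<dots> = ?R"
    unfolding conv2_def by (simp add: mult_ac flip: integral_mult_right_zero)
  finally show "?L = ?R" .
  show "integrable lborel (\<lambda>x. \<psi> x * conv2 p q J x)"
    using lborel_pair.integrable_snd[OF i]
    unfolding conv2_def by (simp add: mult_ac flip: integral_mult_right_zero)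
qed

lemma ker_integral:
  assumes "((\<lambda>x. f (s - x) * F x) has_integral I) {s - r..s}" 
    and "continuous_on UNIV f" "test1 a b F"
  shows "integrable lborel (\<lambda>x. (indicator {0..r} (s - x) * f (s - x)) * F x)"
    and "(\<integral>x. (indicator {0..r} (s - x) * f (s - x)) * F x \<partial>lborel) = I"
proof -
  have "continuous_on {s - r..s} (\<lambda>x. f (s - x) * F x)"
    using assms(2,3) smooth1_continuous unfolding test1_def
    by (intro continuous_intros continuous_on_compose2[OF assms(2)]) auto
  then have i: "set_integrable lborel {s - r..s} (\<lambda>x. f (s - x) * F x)"
    by (rule borel_integrable_atLeastAtMost')
  have eq: "(indicator {0..r} (s - x) * f (s - x)) * F x = indicator {s - r..s} x *\<^sub>R (f (s - x) * F x)" for x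
    by (auto simp: indicator_def)
  show "integrable lborel (\<lambda>x. (indicator {0..r} (s - x) * f (s - x)) * F x)"
    unfolding eq using i by (simp only: set_integrable_def)
  show "(\<integral>x. (indicator {0..r} (s - x) * f (s - x)) * F x \<partial>lborel) = I"
    unfolding eq using set_borel_integral_eq_integral(2)[OF i] assms(1)
    by (simp add: set_lebesgue_integral_def integral_unique)
qed

text \<open>
  In one variable, \<open>w x\<close> is the integral of \<open>kerM r s * w (x + s) - kerN r s * w' (x + s)\<close> over
  \<open>s\<close>; here this is applied in both variables, with \<open>g1\<close>, \<open>g2\<close> and \<open>h\<close> in the place of the first
  derivatives and the mixed derivative of \<open>W\<close>.
\<close>

definition mixed_rep :: "real \<Rightarrow> (real \<times> real \<Rightarrow> real) \<Rightarrow> (real \<times> real \<Rightarrow> real) \<Rightarrow>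
    (real \<times> real \<Rightarrow> real) \<Rightarrow> (real \<times> real \<Rightarrow> real) \<Rightarrow> real \<times> real \<Rightarrow> real" where
  "mixed_rep r W g1 g2 h x = conv2 (kerM r) (kerM r) W x - conv2 (kerN r) (kerM r) g1 x
     - conv2 (kerM r) (kerN r) g2 x + conv2 (kerN r) (kerN r) h x"

lemma mixed_rep_continuous:
  assumes "integrable lborel W" "integrable lborel g1" "integrable lborel g2" "integrable lborel h"
  shows "continuous_on UNIV (mixed_rep r W g1 g2 h)"
  unfolding mixed_rep_def[abs_def]
  by (intro continuous_intros conv2_continuous assms good_kerM good_kerN)

text \<open>Writing F = M + N' and G = m + n' splits the test function into four products. The
  derivatives in them are moved onto \<open>W\<close>, in the last product twice by way of
  \<open>g1\<close>, and Fubini then carries the kernels inside \<open>M\<close>, \<open>N\<close>,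
  \<open>m\<close>, \<open>n\<close> over to \<open>W\<close>, \<open>g1\<close>, \<open>g2\<close>,
  \<open>h\<close>. The rectangle is enlarged by \<open>r\<close> because the averaged functions
  have larger supports.\<close>

lemma mixed_rep_test:
  assumes r: "0 < r"
    and int: "integrable lborel W" "integrable lborel g1" "integrable lborel g2" "integrable lborel h"
    and pd: "pd1 V W g1" "pd2 V W g2" "pd2 V g1 h"
    and F: "test1 a b F" "a \<le> b" and G: "test1 c d G" "c \<le> d" and sub: "{a..b + r} \<times> {c..d + r} \<subseteq> V"
  shows "(\<integral>z. W z * (F (fst z) * G (snd z)) \<partial>lborel)
       = (\<integral>z. (F (fst z) * G (snd z)) * mixed_rep r W g1 g2 h z \<partial>lborel)"
proof -
  obtain M N N' where M: "test1 a (b + r) M" "test1 a (b + r) N"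
    "\<And>x. (N has_real_derivative N' x) (at x)" "\<And>x. F x = M x + N' x"
    "\<And>s. ((\<lambda>x. (1 / r) * F x) has_integral M s) {s - r..s}"
    "\<And>s. ((\<lambda>x. (1 - (s - x) / r) * F x) has_integral N s) {s - r..s}"
    using averaging_decomposition[OF F r] by blast
  obtain m n n' where m: "test1 c (d + r) m" "test1 c (d + r) n"
    "\<And>x. (n has_real_derivative n' x) (at x)" "\<And>x. G x = m x + n' x"
    "\<And>s. ((\<lambda>x. (1 / r) * G x) has_integral m s) {s - r..s}"
    "\<And>s. ((\<lambda>x. (1 - (s - x) / r) * G x) has_integral n s) {s - r..s}"
    using averaging_decomposition[OF G r] by blast
  \<comment> \<open>The derivative of a test function is again one with the same support, hence may
    be inserted in the second variable's identity as well.\<close>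
  have N': "test1 a (b + r) N'" using test1_deriv[OF M(2)] M(3) DERIV_unique by (metis ext)
  have n': "test1 c (d + r) n'" using test1_deriv[OF m(2)] m(3) DERIV_unique by (metis ext)
  note I = integrable_mult_tensor
  have "(\<integral>z. W z * (F (fst z) * G (snd z)) \<partial>lborel)
     = (\<integral>z. W z * (M (fst z) * m (snd z)) + W z * (N' (fst z) * m (snd z))
         + W z * (M (fst z) * n' (snd z)) + W z * (N' (fst z) * n' (snd z)) \<partial>lborel)"
    by (intro Bochner_Integration.integral_cong) (auto simp: M(4) m(4) algebra_simps)
  also have "\<dots> = (\<integral>z. W z * (M (fst z) * m (snd z)) \<partial>lborel) + (\<integral>z. W z * (N' (fst z) * m (snd z)) \<partial>lborel)
       + (\<integral>z. W z * (M (fst z) * n' (snd z)) \<partial>lborel) + (\<integral>z. W z * (N' (fst z) * n' (snd z)) \<partial>lborel)"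
    by (simp add: I[OF int(1) M(1) m(1)] I[OF int(1) N' m(1)] I[OF int(1) M(1) n'] I[OF int(1) N' n'])
  also have "(\<integral>z. W z * (N' (fst z) * m (snd z)) \<partial>lborel) = - (\<integral>z. g1 z * (N (fst z) * m (snd z)) \<partial>lborel)"
    by (rule pd1D[OF pd(1) M(2,3) m(1) sub])
  also have "(\<integral>z. W z * (M (fst z) * n' (snd z)) \<partial>lborel) = - (\<integral>z. g2 z * (M (fst z) * n (snd z)) \<partial>lborel)"
    by (rule pd2D[OF pd(2) M(1) m(3,2) sub])
  also have "(\<integral>z. W z * (N' (fst z) * n' (snd z)) \<partial>lborel) = - (\<integral>z. g1 z * (N (fst z) * n' (snd z)) \<partial>lborel)"
    by (rule pd1D[OF pd(1) M(2,3) n' sub])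
  also have "(\<integral>z. g1 z * (N (fst z) * n' (snd z)) \<partial>lborel) = - (\<integral>z. h z * (N (fst z) * n (snd z)) \<partial>lborel)"
    by (rule pd2D[OF pd(3) M(2) m(3,2) sub])
  also have "(\<integral>z. W z * (M (fst z) * m (snd z)) \<partial>lborel) + - (\<integral>z. g1 z * (N (fst z) * m (snd z)) \<partial>lborel) +
      - (\<integral>z. g2 z * (M (fst z) * n (snd z)) \<partial>lborel) + - (- (\<integral>z. h z * (N (fst z) * n (snd z)) \<partial>lborel))
    = (\<integral>z. (F (fst z) * G (snd z)) * mixed_rep r W g1 g2 h z \<partial>lborel)"
  proof -
    let ?\<psi> = "\<lambda>z. F (fst z) * G (snd z)"
    have \<psi>: "integrable lborel ?\<psi>" by (rule integrable_tensor[OF F(1) G(1)])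
    have KM: "integrable lborel (\<lambda>x. kerM r (s - x) * F x)" "(\<integral>x. kerM r (s - x) * F x \<partial>lborel) = M s"
         "integrable lborel (\<lambda>x. kerM r (s - x) * G x)" "(\<integral>x. kerM r (s - x) * G x \<partial>lborel) = m s" for s
      unfolding kerM_def
      by (rule ker_integral[where f="\<lambda>_. 1 / r", OF _ _ F(1)] ker_integral[where f="\<lambda>_. 1 / r", OF _ _ G(1)] M(5) m(5) continuous_on_const)+
    have cN: "continuous_on UNIV (\<lambda>s. 1 - s / r)" using r by (auto intro!: continuous_intros)
    have KN: "integrable lborel (\<lambda>x. kerN r (s - x) * F x)" "(\<integral>x. kerN r (s - x) * F x \<partial>lborel) = N s"
         "integrable lborel (\<lambda>x. kerN r (s - x) * G x)" "(\<integral>x. kerN r (s - x) * G x \<partial>lborel) = n s" for s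
      unfolding kerN_def
      by (rule ker_integral[where f="\<lambda>s. 1 - s / r", OF _ _ F(1)] ker_integral[where f="\<lambda>s. 1 - s / r", OF _ _ G(1)] M(6) m(6) cN)+
    have T: "(\<integral>x. (p (fst z - fst x) * q (snd z - snd x)) * ?\<psi> x \<partial>lborel) = P (fst z) * Q (snd z)"
      if "\<And>s. integrable lborel (\<lambda>x. p (s - x) * F x)" "\<And>s. (\<integral>x. p (s - x) * F x \<partial>lborel) = P s"
         "\<And>s. integrable lborel (\<lambda>x. q (s - x) * G x)" "\<And>s. (\<integral>x. q (s - x) * G x \<partial>lborel) = Q s" for p q P Q z
      using integral_tensor[OF that(1)[of "fst z"] that(3)[of "snd z"]] that(2,4) by (simp add: mult_ac)
    have T2: "(\<integral>z. J z * (P (fst z) * Q (snd z)) \<partial>lborel) = (\<integral>z. ?\<psi> z * conv2 p q J z \<partial>lborel)"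
      if "integrable lborel J" "good_ker p" "good_ker q"
         "\<And>s. integrable lborel (\<lambda>x. p (s - x) * F x)" "\<And>s. (\<integral>x. p (s - x) * F x \<partial>lborel) = P s"
         "\<And>s. integrable lborel (\<lambda>x. q (s - x) * G x)" "\<And>s. (\<integral>x. q (s - x) * G x \<partial>lborel) = Q s" for p q P Q J
      using conv2_swap(1)[OF that(1) \<psi> that(2,3)] unfolding T[of p P q Q, OF that(4-7)] .
    note gk = good_kerM[of r] good_kerN[of r]
    note C = conv2_swap(2)[OF int(1) \<psi> gk(1) gk(1)] conv2_swap(2)[OF int(2) \<psi> gk(2) gk(1)]
       conv2_swap(2)[OF int(3) \<psi> gk(1) gk(2)] conv2_swap(2)[OF int(4) \<psi> gk(2) gk(2)]
    have "(\<integral>z. ?\<psi> z * mixed_rep r W g1 g2 h z \<partial>lborel) =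
        (\<integral>z. ?\<psi> z * conv2 (kerM r) (kerM r) W z \<partial>lborel) - (\<integral>z. ?\<psi> z * conv2 (kerN r) (kerM r) g1 z \<partial>lborel)
      - (\<integral>z. ?\<psi> z * conv2 (kerM r) (kerN r) g2 z \<partial>lborel) + (\<integral>z. ?\<psi> z * conv2 (kerN r) (kerN r) h z \<partial>lborel)"
      unfolding mixed_rep_def right_diff_distrib distrib_left using C by simp
    then show ?thesis
      unfolding T2[OF int(1) gk(1) gk(1) KM(1,2) KM(3,4)] T2[OF int(2) gk(2) gk(1) KN(1,2) KM(3,4)]
        T2[OF int(3) gk(1) gk(2) KM(1,2) KN(3,4)] T2[OF int(4) gk(2) gk(2) KN(1,2) KN(3,4)] by simp
  qed
  finally show ?thesis by simp
qed

text \<open>The tested identity holds for supports in \<open>V0\<close>, because the cone condition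
  keeps the enlarged rectangles inside \<open>V\<close>; the fundamental lemma turns it into
  equality almost everywhere.\<close>

lemma mixed_rep_AE:
  assumes r: "0 < r"
    and int: "integrable lborel W" "integrable lborel g1" "integrable lborel g2" "integrable lborel h"
    and pd: "pd1 V W g1" "pd2 V W g2" "pd2 V g1 h"
    and V0: "open V0" and cone: "\<And>x \<sigma> \<tau>. x \<in> V0 \<Longrightarrow> 0 \<le> \<sigma> \<Longrightarrow> \<sigma> \<le> r \<Longrightarrow> 0 \<le> \<tau> \<Longrightarrow> \<tau> \<le> r \<Longrightarrow> x + (\<sigma>, \<tau>) \<in> V"
  shows "AE z in lborel. z \<in> V0 \<longrightarrow> W z = mixed_rep r W g1 g2 h z"
proof -
  let ?\<Phi> = "mixed_rep r W g1 g2 h"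
  have c: "continuous_on UNIV ?\<Phi>" by (rule mixed_rep_continuous[OF int])
  have "AE z in lborel. z \<in> V0 \<longrightarrow> W z - ?\<Phi> z = 0"
  proof (rule tensor_fundamental_lemma[OF V0])
    fix a b c' d :: real
    have "integrable lborel (\<lambda>z. indicator ({a..b} \<times> {c'..d}) z *\<^sub>R W z)"
      by (rule integrable_mult_indicator[OF _ int(1)]) simp
    moreover have "integrable lborel (\<lambda>z. indicator ({a..b} \<times> {c'..d}) z *\<^sub>R ?\<Phi> z)"
      by (rule borel_integrable_compact[OF _ continuous_on_subset[OF c]])
        (auto intro!: compact_Times compact_Icc)
    ultimately show "integrable lborel (\<lambda>z. indicator ({a..b} \<times> {c'..d}) z * (W z - ?\<Phi> z))"
      using Bochner_Integration.integrable_diff by (fastforce simp: right_diff_distrib)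
  next
    fix a b c' d F G
    assume F: "test1 a b F" and G: "test1 c' d G" and sub: "{a..b} \<times> {c'..d} \<subseteq> V0"
    show "(\<integral>z. (W z - ?\<Phi> z) * (F (fst z) * G (snd z)) \<partial>lborel) = 0"
    proof (cases "a \<le> b \<and> c' \<le> d")
      case True
      have "{a..b + r} \<times> {c'..d + r} \<subseteq> V"
      proof
        fix z assume "z \<in> {a..b + r} \<times> {c'..d + r}"
        then obtain s t where z: "z = (s, t)" "a \<le> s" "s \<le> b + r" "c' \<le> t" "t \<le> d + r" by auto
        \<comment> \<open>A point of the enlarged rectangle is a point of the original one plus a
          shift by at most \<open>r\<close> in each coordinate.\<close>
        have "(min s b, min t d) \<in> V0" using True z sub by auto
        from cone[OF this, of "s - min s b" "t - min t d"] show "z \<in> V" using z r by auto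
      qed
      from mixed_rep_test[OF r int pd F _ G _ this] True
      have "(\<integral>z. W z * (F (fst z) * G (snd z)) \<partial>lborel) = (\<integral>z. ?\<Phi> z * (F (fst z) * G (snd z)) \<partial>lborel)"
        by (simp add: mult.commute)
      moreover have "integrable lborel (\<lambda>z. ?\<Phi> z * (F (fst z) * G (snd z)))"
      proof -
        have "integrable lborel (\<lambda>z. indicator ({a..b} \<times> {c'..d}) z *\<^sub>R ?\<Phi> z)"
          by (rule borel_integrable_compact[OF _ continuous_on_subset[OF c]])
            (auto intro!: compact_Times compact_Icc)
        from integrable_mult_tensor[OF this F G]
        have "integrable lborel (\<lambda>z. (indicator ({a..b} \<times> {c'..d}) z *\<^sub>R ?\<Phi> z) * (F (fst z) * G (snd z)))" .
        moreover have "(\<lambda>z. (indicator ({a..b} \<times> {c'..d}) z *\<^sub>R ?\<Phi> z) * (F (fst z) * G (snd z)))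
            = (\<lambda>z. ?\<Phi> z * (F (fst z) * G (snd z)))"
          using F G by (auto simp: indicator_def test1_def mem_Times_iff fun_eq_iff)
        ultimately show ?thesis by (simp only:)
      qed
      ultimately show ?thesis
        using integrable_mult_tensor[OF int(1) F G] by (simp add: left_diff_distrib)
    next
      \<comment> \<open>For an empty interval the corresponding test function is identically
        zero.\<close>
      case False
      then have "(\<lambda>z. (W z - ?\<Phi> z) * (F (fst z) * G (snd z))) = (\<lambda>z. 0)"
        using F G by (auto simp: test1_def fun_eq_iff)
      then show ?thesis by (simp only:) simp
    qed
  qed
  then show ?thesis by simp
qed

section \<open>Weak gradients in the plane\<close>

subsection \<open>Integrability against test functions\<close>

text \<open>Local integrability gives information on compact sets only; the factor
  \<open>\<eta>\<close> is bounded and vanishes off \<open>K\<close>, so the integral over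
  \<open>\<Omega>\<close> is one over \<open>K\<close>.\<close>

lemma integrable_scaleR_compact_support:
  fixes f :: "plane \<Rightarrow> 'b::euclidean_space"
  assumes \<Omega>: "open \<Omega>" and f: "locally_integrable \<Omega> f" 
    and K: "compact K" "K \<subseteq> \<Omega>" "\<And>x. x \<notin> K \<Longrightarrow> \<eta> x = 0" and \<eta>: "continuous_on UNIV \<eta>"
  shows "integrable (lebesgue_on \<Omega>) (\<lambda>x. \<eta> x *\<^sub>R f x)"
proof -
  have s: "\<Omega> \<in> sets lebesgue" "K \<in> sets lebesgue"
    using \<Omega> fmeasurableD[OF lmeasurable_compact[OF K(1)]] by auto
  have "integrable (lebesgue_on K) f" using f K unfolding locally_integrable_def by blast
  then have i: "integrable lebesgue (\<lambda>x. indicator K x *\<^sub>R f x)"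
    using s by (simp add: integrable_restrict_space)
  obtain B where B: "\<And>x. \<bar>\<eta> x\<bar> \<le> B"
  proof -
    have "compact (\<eta> ` K)" using K(1) continuous_on_subset[OF \<eta>] by (intro compact_continuous_image) auto
    then obtain B where "\<forall>x\<in>\<eta> ` K. norm x \<le> B" using compact_imp_bounded bounded_iff by blast
    then have "\<bar>\<eta> x\<bar> \<le> max B 0" for x using K(3) by (cases "x \<in> K") (auto simp: le_max_iff_disj)
    then show ?thesis by (rule that)
  qed
  have "\<eta> \<in> borel_measurable borel" using \<eta> by (rule borel_measurable_continuous_onI)
  then have m: "\<eta> \<in> borel_measurable lebesgue" by (simp add: measurable_completion)
  have "integrable lebesgue (\<lambda>x. \<eta> x *\<^sub>R (indicator K x *\<^sub>R f x))"
  proof (rule Bochner_Integration.integrable_bound)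
    show "integrable lebesgue (\<lambda>x. B * norm (indicator K x *\<^sub>R f x))"
      using integrable_norm[OF i] by (intro integrable_mult_right) simp
    show "(\<lambda>x. \<eta> x *\<^sub>R (indicator K x *\<^sub>R f x)) \<in> borel_measurable lebesgue"
      using m borel_measurable_integrable[OF i] by (rule borel_measurable_scaleR)
    show "AE x in lebesgue. norm (\<eta> x *\<^sub>R (indicator K x *\<^sub>R f x)) \<le> norm (B * norm (indicator K x *\<^sub>R f x))"
    proof (rule AE_I2)
      fix x
      have "norm (\<eta> x *\<^sub>R (indicator K x *\<^sub>R f x)) = \<bar>\<eta> x\<bar> * norm (indicator K x *\<^sub>R f x)"
        by (simp only: norm_scaleR)
      also have "\<dots> \<le> B * norm (indicator K x *\<^sub>R f x)" by (rule mult_right_mono[OF B norm_ge_zero])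
      finally show "norm (\<eta> x *\<^sub>R (indicator K x *\<^sub>R f x)) \<le> norm (B * norm (indicator K x *\<^sub>R f x))"
        by (simp only: real_norm_def)
    qed
  qed
  moreover have "(\<lambda>x. \<eta> x *\<^sub>R (indicator K x *\<^sub>R f x)) = (\<lambda>x. indicator \<Omega> x *\<^sub>R (\<eta> x *\<^sub>R f x))"
    using K by (auto simp: indicator_def fun_eq_iff)
  ultimately have "integrable lebesgue (\<lambda>x. indicator \<Omega> x *\<^sub>R (\<eta> x *\<^sub>R f x))" by simp
  then show ?thesis using s by (simp add: integrable_restrict_space)
qed

lemma test_functionE:
  assumes "\<psi> \<in> test_functions \<Omega>"
  obtains K where "compact K" "K \<subseteq> \<Omega>" "\<And>x. x \<notin> K \<Longrightarrow> \<psi> x = 0" "\<And>x. x \<notin> K \<Longrightarrow> grad \<psi> x = 0"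
    "\<And>x. (\<psi> has_derivative (\<lambda>v. grad \<psi> x \<bullet> v)) (at x)" "continuous_on UNIV \<psi>" "\<And>i. continuous_on UNIV (\<lambda>x. grad \<psi> x $ i)"
proof -
  obtain K where K: "compact K" "K \<subseteq> \<Omega>" "\<And>x. x \<notin> K \<Longrightarrow> \<psi> x = 0"
    using assms unfolding test_functions_def by blast
  have C: "Ck k \<psi>" for k using assms unfolding test_functions_def by blast
  have g: "grad \<psi> x = 0" if "x \<notin> K" for x
  proof (rule grad_eqI)
    have "((\<lambda>x. 0) has_derivative (\<lambda>v. 0)) (at x)" by simp
    then have "(\<psi> has_derivative (\<lambda>v. 0)) (at x)"
      by (rule has_derivative_transform_within_open[of _ _ _ UNIV "- K"])
        (use that K in \<open>auto simp: open_Compl compact_imp_closed\<close>)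
    then show "(\<psi> has_derivative (\<lambda>v. 0 \<bullet> v)) (at x)" by simp
  qed
  have "continuous_on UNIV (\<lambda>x. grad \<psi> x $ i)" for i
    using C[of "Suc 0"] by simp
  moreover have "continuous_on UNIV \<psi>" using C[of 0] by simp
  ultimately show ?thesis
    using that[OF K g has_derivative_grad[OF Ck_differentiable[OF C]]] by blast
qed

lemma locally_integrable_lincomb:
  fixes f g :: "plane \<Rightarrow> 'b::euclidean_space"
  shows "locally_integrable \<Omega> f \<Longrightarrow> locally_integrable \<Omega> g \<Longrightarrow> locally_integrable \<Omega> (\<lambda>x. c *\<^sub>R f x + d *\<^sub>R g x)"
  unfolding locally_integrable_def by auto

lemma test_function_integrable:
  fixes w :: "plane \<Rightarrow> real" and g :: "plane \<Rightarrow> 'b::euclidean_space"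
  assumes "open \<Omega>" "\<psi> \<in> test_functions \<Omega>"
  shows "locally_integrable \<Omega> w \<Longrightarrow> integrable (lebesgue_on \<Omega>) (\<lambda>x. w x *\<^sub>R grad \<psi> x)"
    and "locally_integrable \<Omega> g \<Longrightarrow> integrable (lebesgue_on \<Omega>) (\<lambda>x. \<psi> x *\<^sub>R g x)"
proof -
  obtain K where K: "compact K" "K \<subseteq> \<Omega>" "\<And>x. x \<notin> K \<Longrightarrow> \<psi> x = 0" "\<And>x. x \<notin> K \<Longrightarrow> grad \<psi> x = 0"
    "\<And>x. (\<psi> has_derivative (\<lambda>v. grad \<psi> x \<bullet> v)) (at x)" "continuous_on UNIV \<psi>" "\<And>i. continuous_on UNIV (\<lambda>x. grad \<psi> x $ i)"
    using test_functionE[OF assms(2)] by metis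
  show "locally_integrable \<Omega> g \<Longrightarrow> integrable (lebesgue_on \<Omega>) (\<lambda>x. \<psi> x *\<^sub>R g x)"
    by (rule integrable_scaleR_compact_support[OF assms(1) _ K(1-3,6)])
  assume w: "locally_integrable \<Omega> w"
  have "integrable (lebesgue_on \<Omega>) (\<lambda>x. \<Sum>i\<in>UNIV. (grad \<psi> x $ i *\<^sub>R w x) *\<^sub>R (axis i 1 :: plane))"
    using integrable_scaleR_compact_support[OF assms(1) w K(1,2) _ K(7)] K(4) by auto
  moreover have "(\<lambda>x. \<Sum>i\<in>UNIV. (grad \<psi> x $ i *\<^sub>R w x) *\<^sub>R (axis i 1 :: plane)) = (\<lambda>x. w x *\<^sub>R grad \<psi> x)"
    by (auto simp: fun_eq_iff vec_eq_iff axis_def if_distrib cong: if_cong)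
  ultimately show "integrable (lebesgue_on \<Omega>) (\<lambda>x. w x *\<^sub>R grad \<psi> x)" by simp
qed

lemma is_weak_grad_lincomb:
  assumes "open \<Omega>" "is_weak_grad \<Omega> w g" "is_weak_grad \<Omega> w' g'"
  shows "is_weak_grad \<Omega> (\<lambda>x. c * w x + d * w' x) (\<lambda>x. c *\<^sub>R g x + d *\<^sub>R g' x)"
  unfolding is_weak_grad_def
proof (intro conjI ballI)
  show "locally_integrable \<Omega> (\<lambda>x. c * w x + d * w' x)"
    using locally_integrable_lincomb[of \<Omega> w w' c d] assms by (auto simp: is_weak_grad_def)
  show "locally_integrable \<Omega> (\<lambda>x. c *\<^sub>R g x + d *\<^sub>R g' x)"
    using locally_integrable_lincomb assms by (auto simp: is_weak_grad_def)
  fix \<psi> assume \<psi>: "\<psi> \<in> test_functions \<Omega>"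
  have l: "locally_integrable \<Omega> w" "locally_integrable \<Omega> w'" "locally_integrable \<Omega> g" "locally_integrable \<Omega> g'"
    using assms by (auto simp: is_weak_grad_def)
  note I = test_function_integrable(1)[OF assms(1) \<psi> l(1)] test_function_integrable(1)[OF assms(1) \<psi> l(2)]
    test_function_integrable(2)[OF assms(1) \<psi> l(3)] test_function_integrable(2)[OF assms(1) \<psi> l(4)]
  have "(LINT x|lebesgue_on \<Omega>. (c * w x + d * w' x) *\<^sub>R grad \<psi> x)
      = (LINT x|lebesgue_on \<Omega>. c *\<^sub>R (w x *\<^sub>R grad \<psi> x) + d *\<^sub>R (w' x *\<^sub>R grad \<psi> x))"
    by (simp add: scaleR_add_left)
  also have "\<dots> = c *\<^sub>R (LINT x|lebesgue_on \<Omega>. w x *\<^sub>R grad \<psi> x) + d *\<^sub>R (LINT x|lebesgue_on \<Omega>. w' x *\<^sub>R grad \<psi> x)"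
    by (simp only: Bochner_Integration.integral_add[OF integrable_scaleR_right[OF I(1)] integrable_scaleR_right[OF I(2)]]
        integral_scaleR_right)
  also have "\<dots> = - (c *\<^sub>R (LINT x|lebesgue_on \<Omega>. \<psi> x *\<^sub>R g x) + d *\<^sub>R (LINT x|lebesgue_on \<Omega>. \<psi> x *\<^sub>R g' x))"
    using assms(2,3) \<psi> by (simp add: is_weak_grad_def)
  also have "\<dots> = - (LINT x|lebesgue_on \<Omega>. c *\<^sub>R (\<psi> x *\<^sub>R g x) + d *\<^sub>R (\<psi> x *\<^sub>R g' x))"
    by (simp only: Bochner_Integration.integral_add[OF integrable_scaleR_right[OF I(3)] integrable_scaleR_right[OF I(4)]]
        integral_scaleR_right)
  also have "\<dots> = - (LINT x|lebesgue_on \<Omega>. \<psi> x *\<^sub>R (c *\<^sub>R g x + d *\<^sub>R g' x))"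
    by (simp add: scaleR_add_right mult.commute)
  finally show "(LINT x|lebesgue_on \<Omega>. (c * w x + d * w' x) *\<^sub>R grad \<psi> x)
      = - (LINT x|lebesgue_on \<Omega>. \<psi> x *\<^sub>R (c *\<^sub>R g x + d *\<^sub>R g' x))" .
qed

subsection \<open>Linear coordinates\<close>

text \<open>The basis \<alpha>, \<beta> dual to u, v is carried along: coordinates are then inner
  products, and a function of the coordinates has its gradient in terms of \<alpha> and
  \<beta>.\<close>

definition frame :: "plane \<Rightarrow> plane \<Rightarrow> plane \<Rightarrow> plane \<Rightarrow> bool" where
  "frame u v \<alpha> \<beta> \<longleftrightarrow> \<alpha> \<bullet> u = 1 \<and> \<alpha> \<bullet> v = 0 \<and> \<beta> \<bullet> u = 0 \<and> \<beta> \<bullet> v = 1 \<and>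
     (\<forall>x. x = (\<alpha> \<bullet> x) *\<^sub>R u + (\<beta> \<bullet> x) *\<^sub>R v)"

definition fmap :: "plane \<Rightarrow> plane \<Rightarrow> real \<times> real \<Rightarrow> plane" where
  "fmap u v z = fst z *\<^sub>R u + snd z *\<^sub>R v"

lemma frame_exists:
  assumes "u $ 1 * v $ 2 - u $ 2 * v $ 1 \<noteq> 0"
  obtains \<alpha> \<beta> where "frame u v \<alpha> \<beta>"
proof
  define D where "D = u $ 1 * v $ 2 - u $ 2 * v $ 1"
  have D: "D \<noteq> 0" using assms by (simp add: D_def)
  \<comment> \<open>The rows of the inverse of the matrix with columns \<open>u\<close> and
    \<open>v\<close>.\<close>
  show "frame u v (vector [v $ 2 / D, - v $ 1 / D]) (vector [- u $ 2 / D, u $ 1 / D])"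
    using D unfolding frame_def inner_vec_def vec_eq_iff
    by (auto simp: sum_2 forall_2 field_simps) (auto simp: D_def algebra_simps)
qed

lemma frame_axis: "frame (axis 1 1) (axis 2 1) (axis 1 1) (axis 2 1)"
  "frame (axis 2 1) (axis 1 1) (axis 2 1) (axis 1 1)"
  by (auto simp: frame_def inner_vec_def sum_2 vec_eq_iff forall_2 axis_def)

lemma fmap_coord: "frame u v \<alpha> \<beta> \<Longrightarrow> \<alpha> \<bullet> fmap u v z = fst z" "frame u v \<alpha> \<beta> \<Longrightarrow> \<beta> \<bullet> fmap u v z = snd z"
  unfolding frame_def fmap_def by (simp_all add: inner_add_right)

lemma fmap_continuous: "continuous_on A (fmap u v)"
  unfolding fmap_def[abs_def] by (intro continuous_intros)

lemma fmap_measurable [measurable]: "fmap u v \<in> borel_measurable borel"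
  by (rule borel_measurable_continuous_onI[OF fmap_continuous])

lemma box_real_pair: "box (a, b) (c, d) = {a<..<c} \<times> {b<..<d}" for a b c d :: real
  by (auto simp: box_def Basis_prod_def)

lemma distr_fmap_axis: "distr lborel borel (fmap (axis 1 1) (axis 2 1)) = lborel"
proof (rule lborel_eqI[symmetric])
  fix l u :: plane assume le: "\<And>b. b \<in> Basis \<Longrightarrow> l \<bullet> b \<le> u \<bullet> b"
  have le': "l $ i \<le> u $ i" for i using le[of "axis i 1"] by (auto simp: inner_axis axis_in_Basis_iff)
  have eq: "fmap (axis 1 1) (axis 2 1) -` box l u = box (l $ 1, l $ 2) (u $ 1, u $ 2)"
    by (auto simp: fmap_def mem_box_cart forall_2 axis_def box_real_pair)
  have "emeasure (distr lborel borel (fmap (axis 1 1) (axis 2 1))) (box l u)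
      = emeasure lborel (box (l $ 1, l $ 2) (u $ 1, u $ 2))"
    by (subst emeasure_distr) (auto simp: eq)
  also have "\<dots> = ennreal ((u $ 1 - l $ 1) * (u $ 2 - l $ 2))"
    using le' by (subst emeasure_lborel_box) (auto simp: Basis_prod_def prod.union_disjoint)
  also have "\<dots> = ennreal (\<Prod>b\<in>Basis. (u - l) \<bullet> b)"
    by (simp add: Basis_vec_def prod.UNION_disjoint inner_axis UNIV_2 axis_eq_axis mult.commute)
  finally show "emeasure (distr lborel borel (fmap (axis 1 1) (axis 2 1))) (box l u) = ennreal (\<Prod>b\<in>Basis. (u - l) \<bullet> b)" .
qed simp


text \<open>A linear isomorphism changes Lebesgue measure by a constant factor. Its value is left
  unspecified, since it cancels from every identity in which it occurs.\<close>

lemma lborel_eq_density_distr_fmap: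
  assumes "frame u v \<alpha> \<beta>"
  obtains k :: real where "k > 0" "lborel = density (distr lborel borel (fmap u v)) (\<lambda>_. ennreal k)"
proof -
  let ?\<iota> = "fmap (axis 1 1) (axis 2 1)"
  define M where "M = (\<lambda>x :: plane. x $ 1 *\<^sub>R u + x $ 2 *\<^sub>R v)"
  define N where "N = (\<lambda>x :: plane. (\<chi> i. if i = 1 then \<alpha> \<bullet> x else \<beta> \<bullet> x) :: plane)"
  have du: "\<alpha> \<bullet> u = 1" "\<alpha> \<bullet> v = 0" "\<beta> \<bullet> u = 0" "\<beta> \<bullet> v = 1"
    and ex: "x = (\<alpha> \<bullet> x) *\<^sub>R u + (\<beta> \<bullet> x) *\<^sub>R v" for x
    using assms unfolding frame_def by blast+
  have NM: "N (M x) = x" "M (N x) = x" for x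
    using ex[of x, symmetric] du by (auto simp: N_def M_def vec_eq_iff forall_2 inner_add_right)
  have lM: "linear M" unfolding M_def by (intro linearI) (auto simp: algebra_simps)
  have lN: "linear N" unfolding N_def by (intro linearI) (auto simp: vec_eq_iff inner_add_right)
  have cM: "continuous_on UNIV M" using lM by (simp add: linear_continuous_on linear_conv_bounded_linear)
  have fm: "fmap u v = M \<circ> ?\<iota>"
    by (auto simp: fmap_def M_def fun_eq_iff axis_def)
  \<comment> \<open>Preimages under \<open>M\<close> are images under its inverse \<open>N\<close>,
    and for linear images the measure is given by the determinant.\<close>
  have im: "M -` S = N ` S" for S
  proof (intro set_eqI iffI)
    fix x assume "x \<in> M -` S"
    then have "M x \<in> S" by simp
    then have "N (M x) \<in> N ` S" by (rule imageI)
    then show "x \<in> N ` S" by (simp only: NM)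
  qed (auto simp: NM)
  define d where "d = \<bar>det (matrix N)\<bar>"
  have "N \<circ> M = id" using NM by auto
  then have "matrix N ** matrix M = mat 1"
    using matrix_compose[OF lM lN] by (simp add: matrix_id_mat_1)
  then have "det (matrix N) * det (matrix M) = 1" by (metis det_mul det_I)
  then have d: "d > 0" unfolding d_def by auto
  have "lborel = density (distr lborel borel (fmap u v)) (\<lambda>_. ennreal (1 / d))"
  proof (rule lborel_eqI)
    fix l w :: plane assume le: "\<And>b. b \<in> Basis \<Longrightarrow> l \<bullet> b \<le> w \<bullet> b"
    have oM: "open (M -` box l w)" using cM by (intro continuous_open_vimage) (auto simp: continuous_on_eq_continuous_at)
    then have bM: "M -` box l w \<in> sets borel" by auto
    have "emeasure (density (distr lborel borel (fmap u v)) (\<lambda>_. ennreal (1 / d))) (box l w)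
        = ennreal (1 / d) * emeasure lborel (fmap u v -` box l w)"
      by (subst emeasure_density_const) (auto simp: emeasure_distr)
    also have "emeasure lborel (fmap u v -` box l w) = emeasure lborel (?\<iota> -` (M -` box l w))"
      unfolding fm by (simp add: vimage_comp)
    also have "\<dots> = emeasure (distr lborel borel ?\<iota>) (M -` box l w)"
      using bM by (subst emeasure_distr) auto
    also have "\<dots> = emeasure lborel (N ` box l w)" by (simp add: distr_fmap_axis im)
    also have "\<dots> = emeasure lebesgue (N ` box l w)" using bM by (simp add: im)
    also have "\<dots> = ennreal (measure lebesgue (N ` box l w))"
      using measurable_linear_image[OF lN lmeasurable_box[of l w]] by (simp add: emeasure_eq_measure2)
    also have "\<dots> = ennreal (d * measure lebesgue (box l w))"
      by (simp add: measure_linear_image[OF lN lmeasurable_box[of l w]] d_def)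
    also have "ennreal (1 / d) * \<dots> = ennreal (measure lebesgue (box l w))"
      using d by (simp flip: ennreal_mult)
    also have "\<dots> = ennreal (\<Prod>b\<in>Basis. (w - l) \<bullet> b)"
      using emeasure_lborel_box[OF le] emeasure_eq_measure2[OF lmeasurable_box[of l w]] by simp
    finally show "emeasure (density (distr lborel borel (fmap u v)) (\<lambda>_. ennreal (1 / d))) (box l w)
        = ennreal (\<Prod>b\<in>Basis. (w - l) \<bullet> b)" .
  qed simp
  then show ?thesis using d that[of "1 / d"] by simp
qed

lemma frame_change_of_variables:
  assumes "frame u v \<alpha> \<beta>"
  obtains k :: real where "k > 0"
    "\<And>f :: plane \<Rightarrow> real. f \<in> borel_measurable borel \<Longrightarrow> (\<integral>x. f x \<partial>lborel) = k * (\<integral>z. f (fmap u v z) \<partial>lborel)"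
    "\<And>f :: plane \<Rightarrow> real. integrable lborel f \<Longrightarrow> integrable lborel (\<lambda>z. f (fmap u v z))"
    "\<And>Q :: plane \<Rightarrow> bool. Measurable.pred borel Q \<Longrightarrow> (AE z in lborel. Q (fmap u v z)) \<Longrightarrow> (AE x in lborel. Q x)"
    "\<And>Q :: plane \<Rightarrow> bool. (AE x in lborel. Q x) \<Longrightarrow> (AE z in lborel. Q (fmap u v z))"
proof -
  obtain k :: real where k: "k > 0" and L: "lborel = density (distr lborel borel (fmap u v)) (\<lambda>_. ennreal k)"
    using lborel_eq_density_distr_fmap[OF assms] by metis
  show ?thesis
  proof (rule that[OF k])
    fix f :: "plane \<Rightarrow> real" assume f: "f \<in> borel_measurable borel"
    have "(\<integral>x. f x \<partial>lborel) = (\<integral>x. f x \<partial>density (distr lborel borel (fmap u v)) (\<lambda>_. ennreal k))"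
      using L by simp
    also have "\<dots> = (\<integral>x. k * f x \<partial>distr lborel borel (fmap u v))"
      using f k by (subst integral_density) auto
    also have "\<dots> = k * (\<integral>z. f (fmap u v z) \<partial>lborel)"
      using f by (subst integral_distr) auto
    finally show "(\<integral>x. f x \<partial>lborel) = k * (\<integral>z. f (fmap u v z) \<partial>lborel)" .
  next
    fix f :: "plane \<Rightarrow> real" assume f: "integrable lborel f"
    then have fm: "f \<in> borel_measurable borel" by auto
    have "integrable (density (distr lborel borel (fmap u v)) (\<lambda>_. ennreal k)) f" using f L by simp
    then have "integrable (distr lborel borel (fmap u v)) (\<lambda>x. k * f x)"
      using fm k by (subst (asm) integrable_density) auto
    then have "integrable lborel (\<lambda>z. k * f (fmap u v z))"
      using fm by (subst (asm) integrable_distr_eq) auto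
    then show "integrable lborel (\<lambda>z. f (fmap u v z))" using k by simp
  next
    fix Q :: "plane \<Rightarrow> bool" assume Q: "Measurable.pred borel Q" and ae: "AE z in lborel. Q (fmap u v z)"
    have "AE x in distr lborel borel (fmap u v). Q x"
      using Q ae by (subst AE_distr_iff) auto
    then show "AE x in lborel. Q x"
      by (subst L) (auto simp: AE_density)
  next
    fix Q :: "plane \<Rightarrow> bool" assume "AE x in lborel. Q x"
    then have "AE x in distr lborel borel (fmap u v). Q x"
      using k by (subst (asm) L) (auto simp: AE_density)
    then show "AE z in lborel. Q (fmap u v z)" by (rule AE_distrD[rotated]) simp
  qed
qed

subsection \<open>Borel representatives\<close>

text \<open>Fubini and linear changes of variables are carried out for \<open>lborel\<close>, so
  Borel versions are needed. The value 0 off \<open>\<Omega>\<close> makes integrals over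
  \<open>\<Omega>\<close> integrals over the plane.\<close>

definition brep :: "plane set \<Rightarrow> (plane \<Rightarrow> real) \<Rightarrow> (plane \<Rightarrow> real) \<Rightarrow> bool" where
  "brep \<Omega> f f' \<longleftrightarrow> integrable lborel f' \<and> (\<forall>x. x \<notin> \<Omega> \<longrightarrow> f' x = 0) \<and> (AE x in lebesgue. x \<in> \<Omega> \<longrightarrow> f' x = f x)"

lemma brep_exists:
  assumes \<Omega>: "open \<Omega>" and f: "integrable (lebesgue_on \<Omega>) f"
  obtains f' where "brep \<Omega> f f'"
proof -
  have s: "\<Omega> \<in> sets lebesgue" using \<Omega> by auto
  have i: "integrable lebesgue (\<lambda>x. indicator \<Omega> x * f x)"
    using f s by (simp add: integrable_restrict_space)
  obtain g where g: "g \<in> borel_measurable lborel" "AE x in lborel. indicator \<Omega> x * f x = g x"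
    using completion_ex_borel_measurable_real[OF borel_measurable_integrable[OF i]] by auto
  define f' where "f' = (\<lambda>x. indicator \<Omega> x * g x)"
  have b: "f' \<in> borel_measurable lborel" using g(1) \<Omega> unfolding f'_def by auto
  have ae: "AE x in lebesgue. indicator \<Omega> x * f x = f' x"
    using AE_completion[OF g(2)] by eventually_elim (auto simp: f'_def indicator_def split: if_splits)
  have "integrable lebesgue f'"
    using i by (rule integrable_cong_AE_imp) (use b ae in \<open>auto simp: measurable_completion elim: eventually_mono\<close>)
  then have "integrable lborel f'" using b by (simp add: integrable_completion)
  moreover have "AE x in lebesgue. x \<in> \<Omega> \<longrightarrow> f' x = f x" using ae by eventually_elim auto
  ultimately show ?thesis using that[of f'] unfolding brep_def f'_def by auto
qed

lemma brep_integral: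
  assumes \<Omega>: "open \<Omega>" and f: "integrable (lebesgue_on \<Omega>) f" and b: "brep \<Omega> f f'" and h: "h \<in> borel_measurable borel"
  shows "(LINT x|lebesgue_on \<Omega>. f x * h x) = (\<integral>x. f' x * h x \<partial>lborel)"
proof -
  have s: "\<Omega> \<in> sets lebesgue" using \<Omega> by auto
  have i: "integrable lebesgue (\<lambda>x. indicator \<Omega> x * f x)"
    using f s by (simp add: integrable_restrict_space)
  have hm: "h \<in> borel_measurable lebesgue" using h by (simp add: measurable_completion)
  have f'm: "f' \<in> borel_measurable lborel" using b by (auto simp: brep_def)
  have "(LINT x|lebesgue_on \<Omega>. f x * h x) = (\<integral>x. indicator \<Omega> x * (f x * h x) \<partial>lebesgue)"
    using s by (simp add: integral_restrict_space)
  also have "\<dots> = (\<integral>x. f' x * h x \<partial>lebesgue)"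
  proof (rule integral_cong_AE)
    have "(\<lambda>x. (indicator \<Omega> x * f x) * h x) \<in> borel_measurable lebesgue"
      by (intro borel_measurable_times borel_measurable_integrable[OF i] hm)
    then show "(\<lambda>x. indicator \<Omega> x * (f x * h x)) \<in> borel_measurable lebesgue" by (simp add: mult.assoc)
    show "(\<lambda>x. f' x * h x) \<in> borel_measurable lebesgue"
      by (intro borel_measurable_times hm measurable_completion f'm)
    have "AE x in lebesgue. x \<in> \<Omega> \<longrightarrow> f' x = f x" using b by (simp add: brep_def)
    then show "AE x in lebesgue. indicator \<Omega> x * (f x * h x) = f' x * h x"
      by eventually_elim (use b in \<open>auto simp: brep_def indicator_def\<close>)
  qed
  also have "\<dots> = (\<integral>x. f' x * h x \<partial>lborel)"
    using f'm h by (intro integral_completion) auto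
  finally show ?thesis .
qed

lemma tensor_plane_measurable:
  assumes "test1 a b F" "test1 c d G"
  shows "(\<lambda>x :: plane. F (\<alpha> \<bullet> x) * G (\<beta> \<bullet> x)) \<in> borel_measurable borel"
proof -
  have "F \<in> borel_measurable borel" "G \<in> borel_measurable borel" using assms test1_measurable by auto
  then show ?thesis
    by (intro borel_measurable_times measurable_compose[of "\<lambda>x. \<alpha> \<bullet> x" borel borel F]
        measurable_compose[of "\<lambda>x. \<beta> \<bullet> x" borel borel G]) auto
qed

text \<open>The gradient of a tensor product in frame coordinates, multiplied by a vector e, is F' G
  (\<alpha> \<bullet> e) + F G' (\<beta> \<bullet> e). By duality the choices e = u and e = v leave
  exactly one of the two terms.\<close>

lemma weak_grad_frame:
  assumes \<Omega>: "open \<Omega>" and fr: "frame u v \<alpha> \<beta>" and wg: "is_weak_grad \<Omega> w g"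
    and int: "integrable (lebesgue_on \<Omega>) w" "integrable (lebesgue_on \<Omega>) g"
    and w': "brep \<Omega> w w'"
  shows "brep \<Omega> (\<lambda>x. g x \<bullet> u) gu \<Longrightarrow> pd1 (fmap u v -` \<Omega>) (w' \<circ> fmap u v) (gu \<circ> fmap u v)"
    and "brep \<Omega> (\<lambda>x. g x \<bullet> v) gv \<Longrightarrow> pd2 (fmap u v -` \<Omega>) (w' \<circ> fmap u v) (gv \<circ> fmap u v)"
proof -
  obtain k :: real where k: "k > 0"
    "\<And>f :: plane \<Rightarrow> real. f \<in> borel_measurable borel \<Longrightarrow> (\<integral>x. f x \<partial>lborel) = k * (\<integral>z. f (fmap u v z) \<partial>lborel)"
    using frame_change_of_variables[OF fr] by metis
  have dual: "x = (\<alpha> \<bullet> x) *\<^sub>R u + (\<beta> \<bullet> x) *\<^sub>R v" for x using fr unfolding frame_def by blast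
  have w'm: "w' \<in> borel_measurable borel" using w' by (auto simp: brep_def)
  have key: "(\<integral>z. w' (fmap u v z) * (d1 * (F' (fst z) * G (snd z)) + d2 * (F (fst z) * G' (snd z))) \<partial>lborel)
      = - (\<integral>z. gc (fmap u v z) * (F (fst z) * G (snd z)) \<partial>lborel)"
    if F: "test1 a b F" "\<And>x. (F has_real_derivative F' x) (at x)"
      and G: "test1 c d G" "\<And>x. (G has_real_derivative G' x) (at x)"
      and sub: "{a..b} \<times> {c..d} \<subseteq> fmap u v -` \<Omega>" and gc: "brep \<Omega> (\<lambda>x. g x \<bullet> e) gc"
      and d: "d1 = \<alpha> \<bullet> e" "d2 = \<beta> \<bullet> e" for a b c d F F' G G' e gc d1 d2
  proof -
    let ?\<psi> = "\<lambda>x. F (\<alpha> \<bullet> x) * G (\<beta> \<bullet> x)"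
    have \<psi>: "?\<psi> \<in> test_functions \<Omega>"
      by (rule tensor_test_function[OF dual F(1) G(1)]) (use sub in \<open>auto simp: fmap_def\<close>)
    have gr: "grad ?\<psi> x = (F' (\<alpha> \<bullet> x) * G (\<beta> \<bullet> x)) *\<^sub>R \<alpha> + (F (\<alpha> \<bullet> x) * G' (\<beta> \<bullet> x)) *\<^sub>R \<beta>" for x
      by (rule grad_eqI[OF has_derivative_tensor[OF F(2) G(2)]])
    define q where "q = (\<lambda>x. d1 * (F' (\<alpha> \<bullet> x) * G (\<beta> \<bullet> x)) + d2 * (F (\<alpha> \<bullet> x) * G' (\<beta> \<bullet> x)))"
    have ge: "grad ?\<psi> x \<bullet> e = q x" for x
      unfolding gr q_def d by (simp add: inner_add_left)
    have tF': "test1 a b F'" using test1_deriv[OF F(1)] F(2) DERIV_unique by (metis ext)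
    have tG': "test1 c d G'" using test1_deriv[OF G(1)] G(2) DERIV_unique by (metis ext)
    have qm: "q \<in> borel_measurable borel"
      unfolding q_def
      by (intro borel_measurable_add borel_measurable_times borel_measurable_const
          tensor_plane_measurable[OF tF' G(1)] tensor_plane_measurable[OF F(1) tG'])
    have \<psi>m: "?\<psi> \<in> borel_measurable borel" by (rule tensor_plane_measurable[OF F(1) G(1)])
    have l: "locally_integrable \<Omega> w" "locally_integrable \<Omega> g" using wg by (auto simp: is_weak_grad_def)
    note I = test_function_integrable[OF \<Omega> \<psi>]
    have "(LINT x|lebesgue_on \<Omega>. w x *\<^sub>R grad ?\<psi> x) = - (LINT x|lebesgue_on \<Omega>. ?\<psi> x *\<^sub>R g x)"
      using wg \<psi> unfolding is_weak_grad_def by blast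
    then have "(LINT x|lebesgue_on \<Omega>. w x *\<^sub>R grad ?\<psi> x) \<bullet> e = - ((LINT x|lebesgue_on \<Omega>. ?\<psi> x *\<^sub>R g x) \<bullet> e)"
      by simp
    then have "(LINT x|lebesgue_on \<Omega>. (w x *\<^sub>R grad ?\<psi> x) \<bullet> e) = - (LINT x|lebesgue_on \<Omega>. (?\<psi> x *\<^sub>R g x) \<bullet> e)"
      using integral_inner_left[of e _ "\<lambda>x. w x *\<^sub>R grad ?\<psi> x"] integral_inner_left[of e _ "\<lambda>x. ?\<psi> x *\<^sub>R g x"]
        I(1)[OF l(1)] I(2)[OF l(2)] by simp
    then have "(LINT x|lebesgue_on \<Omega>. w x * q x) = - (LINT x|lebesgue_on \<Omega>. (g x \<bullet> e) * ?\<psi> x)"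
      by (simp add: ge mult.commute)
    moreover have "integrable (lebesgue_on \<Omega>) (\<lambda>x. g x \<bullet> e)" using int(2) by (rule integrable_inner_left)
    moreover have gcm: "gc \<in> borel_measurable borel" using gc by (auto simp: brep_def)
    ultimately have "(\<integral>x. w' x * q x \<partial>lborel) = - (\<integral>x. gc x * ?\<psi> x \<partial>lborel)"
      using brep_integral[OF \<Omega> int(1) w' qm] brep_integral[OF \<Omega> _ gc \<psi>m] by simp
    moreover have "(\<integral>x. w' x * q x \<partial>lborel) = k * (\<integral>z. w' (fmap u v z) * q (fmap u v z) \<partial>lborel)"
      by (rule k) (intro borel_measurable_times w'm qm)
    moreover have "(\<integral>x. gc x * ?\<psi> x \<partial>lborel) = k * (\<integral>z. gc (fmap u v z) * ?\<psi> (fmap u v z) \<partial>lborel)"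
      by (rule k) (intro borel_measurable_times gcm \<psi>m)
    ultimately have "k * (\<integral>z. w' (fmap u v z) * q (fmap u v z) \<partial>lborel)
        = k * (- (\<integral>z. gc (fmap u v z) * ?\<psi> (fmap u v z) \<partial>lborel))"
      by simp
    then have "(\<integral>z. w' (fmap u v z) * q (fmap u v z) \<partial>lborel) = - (\<integral>z. gc (fmap u v z) * ?\<psi> (fmap u v z) \<partial>lborel)"
      using k(1) by (simp only: mult_cancel_left) simp
    then show ?thesis by (simp add: q_def fmap_coord[OF fr])
  qed
  have du: "1 = \<alpha> \<bullet> u" "0 = \<beta> \<bullet> u" "0 = \<alpha> \<bullet> v" "1 = \<beta> \<bullet> v"
    using fr unfolding frame_def by metis+
  show "pd1 (fmap u v -` \<Omega>) (w' \<circ> fmap u v) (gu \<circ> fmap u v)" if b: "brep \<Omega> (\<lambda>x. g x \<bullet> u) gu"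
    unfolding pd1_def
  proof (intro allI impI)
    fix a b c d F F' G
    assume F: "test1 a b F" "\<forall>x. (F has_real_derivative F' x) (at x)" and G: "test1 c d G"
      and sub: "{a..b} \<times> {c..d} \<subseteq> fmap u v -` \<Omega>"
    obtain G' where G': "\<And>x. (G has_real_derivative G' x) (at x)" using test1_deriv[OF G] by metis
    from key[OF F(1) F(2)[rule_format] G G' sub b du(1,2)]
    show "(\<integral>z. (w' \<circ> fmap u v) z * (F' (fst z) * G (snd z)) \<partial>lborel)
        = - (\<integral>z. (gu \<circ> fmap u v) z * (F (fst z) * G (snd z)) \<partial>lborel)" by simp
  qed
  show "pd2 (fmap u v -` \<Omega>) (w' \<circ> fmap u v) (gv \<circ> fmap u v)" if b: "brep \<Omega> (\<lambda>x. g x \<bullet> v) gv"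
    unfolding pd2_def
  proof (intro allI impI)
    fix a b c d F G G'
    assume F: "test1 a b F" and G: "\<forall>x. (G has_real_derivative G' x) (at x)" "test1 c d G"
      and sub: "{a..b} \<times> {c..d} \<subseteq> fmap u v -` \<Omega>"
    obtain F' where F': "\<And>x. (F has_real_derivative F' x) (at x)" using test1_deriv[OF F] by metis
    from key[OF F F' G(2) G(1)[rule_format] sub b du(3,4)]
    show "(\<integral>z. (w' \<circ> fmap u v) z * (F (fst z) * G' (snd z)) \<partial>lborel)
        = - (\<integral>z. (gv \<circ> fmap u v) z * (F (fst z) * G (snd z)) \<partial>lborel)" by simp
  qed
qed

subsection \<open>Fundamental lemma and uniqueness of weak gradients\<close>

lemma AE_plane_of_AE_frame:
  assumes fr: "frame u v \<alpha> \<beta>" and f: "f' \<in> borel_measurable borel" "\<phi> \<in> borel_measurable borel"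
    and V: "open V" and ae: "AE z in lborel. fmap u v z \<in> V \<longrightarrow> f' (fmap u v z) = (\<phi> (fmap u v z) :: real)"
  shows "AE x in lebesgue. x \<in> V \<longrightarrow> f' x = \<phi> x"
proof -
  have [measurable]: "f' \<in> borel_measurable borel" "\<phi> \<in> borel_measurable borel" "V \<in> sets borel"
    using f V by auto
  have p: "Measurable.pred borel (\<lambda>x. x \<in> V \<longrightarrow> f' x = \<phi> x)" by measurable
  have "AE x in lborel. x \<in> V \<longrightarrow> f' x = \<phi> x"
  proof (rule frame_change_of_variables[OF fr])
    fix k :: real
    assume "\<And>Q :: plane \<Rightarrow> bool. Measurable.pred borel Q \<Longrightarrow> (AE z in lborel. Q (fmap u v z)) \<Longrightarrow> (AE x in lborel. Q x)"
    from this[OF p ae] show "AE x in lborel. x \<in> V \<longrightarrow> f' x = \<phi> x" .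
  qed
  then show ?thesis by (rule AE_completion)
qed

lemma test_functions_mono: "A \<subseteq> B \<Longrightarrow> test_functions A \<subseteq> test_functions B"
  unfolding test_functions_def by blast

text \<open>Tensor products along the coordinate axes are among the test functions, so a Borel
  representative of \<open>f\<close>, read on the product of two lines, is covered by
  \<open>tensor_fundamental_lemma\<close>.\<close>

lemma fundamental_lemma_plane:
  assumes \<Omega>: "open \<Omega>" and f: "integrable (lebesgue_on \<Omega>) f"
    and z: "\<And>\<psi>. \<psi> \<in> test_functions \<Omega> \<Longrightarrow> (LINT x|lebesgue_on \<Omega>. f x * \<psi> x) = 0"
  shows "AE x in lebesgue. x \<in> \<Omega> \<longrightarrow> f x = 0"
proof -
  let ?u = "axis 1 1 :: plane" and ?v = "axis 2 1 :: plane"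
  note fr = frame_axis(1)
  have dual: "x = (?u \<bullet> x) *\<^sub>R ?u + (?v \<bullet> x) *\<^sub>R ?v" for x using fr unfolding frame_def by blast
  obtain f' where f': "brep \<Omega> f f'" using brep_exists[OF \<Omega> f] by metis
  have i: "integrable lborel f'" and m: "f' \<in> borel_measurable borel" using f' by (auto simp: brep_def)
  have it: "integrable lborel (\<lambda>z. f' (fmap ?u ?v z))"
    using frame_change_of_variables[OF fr] i by metis
  obtain k :: real where k: "k > 0"
    "\<And>f :: plane \<Rightarrow> real. f \<in> borel_measurable borel \<Longrightarrow> (\<integral>x. f x \<partial>lborel) = k * (\<integral>z. f (fmap ?u ?v z) \<partial>lborel)"
    using frame_change_of_variables[OF fr] by metis
  have op: "open (fmap ?u ?v -` \<Omega>)" by (rule open_vimage[OF \<Omega> fmap_continuous])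
  have "AE z in lborel. z \<in> fmap ?u ?v -` \<Omega> \<longrightarrow> f' (fmap ?u ?v z) = 0"
  proof (rule tensor_fundamental_lemma[OF op])
    fix a b c d :: real
    show "integrable lborel (\<lambda>z. indicator ({a..b} \<times> {c..d}) z * f' (fmap ?u ?v z))"
      using integrable_mult_indicator[OF _ it, of "{a..b} \<times> {c..d}"] by simp
  next
    fix a b c d F G assume F: "test1 a b F" and G: "test1 c d G" and sub: "{a..b} \<times> {c..d} \<subseteq> fmap ?u ?v -` \<Omega>"
    let ?\<psi> = "\<lambda>x. F (?u \<bullet> x) * G (?v \<bullet> x)"
    have "?\<psi> \<in> test_functions \<Omega>"
      by (rule tensor_test_function[OF dual F G]) (use sub in \<open>auto simp: fmap_def\<close>)
    then have "(LINT x|lebesgue_on \<Omega>. f x * ?\<psi> x) = 0" by (rule z)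
    then have "(\<integral>x. f' x * ?\<psi> x \<partial>lborel) = 0"
      using brep_integral[OF \<Omega> f f' tensor_plane_measurable[OF F G]] by simp
    moreover have "(\<integral>x. f' x * ?\<psi> x \<partial>lborel) = k * (\<integral>z. f' (fmap ?u ?v z) * ?\<psi> (fmap ?u ?v z) \<partial>lborel)"
      by (rule k) (intro borel_measurable_times m tensor_plane_measurable[OF F G])
    ultimately show "(\<integral>z. f' (fmap ?u ?v z) * (F (fst z) * G (snd z)) \<partial>lborel) = 0"
      using k(1) by (simp add: fmap_coord[OF fr])
  qed
  then have "AE x in lebesgue. x \<in> \<Omega> \<longrightarrow> f' x = 0"
    by (intro AE_plane_of_AE_frame[OF fr m _ \<Omega>]) auto
  moreover have "AE x in lebesgue. x \<in> \<Omega> \<longrightarrow> f' x = f x" using f' by (simp add: brep_def)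
  ultimately show ?thesis by eventually_elim auto
qed

lemma integrable_lebesgue_on_subset:
  fixes f :: "plane \<Rightarrow> 'b::euclidean_space"
  assumes "integrable (lebesgue_on A) f" "A \<in> sets lebesgue" "B \<in> sets lebesgue" "B \<subseteq> A"
  shows "integrable (lebesgue_on B) f"
proof -
  have "integrable lebesgue (\<lambda>x. indicator A x *\<^sub>R f x)"
    using assms by (simp add: integrable_restrict_space)
  from integrable_mult_indicator[OF assms(3) this]
  have "integrable lebesgue (\<lambda>x. indicator B x *\<^sub>R (indicator A x *\<^sub>R f x))" .
  moreover have "(\<lambda>x. indicator B x *\<^sub>R (indicator A x *\<^sub>R f x)) = (\<lambda>x. indicator B x *\<^sub>R f x)"
    using assms(4) by (auto simp: indicator_def fun_eq_iff)
  ultimately have "integrable lebesgue (\<lambda>x. indicator B x *\<^sub>R f x)" by (simp only:)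
  then show ?thesis using assms(3) by (simp add: integrable_restrict_space)
qed

text \<open>Weak gradients are only locally integrable. The comparison is therefore made on
  countably many closed boxes that exhaust \<open>\<Omega>\<close>; in each the fundamental lemma
  applies to the open box, and the boundary of a box is null.\<close>

lemma weak_grad_unique:
  assumes \<Omega>: "open \<Omega>" and g: "is_weak_grad \<Omega> w g" and g': "is_weak_grad \<Omega> w g'"
  shows "AE x in lebesgue. x \<in> \<Omega> \<longrightarrow> g x = g' x"
proof -
  have l: "locally_integrable \<Omega> g" "locally_integrable \<Omega> g'" using g g' by (auto simp: is_weak_grad_def)
  have box: "AE x in lebesgue. x \<in> cbox a b \<longrightarrow> g x = g' x" if sub: "cbox a b \<subseteq> \<Omega>" for a b
  proof -
    have comp: "AE x in lebesgue. x \<in> box a b \<longrightarrow> (g x - g' x) $ i = 0" for i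
    proof (rule fundamental_lemma_plane[OF open_box])
      have "integrable (lebesgue_on (cbox a b)) (\<lambda>x. g x - g' x)"
        using l sub unfolding locally_integrable_def by (auto intro!: Bochner_Integration.integrable_diff)
      then have "integrable (lebesgue_on (box a b)) (\<lambda>x. g x - g' x)"
        by (rule integrable_lebesgue_on_subset) (auto simp: box_subset_cbox)
      from integrable_inner_left[OF this, of "axis i 1"]
      show "integrable (lebesgue_on (box a b)) (\<lambda>x. (g x - g' x) $ i)" by (simp add: inner_axis)
      fix \<psi> assume \<psi>0: "\<psi> \<in> test_functions (box a b)"
      have bsub: "box a b \<subseteq> \<Omega>" using sub box_subset_cbox by blast
      then have \<psi>: "\<psi> \<in> test_functions \<Omega>" using \<psi>0 test_functions_mono by blast
      have v0: "\<psi> x = 0" if "x \<notin> box a b" for x using \<psi>0 that unfolding test_functions_def by blast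
      have s: "\<Omega> \<in> sets lebesgue" using \<Omega> by auto
      note I = test_function_integrable(2)[OF \<Omega> \<psi> l(1)] test_function_integrable(2)[OF \<Omega> \<psi> l(2)]
      have "(LINT x|lebesgue_on \<Omega>. \<psi> x *\<^sub>R g x) = (LINT x|lebesgue_on \<Omega>. \<psi> x *\<^sub>R g' x)"
      proof -
        have "(LINT x|lebesgue_on \<Omega>. w x *\<^sub>R grad \<psi> x) = - (LINT x|lebesgue_on \<Omega>. \<psi> x *\<^sub>R g x)"
          using g \<psi> unfolding is_weak_grad_def by blast
        moreover have "(LINT x|lebesgue_on \<Omega>. w x *\<^sub>R grad \<psi> x) = - (LINT x|lebesgue_on \<Omega>. \<psi> x *\<^sub>R g' x)"
          using g' \<psi> unfolding is_weak_grad_def by blast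
        ultimately show ?thesis by simp
      qed
      then have "(LINT x|lebesgue_on \<Omega>. \<psi> x *\<^sub>R g x - \<psi> x *\<^sub>R g' x) = 0"
        by (simp only: Bochner_Integration.integral_diff[OF I]) simp
      then have "(LINT x|lebesgue_on \<Omega>. (\<psi> x *\<^sub>R g x - \<psi> x *\<^sub>R g' x) \<bullet> axis i 1) = 0"
        using integral_inner_left[of "axis i 1" _ "\<lambda>x. \<psi> x *\<^sub>R g x - \<psi> x *\<^sub>R g' x"]
          Bochner_Integration.integrable_diff[OF I] by simp
      then have "(LINT x|lebesgue_on \<Omega>. (g x - g' x) $ i * \<psi> x) = 0"
        by (simp add: inner_axis algebra_simps)
      then have "(\<integral>x. indicator \<Omega> x * ((g x - g' x) $ i * \<psi> x) \<partial>lebesgue) = 0"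
        using s by (simp add: integral_restrict_space)
      moreover have "(\<lambda>x. indicator \<Omega> x * ((g x - g' x) $ i * \<psi> x)) = (\<lambda>x. indicator (box a b) x * ((g x - g' x) $ i * \<psi> x))"
        using v0 bsub by (auto simp: indicator_def fun_eq_iff)
      ultimately have "(\<integral>x. indicator (box a b) x * ((g x - g' x) $ i * \<psi> x) \<partial>lebesgue) = 0" by simp
      then show "(LINT x|lebesgue_on (box a b). (g x - g' x) $ i * \<psi> x) = 0"
        by (simp add: integral_restrict_space)
    qed
    have "negligible (cbox a b - box a b)" by (rule negligible_frontier_interval)
    then have "AE x in lebesgue. x \<notin> cbox a b - box a b"
      unfolding negligible_iff_null_sets by (rule AE_not_in)
    then show ?thesis using comp[of 1] comp[of 2]
      by eventually_elim (auto simp: vec_eq_iff forall_2)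
  qed
  obtain \<D> where D: "countable \<D>" "\<D> \<subseteq> Pow \<Omega>" "\<And>X. X \<in> \<D> \<Longrightarrow> \<exists>a b. X = cbox a b" "\<Union>\<D> = \<Omega>"
    using open_countable_Union_open_cbox[OF \<Omega>] by metis
  have "AE x in lebesgue. \<forall>X\<in>\<D>. x \<in> X \<longrightarrow> g x = g' x"
  proof (rule AE_ball_countable'[OF _ D(1)])
    fix X assume X: "X \<in> \<D>"
    then obtain a b where "X = cbox a b" using D(3) by blast
    then show "AE x in lebesgue. x \<in> X \<longrightarrow> g x = g' x" using box X D(2) by blast
  qed
  then show ?thesis by eventually_elim (use D(4) in blast)
qed

subsection \<open>Lipschitz functions\<close>

lemma continuous_compact_support_integrable:
  fixes f :: "plane \<Rightarrow> real"
  assumes "continuous_on UNIV f" "\<And>x. x \<notin> cball 0 R \<Longrightarrow> f x = 0"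
  shows "integrable lborel f"
proof -
  have "integrable lborel (\<lambda>x. indicator (cball 0 R) x *\<^sub>R f x)"
    by (rule borel_integrable_compact[OF compact_cball continuous_on_subset[OF assms(1)]]) simp
  moreover have "(\<lambda>x. indicator (cball 0 R) x *\<^sub>R f x) = f"
    using assms(2) by (auto simp: indicator_def fun_eq_iff)
  ultimately show ?thesis by simp
qed

text \<open>The difference quotients have integral zero by translation invariance.\<close>

lemma integral_directional_derivative_zero:
  fixes f :: "plane \<Rightarrow> real"
  assumes c: "continuous_on UNIV f" and supp: "\<And>x. x \<notin> cball 0 R \<Longrightarrow> f x = 0"
    and h0: "h0 > 0" and lip: "\<And>x h. 0 < h \<Longrightarrow> h \<le> h0 \<Longrightarrow> \<bar>f (x + h *\<^sub>R e) - f x\<bar> \<le> C * h"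
    and der: "AE x in lebesgue. ((\<lambda>h. f (x + h *\<^sub>R e)) has_real_derivative f' x) (at 0)"
    and m: "f' \<in> borel_measurable lebesgue"
  shows "(\<integral>x. f' x \<partial>lebesgue) = 0"
proof -
  \<comment> \<open>Step sizes that tend to 0 and never exceed \<open>h0\<close>, so that the
    Lipschitz estimate covers all of them.\<close>
  define h where "h = (\<lambda>n. h0 * inverse (real (Suc n)))"
  have h: "0 < h n" "h n \<le> h0" for n
    using h0 by (auto simp: h_def field_simps)
  have hl: "h \<longlonglongrightarrow> 0" unfolding h_def
    using tendsto_mult[OF tendsto_const LIMSEQ_inverse_real_of_nat, of h0] by simp
  have C: "C \<ge> 0"
  proof -
    have "0 \<le> C * h0" using lip[of h0 0] h0 by force
    then show ?thesis using h0 by (simp add: zero_le_mult_iff)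
  qed
  have fi: "integrable lborel f" by (rule continuous_compact_support_integrable[OF c supp])
  have fm: "f \<in> borel_measurable borel" using c by (rule borel_measurable_continuous_onI)
  define s where "s = (\<lambda>n x. (f (x + h n *\<^sub>R e) - f x) / h n)"
  have sc: "continuous_on UNIV (s n)" for n
    unfolding s_def using h(1)[of n] by (intro continuous_intros continuous_on_compose2[OF c]) auto
  then have sm: "s n \<in> borel_measurable lebesgue" for n
    by (intro measurable_completion) (simp add: borel_measurable_continuous_onI)
  have s0: "(\<integral>x. s n x \<partial>lebesgue) = 0" for n
  proof -
    have "(\<integral>x. s n x \<partial>lebesgue) = (\<integral>x. s n x \<partial>lborel)"
      using sc[of n] by (intro integral_completion) (simp add: borel_measurable_continuous_onI)
    also have "\<dots> = ((\<integral>x. f (h n *\<^sub>R e + x) \<partial>lborel) - (\<integral>x. f x \<partial>lborel)) / h n"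
      unfolding s_def using integrable_lborel_shift[OF fi, of "h n *\<^sub>R e"] fi by (simp add: add.commute)
    also have "\<dots> = 0" using integral_lborel_shift[OF fm, of "h n *\<^sub>R e"] by simp
    finally show ?thesis .
  qed
  \<comment> \<open>Outside this ball \<open>f\<close> vanishes at \<open>x\<close> and at every
    shifted point, so a single indicator dominates all difference quotients.\<close>
  let ?B = "cball 0 (R + h0 * norm e) :: plane set"
  have "(\<lambda>n. \<integral>x. s n x \<partial>lebesgue) \<longlonglongrightarrow> (\<integral>x. f' x \<partial>lebesgue)"
  proof (rule integral_dominated_convergence[where w="\<lambda>x. C * indicator ?B x"])
    show "f' \<in> borel_measurable lebesgue" "\<And>n. s n \<in> borel_measurable lebesgue" by (rule m sm)+
    show "integrable lebesgue (\<lambda>x. C * indicator ?B x)"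
      using lmeasurable_cball[of 0 "R + h0 * norm e"]
      by (intro integrable_mult_right integrable_real_indicator) (auto simp: fmeasurable_def)
    show "AE x in lebesgue. (\<lambda>n. s n x) \<longlonglongrightarrow> f' x"
      using der
    proof eventually_elim
      case (elim x)
      then have l: "((\<lambda>t. (f (x + (0 + t) *\<^sub>R e) - f (x + 0 *\<^sub>R e)) / t) \<longlongrightarrow> f' x) (at 0)"
        unfolding DERIV_def by simp
      have "filterlim h (at 0) sequentially"
        using hl h(1) by (auto simp: filterlim_at intro!: always_eventually) (metis less_irrefl)
      from filterlim_compose[OF l this] show ?case by (simp add: s_def)
    qed
    show "AE x in lebesgue. norm (s n x) \<le> C * indicator ?B x" for n
    proof (rule AE_I2)
      fix x
      show "norm (s n x) \<le> C * indicator ?B x"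
      proof (cases "x \<in> ?B")
        case True
        have "\<bar>f (x + h n *\<^sub>R e) - f x\<bar> \<le> C * h n" by (rule lip) (rule h)+
        then show ?thesis using True h(1)[of n] by (simp add: s_def abs_divide field_simps)
      next
        case False
        have "h n * norm e \<le> h0 * norm e" by (rule mult_right_mono[OF h(2) norm_ge_zero])
        moreover have "norm x \<le> norm (x + h n *\<^sub>R e) + h n * norm e"
          using norm_triangle_ineq4[of "x + h n *\<^sub>R e" "h n *\<^sub>R e"] h(1)[of n] by simp
        moreover have "0 \<le> h0 * norm e" using h0 by simp
        ultimately have "x \<notin> cball 0 R" "x + h n *\<^sub>R e \<notin> cball 0 R" using False by auto
        then have "f x = 0" "f (x + h n *\<^sub>R e) = 0" by (auto intro: supp)
        then show ?thesis by (simp add: s_def C)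
      qed
    qed
  qed
  then show ?thesis unfolding s0 by (simp add: LIMSEQ_const_iff)
qed

lemma test_function_lipschitz:
  assumes "\<psi> \<in> test_functions \<Omega>"
  obtains L where "L \<ge> 0" "\<And>x y. \<bar>\<psi> x - \<psi> y\<bar> \<le> L * norm (x - y)" "\<And>x. \<bar>\<psi> x\<bar> \<le> L"
proof -
  obtain K where K: "compact K" "K \<subseteq> \<Omega>" "\<And>x. x \<notin> K \<Longrightarrow> \<psi> x = 0" "\<And>x. x \<notin> K \<Longrightarrow> grad \<psi> x = 0"
    "\<And>x. (\<psi> has_derivative (\<lambda>v. grad \<psi> x \<bullet> v)) (at x)" "continuous_on UNIV \<psi>" "\<And>i. continuous_on UNIV (\<lambda>x. grad \<psi> x $ i)"
    using test_functionE[OF assms] by metis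
  have c: "continuous_on UNIV (grad \<psi>)"
    using K(7) by (subst continuous_on_componentwise) (auto simp: Basis_vec_def inner_axis)
  obtain B where B: "\<And>x. x \<in> K \<Longrightarrow> norm (grad \<psi> x) \<le> B"
    using compact_imp_bounded[OF compact_continuous_image[OF continuous_on_subset[OF c subset_UNIV] K(1)]]
    unfolding bounded_iff by auto
  obtain B' where B': "\<And>x. x \<in> K \<Longrightarrow> \<bar>\<psi> x\<bar> \<le> B'"
    using compact_imp_bounded[OF compact_continuous_image[OF continuous_on_subset[OF K(6) subset_UNIV] K(1)]]
    unfolding bounded_iff by auto
  define L where "L = max 0 (max B B')"
  have g: "norm (grad \<psi> x) \<le> L" for x
    using B[of x] K(4)[of x] by (cases "x \<in> K") (auto simp: L_def)
  have p: "\<bar>\<psi> x\<bar> \<le> L" for x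
    using B'[of x] K(3)[of x] by (cases "x \<in> K") (auto simp: L_def)
  have "norm (\<psi> x - \<psi> y) \<le> L * norm (x - y)" for x y
  proof (rule differentiable_bound[where S=UNIV])
    show "(\<psi> has_derivative (\<lambda>v. grad \<psi> x \<bullet> v)) (at x within UNIV)" for x using K(5) by simp
    show "onorm (\<lambda>v. grad \<psi> x \<bullet> v) \<le> L" for x
    proof (rule onorm_le)
      fix v show "norm (grad \<psi> x \<bullet> v) \<le> L * norm v"
        using Cauchy_Schwarz_ineq2[of "grad \<psi> x" v] mult_right_mono[OF g norm_ge_zero] by (metis order_trans real_norm_def)
    qed
  qed auto
  then show ?thesis using that[of L] p by (auto simp: L_def)
qed

text \<open>The product of \<open>q\<close> with a test function is compactly supported and
  Lipschitz for small steps, so its directional derivatives have integral zero, and the product rule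
  turns this into integration by parts. The Lipschitz bound is required only along segments in
  \<open>\<Omega>\<close>, which is what a domain that is not convex can offer.\<close>

lemma weak_grad_of_lipschitz:
  assumes \<Omega>: "open \<Omega>" and c: "continuous_on \<Omega> q"
    and lip: "\<And>x y. closed_segment x y \<subseteq> \<Omega> \<Longrightarrow> \<bar>q x - q y\<bar> \<le> L * norm (x - y)"
    and der: "AE x in lebesgue. x \<in> \<Omega> \<longrightarrow> (q has_derivative (\<lambda>v. g x \<bullet> v)) (at x)"
    and gm: "g \<in> borel_measurable (lebesgue_on \<Omega>)" and gb: "\<And>x. x \<in> \<Omega> \<Longrightarrow> norm (g x) \<le> B"
  shows "is_weak_grad \<Omega> q g"
proof -
  have s: "\<Omega> \<in> sets lebesgue" using \<Omega> by auto
  have lq: "locally_integrable \<Omega> q"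
    unfolding locally_integrable_def
  proof (intro allI impI)
    fix K assume K: "compact K \<and> K \<subseteq> \<Omega>"
    have "integrable lborel (\<lambda>x. indicator K x *\<^sub>R q x)"
      using K c continuous_on_subset by (intro borel_integrable_compact) auto
    then have "integrable lebesgue (\<lambda>x. indicator K x *\<^sub>R q x)"
      by (subst integrable_completion) auto
    then show "integrable (lebesgue_on K) q"
      using K by (subst integrable_restrict_space) (auto simp: fmeasurableD lmeasurable_compact)
  qed
  have lg: "locally_integrable \<Omega> g"
    unfolding locally_integrable_def
  proof (intro allI impI)
    fix K assume K: "compact K \<and> K \<subseteq> \<Omega>"
    have Kl: "K \<in> lmeasurable" using K lmeasurable_compact by blast
    have gi: "(\<lambda>x. indicator \<Omega> x *\<^sub>R g x) \<in> borel_measurable lebesgue"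
      using gm s by (simp add: borel_measurable_restrict_space_iff)
    have "integrable lebesgue (\<lambda>x. indicator K x *\<^sub>R (indicator \<Omega> x *\<^sub>R g x))"
    proof (rule Bochner_Integration.integrable_bound)
      show "integrable lebesgue (\<lambda>x. B * indicator K x)"
        using Kl by (intro integrable_mult_right integrable_real_indicator) (auto simp: fmeasurable_def)
      show "(\<lambda>x. indicator K x *\<^sub>R (indicator \<Omega> x *\<^sub>R g x)) \<in> borel_measurable lebesgue"
        using Kl by (intro borel_measurable_scaleR gi borel_measurable_indicator) (auto simp: fmeasurable_def)
      show "AE x in lebesgue. norm (indicator K x *\<^sub>R (indicator \<Omega> x *\<^sub>R g x)) \<le> norm (B * indicator K x)"
        using gb K by (intro AE_I2) (force simp: indicator_def)
    qed
    moreover have "(\<lambda>x. indicator K x *\<^sub>R (indicator \<Omega> x *\<^sub>R g x)) = (\<lambda>x. indicator K x *\<^sub>R g x)"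
      using K by (auto simp: indicator_def fun_eq_iff)
    ultimately have "integrable lebesgue (\<lambda>x. indicator K x *\<^sub>R g x)" by simp
    then show "integrable (lebesgue_on K) g"
      using Kl by (subst integrable_restrict_space) (auto simp: fmeasurableD)
  qed
  show ?thesis
    unfolding is_weak_grad_def
  proof (intro conjI lq lg ballI)
    fix \<psi> assume \<psi>: "\<psi> \<in> test_functions \<Omega>"
    obtain K where K: "compact K" "K \<subseteq> \<Omega>" "\<And>x. x \<notin> K \<Longrightarrow> \<psi> x = 0" "\<And>x. x \<notin> K \<Longrightarrow> grad \<psi> x = 0"
      "\<And>x. (\<psi> has_derivative (\<lambda>v. grad \<psi> x \<bullet> v)) (at x)" "continuous_on UNIV \<psi>" "\<And>i. continuous_on UNIV (\<lambda>x. grad \<psi> x $ i)"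
      using test_functionE[OF \<psi>] by metis
    obtain P where P: "P \<ge> 0" "\<And>x y. \<bar>\<psi> x - \<psi> y\<bar> \<le> P * norm (x - y)" "\<And>x. \<bar>\<psi> x\<bar> \<le> P"
      using test_function_lipschitz[OF \<psi>] by metis
    \<comment> \<open>A margin around \<open>K\<close>: for steps up to \<open>\<delta> / 2\<close>,
      a segment with one end in \<open>K\<close> stays inside \<open>\<Omega>\<close>.\<close>
    obtain \<delta> where \<delta>: "\<delta> > 0" "(\<Union>x\<in>K. ball x \<delta>) \<subseteq> \<Omega>"
      using compact_subset_open_imp_ball_epsilon_subset[OF K(1) \<Omega> K(2)] by metis
    obtain Q where Q: "\<And>x. x \<in> K \<Longrightarrow> \<bar>q x\<bar> \<le> Q"
      using compact_imp_bounded[OF compact_continuous_image[OF continuous_on_subset[OF c K(2)] K(1)]]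
      unfolding bounded_iff by auto
    obtain R where R: "K \<subseteq> cball 0 R"
      using compact_imp_bounded[OF K(1)] by (auto simp: bounded_iff subset_iff)
    define f where "f = (\<lambda>x. q x * \<psi> x)"
    have fc: "continuous_on UNIV f"
    proof -
      have "continuous_on (\<Omega> \<union> - K) f"
      proof (rule continuous_on_open_Un[OF \<Omega>])
        show "open (- K)" using K(1) by (simp add: open_Compl compact_imp_closed)
        show "continuous_on \<Omega> f" unfolding f_def
          by (intro continuous_on_mult c continuous_on_subset[OF K(6)]) auto
        have "continuous_on (- K) f \<longleftrightarrow> continuous_on (- K) (\<lambda>_. 0 :: real)"
          by (rule continuous_on_cong) (auto simp: f_def K(3))
        then show "continuous_on (- K) f" by simp
      qed
      moreover have "\<Omega> \<union> - K = UNIV" using K(2) by auto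
      ultimately show ?thesis by simp
    qed
    have axis0: "(LINT x|lebesgue_on \<Omega>. (q x * grad \<psi> x $ i)) = - (LINT x|lebesgue_on \<Omega>. (\<psi> x * g x $ i))" for i
    proof -
      let ?e = "axis i 1 :: plane"
      let ?f' = "\<lambda>x. indicator \<Omega> x * (q x * (grad \<psi> x $ i) + \<psi> x * g x $ i)"
      have I1: "integrable (lebesgue_on \<Omega>) (\<lambda>x. q x * grad \<psi> x $ i)"
        using integrable_inner_left[OF test_function_integrable(1)[OF \<Omega> \<psi> lq], of ?e] by (simp add: inner_axis)
      have I2: "integrable (lebesgue_on \<Omega>) (\<lambda>x. \<psi> x * g x $ i)"
        using integrable_inner_left[OF test_function_integrable(2)[OF \<Omega> \<psi> lg], of ?e] by (simp add: inner_axis)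
      have I3: "integrable (lebesgue_on \<Omega>) (\<lambda>x. q x * (grad \<psi> x $ i) + \<psi> x * g x $ i)"
        using I1 I2 by (rule Bochner_Integration.integrable_add)
      have "(\<integral>x. ?f' x \<partial>lebesgue) = 0"
      proof (rule integral_directional_derivative_zero[OF fc])
        show "f x = 0" if "x \<notin> cball 0 R" for x
        proof -
          have "x \<notin> K" using R that by blast
          then show ?thesis by (simp add: f_def K(3))
        qed
        show "\<delta> / 2 > 0" using \<delta> by simp
        show "?f' \<in> borel_measurable lebesgue"
          using I3 s by (auto simp: integrable_restrict_space dest: borel_measurable_integrable)
        show "AE x in lebesgue. ((\<lambda>h. f (x + h *\<^sub>R ?e)) has_real_derivative ?f' x) (at 0)"
          using der
        proof eventually_elim
          case (elim x)
          have l: "((\<lambda>h. x + h *\<^sub>R ?e) has_derivative (\<lambda>h. h *\<^sub>R ?e)) (at 0)"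
            by (auto intro!: derivative_eq_intros)
          show ?case
          proof (cases "x \<in> \<Omega>")
            case True
            then have "(q has_derivative (\<lambda>v. g x \<bullet> v)) (at x)" using elim by simp
            from has_derivative_mult[OF this K(5)[of x]]
            have "(f has_derivative (\<lambda>v. q x * (grad \<psi> x \<bullet> v) + (g x \<bullet> v) * \<psi> x)) (at (x + 0 *\<^sub>R ?e))"
              by (simp add: f_def)
            from has_derivative_compose[OF l this]
            have "((\<lambda>h. f (x + h *\<^sub>R ?e)) has_derivative
                (\<lambda>h. q x * (grad \<psi> x \<bullet> (h *\<^sub>R ?e)) + (g x \<bullet> (h *\<^sub>R ?e)) * \<psi> x)) (at 0)" .
            moreover have "(\<lambda>h. q x * (grad \<psi> x \<bullet> (h *\<^sub>R ?e)) + (g x \<bullet> (h *\<^sub>R ?e)) * \<psi> x) = (*) (?f' x)"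
              using True by (simp add: fun_eq_iff inner_axis algebra_simps)
            ultimately show ?thesis unfolding has_field_derivative_def by (simp only:)
          next
            case False
            have "((\<lambda>h. 0) has_derivative (\<lambda>h. 0)) (at x)" by simp
            then have "(f has_derivative (\<lambda>h. 0)) (at x)"
              by (rule has_derivative_transform_within_open[of _ _ _ UNIV "- K"])
                (use False K in \<open>auto simp: f_def open_Compl compact_imp_closed\<close>)
            then have "(f has_derivative (\<lambda>v. 0)) (at (x + 0 *\<^sub>R ?e))" by simp
            from has_derivative_compose[OF l this]
            have "((\<lambda>h. f (x + h *\<^sub>R ?e)) has_derivative (\<lambda>h. 0)) (at 0)" .
            moreover have "(\<lambda>h. 0) = (*) (?f' x)" using False by (simp add: fun_eq_iff)
            ultimately show ?thesis unfolding has_field_derivative_def by (simp only:)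
          qed
        qed
        fix h :: real and x :: plane assume h: "0 < h" "h \<le> \<delta> / 2"
        let ?y = "x + h *\<^sub>R ?e"
        have d: "norm (x - ?y) = h" "norm (?y - x) = h" using h by (auto simp: norm_axis_1)
        show "\<bar>f ?y - f x\<bar> \<le> (\<bar>Q\<bar> * P + \<bar>L\<bar> * P) * h"
        proof (cases "x \<in> K \<or> ?y \<in> K")
          case False
          then show ?thesis using h P(1) by (simp add: f_def K(3))
        next
          case True
          have seg: "closed_segment ?y x \<subseteq> \<Omega>"
          proof -
            have "closed_segment ?y x \<subseteq> ball z \<delta>" if "z = x \<or> z = ?y" for z
              using that d h \<delta>(1)
              by (intro closed_segment_subset[OF _ _ convex_ball]) (auto simp: dist_norm norm_axis_1)
            then show ?thesis using True \<delta>(2) by blast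
          qed
          have lq: "\<bar>q ?y - q x\<bar> \<le> \<bar>L\<bar> * h"
          proof -
            have "\<bar>q ?y - q x\<bar> \<le> L * h" using lip[OF seg] d(2) by simp
            also have "\<dots> \<le> \<bar>L\<bar> * h" using h(1) by (intro mult_right_mono) auto
            finally show ?thesis .
          qed
          have lp: "\<bar>\<psi> ?y - \<psi> x\<bar> \<le> P * h" using P(2)[of ?y x] d by simp
          \<comment> \<open>A bound on \<open>q\<close> is available on \<open>K\<close> only, so
            the product is expanded in the way that evaluates \<open>q\<close> alone at the endpoint
            in \<open>K\<close>.\<close>
          have split: "\<bar>f ?y - f x\<bar> \<le> \<bar>Q\<bar> * (P * h) + (\<bar>L\<bar> * h) * P"
          proof (cases "x \<in> K")
            case True
            have "f ?y - f x = q x * (\<psi> ?y - \<psi> x) + (q ?y - q x) * \<psi> ?y" by (simp add: f_def algebra_simps)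
            also have "\<bar>\<dots>\<bar> \<le> \<bar>q x\<bar> * \<bar>\<psi> ?y - \<psi> x\<bar> + \<bar>q ?y - q x\<bar> * \<bar>\<psi> ?y\<bar>"
              by (rule order_trans[OF abs_triangle_ineq]) (simp add: abs_mult)
            also have "\<dots> \<le> \<bar>Q\<bar> * (P * h) + (\<bar>L\<bar> * h) * P"
              using Q[OF True] h by (intro add_mono mult_mono lp lq P) auto
            finally show ?thesis .
          next
            case False
            then have y: "?y \<in> K" using \<open>x \<in> K \<or> ?y \<in> K\<close> by blast
            have "f ?y - f x = q ?y * (\<psi> ?y - \<psi> x) + (q ?y - q x) * \<psi> x" by (simp add: f_def algebra_simps)
            also have "\<bar>\<dots>\<bar> \<le> \<bar>q ?y\<bar> * \<bar>\<psi> ?y - \<psi> x\<bar> + \<bar>q ?y - q x\<bar> * \<bar>\<psi> x\<bar>"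
              by (rule order_trans[OF abs_triangle_ineq]) (simp add: abs_mult)
            also have "\<dots> \<le> \<bar>Q\<bar> * (P * h) + (\<bar>L\<bar> * h) * P"
              using Q[OF y] h by (intro add_mono mult_mono lp lq P) auto
            finally show ?thesis .
          qed
          then show ?thesis by (simp add: algebra_simps)
        qed
      qed
      then have "(LINT x|lebesgue_on \<Omega>. q x * (grad \<psi> x $ i) + \<psi> x * g x $ i) = 0"
        using s by (simp add: integral_restrict_space)
      then show ?thesis using Bochner_Integration.integral_add[OF I1 I2] by simp
    qed
    show "(LINT x|lebesgue_on \<Omega>. q x *\<^sub>R grad \<psi> x) = - (LINT x|lebesgue_on \<Omega>. \<psi> x *\<^sub>R g x)"
    proof (rule vec_eq_iff[THEN iffD2], rule allI)
      fix i
      have "(LINT x|lebesgue_on \<Omega>. q x *\<^sub>R grad \<psi> x) $ i = (LINT x|lebesgue_on \<Omega>. (q x *\<^sub>R grad \<psi> x) \<bullet> axis i 1)"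
        using integral_inner_left[of "axis i 1", OF test_function_integrable(1)[OF \<Omega> \<psi> lq]] by (simp add: inner_axis)
      moreover have "(LINT x|lebesgue_on \<Omega>. \<psi> x *\<^sub>R g x) $ i = (LINT x|lebesgue_on \<Omega>. (\<psi> x *\<^sub>R g x) \<bullet> axis i 1)"
        using integral_inner_left[of "axis i 1", OF test_function_integrable(2)[OF \<Omega> \<psi> lg]] by (simp add: inner_axis)
      ultimately show "(LINT x|lebesgue_on \<Omega>. q x *\<^sub>R grad \<psi> x) $ i = (- (LINT x|lebesgue_on \<Omega>. \<psi> x *\<^sub>R g x)) $ i"
        using axis0[of i] by (simp add: inner_axis)
    qed
  qed
qed


lemma weak_grad_linear:
  assumes "open \<Omega>"
  shows "is_weak_grad \<Omega> (\<lambda>x. c \<bullet> x) (\<lambda>_. c)"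
proof (rule weak_grad_of_lipschitz[OF assms, where L="norm c" and B="norm c"])
  show "continuous_on \<Omega> (\<lambda>x. c \<bullet> x)" by (intro continuous_intros)
  show "\<bar>c \<bullet> x - c \<bullet> y\<bar> \<le> norm c * norm (x - y)" for x y
    by (metis Cauchy_Schwarz_ineq2 inner_diff_right)
  show "AE x in lebesgue. x \<in> \<Omega> \<longrightarrow> ((\<lambda>x. c \<bullet> x) has_derivative (\<lambda>v. c \<bullet> v)) (at x)"
    by (auto intro!: derivative_eq_intros)
qed auto

lemma integrable_continuous_bounded_set:
  fixes f :: "plane \<Rightarrow> real"
  assumes "open \<Omega>" "bounded \<Omega>" "continuous_on UNIV f"
  shows "integrable (lebesgue_on \<Omega>) f"
proof -
  obtain R where R: "\<Omega> \<subseteq> cball 0 R" using assms(2) by (auto simp: bounded_iff subset_iff)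
  have "integrable lborel (\<lambda>x. indicator (cball 0 R) x *\<^sub>R f x)"
    by (rule borel_integrable_compact[OF compact_cball continuous_on_subset[OF assms(3)]]) simp
  then have "integrable lebesgue (\<lambda>x. indicator (cball 0 R) x *\<^sub>R f x)"
    by (subst integrable_completion) auto
  then have "integrable (lebesgue_on (cball 0 R)) f" by (simp add: integrable_restrict_space)
  then show ?thesis by (rule integrable_lebesgue_on_subset) (use assms R in auto)
qed

lemma brep_continuous:
  assumes "open \<Omega>" "continuous_on \<Omega> w" "integrable (lebesgue_on \<Omega>) w"
  shows "brep \<Omega> w (\<lambda>x. indicator \<Omega> x * w x)"
proof -
  have "(\<lambda>x. indicator \<Omega> x *\<^sub>R w x) \<in> borel_measurable borel"
    using assms by (intro borel_measurable_continuous_on_indicator) auto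
  moreover have "integrable lebesgue (\<lambda>x. indicator \<Omega> x *\<^sub>R w x)"
    using assms by (simp add: integrable_restrict_space)
  ultimately show ?thesis unfolding brep_def by (simp add: integrable_completion)
qed

lemma fmap_inv: "frame u v \<alpha> \<beta> \<Longrightarrow> fmap u v (\<alpha> \<bullet> x, \<beta> \<bullet> x) = x"
  unfolding frame_def fmap_def by (metis fst_conv snd_conv)

lemma AE_frame_of_AE_plane:
  assumes fr: "frame u v \<alpha> \<beta>" and ae: "AE x in lborel. Q (x :: plane)"
  shows "AE z in lborel. Q (fmap u v z)"
proof (rule frame_change_of_variables[OF fr])
  fix k :: real
  assume "\<And>Q :: plane \<Rightarrow> bool. (AE x in lborel. Q x) \<Longrightarrow> (AE z in lborel. Q (fmap u v z))"
  from this[OF ae] show "AE z in lborel. Q (fmap u v z)" .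
qed

lemma integrable_frame:
  assumes fr: "frame u v \<alpha> \<beta>" and f: "integrable lborel (f :: plane \<Rightarrow> real)"
  shows "integrable lborel (f \<circ> fmap u v)"
proof (rule frame_change_of_variables[OF fr])
  fix k :: real
  assume "\<And>f :: plane \<Rightarrow> real. integrable lborel f \<Longrightarrow> integrable lborel (\<lambda>z. f (fmap u v z))"
  from this[OF f] show "integrable lborel (f \<circ> fmap u v)" by (simp add: comp_def)
qed

text \<open>With \<open>u\<close> the unit vector along the segment, subtracting L times the linear
  coordinate \<alpha> turns the bound on the gradient into a nonpositive derivative in direction
  \<open>u\<close>. Monotonicity along the segment then gives the estimate, since \<alpha> grows by
  exactly its length.\<close>

lemma weak_grad_bound_one_sided:
  assumes \<Omega>: "open \<Omega>" "bounded \<Omega>" and w: "continuous_on \<Omega> w" "integrable (lebesgue_on \<Omega>) w"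
    and g: "is_weak_grad \<Omega> w g" "integrable (lebesgue_on \<Omega>) g"
    and L: "AE x in lebesgue. x \<in> \<Omega> \<longrightarrow> norm (g x) \<le> L" and seg: "closed_segment x y \<subseteq> \<Omega>"
  shows "w y - w x \<le> L * norm (y - x)"
proof (cases "x = y")
  case False
  define l where "l = norm (y - x)"
  have l: "l > 0" using False by (simp add: l_def)
  define u where "u = (1 / l) *\<^sub>R (y - x)"
  have nu: "norm u = 1" using l by (simp add: u_def l_def)
  have yx: "y = x + l *\<^sub>R u" using l by (simp add: u_def)
  \<comment> \<open>\<open>u\<close> turned by a right angle; the determinant is then |u|^2 = 1, so
    the pair is a basis.\<close>
  define v :: plane where "v = vector [- u $ 2, u $ 1]"
  have "u $ 1 * v $ 2 - u $ 2 * v $ 1 = (norm u)\<^sup>2"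
    by (simp add: v_def norm_vec_def L2_set_def sum_2 power2_eq_square)
  then obtain \<alpha> \<beta> where fr: "frame u v \<alpha> \<beta>" using frame_exists[of u v] nu by auto
  have du: "\<alpha> \<bullet> u = 1" "\<beta> \<bullet> u = 0" using fr unfolding frame_def by auto
  define w2 where "w2 = (\<lambda>z. 1 * w z + (- L) * (\<alpha> \<bullet> z))"
  define g2 where "g2 = (\<lambda>z. 1 *\<^sub>R g z + (- L) *\<^sub>R \<alpha>)"
  have wg: "is_weak_grad \<Omega> w2 g2"
    unfolding w2_def g2_def by (rule is_weak_grad_lincomb[OF \<Omega>(1) g(1) weak_grad_linear[OF \<Omega>(1)]])
  have ia: "integrable (lebesgue_on \<Omega>) (\<lambda>z. \<alpha> \<bullet> z)" "integrable (lebesgue_on \<Omega>) (\<lambda>z. 1 :: real)"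
    by (rule integrable_continuous_bounded_set[OF \<Omega>]; intro continuous_intros)+
  have iw: "integrable (lebesgue_on \<Omega>) w2" unfolding w2_def
    by (intro Bochner_Integration.integrable_add integrable_mult_right w(2) ia)
  have ic: "integrable (lebesgue_on \<Omega>) (\<lambda>z. \<alpha>)"
    using integrable_scaleR_left[of \<alpha>, OF ia(2)] by simp
  have ig: "integrable (lebesgue_on \<Omega>) g2" unfolding g2_def
    by (intro Bochner_Integration.integrable_add integrable_scaleR_right g(2) ic)
  have cw: "continuous_on \<Omega> w2" unfolding w2_def by (intro continuous_intros w(1))
  define W where "W = (\<lambda>z. indicator \<Omega> z * w2 z)"
  have W: "brep \<Omega> w2 W" unfolding W_def by (rule brep_continuous[OF \<Omega>(1) cw iw])
  have igu: "integrable (lebesgue_on \<Omega>) (\<lambda>z. g2 z \<bullet> u)" using ig by (rule integrable_inner_left)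
  obtain G where G: "brep \<Omega> (\<lambda>z. g2 z \<bullet> u) G" using brep_exists[OF \<Omega>(1) igu] by metis
  have pd: "pd1 (fmap u v -` \<Omega>) (W \<circ> fmap u v) (G \<circ> fmap u v)"
    by (rule weak_grad_frame(1)[OF \<Omega>(1) fr wg iw ig W G])
  have "AE z in lebesgue. z \<in> \<Omega> \<longrightarrow> G z = g2 z \<bullet> u" using G by (simp add: brep_def)
  then have "AE z in lebesgue. z \<in> \<Omega> \<longrightarrow> G z \<le> 0"
    using L
  proof eventually_elim
    case (elim z)
    show ?case
    proof
      assume z: "z \<in> \<Omega>"
      have "g z \<bullet> u \<le> norm (g z)" using norm_cauchy_schwarz[of "g z" u] nu by simp
      then show "G z \<le> 0" using elim z du by (simp add: g2_def inner_diff_left)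
    qed
  qed
  then have "AE z in lborel. z \<in> \<Omega> \<longrightarrow> G z \<le> 0" by (simp add: AE_completion_iff)
  from AE_frame_of_AE_plane[OF fr this]
  have ae: "AE z in lborel. z \<in> fmap u v -` \<Omega> \<longrightarrow> (G \<circ> fmap u v) z \<le> 0" by simp
  have op: "open (fmap u v -` \<Omega>)" by (rule open_vimage[OF \<Omega>(1) fmap_continuous])
  have cW: "continuous_on (fmap u v -` \<Omega>) (W \<circ> fmap u v)"
  proof -
    have "continuous_on (fmap u v -` \<Omega>) (w2 \<circ> fmap u v)"
      by (intro continuous_on_compose fmap_continuous continuous_on_subset[OF cw]) auto
    then show ?thesis
      by (rule continuous_on_eq) (auto simp: W_def)
  qed
  have fm: "fmap u v (\<tau>, \<beta> \<bullet> x) = x + (\<tau> - \<alpha> \<bullet> x) *\<^sub>R u" for \<tau>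
  proof -
    have "fmap u v (\<tau>, \<beta> \<bullet> x) = fmap u v (\<alpha> \<bullet> x, \<beta> \<bullet> x) + (\<tau> - \<alpha> \<bullet> x) *\<^sub>R u"
      by (simp add: fmap_def algebra_simps)
    then show ?thesis by (simp add: fmap_inv[OF fr])
  qed
  have ay: "\<alpha> \<bullet> y = \<alpha> \<bullet> x + l" using yx du by (simp add: inner_add_right)
  have "(W \<circ> fmap u v) (\<alpha> \<bullet> y, \<beta> \<bullet> x) \<le> (W \<circ> fmap u v) (\<alpha> \<bullet> x, \<beta> \<bullet> x)"
  proof (rule pd1_nonpos_imp_decreasing[OF op _ cW _ pd ae])
    show "integrable lborel (W \<circ> fmap u v)" "integrable lborel (G \<circ> fmap u v)"
      using W G by (auto simp: brep_def intro: integrable_frame[OF fr])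
    show "\<alpha> \<bullet> x \<le> \<alpha> \<bullet> y" using ay l by simp
    fix \<tau> assume \<tau>: "\<alpha> \<bullet> x \<le> \<tau>" "\<tau> \<le> \<alpha> \<bullet> y"
    have "(1 - c) *\<^sub>R x + c *\<^sub>R (x + l *\<^sub>R u) = x + (c * l) *\<^sub>R u" for c by (simp add: algebra_simps)
    from this[of "(\<tau> - \<alpha> \<bullet> x) / l"]
    have "x + (\<tau> - \<alpha> \<bullet> x) *\<^sub>R u = (1 - (\<tau> - \<alpha> \<bullet> x) / l) *\<^sub>R x + ((\<tau> - \<alpha> \<bullet> x) / l) *\<^sub>R y"
      using l yx by simp
    then have "x + (\<tau> - \<alpha> \<bullet> x) *\<^sub>R u \<in> closed_segment x y"
      unfolding in_segment using \<tau> ay l by (intro exI[of _ "(\<tau> - \<alpha> \<bullet> x) / l"]) (auto simp: field_simps)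
    then show "(\<tau>, \<beta> \<bullet> x) \<in> fmap u v -` \<Omega>" using seg by (auto simp: fm)
  qed
  moreover have "fmap u v (\<alpha> \<bullet> y, \<beta> \<bullet> x) = y" using fm[of "\<alpha> \<bullet> y"] ay yx by simp
  ultimately have "W y \<le> W x" using fmap_inv[OF fr, of x] by simp
  moreover have "x \<in> \<Omega>" "y \<in> \<Omega>" using seg by auto
  ultimately show ?thesis using ay by (simp add: W_def w2_def l_def algebra_simps)
qed simp

lemma weak_grad_bound_imp_lipschitz:
  assumes \<Omega>: "open \<Omega>" "bounded \<Omega>" and w: "continuous_on \<Omega> w" "integrable (lebesgue_on \<Omega>) w"
    and g: "is_weak_grad \<Omega> w g" "integrable (lebesgue_on \<Omega>) g"
    and L: "AE x in lebesgue. x \<in> \<Omega> \<longrightarrow> norm (g x) \<le> L" and seg: "closed_segment x y \<subseteq> \<Omega>"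
  shows "\<bar>w x - w y\<bar> \<le> L * norm (x - y)"
  using weak_grad_bound_one_sided[OF assms] seg
    weak_grad_bound_one_sided[OF \<Omega> w g L, of y x] 
  by (simp add: closed_segment_commute norm_minus_commute abs_le_iff)

subsection \<open>Continuous representatives\<close>

text \<open>In frame coordinates \<open>w\<close> has integrable first derivatives and an integrable
  mixed derivative, so the representation with bounded kernels applies. The cone condition says that
  the parallelogram attached to each point of \<open>V\<close> stays in \<open>\<Omega>\<close>;
  \<open>V\<close> may thus reach up to the boundary.\<close>

lemma local_continuous_representative:
  assumes \<Omega>: "open \<Omega>" and w: "is_weak_grad \<Omega> w g" "integrable (lebesgue_on \<Omega>) w" "integrable (lebesgue_on \<Omega>) g"
    and H: "\<And>i. is_weak_grad \<Omega> (\<lambda>x. g x $ i) (H i)" "\<And>i. integrable (lebesgue_on \<Omega>) (H i)"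
    and fr: "frame u v \<alpha> \<beta>" and r: "r > 0" and V: "open V"
    and cone: "\<And>x \<sigma> \<tau>. x \<in> V \<Longrightarrow> 0 \<le> \<sigma> \<Longrightarrow> \<sigma> \<le> r \<Longrightarrow> 0 \<le> \<tau> \<Longrightarrow> \<tau> \<le> r \<Longrightarrow> x + \<sigma> *\<^sub>R u + \<tau> *\<^sub>R v \<in> \<Omega>"
  obtains \<Phi> where "continuous_on UNIV \<Phi>" "AE x in lebesgue. x \<in> V \<longrightarrow> w x = \<Phi> x"
proof -
  let ?T = "fmap u v"
  \<comment> \<open>The mixed derivative is the \<open>v\<close>-component of the weak gradient
    \<open>Hu\<close> of the \<open>u\<close>-derivative; \<open>gu\<close> is written as a
    combination of the components of \<open>g\<close> because weak differentiability is known for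
    these.\<close>
  define gu where "gu = (\<lambda>x. u $ 1 * (g x $ 1) + u $ 2 * (g x $ 2))"
  define Hu where "Hu = (\<lambda>x. u $ 1 *\<^sub>R H 1 x + u $ 2 *\<^sub>R H 2 x)"
  have gu: "gu = (\<lambda>x. g x \<bullet> u)" by (simp add: gu_def inner_vec_def sum_2 mult.commute fun_eq_iff)
  have wgu: "is_weak_grad \<Omega> gu Hu" unfolding gu_def Hu_def
    by (rule is_weak_grad_lincomb[OF \<Omega> H(1) H(1)])
  have igu: "integrable (lebesgue_on \<Omega>) gu" unfolding gu using w(3) by (rule integrable_inner_left)
  have igv: "integrable (lebesgue_on \<Omega>) (\<lambda>x. g x \<bullet> v)" using w(3) by (rule integrable_inner_left)
  have iHu: "integrable (lebesgue_on \<Omega>) Hu" unfolding Hu_def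
    by (intro Bochner_Integration.integrable_add integrable_scaleR_right H(2))
  obtain W where W: "brep \<Omega> w W" using brep_exists[OF \<Omega> w(2)] by metis
  obtain Gu where Gu: "brep \<Omega> gu Gu" using brep_exists[OF \<Omega> igu] by metis
  obtain Gv where Gv: "brep \<Omega> (\<lambda>x. g x \<bullet> v) Gv" using brep_exists[OF \<Omega> igv] by metis
  obtain h where h: "brep \<Omega> (\<lambda>x. Hu x \<bullet> v) h"
    using brep_exists[OF \<Omega> integrable_inner_left[OF iHu]] by metis
  have i: "integrable lborel W" "integrable lborel Gu" "integrable lborel Gv" "integrable lborel h"
    using W Gu Gv h by (auto simp: brep_def)
  note it = i[THEN integrable_frame[OF fr]]
  note pd = weak_grad_frame(1)[OF \<Omega> fr w W Gu[unfolded gu]] weak_grad_frame(2)[OF \<Omega> fr w W Gv]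
    weak_grad_frame(2)[OF \<Omega> fr wgu igu iHu Gu h]
  define \<Phi>0 where "\<Phi>0 = mixed_rep r (W \<circ> ?T) (Gu \<circ> ?T) (Gv \<circ> ?T) (h \<circ> ?T)"
  define \<Phi> where "\<Phi> = (\<lambda>x. \<Phi>0 (\<alpha> \<bullet> x, \<beta> \<bullet> x))"
  have c0: "continuous_on UNIV \<Phi>0" unfolding \<Phi>0_def by (rule mixed_rep_continuous[OF it])
  have c: "continuous_on UNIV \<Phi>" unfolding \<Phi>_def
    by (intro continuous_on_compose2[OF c0] continuous_intros) auto
  have \<Phi>T: "\<Phi> (?T z) = \<Phi>0 z" for z by (simp add: \<Phi>_def fmap_coord[OF fr])
  have "AE z in lborel. z \<in> ?T -` V \<longrightarrow> (W \<circ> ?T) z = \<Phi>0 z"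
    unfolding \<Phi>0_def
  proof (rule mixed_rep_AE[OF r it pd open_vimage[OF V fmap_continuous]])
    fix x :: "real \<times> real" and \<sigma> \<tau>
    assume a: "x \<in> ?T -` V" "0 \<le> \<sigma>" "\<sigma> \<le> r" "0 \<le> \<tau>" "\<tau> \<le> r"
    have "?T (x + (\<sigma>, \<tau>)) = ?T x + \<sigma> *\<^sub>R u + \<tau> *\<^sub>R v" by (simp add: fmap_def algebra_simps)
    then show "x + (\<sigma>, \<tau>) \<in> ?T -` \<Omega>" using cone[of "?T x" \<sigma> \<tau>] a by simp
  qed
  then have "AE z in lborel. ?T z \<in> V \<longrightarrow> W (?T z) = \<Phi> (?T z)" by (simp add: \<Phi>T)
  then have "AE x in lebesgue. x \<in> V \<longrightarrow> W x = \<Phi> x"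
    using W by (intro AE_plane_of_AE_frame[OF fr _ _ V])
      (auto simp: brep_def intro: borel_measurable_continuous_onI[OF c])
  moreover have "AE x in lebesgue. x \<in> \<Omega> \<longrightarrow> W x = w x" using W by (simp add: brep_def)
  moreover have "V \<subseteq> \<Omega>" using cone[of _ 0 0] r by auto
  ultimately have "AE x in lebesgue. x \<in> V \<longrightarrow> w x = \<Phi> x"
    by (auto elim: eventually_elim2)
  then show ?thesis using that c by blast
qed

section \<open>Lipschitz boundaries\<close>

text \<open>The set in \<open>\<Omega>\<close> where two continuous functions differ is open and
  null, hence empty; continuity carries the equality to the closure.\<close>

lemma AE_eq_imp_eq_on_closure:
  fixes f g :: "plane \<Rightarrow> real"
  assumes \<Omega>: "open \<Omega>" and c: "continuous_on (closure \<Omega>) f" "continuous_on (closure \<Omega>) g"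
    and ae: "AE x in lebesgue. x \<in> \<Omega> \<longrightarrow> f x = g x" and x: "x \<in> closure \<Omega>"
  shows "f x = g x"
proof -
  have cd: "continuous_on (closure \<Omega>) (\<lambda>x. f x - g x)" by (intro continuous_intros c)
  let ?N = "{x \<in> \<Omega>. f x - g x \<in> - {0}}"
  have "open ?N"
    using continuous_open_preimage[OF continuous_on_subset[OF cd closure_subset] \<Omega>, of "- {0}"]
    by (simp add: open_Compl vimage_def Int_def)
  moreover have "negligible ?N"
  proof -
    obtain N where N: "negligible N" "{x. \<not> (x \<in> \<Omega> \<longrightarrow> f x = g x)} \<subseteq> N"
      using ae unfolding eventually_ae_filter_negligible by metis
    show ?thesis by (rule negligible_subset[OF N(1)]) (use N(2) in auto)
  qed
  ultimately have "?N = {}" using open_not_negligible by blast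
  then have "y \<in> \<Omega> \<Longrightarrow> f y - g y = 0" for y by auto
  from continuous_constant_on_closure[OF cd this x] show ?thesis by simp
qed

lemma orthogonal_matrix_facts:
  fixes R :: "real ^ 2 ^ 2"
  assumes "orthogonal_matrix R"
  shows "(R *v x) v* R = x" "R *v (x v* R) = x"
    "(a v* R) \<bullet> x = a \<bullet> (R *v x)" "norm (R *v x) = norm x" "norm (x v* R) = norm x"
    "(s *\<^sub>R a + t *\<^sub>R b) v* R = s *\<^sub>R (a v* R) + t *\<^sub>R (b v* R)" "(a - b) v* R = a v* R - b v* R"
proof -
  have m: "transpose R ** R = mat 1" "R ** transpose R = mat 1" using assms by (auto simp: orthogonal_matrix_def)
  have 1: "(R *v x) v* R = x" "R *v (x v* R) = x" for x
    unfolding transpose_matrix_vector[symmetric] matrix_vector_mul_assoc m by simp_all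
  show "(R *v x) v* R = x" "R *v (x v* R) = x" by (rule 1)+
  have d: "(a v* R) \<bullet> x = a \<bullet> (R *v x)" for a x
    by (simp add: dot_lmul_matrix)
  show "(a v* R) \<bullet> x = a \<bullet> (R *v x)" by (rule d)
  show "norm (R *v x) = norm x"
    using d[of "R *v x" x] 1(1)[of x] by (simp add: norm_eq_sqrt_inner)
  show "norm (x v* R) = norm x"
    using d[of x "x v* R"] 1(2)[of x] by (simp add: norm_eq_sqrt_inner)
  show "(s *\<^sub>R a + t *\<^sub>R b) v* R = s *\<^sub>R (a v* R) + t *\<^sub>R (b v* R)"
    unfolding transpose_matrix_vector[symmetric] by (simp only: matrix_vector_right_distrib matrix_vector_mult_scaleR)
  show "(a - b) v* R = a v* R - b v* R"
    unfolding transpose_matrix_vector[symmetric] by (simp only: matrix_vector_mult_diff_distrib)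
qed

text \<open>The graph passes through the centre of the chart: \<open>\<gamma> 0 \<ge> 0\<close>
  because \<open>x\<close> is not in the open set, and \<open>\<gamma> 0 \<le> 0\<close> because
  \<open>x\<close> is a limit of points above the graph.\<close>

lemma graph_chart:
  assumes \<Omega>: "open \<Omega>" and x: "x \<in> frontier \<Omega>" and gb: "graph_boundary_at lipschitz_fun \<Omega> x"
  obtains R :: "real ^ 2 ^ 2" and \<rho> \<gamma> L where "orthogonal_matrix R" "\<rho> > 0" "L \<ge> 0" "\<And>s t. \<bar>\<gamma> s - \<gamma> t\<bar> \<le> L * \<bar>s - t\<bar>"
    "continuous_on UNIV \<gamma>" "\<gamma> 0 = 0"
    "\<And>z. z \<in> ball x \<rho> \<Longrightarrow> z \<in> \<Omega> \<longleftrightarrow> \<gamma> ((R *v (z - x)) $ 1) < (R *v (z - x)) $ 2"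
proof -
  obtain R :: "real ^ 2 ^ 2" and \<rho> \<gamma> where R: "orthogonal_matrix R" "\<rho> > 0" "lipschitz_fun \<gamma>"
    "\<forall>z\<in>ball x \<rho>. z \<in> \<Omega> \<longleftrightarrow> \<gamma> ((R *v (z - x)) $ 1) < (R *v (z - x)) $ 2"
    using gb unfolding graph_boundary_at_def by metis
  obtain L where L: "L-lipschitz_on UNIV \<gamma>" using R(3) unfolding lipschitz_fun_def by blast
  have l: "\<bar>\<gamma> s - \<gamma> t\<bar> \<le> L * \<bar>s - t\<bar>" for s t using lipschitz_onD[OF L, of s t] by (simp add: dist_real_def)
  have c: "continuous_on UNIV \<gamma>" using L by (rule lipschitz_on_continuous_on)
  have "x \<notin> \<Omega>" using x \<Omega> by (simp add: frontier_def interior_open)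
  then have "\<gamma> 0 \<ge> 0" using R(4)[rule_format, of x] R(2) by simp
  moreover have "\<gamma> 0 \<le> 0"
  proof -
    have "x \<in> closure \<Omega>" using x by (simp add: frontier_def)
    then obtain X where X: "\<And>n. X n \<in> \<Omega>" "X \<longlonglongrightarrow> x" unfolding closure_sequential by blast
    have l0: "(\<lambda>n. R *v (X n - x)) \<longlonglongrightarrow> R *v (x - x)"
      by (intro tendsto_intros X bounded_linear.tendsto[OF matrix_vector_mul_bounded_linear])
    have "(\<lambda>n. \<gamma> ((R *v (X n - x)) $ 1)) \<longlonglongrightarrow> \<gamma> ((R *v (x - x)) $ 1)"
      using c by (intro isCont_tendsto_compose[where g=\<gamma>] tendsto_vec_nth l0) (simp add: continuous_on_eq_continuous_at)
    moreover have "(\<lambda>n. (R *v (X n - x)) $ 2) \<longlonglongrightarrow> (R *v (x - x)) $ 2" by (intro tendsto_vec_nth l0)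
    moreover have "eventually (\<lambda>n. \<gamma> ((R *v (X n - x)) $ 1) \<le> (R *v (X n - x)) $ 2) sequentially"
    proof -
      have "eventually (\<lambda>n. X n \<in> ball x \<rho>) sequentially"
        using X(2) R(2) by (auto simp: tendsto_iff dist_commute)
      then show ?thesis by eventually_elim (use X(1) R(4) in \<open>force\<close>)
    qed
    ultimately have "\<gamma> ((R *v (x - x)) $ 1) \<le> (R *v (x - x)) $ 2" by (intro tendsto_le[OF sequentially_bot])
    then show ?thesis by simp
  qed
  ultimately have "\<gamma> 0 = 0" by simp
  then show ?thesis using that[OF R(1,2) lipschitz_on_nonneg[OF L] l c] R(4) by blast
qed

text \<open>In the chart, points straight below \<open>x\<close>, however close, have a
  neighbourhood that misses \<open>\<Omega>\<close>. Slits are thereby excluded, and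
  \<open>\<Omega>\<close> is recovered as the interior of its closure, the union of the
  triangles.\<close>

lemma frontier_chart_below:
  assumes \<Omega>: "open \<Omega>" and x: "x \<in> frontier \<Omega>" and gb: "graph_boundary_at lipschitz_fun \<Omega> x"
  shows "x \<notin> interior (closure \<Omega>)"
proof
  assume "x \<in> interior (closure \<Omega>)"
  then obtain e where e: "e > 0" "ball x e \<subseteq> closure \<Omega>" by (auto simp: mem_interior)
  obtain R :: "real ^ 2 ^ 2" and \<rho> \<gamma> L where R: "orthogonal_matrix R" "\<rho> > 0" "L \<ge> 0" "\<And>s t. \<bar>\<gamma> s - \<gamma> t\<bar> \<le> L * \<bar>s - t\<bar>"
    "continuous_on UNIV \<gamma>" "\<gamma> 0 = 0"
    "\<And>z. z \<in> ball x \<rho> \<Longrightarrow> z \<in> \<Omega> \<longleftrightarrow> \<gamma> ((R *v (z - x)) $ 1) < (R *v (z - x)) $ 2"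
    using graph_chart[OF assms] by metis
  note O = orthogonal_matrix_facts[OF R(1)]
  define \<eta> where "\<eta> = min e \<rho> / 2"
  have \<eta>: "0 < \<eta>" "\<eta> < e" "\<eta> < \<rho>" using e R(2) by (auto simp: \<eta>_def)
  define a :: plane where "a = vector [0, - \<eta>]"
  have a: "a $ 1 = 0" "a $ 2 = - \<eta>" "norm a = \<eta>"
    using \<eta> by (simp_all add: a_def norm_vec_def L2_set_def sum_2)
  define z where "z = x + a v* R"
  have zx: "R *v (z - x) = a" by (simp add: z_def O)
  have dz: "dist x z = \<eta>" by (simp add: z_def dist_norm O a)
  have cR: "continuous_on A (\<lambda>y. R *v (y - x))" for A
    by (intro bounded_linear.continuous_on[OF matrix_vector_mul_bounded_linear] continuous_intros)
  have "open {y. \<gamma> ((R *v (y - x)) $ 1) > (R *v (y - x)) $ 2}"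
    by (intro open_Collect_less continuous_on_component cR continuous_on_compose2[OF R(5)]) auto
  then have op: "open (ball x \<rho> \<inter> {y. \<gamma> ((R *v (y - x)) $ 1) > (R *v (y - x)) $ 2})" by (intro open_Int open_ball)
  have "z \<in> ball x \<rho> \<inter> {y. \<gamma> ((R *v (y - x)) $ 1) > (R *v (y - x)) $ 2}"
    using dz \<eta> by (simp add: zx a R(6))
  moreover have "z \<in> closure \<Omega>" using e(2) dz \<eta> by auto
  ultimately have "(ball x \<rho> \<inter> {y. \<gamma> ((R *v (y - x)) $ 1) > (R *v (y - x)) $ 2}) \<inter> \<Omega> \<noteq> {}"
    using open_Int_closure_eq_empty[OF op, of \<Omega>] by blast
  then show False using R(7) by force
qed

lemma interior_closure_graph_boundary:
  assumes \<Omega>: "open \<Omega>" and gb: "\<And>x. x \<in> frontier \<Omega> \<Longrightarrow> graph_boundary_at lipschitz_fun \<Omega> x"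
  shows "interior (closure \<Omega>) = \<Omega>"
proof
  show "\<Omega> \<subseteq> interior (closure \<Omega>)" using \<Omega> closure_subset interior_maximal by blast
  show "interior (closure \<Omega>) \<subseteq> \<Omega>"
  proof
    fix x assume x: "x \<in> interior (closure \<Omega>)"
    show "x \<in> \<Omega>"
    proof (rule ccontr)
      assume "x \<notin> \<Omega>"
      then have "x \<in> frontier \<Omega>" using x \<Omega> interior_subset by (auto simp: frontier_def interior_open)
      then show False using frontier_chart_below[OF \<Omega> _ gb] x by blast
    qed
  qed
qed

text \<open>At a boundary point the two directions are, in chart coordinates, (1, K) and (-1, K)
  with K larger than the Lipschitz constant of the graph: moving along nonnegative combinations, one
  rises at least as fast as the graph can.\<close>

lemma cone_property:
  assumes \<Omega>: "open \<Omega>" and gb: "\<And>x. x \<in> frontier \<Omega> \<Longrightarrow> graph_boundary_at lipschitz_fun \<Omega> x"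
    and x0: "x0 \<in> closure \<Omega>"
  obtains u v \<alpha> \<beta> \<rho> r where "frame u v \<alpha> \<beta>" "\<rho> > 0" "r > 0"
    "\<And>x \<sigma> \<tau>. x \<in> \<Omega> \<inter> ball x0 \<rho> \<Longrightarrow> 0 \<le> \<sigma> \<Longrightarrow> \<sigma> \<le> r \<Longrightarrow> 0 \<le> \<tau> \<Longrightarrow> \<tau> \<le> r \<Longrightarrow> x + \<sigma> *\<^sub>R u + \<tau> *\<^sub>R v \<in> \<Omega>"
proof -
  have small: "dist x0 (x + \<sigma> *\<^sub>R u + \<tau> *\<^sub>R v) < e"
    if "dist x0 x < e / 2" "0 \<le> \<sigma>" "\<sigma> \<le> e / (4 * N)" "0 \<le> \<tau>" "\<tau> \<le> e / (4 * N)" "norm u \<le> N" "norm v \<le> N" "0 < N"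
    for x \<sigma> \<tau> e N and u v :: plane
  proof -
    have b: "\<sigma> * norm u \<le> e / (4 * N) * N" "\<tau> * norm v \<le> e / (4 * N) * N"
      using that by (intro mult_mono; auto)+
    have "dist x0 (x + \<sigma> *\<^sub>R u + \<tau> *\<^sub>R v) \<le> dist x0 x + dist x (x + \<sigma> *\<^sub>R u + \<tau> *\<^sub>R v)" by (rule dist_triangle)
    also have "dist x (x + \<sigma> *\<^sub>R u + \<tau> *\<^sub>R v) = norm (\<sigma> *\<^sub>R u + \<tau> *\<^sub>R v)"
      by (subst dist_commute) (simp add: dist_norm add.assoc)
    also have "\<dots> \<le> \<sigma> * norm u + \<tau> * norm v"
      using norm_triangle_ineq[of "\<sigma> *\<^sub>R u" "\<tau> *\<^sub>R v"] that by simp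
    finally show ?thesis using b that(1,8) by simp
  qed
  show ?thesis
  proof (cases "x0 \<in> \<Omega>")
    case True
    then obtain e where e: "e > 0" "ball x0 e \<subseteq> \<Omega>" using \<Omega> open_contains_ball by blast
    show ?thesis
    proof (rule that[OF frame_axis(1), of "e / 2" "e / (4 * 1)"])
      fix x \<sigma> \<tau> assume "x \<in> \<Omega> \<inter> ball x0 (e / 2)" "0 \<le> \<sigma>" "\<sigma> \<le> e / (4 * 1)" "0 \<le> \<tau>" "\<tau> \<le> e / (4 * 1)"
      then show "x + \<sigma> *\<^sub>R axis 1 1 + \<tau> *\<^sub>R axis 2 1 \<in> \<Omega>"
        using small[of x e \<sigma> 1 \<tau> "axis 1 1" "axis 2 1"] e(2) by (auto simp: norm_axis_1)
    qed (use e in auto)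
  next
    case False
    then have fr: "x0 \<in> frontier \<Omega>" using x0 \<Omega> by (simp add: frontier_def interior_open)
    obtain R :: "real ^ 2 ^ 2" and \<rho> \<gamma> L where R: "orthogonal_matrix R" "\<rho> > 0" "L \<ge> 0" "\<And>s t. \<bar>\<gamma> s - \<gamma> t\<bar> \<le> L * \<bar>s - t\<bar>"
      "continuous_on UNIV \<gamma>" "\<gamma> 0 = 0"
      "\<And>z. z \<in> ball x0 \<rho> \<Longrightarrow> z \<in> \<Omega> \<longleftrightarrow> \<gamma> ((R *v (z - x0)) $ 1) < (R *v (z - x0)) $ 2"
      using graph_chart[OF \<Omega> fr gb[OF fr]] by metis
    note O = orthogonal_matrix_facts[OF R(1)]
    \<comment> \<open>Strictly steeper than the graph, and positive also for \<open>L = 0\<close>,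
      as the division by \<open>K\<close> requires.\<close>
    define K where "K = L + 1"
    have K: "K > 0" "L \<le> K" using R(3) by (auto simp: K_def)
    \<comment> \<open>In chart coordinates, \<open>p\<close> and \<open>q\<close> form the basis
      dual to \<open>a\<close> and \<open>b\<close>.\<close>
    define a b p q :: plane where "a = vector [1, K]" and "b = vector [- 1, K]"
      and "p = vector [1/2, 1 / (2 * K)]" and "q = vector [- 1/2, 1 / (2 * K)]"
    define u v \<alpha> \<beta> where "u = a v* R" and "v = b v* R"
      and "\<alpha> = p v* R" and "\<beta> = q v* R"
    have Ru: "R *v u = a" "R *v v = b" by (simp_all add: u_def v_def O)
    have F: "frame u v \<alpha> \<beta>"
      unfolding frame_def
    proof (intro conjI allI)
      show "\<alpha> \<bullet> u = 1" "\<alpha> \<bullet> v = 0" "\<beta> \<bullet> u = 0" "\<beta> \<bullet> v = 1"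
        unfolding \<alpha>_def \<beta>_def O(3) Ru
        using K by (simp_all add: a_def b_def p_def q_def inner_vec_def sum_2)
      fix x
      define y where "y = R *v x"
      have "(p \<bullet> y) *\<^sub>R a + (q \<bullet> y) *\<^sub>R b = y"
        using K by (simp add: a_def b_def p_def q_def inner_vec_def sum_2 vec_eq_iff forall_2 field_simps)
      then have "((p \<bullet> y) *\<^sub>R a + (q \<bullet> y) *\<^sub>R b) v* R = x" by (simp add: y_def O)
      then show "x = (\<alpha> \<bullet> x) *\<^sub>R u + (\<beta> \<bullet> x) *\<^sub>R v"
        by (simp add: \<alpha>_def \<beta>_def O u_def v_def y_def)
    qed
    define N where "N = max (norm u) (norm v) + 1"
    have N: "norm u \<le> N" "norm v \<le> N" "N > 0" unfolding N_def by (auto simp: le_max_iff_disj max_def intro: add_nonneg_pos)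
    show ?thesis
    proof (rule that[OF F, of "\<rho> / 2" "\<rho> / (4 * N)"])
      show "\<rho> / 2 > 0" "\<rho> / (4 * N) > 0" using R(2) N by auto
      fix x \<sigma> \<tau> assume a': "x \<in> \<Omega> \<inter> ball x0 (\<rho> / 2)" "0 \<le> \<sigma>" "\<sigma> \<le> \<rho> / (4 * N)" "0 \<le> \<tau>" "\<tau> \<le> \<rho> / (4 * N)"
      let ?z = "x + \<sigma> *\<^sub>R u + \<tau> *\<^sub>R v"
      have z: "?z \<in> ball x0 \<rho>" using small[of x \<rho> \<sigma> N \<tau> u v] a' N by simp
      have x: "x \<in> ball x0 \<rho>" using a' R(2) by auto
      define \<zeta> where "\<zeta> = R *v (x - x0)"
      have "R *v (?z - x0) = \<zeta> + \<sigma> *\<^sub>R a + \<tau> *\<^sub>R b"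
      proof -
        have "?z - x0 = (x - x0) + \<sigma> *\<^sub>R u + \<tau> *\<^sub>R v" by simp
        then show ?thesis by (simp only: matrix_vector_right_distrib matrix_vector_mult_scaleR Ru \<zeta>_def)
      qed
      then have c: "(R *v (?z - x0)) $ 1 = \<zeta> $ 1 + (\<sigma> - \<tau>)" "(R *v (?z - x0)) $ 2 = \<zeta> $ 2 + (\<sigma> + \<tau>) * K"
        by (simp_all add: a_def b_def algebra_simps)
      have "\<gamma> (\<zeta> $ 1) < \<zeta> $ 2" using R(7)[OF x] a'(1) by (simp add: \<zeta>_def)
      moreover have "\<gamma> (\<zeta> $ 1 + (\<sigma> - \<tau>)) - \<gamma> (\<zeta> $ 1) \<le> L * \<bar>\<sigma> - \<tau>\<bar>" using R(4)[of "\<zeta> $ 1 + (\<sigma> - \<tau>)" "\<zeta> $ 1"] by simp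
      moreover have "L * \<bar>\<sigma> - \<tau>\<bar> \<le> K * (\<sigma> + \<tau>)" using a' K R(3) by (intro mult_mono) auto
      ultimately show "?z \<in> \<Omega>" unfolding R(7)[OF z] c by (simp add: mult.commute)
    qed
  qed
qed

subsection \<open>Continuity up to the boundary\<close>

text \<open>Local representatives agree wherever their balls overlap, because they are continuous
  and almost everywhere equal to \<open>w\<close>; hence they glue. Compactness of the closure
  reduces the exceptional null sets to finitely many.\<close>

lemma continuous_representative:
  assumes \<Omega>: "open \<Omega>" "bounded \<Omega>" and gb: "\<And>x. x \<in> frontier \<Omega> \<Longrightarrow> graph_boundary_at lipschitz_fun \<Omega> x"
    and w: "is_weak_grad \<Omega> w g" "integrable (lebesgue_on \<Omega>) w" "integrable (lebesgue_on \<Omega>) g"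
    and H: "\<And>i. is_weak_grad \<Omega> (\<lambda>x. g x $ i) (H i)" "\<And>i. integrable (lebesgue_on \<Omega>) (H i)"
  obtains w' where "continuous_on (closure \<Omega>) w'" "AE x in lebesgue. x \<in> \<Omega> \<longrightarrow> w' x = w x"
proof -
  have "\<exists>p. fst p > 0 \<and> continuous_on UNIV (snd p) \<and> (AE x in lebesgue. x \<in> \<Omega> \<inter> ball x0 (fst p) \<longrightarrow> w x = snd p x)"
    if x0: "x0 \<in> closure \<Omega>" for x0
  proof (rule cone_property[OF \<Omega>(1) gb x0])
    fix u v \<alpha> \<beta> \<rho> r
    assume a: "frame u v \<alpha> \<beta>" "\<rho> > 0" "r > 0"
      "\<And>x \<sigma> \<tau>. x \<in> \<Omega> \<inter> ball x0 \<rho> \<Longrightarrow> 0 \<le> \<sigma> \<Longrightarrow> \<sigma> \<le> r \<Longrightarrow> 0 \<le> \<tau> \<Longrightarrow> \<tau> \<le> r \<Longrightarrow> x + \<sigma> *\<^sub>R u + \<tau> *\<^sub>R v \<in> \<Omega>"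
    have "open (\<Omega> \<inter> ball x0 \<rho>)" using \<Omega>(1) by auto
    then obtain \<Phi> where "continuous_on UNIV \<Phi>" "AE x in lebesgue. x \<in> \<Omega> \<inter> ball x0 \<rho> \<longrightarrow> w x = \<Phi> x"
      by (rule local_continuous_representative[OF \<Omega>(1) w H a(1,3) _ a(4)])
    then show ?thesis using a(2) by (intro exI[of _ "(\<rho>, \<Phi>)"]) simp
  qed
  then have "\<forall>x0\<in>closure \<Omega>. \<exists>p. fst p > 0 \<and> continuous_on UNIV (snd p) \<and>
      (AE x in lebesgue. x \<in> \<Omega> \<inter> ball x0 (fst p) \<longrightarrow> w x = snd p x)" by blast
  from bchoice[OF this] obtain p where p: "\<forall>x0\<in>closure \<Omega>. fst (p x0) > 0 \<and> continuous_on UNIV (snd (p x0)) \<and>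
      (AE x in lebesgue. x \<in> \<Omega> \<inter> ball x0 (fst (p x0)) \<longrightarrow> w x = snd (p x0) x)" by blast
  define \<rho> \<Phi> where "\<rho> = (\<lambda>x0. fst (p x0))" and "\<Phi> = (\<lambda>x0. snd (p x0))"
  have P: "\<And>x0. x0 \<in> closure \<Omega> \<Longrightarrow> \<rho> x0 > 0" "\<And>x0. x0 \<in> closure \<Omega> \<Longrightarrow> continuous_on UNIV (\<Phi> x0)"
    "\<And>x0. x0 \<in> closure \<Omega> \<Longrightarrow> AE x in lebesgue. x \<in> \<Omega> \<inter> ball x0 (\<rho> x0) \<longrightarrow> w x = \<Phi> x0 x"
    using p unfolding \<rho>_def \<Phi>_def by blast+
  \<comment> \<open>Each point uses the local function centred at itself; \<open>agree\<close> shows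
    that any other centre nearby would give the same value.\<close>
  define w' where "w' = (\<lambda>x. \<Phi> x x)"
  have agree: "w' y = \<Phi> x0 y" if x0: "x0 \<in> closure \<Omega>" and y: "y \<in> closure \<Omega>" "y \<in> ball x0 (\<rho> x0)" for x0 y
  proof -
    let ?B = "ball x0 (\<rho> x0) \<inter> ball y (\<rho> y)"
    have "AE x in lebesgue. x \<in> ?B \<inter> \<Omega> \<longrightarrow> \<Phi> y x = \<Phi> x0 x"
      using P(3)[OF x0] P(3)[OF y(1)] by eventually_elim auto
    then have ae: "AE x in lebesgue. x \<in> ?B \<inter> \<Omega> \<longrightarrow> \<Phi> y x = \<Phi> x0 x" .
    have "open ?B" by auto
    moreover have "y \<in> ?B" using y P(1)[OF y(1)] by simp
    \<comment> \<open>For boundary points equality is known only on the part of the overlap inside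
      \<open>\<Omega>\<close>, and it reaches \<open>y\<close> because \<open>y\<close> is in the
      closure of that part.\<close>
    ultimately have yc: "y \<in> closure (?B \<inter> \<Omega>)" using open_Int_closure_subset[of ?B \<Omega>] y(1) by blast
    have op: "open (?B \<inter> \<Omega>)" using \<Omega>(1) by auto
    show ?thesis unfolding w'_def
      by (rule AE_eq_imp_eq_on_closure[OF op continuous_on_subset[OF P(2)[OF y(1)] subset_UNIV]
            continuous_on_subset[OF P(2)[OF x0] subset_UNIV] ae yc])
  qed
  have c: "continuous_on (closure \<Omega>) w'"
    unfolding continuous_on_eq_continuous_within
  proof
    fix x0 assume x0: "x0 \<in> closure \<Omega>"
    have "continuous (at x0 within closure \<Omega>) (\<Phi> x0)"
      using P(2)[OF x0] by (simp add: continuous_on_eq_continuous_at continuous_at_imp_continuous_at_within)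
    then show "continuous (at x0 within closure \<Omega>) w'"
      by (rule continuous_transform_within[OF _ P(1)[OF x0] x0]) (use agree[OF x0] in \<open>auto simp: dist_commute\<close>)
  qed
  have "compact (closure \<Omega>)" using \<Omega>(2) by (simp add: compact_closure)
  moreover have "closure \<Omega> \<subseteq> (\<Union>x0\<in>closure \<Omega>. ball x0 (\<rho> x0))" using P(1) by force
  ultimately obtain C where C: "C \<subseteq> closure \<Omega>" "finite C" "closure \<Omega> \<subseteq> (\<Union>x0\<in>C. ball x0 (\<rho> x0))"
    using compactE_image[of "closure \<Omega>" "closure \<Omega>" "\<lambda>x0. ball x0 (\<rho> x0)"] by blast
  have "AE x in lebesgue. \<forall>x0\<in>C. x \<in> \<Omega> \<inter> ball x0 (\<rho> x0) \<longrightarrow> w x = \<Phi> x0 x"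
  proof (rule AE_ball_countable'[OF _ countable_finite[OF C(2)]])
    fix x0 assume "x0 \<in> C"
    then show "AE x in lebesgue. x \<in> \<Omega> \<inter> ball x0 (\<rho> x0) \<longrightarrow> w x = \<Phi> x0 x" using P(3) C(1) by blast
  qed
  then have "AE x in lebesgue. x \<in> \<Omega> \<longrightarrow> w' x = w x"
  proof eventually_elim
    case (elim x)
    show ?case
    proof
      assume x: "x \<in> \<Omega>"
      then have xc: "x \<in> closure \<Omega>" using closure_subset by blast
      then obtain x0 where x0: "x0 \<in> C" "x \<in> ball x0 (\<rho> x0)" using C(3) by blast
      then show "w' x = w x" using agree[of x0 x] elim x xc C(1) by auto
    qed
  qed
  then show ?thesis using that c by blast
qed

subsection \<open>Zero traces\<close>

text \<open>The means of |w| near \<open>x\<close> are those of |w'|. If \<open>w' x\<close> is not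
  zero they eventually stay above half of its modulus; if it is zero they fall below every positive
  bound.\<close>

lemma has_trace_at_continuous:
  assumes \<Omega>: "open \<Omega>" "bounded \<Omega>" and c: "continuous_on (closure \<Omega>) w'"
    and ae: "AE x in lebesgue. x \<in> \<Omega> \<longrightarrow> w' x = w x" and wm: "w \<in> borel_measurable (lebesgue_on \<Omega>)"
    and x: "x \<in> closure \<Omega>"
  shows "has_trace_at \<Omega> w x 0 \<longleftrightarrow> w' x = 0"
proof -
  have "bounded (w' ` closure \<Omega>)"
    using compact_imp_bounded[OF compact_continuous_image[OF c]] \<Omega>(2) by (simp add: compact_closure)
  then obtain B where B: "\<And>z. z \<in> closure \<Omega> \<Longrightarrow> \<bar>w' z\<bar> \<le> B"
    unfolding bounded_iff by auto
  define D where "D = (\<lambda>\<rho>. \<Omega> \<inter> ball x \<rho>)"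
  have oD: "open (D \<rho>)" and bD: "bounded (D \<rho>)" and DO: "D \<rho> \<subseteq> \<Omega>" for \<rho>
    using \<Omega> by (auto simp: D_def bounded_Int)
  have lD: "D \<rho> \<in> lmeasurable" for \<rho> using oD bD by (simp add: lmeasurable_open)
  have pos: "measure lebesgue (D \<rho>) > 0" if r: "\<rho> > 0" for \<rho>
  proof -
    obtain y where "y \<in> \<Omega>" "dist y x < \<rho>" using x r unfolding closure_approachable by blast
    then have "D \<rho> \<noteq> {}" by (auto simp: D_def dist_commute)
    then have "\<not> negligible (D \<rho>)" using oD open_not_negligible by blast
    then have "measure lebesgue (D \<rho>) \<noteq> 0" using negligible_iff_measure0[OF lD] by simp
    then show ?thesis using measure_nonneg[of lebesgue "D \<rho>"] by linarith
  qed
  define m where "m = (\<lambda>\<rho>. (LINT z|lebesgue_on (D \<rho>). \<bar>w z - 0\<bar>) / measure lebesgue (D \<rho>))"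
  have i1: "integrable (lebesgue_on (D \<rho>)) (\<lambda>z. \<bar>w' z\<bar>)" for \<rho>
  proof -
    have "D \<rho> \<subseteq> closure \<Omega>" using DO[of \<rho>] closure_subset[of \<Omega>] by (rule subset_trans)
    then have "continuous_on (D \<rho>) w'" by (rule continuous_on_subset[OF c])
    then have "(\<lambda>z. indicator (D \<rho>) z *\<^sub>R w' z) \<in> borel_measurable borel"
      using oD by (intro borel_measurable_continuous_on_indicator) auto
    then have "(\<lambda>z. indicator (D \<rho>) z *\<^sub>R w' z) \<in> borel_measurable lebesgue"
      by (intro measurable_completion) simp
    moreover have "integrable lebesgue (\<lambda>z. B * indicator (D \<rho>) z)"
      using lD[of \<rho>] unfolding lmeasurable_iff_integrable by (rule integrable_mult_right)
    moreover have "AE z in lebesgue. norm (indicator (D \<rho>) z *\<^sub>R w' z) \<le> norm (B * indicator (D \<rho>) z)"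
    proof (rule AE_I2)
      fix z show "norm (indicator (D \<rho>) z *\<^sub>R w' z) \<le> norm (B * indicator (D \<rho>) z)"
      proof (cases "z \<in> D \<rho>")
        case True
        then have "z \<in> closure \<Omega>" using DO closure_subset by blast
        from B[OF this] True show ?thesis by simp
      qed simp
    qed
    ultimately have "integrable lebesgue (\<lambda>z. indicator (D \<rho>) z *\<^sub>R w' z)"
      using Bochner_Integration.integrable_bound by blast
    then have "integrable (lebesgue_on (D \<rho>)) w'" using lD by (subst integrable_restrict_space) (auto simp: fmeasurableD)
    then show ?thesis by (rule integrable_abs)
  qed
  have meq: "m \<rho> = (LINT z|lebesgue_on (D \<rho>). \<bar>w' z\<bar>) / measure lebesgue (D \<rho>)" for \<rho>
  proof -
    have "(LINT z|lebesgue_on (D \<rho>). \<bar>w' z\<bar>) = (LINT z|lebesgue_on (D \<rho>). \<bar>w z - 0\<bar>)"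
    proof (rule integral_cong_AE)
      have ae': "AE z in lebesgue_on (D \<rho>). w' z = w z"
        using ae lD DO by (auto simp: AE_restrict_space_iff fmeasurableD elim!: eventually_mono)
      then show "AE z in lebesgue_on (D \<rho>). \<bar>w' z\<bar> = \<bar>w z - 0\<bar>" by eventually_elim simp
      show "(\<lambda>z. \<bar>w' z\<bar>) \<in> borel_measurable (lebesgue_on (D \<rho>))" using i1 by auto
      have "w \<in> borel_measurable (lebesgue_on (D \<rho>))" by (rule measurable_restrict_mono[OF wm DO])
      then show "(\<lambda>z. \<bar>w z - 0\<bar>) \<in> borel_measurable (lebesgue_on (D \<rho>))" by simp
    qed
    then show ?thesis by (simp add: m_def)
  qed
  have cst: "(LINT z|lebesgue_on (D \<rho>). c) = c * measure lebesgue (D \<rho>)" for c :: real and \<rho>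
    using lD by (simp add: measure_restrict_space fmeasurableD space_restrict_space)
  have ci: "integrable (lebesgue_on (D \<rho>)) (\<lambda>z. c)" for c :: real and \<rho>
    using integrable_continuous_bounded_set[OF oD bD, of "\<lambda>_. c"] by simp
  have near: "\<exists>\<delta>>0. \<forall>z\<in>D \<delta>. \<bar>w' z - w' x\<bar> < e" if e: "e > 0" for e
  proof -
    obtain \<delta> where "\<delta> > 0" "\<forall>z\<in>closure \<Omega>. dist z x < \<delta> \<longrightarrow> dist (w' z) (w' x) < e"
      using c x e unfolding continuous_on_iff by blast
    then show ?thesis using closure_subset[of \<Omega>]
      by (intro exI[of _ \<delta>]) (auto simp: D_def dist_real_def dist_commute)
  qed
  have tr: "has_trace_at \<Omega> w x 0 \<longleftrightarrow> (m \<longlongrightarrow> 0) (at_right 0)"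
    unfolding has_trace_at_def m_def D_def ..
  show ?thesis
  proof
    assume "has_trace_at \<Omega> w x 0"
    then have lim: "(m \<longlongrightarrow> 0) (at_right 0)" using tr by simp
    show "w' x = 0"
    proof (rule ccontr)
      assume n: "w' x \<noteq> 0"
      define e where "e = \<bar>w' x\<bar> / 2"
      have e: "e > 0" using n by (simp add: e_def)
      obtain \<delta> where \<delta>: "\<delta> > 0" "\<forall>z\<in>D \<delta>. \<bar>w' z - w' x\<bar> < e" using near[OF e] by blast
      have "m \<rho> \<ge> e" if "0 < \<rho>" "\<rho> < \<delta>" for \<rho>
      proof -
        have "(LINT z|lebesgue_on (D \<rho>). e) \<le> (LINT z|lebesgue_on (D \<rho>). \<bar>w' z\<bar>)"
        proof (rule integral_mono[OF ci i1])
          fix z assume "z \<in> space (lebesgue_on (D \<rho>))"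
          then have "z \<in> D \<delta>" using that by (auto simp: space_restrict_space D_def)
          then have "\<bar>w' z - w' x\<bar> < e" using \<delta> by blast
          then show "e \<le> \<bar>w' z\<bar>" unfolding e_def by linarith
        qed
        then show ?thesis unfolding meq cst using pos[OF that(1)] by (simp add: field_simps)
      qed
      then have "eventually (\<lambda>\<rho>. e \<le> m \<rho>) (at_right 0)"
        using \<delta>(1) by (auto intro: eventually_at_rightI[of 0 \<delta>])
      from tendsto_le[OF trivial_limit_at_right_real lim tendsto_const this] show False using e by simp
    qed
  next
    assume z0: "w' x = 0"
    show "has_trace_at \<Omega> w x 0"
      unfolding tr
    proof (rule tendstoI)
      fix e :: real assume e: "e > 0"
      obtain \<delta> where \<delta>: "\<delta> > 0" "\<forall>z\<in>D \<delta>. \<bar>w' z - w' x\<bar> < e / 2" using near[of "e/2"] e by auto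
      have "dist (m \<rho>) 0 < e" if "0 < \<rho>" "\<rho> < \<delta>" for \<rho>
      proof -
        have "(LINT z|lebesgue_on (D \<rho>). \<bar>w' z\<bar>) \<le> (LINT z|lebesgue_on (D \<rho>). e / 2)"
        proof (rule integral_mono[OF i1 ci])
          fix z assume "z \<in> space (lebesgue_on (D \<rho>))"
          then have "z \<in> D \<delta>" using that by (auto simp: space_restrict_space D_def)
          then show "\<bar>w' z\<bar> \<le> e / 2" using \<delta> z0 by force
        qed
        then have "m \<rho> \<le> e / 2" unfolding meq cst using pos[OF that(1)] by (simp add: field_simps)
        moreover have "m \<rho> \<ge> 0" unfolding m_def by (intro divide_nonneg_nonneg integral_nonneg_AE) auto
        ultimately show ?thesis using e by simp
      qed
      then show "eventually (\<lambda>\<rho>. dist (m \<rho>) 0 < e) (at_right 0)"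
        using \<delta>(1) by (auto intro: eventually_at_rightI[of 0 \<delta>])
    qed
  qed
qed

text \<open>Projection to the first chart coordinate does not increase distances, and it maps the
  frontier near \<open>x\<close> onto a set containing an interval. Sets covering the frontier
  therefore project to sets covering that interval, which bounds the sum of their diameters from
  below.\<close>

lemma frontier_not_H1_null:
  assumes \<Omega>: "open \<Omega>" and x: "x \<in> frontier \<Omega>" and gb: "graph_boundary_at lipschitz_fun \<Omega> x" and \<delta>: "\<delta> > 0"
  shows "\<not> H1_null (frontier \<Omega> \<inter> ball x \<delta>)"
proof
  assume null: "H1_null (frontier \<Omega> \<inter> ball x \<delta>)"
  obtain R :: "real ^ 2 ^ 2" and \<rho> \<gamma> L where R: "orthogonal_matrix R" "\<rho> > 0" "L \<ge> 0" "\<And>s t. \<bar>\<gamma> s - \<gamma> t\<bar> \<le> L * \<bar>s - t\<bar>"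
    "continuous_on UNIV \<gamma>" "\<gamma> 0 = 0"
    "\<And>z. z \<in> ball x \<rho> \<Longrightarrow> z \<in> \<Omega> \<longleftrightarrow> \<gamma> ((R *v (z - x)) $ 1) < (R *v (z - x)) $ 2"
    using graph_chart[OF \<Omega> x gb] by metis
  note O = orthogonal_matrix_facts[OF R(1)]
  define m where "m = min \<delta> \<rho>"
  have m: "m > 0" "m \<le> \<delta>" "m \<le> \<rho>" using \<delta> R(2) by (auto simp: m_def)
  \<comment> \<open>Small enough that the graph over \<open>{-\<kappa>..\<kappa>}\<close> stays in
    both balls: |s| + |\<gamma> s| is at most \<kappa> (1 + L), hence less than
    \<open>m\<close>.\<close>
  define \<kappa> where "\<kappa> = m / (2 * (1 + L))"
  have "1 + L > 0" using R(3) by simp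
  moreover have "m / (2 * c) > 0 \<and> m / (2 * c) * c < m" if "c > 0" for c using m that by (simp add: field_simps)
  ultimately have \<kappa>: "\<kappa> > 0" "\<kappa> * (1 + L) < m" unfolding \<kappa>_def by blast+
  define pt where "pt = (\<lambda>s t. x + (vector [s, t] :: plane) v* R)"
  have pc: "R *v (pt s t - x) = vector [s, t]" for s t by (simp add: pt_def O)
  have pd: "dist x (pt s t) \<le> \<bar>s\<bar> + \<bar>t\<bar>" for s t
  proof -
    have "dist x (pt s t) = norm (vector [s, t] :: plane)" by (simp add: pt_def dist_norm O)
    also have "\<dots> \<le> \<bar>s\<bar> + \<bar>t\<bar>"
      using sqrt_sum_squares_le_sum_abs[of s t] by (simp add: norm_vec_def L2_set_def sum_2)
    finally show ?thesis .
  qed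
  have graph: "pt s (\<gamma> s) \<in> frontier \<Omega> \<inter> ball x \<delta>" if s: "\<bar>s\<bar> \<le> \<kappa>" for s
  proof -
    have "\<bar>s\<bar> + \<bar>\<gamma> s\<bar> \<le> \<bar>s\<bar> * (1 + L)" using R(4)[of s 0] R(6) by (simp add: algebra_simps)
    also have "\<dots> \<le> \<kappa> * (1 + L)" using s R(3) by (intro mult_right_mono) auto
    finally have sm: "\<bar>s\<bar> + \<bar>\<gamma> s\<bar> < m" using \<kappa> by simp
    have b: "pt s (\<gamma> s) \<in> ball x m" using pd[of s "\<gamma> s"] sm by simp
    have nin: "pt s (\<gamma> s) \<notin> \<Omega>" using R(7)[of "pt s (\<gamma> s)"] b m(3) by (auto simp: pc)
    have "pt s (\<gamma> s) \<in> closure \<Omega>"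
      unfolding closure_approachable
    proof (intro allI impI)
      fix e :: real assume e: "e > 0"
      define \<eta> where "\<eta> = min (e / 2) ((m - (\<bar>s\<bar> + \<bar>\<gamma> s\<bar>)) / 2)"
      have \<eta>: "\<eta> > 0" "\<eta> < e" "\<bar>s\<bar> + \<bar>\<gamma> s\<bar> + \<eta> < m" using e sm by (auto simp: \<eta>_def min_def field_simps)
      let ?y = "pt s (\<gamma> s + \<eta>)"
      have "dist x ?y \<le> \<bar>s\<bar> + \<bar>\<gamma> s + \<eta>\<bar>" by (rule pd)
      then have "?y \<in> ball x \<rho>" using \<eta> m by auto
      then have "?y \<in> \<Omega>" using R(7)[of ?y] \<eta>(1) by (simp add: pc)
      moreover have "dist ?y (pt s (\<gamma> s)) < e"
      proof -
        have "?y - pt s (\<gamma> s) = (vector [s, \<gamma> s + \<eta>] - vector [s, \<gamma> s]) v* R"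
          by (simp add: pt_def O)
        then have "dist ?y (pt s (\<gamma> s)) = norm (vector [s, \<gamma> s + \<eta>] - vector [s, \<gamma> s] :: plane)"
          unfolding dist_norm by (simp only: O(5))
        also have "\<dots> = \<eta>" using \<eta>(1) by (simp add: norm_vec_def L2_set_def sum_2)
        finally show ?thesis using \<eta> by simp
      qed
      ultimately show "\<exists>y\<in>\<Omega>. dist y (pt s (\<gamma> s)) < e" by blast
    qed
    then have "pt s (\<gamma> s) \<in> frontier \<Omega>" using nin \<Omega> by (simp add: frontier_def interior_open)
    then show ?thesis using b m(2) by auto
  qed
  obtain C :: "nat \<Rightarrow> plane set" where C: "frontier \<Omega> \<inter> ball x \<delta> \<subseteq> (\<Union>i. C i)" "\<And>i. bounded (C i)"
    "summable (\<lambda>i. diameter (C i))" "(\<Sum>i. diameter (C i)) < \<kappa>"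
    using null \<kappa>(1) unfolding H1_null_def by metis
  define c where "c = (\<lambda>i. SOME z. z \<in> C i)"
  define \<pi> where "\<pi> = (\<lambda>z. (R *v (z - x)) $ 1)"
  \<comment> \<open>The projection of a set lies within its diameter on either side of the
    projection of any of its points. The intervals have total length below 2 \<kappa>, which is the
    length of the interval they cover.\<close>
  define I where "I = (\<lambda>i. {\<pi> (c i) - diameter (C i)..\<pi> (c i) + diameter (C i)})"
  have "{-\<kappa>..\<kappa>} \<subseteq> (\<Union>i. I i)"
  proof
    fix s assume s: "s \<in> {-\<kappa>..\<kappa>}"
    then have "\<bar>s\<bar> \<le> \<kappa>" by auto
    from graph[OF this] obtain i where i: "pt s (\<gamma> s) \<in> C i" using C(1) by blast
    then have ci: "c i \<in> C i" unfolding c_def by (rule someI)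
    have "\<bar>\<pi> (pt s (\<gamma> s)) - \<pi> (c i)\<bar> \<le> norm (R *v (pt s (\<gamma> s) - x) - R *v (c i - x))"
      unfolding \<pi>_def
      using component_le_norm_cart[of "R *v (pt s (\<gamma> s) - x) - R *v (c i - x)" 1] by simp
    also have "\<dots> = norm (R *v (pt s (\<gamma> s) - c i))" by (simp flip: matrix_vector_mult_diff_distrib)
    also have "\<dots> = dist (pt s (\<gamma> s)) (c i)" by (simp add: O dist_norm)
    also have "\<dots> \<le> diameter (C i)" by (rule diameter_bounded_bound[OF C(2) i ci])
    finally have "s \<in> I i" by (auto simp: \<pi>_def pc I_def abs_le_iff)
    then show "s \<in> (\<Union>i. I i)" by blast
  qed
  then have "emeasure lborel {-\<kappa>..\<kappa>} \<le> emeasure lborel (\<Union>i. I i)"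
    by (intro emeasure_mono) (auto simp: I_def)
  also have "\<dots> \<le> (\<Sum>i. emeasure lborel (I i))"
    by (intro emeasure_subadditive_countably) (auto simp: I_def)
  also have "\<dots> = (\<Sum>i. ennreal (2 * diameter (C i)))"
    using diameter_ge_0[OF C(2)] by (simp add: I_def)
  also have "\<dots> = ennreal (\<Sum>i. 2 * diameter (C i))"
    using C(3) diameter_ge_0[OF C(2)] by (intro suminf_ennreal2 summable_mult) auto
  also have "\<dots> = ennreal (2 * (\<Sum>i. diameter (C i)))"
    using suminf_mult[OF C(3), of 2] by simp
  also have "\<dots> < ennreal (2 * \<kappa>)"
    using C(4) \<kappa>(1) suminf_nonneg[OF C(3) diameter_ge_0[OF C(2)]] by (intro ennreal_lessI) auto
  finally show False using \<kappa>(1) by simp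
qed

text \<open>By continuity, a boundary point with nonzero value has a whole piece of the frontier
  around it in the exceptional set, and such a piece is not null. Trace zero almost everywhere thus
  becomes vanishing at every boundary point.\<close>

lemma zero_trace_iff_zero_on_frontier:
  assumes \<Omega>: "open \<Omega>" "bounded \<Omega>" and gb: "\<And>x. x \<in> frontier \<Omega> \<Longrightarrow> graph_boundary_at lipschitz_fun \<Omega> x"
    and c: "continuous_on (closure \<Omega>) w'" and ae: "AE x in lebesgue. x \<in> \<Omega> \<longrightarrow> w' x = w x"
    and wm: "w \<in> borel_measurable (lebesgue_on \<Omega>)"
  shows "zero_trace \<Omega> w \<longleftrightarrow> (\<forall>x\<in>frontier \<Omega>. w' x = 0)"
proof -
  have fc: "x \<in> frontier \<Omega> \<Longrightarrow> x \<in> closure \<Omega>" for x by (simp add: frontier_def)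
  have eq: "{x \<in> frontier \<Omega>. \<not> has_trace_at \<Omega> w x 0} = {x \<in> frontier \<Omega>. w' x \<noteq> 0}"
    using has_trace_at_continuous[OF \<Omega> c ae wm fc] by auto
  have empty: "H1_null {}"
    unfolding H1_null_def by (intro allI impI exI[of _ "\<lambda>_. {}"]) (auto simp: diameter_def)
  show ?thesis
    unfolding zero_trace_def eq
  proof
    assume "\<forall>x\<in>frontier \<Omega>. w' x = 0"
    then have "{x \<in> frontier \<Omega>. w' x \<noteq> 0} = {}" by auto
    then show "H1_null {x \<in> frontier \<Omega>. w' x \<noteq> 0}" using empty by (simp only:)
  next
    assume null: "H1_null {x \<in> frontier \<Omega>. w' x \<noteq> 0}"
    show "\<forall>x\<in>frontier \<Omega>. w' x = 0"
    proof (rule ballI, rule ccontr)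
      fix x assume x: "x \<in> frontier \<Omega>" and n: "w' x \<noteq> 0"
      obtain \<delta> where \<delta>: "\<delta> > 0" "\<forall>z\<in>closure \<Omega>. dist z x < \<delta> \<longrightarrow> dist (w' z) (w' x) < \<bar>w' x\<bar>"
        using c fc[OF x] n unfolding continuous_on_iff zero_less_abs_iff[symmetric] by blast
      have "frontier \<Omega> \<inter> ball x \<delta> \<subseteq> {x \<in> frontier \<Omega>. w' x \<noteq> 0}"
        using \<delta>(2) fc by (force simp: dist_commute dist_real_def)
      then have "H1_null (frontier \<Omega> \<inter> ball x \<delta>)" using null unfolding H1_null_def by (meson subset_trans)
      then show False using frontier_not_H1_null[OF \<Omega>(1) x gb[OF x] \<delta>(1)] by blast
    qed
  qed
qed

section \<open>Triangulated domains\<close>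

locale triangulated_domain =
  fixes \<Omega> :: "plane set" and \<T> :: "plane set set"
  assumes open_domain: "open \<Omega>" and bounded_domain: "bounded \<Omega>"
    and lipschitz_boundary: "\<And>x. x \<in> frontier \<Omega> \<Longrightarrow> graph_boundary_at lipschitz_fun \<Omega> x"
    and tri: "triangulation_of \<Omega> \<T>"
begin

section \<open>Cells and the skeleton of the mesh\<close>

lemma finite_mesh: "finite \<T>"
  and simplex_mesh: "K \<in> \<T> \<Longrightarrow> 2 simplex K"
  and Int_face: "K \<in> \<T> \<Longrightarrow> K' \<in> \<T> \<Longrightarrow> (K \<inter> K') face_of K"
  and Union_mesh: "\<Union>\<T> = closure \<Omega>"
  using tri by (auto simp: triangulation_of_def triangulation_def)

lemma cell:
  assumes "K \<in> \<T>"
  shows "polytope K" "convex K" "compact K" "closed K" "K \<subseteq> closure \<Omega>" "interior K \<noteq> {}" "closure (interior K) = K"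
proof -
  have s: "2 simplex K" by (rule simplex_mesh[OF assms])
  show p: "polytope K" by (rule simplex_imp_polytope[OF s])
  show c: "convex K" "compact K" using p by (simp_all add: polytope_imp_convex polytope_imp_compact)
  then show cl: "closed K" by (simp add: compact_imp_closed)
  show "K \<subseteq> closure \<Omega>" using assms Union_mesh by blast
  have d: "aff_dim K = 2" by (rule aff_dim_simplex[OF s])
  then have "affine hull K = UNIV" using aff_dim_eq_full[of K] by simp
  then have "rel_interior K = interior K" by (rule rel_interior_interior)
  moreover have "K \<noteq> {}" using d by auto
  ultimately show i: "interior K \<noteq> {}" using rel_interior_eq_empty[OF c(1)] by auto
  show "closure (interior K) = K" using convex_closure_interior[OF c(1) i] cl by simp
qed

lemma interior_closure_domain: "interior (closure \<Omega>) = \<Omega>"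
  by (rule interior_closure_graph_boundary[OF open_domain lipschitz_boundary])

lemma interior_cell: "K \<in> \<T> \<Longrightarrow> interior K \<subseteq> \<Omega>"
  using interior_mono[OF cell(5)] interior_closure_domain by blast

lemma frontier_eq: "frontier \<Omega> = closure \<Omega> - \<Omega>"
  by (simp add: frontier_def interior_open[OF open_domain])

text \<open>The intersection of two cells is a face of each; a face that contains a relative
  interior point is the whole cell.\<close>

lemma interiors_disjoint:
  assumes "K \<in> \<T>" "K' \<in> \<T>" "x \<in> interior K" "x \<in> interior K'"
  shows "K = K'"
proof -
  have rel: "rel_interior A = interior A" if "A \<in> \<T>" for A
    using cell(6)[OF that] interior_rel_interior_gen by (metis rel_interior_nonempty_interior)
  have x: "x \<in> K" "x \<in> K'" using assms(3,4) interior_subset by auto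
  have "K \<subseteq> K \<inter> K'"
    by (rule subset_of_face_of[OF Int_face[OF assms(1,2)] subset_refl]) (use assms x rel in auto)
  moreover have "K' \<subseteq> K' \<inter> K"
    by (rule subset_of_face_of[OF Int_face[OF assms(2,1)] subset_refl]) (use assms x rel in auto)
  ultimately show ?thesis by blast
qed

definition skeleton :: "plane set" where "skeleton = (\<Union>K\<in>\<T>. frontier K)"

lemma negligible_skeleton: "negligible skeleton"
  unfolding skeleton_def
  by (rule negligible_Union) (auto simp: finite_mesh negligible_convex_frontier cell)

lemma off_skeleton:
  assumes "x \<in> closure \<Omega>" "x \<notin> skeleton"
  obtains K where "K \<in> \<T>" "x \<in> interior K"
proof -
  obtain K where K: "K \<in> \<T>" "x \<in> K" using assms(1) Union_mesh by blast
  then have "x \<in> interior K"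
    using assms(2) cell(4)[OF K(1)] by (auto simp: skeleton_def frontier_def)
  then show ?thesis using that K(1) by blast
qed

lemma AE_off_skeleton: "AE x in lebesgue. x \<notin> skeleton"
  using negligible_skeleton unfolding negligible_iff_null_sets by (rule AE_not_in)

text \<open>Interiors of cells are part of \<open>\<Omega>\<close>, so every frontier point lies in
  the skeleton, which is null.\<close>

lemma AE_frontier: "AE x in lebesgue. x \<notin> frontier \<Omega>"
  using AE_off_skeleton
proof eventually_elim
  case (elim x)
  show ?case
  proof
    assume "x \<in> frontier \<Omega>"
    then have x: "x \<in> closure \<Omega>" "x \<notin> \<Omega>" by (auto simp: frontier_eq)
    obtain K where "K \<in> \<T>" "x \<in> interior K" using off_skeleton[OF x(1) elim] by blast
    then show False using interior_cell x(2) by blast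
  qed
qed

subsection \<open>Boundary faces\<close>

text \<open>A polytope has finitely many faces, so there is a smallest one containing
  \<open>x\<close>; if \<open>x\<close> were in its relative frontier, a still smaller face would
  contain \<open>x\<close>.\<close>

lemma minimal_face:
  fixes K :: "plane set"
  assumes K: "polytope K" and x: "x \<in> K"
  obtains F where "F face_of K" "x \<in> rel_interior F"
proof -
  let ?A = "{F. F face_of K \<and> x \<in> F}"
  have fin: "finite ?A" by (rule finite_subset[OF _ finite_polytope_faces[OF K]]) auto
  have "K \<in> ?A" using K x by (simp add: face_of_refl polytope_imp_convex)
  from finite_has_minimal2[OF fin this] obtain F where "F \<in> ?A" and Fm: "F \<subseteq> K \<and> (\<forall>G\<in>?A. G \<subseteq> F \<longrightarrow> F = G)"
    by (rule bexE)
  then have F: "F face_of K" "x \<in> F" by auto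
  have Fmin: "F = G" if "G face_of K" "x \<in> G" "G \<subseteq> F" for G using Fm that by blast
  have pF: "polytope F" by (rule face_of_polytope_polytope[OF K F(1)])
  have "x \<in> rel_interior F"
  proof (rule ccontr)
    assume "x \<notin> rel_interior F"
    then have "x \<in> rel_frontier F" using F(2) closure_subset[of F] by (auto simp: rel_frontier_def)
    then obtain G where G: "G face_of F" "G \<noteq> F" "x \<in> G"
      unfolding rel_frontier_of_polyhedron_alt[OF polytope_imp_polyhedron[OF pF]] by blast
    have "G face_of K" by (rule face_of_trans[OF G(1) F(1)])
    then have "F = G" by (rule Fmin[OF _ G(3) face_of_imp_subset[OF G(1)]])
    then show False using G by simp
  qed
  then show ?thesis by (rule that[OF F(1)])
qed

text \<open>
  All points of the relative interior of a face have the same position relative to the domain: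
  a homothety with centre in the face maps a neighbourhood of one of them to a neighbourhood of
  the other and respects the triangles that contain the face.
\<close>

lemma rel_interior_face_alternative:
  assumes K: "K \<in> \<T>" and F: "F face_of K" and x: "x \<in> rel_interior F" and p: "p \<in> rel_interior F" "p \<in> \<Omega>"
  shows "x \<in> \<Omega>"
proof -
  \<comment> \<open>\<open>U\<close> meets only cells that contain all of \<open>F\<close>, and it
    is a neighbourhood of \<open>p\<close> because a cell containing a relative interior point of
    \<open>F\<close> contains \<open>F\<close>.\<close>
  define G where "G = {K' \<in> \<T>. F \<subseteq> K'}"
  define U where "U = - \<Union>(\<T> - G)"
  have FK: "F \<subseteq> K" using F by (rule face_of_imp_subset)
  have pF: "p \<in> F" and xF: "x \<in> F" using p(1) x rel_interior_subset by auto
  have "closed (\<Union>(\<T> - G))" by (rule closed_Union) (auto simp: finite_mesh cell)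
  then have oU: "open U" by (simp add: U_def open_Compl)
  have pU: "p \<in> U"
  proof (rule ccontr)
    assume "p \<notin> U"
    then obtain K' where K': "K' \<in> \<T>" "\<not> F \<subseteq> K'" "p \<in> K'" by (auto simp: U_def G_def)
    have "F \<subseteq> K \<inter> K'"
      by (rule subset_of_face_of[OF Int_face[OF K K'(1)] FK]) (use p(1) pF FK K' in auto)
    then show False using K' by blast
  qed
  have "open (\<Omega> \<inter> U)" using oU open_domain by auto
  then obtain \<epsilon> where \<epsilon>: "\<epsilon> > 0" "ball p \<epsilon> \<subseteq> \<Omega> \<inter> U"
    using pU p(2) by (meson IntI open_contains_ball)
  have cF: "convex F" "F \<noteq> {}" using face_of_imp_convex[OF F] xF by auto
  \<comment> \<open>Prolonging the segment from \<open>p\<close> to \<open>x\<close> beyond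
    \<open>x\<close> within \<open>F\<close> gives a centre \<open>c\<close>; the homothety at
    \<open>c\<close> with ratio \<mu> = 1 - 1/e maps \<open>p\<close> to \<open>x\<close>.\<close>
  obtain e where e: "e > 1" "(1 - e) *\<^sub>R p + e *\<^sub>R x \<in> F"
    using x pF unfolding convex_rel_interior_iff[OF cF] by blast
  define c where "c = (1 - e) *\<^sub>R p + e *\<^sub>R x"
  define \<mu> where "\<mu> = 1 - 1 / e"
  have \<mu>: "0 < \<mu>" "\<mu> < 1" using e(1) by (auto simp: \<mu>_def)
  have xc: "x = (1 - \<mu>) *\<^sub>R c + \<mu> *\<^sub>R p"
  proof -
    have "(1 - \<mu>) *\<^sub>R c = ((1 / e) * (1 - e)) *\<^sub>R p + ((1 / e) * e) *\<^sub>R x"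
      by (simp add: \<mu>_def c_def scaleR_add_right)
    also have "(1 / e) * (1 - e) = - \<mu>" using e(1) by (simp add: \<mu>_def field_simps)
    finally show ?thesis using e(1) by simp
  qed
  have "ball x (\<mu> * \<epsilon>) \<subseteq> closure \<Omega>"
  proof
    fix z assume z: "z \<in> ball x (\<mu> * \<epsilon>)"
    define d where "d = (1 / \<mu>) *\<^sub>R (z - x)"
    have zd: "z = x + \<mu> *\<^sub>R d" using \<mu> by (simp add: d_def)
    have "norm (z - x) < \<mu> * \<epsilon>" using z by (simp add: dist_norm norm_minus_commute)
    moreover have "norm (z - x) = \<mu> * norm d" unfolding zd using \<mu> by simp
    ultimately have "norm d < \<epsilon>" using \<mu> by simp
    then have "p + d \<in> ball p \<epsilon>" by (simp add: dist_norm)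
    then have pd: "p + d \<in> \<Omega>" "p + d \<in> U" using \<epsilon>(2) by auto
    then obtain K' where K': "K' \<in> \<T>" "p + d \<in> K'" using Union_mesh closure_subset by blast
    then have "K' \<in> G" using pd(2) by (auto simp: U_def)
    then have "c \<in> K'" using e(2) by (auto simp: G_def c_def)
    then have "(1 - \<mu>) *\<^sub>R c + \<mu> *\<^sub>R (p + d) \<in> K'"
      using convexD[OF cell(2)[OF K'(1)] _ K'(2)] \<mu> by simp
    also have "(1 - \<mu>) *\<^sub>R c + \<mu> *\<^sub>R (p + d) = z" unfolding zd by (subst xc) (simp add: algebra_simps)
    finally show "z \<in> closure \<Omega>" using K'(1) Union_mesh by blast
  qed
  moreover have "0 < \<mu> * \<epsilon>" using \<mu>(1) \<epsilon>(1) by simp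
  ultimately have "x \<in> interior (closure \<Omega>)" unfolding mem_interior by blast
  then show ?thesis by (simp add: interior_closure_domain)
qed

text \<open>The minimal face through a boundary point cannot have relative interior points in
  \<open>\<Omega>\<close>, so all of it lies in the frontier. This makes vanishing at boundary
  vertices equivalent to information about whole boundary faces for affine functions.\<close>

lemma boundary_face:
  assumes K: "K \<in> \<T>" and x: "x \<in> K" "x \<in> frontier \<Omega>"
  obtains F where "F face_of K" "x \<in> F" "F \<subseteq> frontier \<Omega>" "F = convex hull {a. a extreme_point_of F}"
proof -
  obtain F where F: "F face_of K" "x \<in> rel_interior F" using minimal_face[OF cell(1)[OF K] x(1)] by blast
  have FK: "F \<subseteq> K" using F(1) by (rule face_of_imp_subset)
  have c: "convex F" "compact F" using F(1) cell[OF K] face_of_imp_convex face_of_imp_compact by blast+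
  have "rel_interior F \<subseteq> frontier \<Omega>"
  proof
    fix p assume p: "p \<in> rel_interior F"
    have "p \<notin> \<Omega>"
    proof
      assume "p \<in> \<Omega>"
      then have "x \<in> \<Omega>" by (rule rel_interior_face_alternative[OF K F p])
      then show False using x(2) by (simp add: frontier_eq)
    qed
    moreover have "p \<in> closure \<Omega>" using p rel_interior_subset FK cell(5)[OF K] by blast
    ultimately show "p \<in> frontier \<Omega>" by (simp add: frontier_eq)
  qed
  then have "closure (rel_interior F) \<subseteq> frontier \<Omega>" by (simp add: closure_minimal)
  moreover have "F \<subseteq> closure (rel_interior F)" using convex_closure_rel_interior[OF c(1)] closure_subset by blast
  ultimately show ?thesis
    using that[OF F(1) _ _ Krein_Milman_Minkowski[OF c(2,1)]] F(2) rel_interior_subset by blast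
qed

lemma extreme_point_boundary_face:
  assumes "K \<in> \<T>" "F face_of K" "F \<subseteq> frontier \<Omega>" "a extreme_point_of F"
  shows "a extreme_point_of K" "a \<in> frontier \<Omega>"
  using assms extreme_point_of_face by blast+

subsection \<open>Segments\<close>

text \<open>On the parameter interval of the segment, a finite closed cover with a common Lipschitz
  constant on its members yields the same constant for the whole interval. The number of cells
  crossed does not enter.\<close>

lemma lipschitz_on_segment_cover:
  fixes f :: "plane \<Rightarrow> real"
  assumes fin: "finite \<C>" and cl: "\<And>C. C \<in> \<C> \<Longrightarrow> closed C" and L: "L \<ge> 0"
    and lip: "\<And>C x y. C \<in> \<C> \<Longrightarrow> x \<in> C \<Longrightarrow> y \<in> C \<Longrightarrow> \<bar>f x - f y\<bar> \<le> L * norm (x - y)"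
    and seg: "closed_segment x y \<subseteq> \<Union>\<C>"
  shows "\<bar>f x - f y\<bar> \<le> L * norm (x - y)"
proof -
  define c where "c = (\<lambda>t :: real. (1 - t) *\<^sub>R x + t *\<^sub>R y)"
  have cc: "continuous_on UNIV c" unfolding c_def by (intro continuous_intros)
  have cd: "c s - c t = (s - t) *\<^sub>R (y - x)" for s t by (simp add: c_def algebra_simps)
  have "(L * norm (x - y))-lipschitz_on {0..1} (f \<circ> c)"
  proof (rule lipschitz_on_closed_Union[where I=\<C> and U="\<lambda>C. c -` C"])
    fix C assume C: "C \<in> \<C>"
    show "closed (c -` C)" using cl[OF C] cc by (rule closed_vimage)
    show "(L * norm (x - y))-lipschitz_on (c -` C) (f \<circ> c)"
    proof (rule lipschitz_onI)
      fix s t assume "s \<in> c -` C" "t \<in> c -` C"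
      then have "\<bar>f (c s) - f (c t)\<bar> \<le> L * norm (c s - c t)" using lip[OF C] by auto
      then show "dist ((f \<circ> c) s) ((f \<circ> c) t) \<le> L * norm (x - y) * dist s t"
        unfolding cd by (simp add: dist_real_def norm_minus_commute mult_ac)
    qed (use L in simp)
  next
    show "{0..1} \<subseteq> (\<Union>C\<in>\<C>. c -` C)"
    proof
      fix t :: real assume "t \<in> {0..1}"
      then have "c t \<in> closed_segment x y" unfolding in_segment c_def by auto
      then show "t \<in> (\<Union>C\<in>\<C>. c -` C)" using seg by blast
    qed
  qed (use fin L in auto)
  then have "dist ((f \<circ> c) 0) ((f \<circ> c) 1) \<le> (L * norm (x - y)) * dist 0 (1 :: real)"
    by (rule lipschitz_onD) auto
  then show ?thesis by (simp add: c_def dist_real_def)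
qed

lemma lipschitz_from_cells:
  fixes f :: "plane \<Rightarrow> real"
  assumes L: "L \<ge> 0" and lip: "\<And>K x y. K \<in> \<T> \<Longrightarrow> x \<in> K \<Longrightarrow> y \<in> K \<Longrightarrow> \<bar>f x - f y\<bar> \<le> L * norm (x - y)"
    and seg: "closed_segment x y \<subseteq> closure \<Omega>"
  shows "\<bar>f x - f y\<bar> \<le> L * norm (x - y)"
  by (rule lipschitz_on_segment_cover[OF finite_mesh cell(4) L lip]) (use seg Union_mesh in auto)

lemma reach_frontier:
  assumes x: "x \<in> \<Omega>"
  obtains y where "y \<in> frontier \<Omega>" "closed_segment x y \<subseteq> closure \<Omega>"
proof -
  let ?e = "axis 1 1 :: plane"
  have "?e \<noteq> 0" by (metis norm_axis_1 norm_zero zero_neq_one)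
  then obtain d where d: "0 < d" "x + d *\<^sub>R ?e \<in> frontier \<Omega>"
    "\<And>e. 0 \<le> e \<Longrightarrow> e < d \<Longrightarrow> x + e *\<^sub>R ?e \<in> interior \<Omega>"
    using ray_to_frontier[OF bounded_domain, of x ?e] x interior_open[OF open_domain] by metis
  have "closed_segment x (x + d *\<^sub>R ?e) \<subseteq> closure \<Omega>"
  proof
    fix z assume "z \<in> closed_segment x (x + d *\<^sub>R ?e)"
    then obtain t where t: "0 \<le> t" "t \<le> 1" "z = (1 - t) *\<^sub>R x + t *\<^sub>R (x + d *\<^sub>R ?e)"
      unfolding in_segment by blast
    then have z: "z = x + (t * d) *\<^sub>R ?e" by (simp add: algebra_simps)
    show "z \<in> closure \<Omega>"
    proof (cases "t = 1")
      case True
      then show ?thesis using d(2) z by (simp add: frontier_eq)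
    next
      case False
      then have "t * d < d" "0 \<le> t * d" using t d(1) by auto
      then have "z \<in> interior \<Omega>" unfolding z by (intro d(3))
      then show ?thesis using interior_subset closure_subset by blast
    qed
  qed
  then show ?thesis using that d(2) by blast
qed

text \<open>
  From any point one reaches the boundary along a line, and then a boundary vertex along a
  boundary face, where the function vanishes.
\<close>

lemma bound_from_boundary_vertices:
  fixes f :: "plane \<Rightarrow> real"
  assumes L: "L \<ge> 0" and lip: "\<And>K x y. K \<in> \<T> \<Longrightarrow> x \<in> K \<Longrightarrow> y \<in> K \<Longrightarrow> \<bar>f x - f y\<bar> \<le> L * norm (x - y)"
    and zero: "\<And>K a. K \<in> \<T> \<Longrightarrow> a extreme_point_of K \<Longrightarrow> a \<in> frontier \<Omega> \<Longrightarrow> f a = 0"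
    and R: "\<And>x. x \<in> closure \<Omega> \<Longrightarrow> norm x \<le> R" and x: "x \<in> \<Omega>"
  shows "\<bar>f x\<bar> \<le> 4 * R * L"
proof -
  \<comment> \<open>Each of the two legs of the path has endpoints at distance at most 2 R, whence
    the constant 4 R.\<close>
  have dist: "norm (x - y) \<le> 2 * R" if "x \<in> closure \<Omega>" "y \<in> closure \<Omega>" for x y
    using R[OF that(1)] R[OF that(2)] norm_triangle_ineq4[of x y] by linarith
  obtain y where y: "y \<in> frontier \<Omega>" "closed_segment x y \<subseteq> closure \<Omega>" using reach_frontier[OF x] by metis
  have yc: "y \<in> closure \<Omega>" using y(1) by (simp add: frontier_eq)
  obtain K where K: "K \<in> \<T>" "y \<in> K" using yc Union_mesh by blast
  obtain F where F: "F face_of K" "y \<in> F" "F \<subseteq> frontier \<Omega>" "F = convex hull {a. a extreme_point_of F}"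
    using boundary_face[OF K y(1)] by blast
  then have "{a. a extreme_point_of F} \<noteq> {}" by (metis convex_hull_empty empty_iff)
  then obtain a where "a extreme_point_of F" by blast
  from extreme_point_boundary_face[OF K(1) F(1,3) this]
  have a: "a extreme_point_of K" "a \<in> frontier \<Omega>" by auto
  then have aK: "a \<in> K" by (simp add: extreme_point_of_def)
  have "\<bar>f x - f y\<bar> \<le> L * norm (x - y)" by (rule lipschitz_from_cells[OF L lip y(2)])
  also have "\<dots> \<le> L * (2 * R)" using dist[of x y] x yc closure_subset L by (intro mult_left_mono) auto
  finally have 1: "\<bar>f x - f y\<bar> \<le> L * (2 * R)" .
  have "\<bar>f y - f a\<bar> \<le> L * norm (y - a)" by (rule lip[OF K aK])
  also have "\<dots> \<le> L * (2 * R)" using dist[of y a] yc a(2) L by (intro mult_left_mono) (auto simp: frontier_eq)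
  finally show ?thesis using 1 zero[OF K(1) a] by (simp add: algebra_simps)
qed

text \<open>The domain need not be convex, but the interior of a cell is, so every segment in it is
  admissible; continuity extends the bound to the closed cell.\<close>

lemma weak_grad_bound_lipschitz_on_cell:
  assumes c: "continuous_on (closure \<Omega>) w" and i: "integrable (lebesgue_on \<Omega>) w"
    and g: "is_weak_grad \<Omega> w g" "integrable (lebesgue_on \<Omega>) g"
    and L: "AE x in lebesgue. x \<in> \<Omega> \<longrightarrow> norm (g x) \<le> L" "L \<ge> 0" and K: "K \<in> \<T>" "x \<in> K" "y \<in> K"
  shows "\<bar>w x - w y\<bar> \<le> L * norm (x - y)"
proof -
  have "L-lipschitz_on (interior K) w"
  proof (rule lipschitz_onI[OF _ L(2)])
    fix x y assume "x \<in> interior K" "y \<in> interior K"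
    then have "closed_segment x y \<subseteq> interior K" by (intro closed_segment_subset convex_interior cell(2)[OF K(1)])
    then have "closed_segment x y \<subseteq> \<Omega>" using interior_cell[OF K(1)] by blast
    from weak_grad_bound_imp_lipschitz[OF open_domain bounded_domain continuous_on_subset[OF c closure_subset] i g L(1) this]
    show "dist (w x) (w y) \<le> L * dist x y" by (simp add: dist_norm)
  qed
  moreover have "continuous_on (closure (interior K)) w"
    unfolding cell(7)[OF K(1)] by (rule continuous_on_subset[OF c cell(5)[OF K(1)]])
  ultimately have "L-lipschitz_on (closure (interior K)) w" by (rule lipschitz_on_closure)
  then have "L-lipschitz_on K w" unfolding cell(7)[OF K(1)] .
  from lipschitz_onD[OF this K(2,3)] show ?thesis by (simp add: dist_norm)
qed

end

section \<open>Continuous piecewise affine functions\<close>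

lemma AE_lebesgue_on_iff:
  fixes \<Omega> :: "plane set"
  shows "open \<Omega> \<Longrightarrow> (AE x in lebesgue_on \<Omega>. P x) \<longleftrightarrow> (AE x in lebesgue. x \<in> \<Omega> \<longrightarrow> P x)"
  by (subst AE_restrict_space_iff) auto

lemma borel_measurable_lebesgue_on_AE_cong:
  fixes f g :: "plane \<Rightarrow> 'b::euclidean_space"
  assumes \<Omega>: "open \<Omega>" and f: "f \<in> borel_measurable (lebesgue_on \<Omega>)" and ae: "AE x in lebesgue. x \<in> \<Omega> \<longrightarrow> f x = g x"
  shows "g \<in> borel_measurable (lebesgue_on \<Omega>)"
proof -
  have s: "\<Omega> \<in> sets lebesgue" using \<Omega> by auto
  have "(\<lambda>x. indicator \<Omega> x *\<^sub>R f x) \<in> borel_measurable lebesgue"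
    using f s by (simp add: borel_measurable_restrict_space_iff)
  moreover have "AE x in lebesgue. indicator \<Omega> x *\<^sub>R f x = indicator \<Omega> x *\<^sub>R g x"
    using ae by eventually_elim (auto simp: indicator_def)
  ultimately have "(\<lambda>x. indicator \<Omega> x *\<^sub>R g x) \<in> borel_measurable lebesgue" by (rule borel_measurable_AE)
  then show ?thesis using s by (simp add: borel_measurable_restrict_space_iff)
qed

lemma continuous_on_closure_measurable:
  fixes f :: "plane \<Rightarrow> real"
  assumes "open \<Omega>" "continuous_on (closure \<Omega>) f"
  shows "f \<in> borel_measurable (lebesgue_on \<Omega>)"
proof -
  have "(\<lambda>x. indicator \<Omega> x *\<^sub>R f x) \<in> borel_measurable borel"
    using assms continuous_on_subset[OF assms(2) closure_subset]
    by (intro borel_measurable_continuous_on_indicator) auto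
  then have "(\<lambda>x. indicator \<Omega> x *\<^sub>R f x) \<in> borel_measurable lebesgue"
    by (intro measurable_completion) simp
  then show ?thesis using assms(1) by (subst borel_measurable_restrict_space_iff) auto
qed

text \<open>Affine independence of the nodes is linear independence of their differences to one of
  them, on which a linear functional can be prescribed.\<close>

lemma affine_interpolation:
  fixes C :: "plane set" and f :: "plane \<Rightarrow> real"
  assumes "\<not> affine_dependent C"
  obtains a b where "\<And>c. c \<in> C \<Longrightarrow> a + b \<bullet> c = f c"
proof (cases "C = {}")
  case False
  then obtain c0 where c0: "c0 \<in> C" by blast
  let ?B = "(\<lambda>x. - c0 + x) ` (C - {c0})"
  have "independent ?B" using assms affine_dependent_iff_dependent2[OF c0] by blast
  from linear_independent_extend[OF this, of "\<lambda>x. f (c0 + x) - f c0"]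
  obtain G :: "plane \<Rightarrow> real" where G: "linear G" "\<And>x. x \<in> ?B \<Longrightarrow> G x = f (c0 + x) - f c0" by blast
  define b where "b = adjoint G 1"
  have Gb: "G x = b \<bullet> x" for x
    using adjoint_works[OF G(1), of x 1] by (simp add: b_def inner_commute)
  have "(f c0 - b \<bullet> c0) + b \<bullet> c = f c" if "c \<in> C" for c
  proof (cases "c = c0")
    case False
    then have "- c0 + c \<in> ?B" using that by blast
    from G(2)[OF this] have "b \<bullet> (c - c0) = f c - f c0" by (simp add: Gb)
    then show ?thesis by (simp add: inner_diff_right)
  qed simp
  then show ?thesis using that by blast
qed (use that in blast)

lemma affine_eq_on_convex_hull:
  fixes b b' :: plane
  assumes "\<And>x. x \<in> S \<Longrightarrow> a + b \<bullet> x = a' + b' \<bullet> x" "x \<in> convex hull S"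
  shows "a + b \<bullet> x = a' + b' \<bullet> x"
proof -
  have eq: "{x. (b - b') \<bullet> x = a' - a} = {x. a + b \<bullet> x = a' + b' \<bullet> x}"
    by (auto simp: inner_diff_left algebra_simps)
  have "S \<subseteq> {x. (b - b') \<bullet> x = a' - a}" unfolding eq using assms(1) by blast
  then have "convex hull S \<subseteq> {x. (b - b') \<bullet> x = a' - a}"
    by (rule hull_minimal) (rule convex_hyperplane)
  then show ?thesis using assms(2) eq by blast
qed

context triangulated_domain
begin

lemma Yh_affineE:
  assumes "q \<in> Yh \<Omega> \<T>" "K \<in> \<T>"
  obtains a b where "\<And>x. x \<in> K \<Longrightarrow> q x = a + b \<bullet> x"
  using assms unfolding Yh_def by blast

lemma Yh_continuous: "q \<in> Yh \<Omega> \<T> \<Longrightarrow> continuous_on (closure \<Omega>) q"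
  by (simp add: Yh_def)

lemma Yh_diff:
  assumes "q \<in> Yh \<Omega> \<T>" "r \<in> Yh \<Omega> \<T>"
  shows "(\<lambda>x. q x - r x) \<in> Yh \<Omega> \<T>"
  unfolding Yh_def mem_Collect_eq
proof (intro conjI ballI)
  show "continuous_on (closure \<Omega>) (\<lambda>x. q x - r x)" by (intro continuous_intros Yh_continuous assms)
  fix K assume K: "K \<in> \<T>"
  obtain a b where 1: "\<And>x. x \<in> K \<Longrightarrow> q x = a + b \<bullet> x" using Yh_affineE[OF assms(1) K] by blast
  obtain a' b' where 2: "\<And>x. x \<in> K \<Longrightarrow> r x = a' + b' \<bullet> x" using Yh_affineE[OF assms(2) K] by blast
  show "\<exists>a b. \<forall>x\<in>K. q x - r x = a + b \<bullet> x"
    using 1 2 by (intro exI[of _ "a - a'"] exI[of _ "b - b'"]) (auto simp: inner_diff_left)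
qed

text \<open>A concrete Borel gradient: constant inside each cell and 0 on the skeleton. The bound
  \<open>L\<close> sums over all cells and thus depends on the mesh; it secures boundedness and does
  not appear in the final constants.\<close>

lemma Yh_gradientE:
  assumes q: "q \<in> Yh \<Omega> \<T>"
  obtains g L where "\<And>K x. K \<in> \<T> \<Longrightarrow> x \<in> interior K \<Longrightarrow> (q has_derivative (\<lambda>v. g x \<bullet> v)) (at x)"
    "g \<in> borel_measurable borel" "\<And>x. norm (g x) \<le> L" "L \<ge> 0"
    "\<And>K x y. K \<in> \<T> \<Longrightarrow> x \<in> K \<Longrightarrow> y \<in> K \<Longrightarrow> \<bar>q x - q y\<bar> \<le> L * norm (x - y)"
proof -
  have "\<forall>K\<in>\<T>. \<exists>p. \<forall>x\<in>K. q x = fst p + snd p \<bullet> x" using q unfolding Yh_def by auto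
  from bchoice[OF this] obtain p where p: "\<forall>K\<in>\<T>. \<forall>x\<in>K. q x = fst (p K) + snd (p K) \<bullet> x" by blast
  define g where "g = (\<lambda>x. \<Sum>K\<in>\<T>. indicator (interior K) x *\<^sub>R snd (p K))"
  define L where "L = (\<Sum>K\<in>\<T>. norm (snd (p K)))"
  have gK: "g x = snd (p K)" if K: "K \<in> \<T>" "x \<in> interior K" for K x
  proof -
    have "g x = (\<Sum>K'\<in>\<T>. if K' = K then snd (p K) else 0)"
      unfolding g_def by (rule sum.cong) (use interiors_disjoint K in \<open>auto simp: indicator_def\<close>)
    then show ?thesis using K finite_mesh by simp
  qed
  have "(q has_derivative (\<lambda>v. g x \<bullet> v)) (at x)" if K: "K \<in> \<T>" "x \<in> interior K" for K x
  proof -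
    have "((\<lambda>x. fst (p K) + snd (p K) \<bullet> x) has_derivative (\<lambda>v. snd (p K) \<bullet> v)) (at x)"
      by (auto intro!: derivative_eq_intros)
    then have "(q has_derivative (\<lambda>v. snd (p K) \<bullet> v)) (at x)"
      by (rule has_derivative_transform_within_open[of _ _ _ UNIV "interior K"])
        (use p K interior_subset[of K] in \<open>auto\<close>)
    then show ?thesis by (simp add: gK[OF K])
  qed
  moreover have "g \<in> borel_measurable borel" unfolding g_def
    by (intro borel_measurable_sum borel_measurable_scaleR borel_measurable_indicator borel_measurable_const) auto
  moreover have "norm (g x) \<le> L" for x unfolding g_def L_def
    by (rule sum_norm_le) (auto simp: indicator_def)
  moreover have L0: "L \<ge> 0" unfolding L_def by (rule sum_nonneg) simp
  moreover have "\<bar>q x - q y\<bar> \<le> L * norm (x - y)" if K: "K \<in> \<T>" "x \<in> K" "y \<in> K" for K x y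
  proof -
    have "q x - q y = snd (p K) \<bullet> (x - y)" using p K by (simp add: inner_diff_right)
    also have "\<bar>\<dots>\<bar> \<le> norm (snd (p K)) * norm (x - y)" by (rule Cauchy_Schwarz_ineq2)
    also have "norm (snd (p K)) \<le> L" unfolding L_def
      using member_le_sum[of K \<T> "\<lambda>K. norm (snd (p K))"] K finite_mesh by auto
    finally show ?thesis by (simp add: mult_right_mono)
  qed
  ultimately show ?thesis using that by blast
qed

lemma Yh_is_weak_grad:
  assumes q: "q \<in> Yh \<Omega> \<T>" and der: "\<And>K x. K \<in> \<T> \<Longrightarrow> x \<in> interior K \<Longrightarrow> (q has_derivative (\<lambda>v. g x \<bullet> v)) (at x)"
    and g: "g \<in> borel_measurable borel" "\<And>x. norm (g x) \<le> L" "L \<ge> 0"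
    and lip: "\<And>K x y. K \<in> \<T> \<Longrightarrow> x \<in> K \<Longrightarrow> y \<in> K \<Longrightarrow> \<bar>q x - q y\<bar> \<le> L * norm (x - y)"
  shows "is_weak_grad \<Omega> q g"
proof (rule weak_grad_of_lipschitz[OF open_domain])
  show "continuous_on \<Omega> q" by (rule continuous_on_subset[OF Yh_continuous[OF q] closure_subset])
  show "\<bar>q x - q y\<bar> \<le> L * norm (x - y)" if "closed_segment x y \<subseteq> \<Omega>" for x y
    by (rule lipschitz_from_cells[OF g(3) lip]) (use that closure_subset in blast)+
  show "AE x in lebesgue. x \<in> \<Omega> \<longrightarrow> (q has_derivative (\<lambda>v. g x \<bullet> v)) (at x)"
    using AE_off_skeleton
  proof eventually_elim
    case (elim x)
    show ?case
    proof
      assume "x \<in> \<Omega>"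
      then have "x \<in> closure \<Omega>" using closure_subset by blast
      then obtain K where "K \<in> \<T>" "x \<in> interior K" using off_skeleton[OF _ elim] by blast
      then show "(q has_derivative (\<lambda>v. g x \<bullet> v)) (at x)" by (rule der)
    qed
  qed
  have "g \<in> borel_measurable lebesgue" using g(1) by (intro measurable_completion) simp
  then show "g \<in> borel_measurable (lebesgue_on \<Omega>)" by (rule measurable_restrict_space1)
  show "norm (g x) \<le> L" for x by (rule g(2))
qed

lemma wgrad_ex: "is_weak_grad \<Omega> w g \<Longrightarrow> is_weak_grad \<Omega> w (wgrad \<Omega> w)"
  unfolding wgrad_def by (rule someI[of "is_weak_grad \<Omega> w"])

lemma wgrad_AE: "is_weak_grad \<Omega> w g \<Longrightarrow> AE x in lebesgue. x \<in> \<Omega> \<longrightarrow> wgrad \<Omega> w x = g x"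
  using weak_grad_unique[OF open_domain wgrad_ex] by blast

lemma Yh_W1_infinity:
  assumes q: "q \<in> Yh \<Omega> \<T>"
  shows "q \<in> W1 \<infinity> \<Omega>"
proof -
  obtain g L where g: "\<And>K x. K \<in> \<T> \<Longrightarrow> x \<in> interior K \<Longrightarrow> (q has_derivative (\<lambda>v. g x \<bullet> v)) (at x)"
    "g \<in> borel_measurable borel" "\<And>x. norm (g x) \<le> L" "L \<ge> 0"
    "\<And>K x y. K \<in> \<T> \<Longrightarrow> x \<in> K \<Longrightarrow> y \<in> K \<Longrightarrow> \<bar>q x - q y\<bar> \<le> L * norm (x - y)"
    using Yh_gradientE[OF q] by blast
  have wg: "is_weak_grad \<Omega> q g" by (rule Yh_is_weak_grad[OF q g])
  have ae: "AE x in lebesgue. x \<in> \<Omega> \<longrightarrow> wgrad \<Omega> q x = g x" by (rule wgrad_AE[OF wg])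
  have "g \<in> borel_measurable lebesgue" using g(2) by (intro measurable_completion) simp
  then have gm: "g \<in> borel_measurable (lebesgue_on \<Omega>)" by (rule measurable_restrict_space1)
  have "bounded (q ` closure \<Omega>)"
    using compact_imp_bounded[OF compact_continuous_image[OF Yh_continuous[OF q]]] bounded_domain
    by (simp add: compact_closure)
  then obtain B where B: "\<And>x. x \<in> closure \<Omega> \<Longrightarrow> norm (q x) \<le> B" unfolding bounded_iff by auto
  have "q \<in> Lspace \<infinity> \<Omega>"
    unfolding Lspace_def using continuous_on_closure_measurable[OF open_domain Yh_continuous[OF q]] B closure_subset
    by (auto simp: AE_lebesgue_on_iff[OF open_domain] intro!: exI[of _ B])
  moreover have "wgrad \<Omega> q \<in> Lspace \<infinity> \<Omega>"
  proof -
    have "AE x in lebesgue. x \<in> \<Omega> \<longrightarrow> g x = wgrad \<Omega> q x" using ae by eventually_elim auto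
    from borel_measurable_lebesgue_on_AE_cong[OF open_domain gm this]
    have "wgrad \<Omega> q \<in> borel_measurable (lebesgue_on \<Omega>)" .
    moreover have "AE x in lebesgue_on \<Omega>. norm (wgrad \<Omega> q x) \<le> L"
      unfolding AE_lebesgue_on_iff[OF open_domain] using ae by eventually_elim (use g(3) in auto)
    ultimately show ?thesis unfolding Lspace_def by auto
  qed
  ultimately show ?thesis unfolding W1_def using wg by blast
qed

text \<open>A discrete function is its own continuous representative, so its trace is given by its
  boundary values.\<close>

lemma Yh_0_iff:
  "q \<in> Yh_0 \<Omega> \<T> \<longleftrightarrow> q \<in> Yh \<Omega> \<T> \<and> (\<forall>x\<in>frontier \<Omega>. q x = 0)"
proof -
  have "zero_trace \<Omega> q \<longleftrightarrow> (\<forall>x\<in>frontier \<Omega>. q x = 0)" if "q \<in> Yh \<Omega> \<T>"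
    by (rule zero_trace_iff_zero_on_frontier[OF open_domain bounded_domain lipschitz_boundary Yh_continuous[OF that]])
      (auto intro: continuous_on_closure_measurable[OF open_domain Yh_continuous[OF that]])
  then show ?thesis unfolding Yh_0_def W1_0_def using Yh_W1_infinity by auto
qed

lemma Yh_0_diff: "q \<in> Yh_0 \<Omega> \<T> \<Longrightarrow> r \<in> Yh_0 \<Omega> \<T> \<Longrightarrow> (\<lambda>x. q x - r x) \<in> Yh_0 \<Omega> \<T>"
  unfolding Yh_0_iff using Yh_diff by auto

subsection \<open>Nodal interpolation\<close>

text \<open>Affine functions with the prescribed vertex values exist cell by cell. On the
  intersection of two cells, a common face, they agree at its extreme points, which are vertices of
  both cells, and hence on the hull of these points.\<close>

lemma nodal_interpolant_exists:
  obtains q where "q \<in> Yh \<Omega> \<T>" "\<And>K a. K \<in> \<T> \<Longrightarrow> a extreme_point_of K \<Longrightarrow> q a = f a"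
proof -
  have "\<exists>p. \<forall>c. c extreme_point_of K \<longrightarrow> fst p + snd p \<bullet> c = f c" if K: "K \<in> \<T>" for K
  proof -
    obtain C where C: "\<not> affine_dependent C" "K = convex hull C"
      using simplex_mesh[OF K] unfolding simplex_def by blast
    obtain a b where "\<And>c. c \<in> C \<Longrightarrow> a + b \<bullet> c = f c" using affine_interpolation[OF C(1)] by blast
    then show ?thesis
      unfolding C(2) extreme_point_of_convex_hull_affine_independent[OF C(1)]
      by (intro exI[of _ "(a, b)"]) auto
  qed
  then have "\<forall>K\<in>\<T>. \<exists>p. \<forall>c. c extreme_point_of K \<longrightarrow> fst p + snd p \<bullet> c = f c" by blast
  from bchoice[OF this] obtain p where
    p: "\<forall>K\<in>\<T>. \<forall>c. c extreme_point_of K \<longrightarrow> fst (p K) + snd (p K) \<bullet> c = f c" by blast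
  have agree: "fst (p K) + snd (p K) \<bullet> x = fst (p K') + snd (p K') \<bullet> x"
    if K: "K \<in> \<T>" "K' \<in> \<T>" and x: "x \<in> K" "x \<in> K'" for K K' x
  proof (rule affine_eq_on_convex_hull)
    let ?F = "K \<inter> K'"
    have f: "?F face_of K" "?F face_of K'" using Int_face[OF K] Int_face[OF K(2,1)] by (auto simp: Int_commute)
    show "fst (p K) + snd (p K) \<bullet> c = fst (p K') + snd (p K') \<bullet> c" if "c \<in> {c. c extreme_point_of ?F}" for c
    proof -
      have "c extreme_point_of K" "c extreme_point_of K'"
        using that extreme_point_of_face[OF f(1)] extreme_point_of_face[OF f(2)] by blast+
      then show ?thesis using p K by metis
    qed
    have "?F = convex hull {c. c extreme_point_of ?F}"
      by (rule Krein_Milman_Minkowski) (use cell K in \<open>auto intro: convex_Int compact_Int\<close>)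
    then show "x \<in> convex hull {c. c extreme_point_of ?F}" using x by blast
  qed
  define cl where "cl = (\<lambda>x. SOME K. K \<in> \<T> \<and> x \<in> K)"
  define q where "q = (\<lambda>x. fst (p (cl x)) + snd (p (cl x)) \<bullet> x)"
  have qK: "q x = fst (p K) + snd (p K) \<bullet> x" if K: "K \<in> \<T>" "x \<in> K" for K x
  proof -
    have "cl x \<in> \<T> \<and> x \<in> cl x" unfolding cl_def by (rule someI[of _ K]) (use K in blast)
    then show ?thesis unfolding q_def using agree K by blast
  qed
  have "continuous_on (\<Union>K\<in>\<T>. K) q"
  proof (rule continuous_on_closed_Union[OF finite_mesh])
    fix K assume K: "K \<in> \<T>"
    show "closed K" by (rule cell(4)[OF K])
    have "continuous_on K (\<lambda>x. fst (p K) + snd (p K) \<bullet> x)" by (intro continuous_intros)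
    then show "continuous_on K q" by (rule continuous_on_eq) (simp add: qK[OF K])
  qed
  then have "q \<in> Yh \<Omega> \<T>"
    unfolding Yh_def using qK Union_mesh by auto
  moreover have "q a = f a" if "K \<in> \<T>" "a extreme_point_of K" for K a
    using qK[OF that(1), of a] p that by (auto simp: extreme_point_of_def)
  ultimately show ?thesis using that by blast
qed

text \<open>The interpolant is a choice that refers to some continuous representative. Any two of
  these coincide on the closure, so the nodal values are those of the given
  \<open>w'\<close>.\<close>

lemma lagrange_interp_spec:
  assumes c: "continuous_on (closure \<Omega>) w'" and ae: "AE x in lebesgue. x \<in> \<Omega> \<longrightarrow> w' x = w x"
  shows "lagrange_interp \<Omega> \<T> w \<in> Yh \<Omega> \<T>"
    and "K \<in> \<T> \<Longrightarrow> a extreme_point_of K \<Longrightarrow> lagrange_interp \<Omega> \<T> w a = w' a"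
proof -
  let ?P = "\<lambda>q. q \<in> Yh \<Omega> \<T> \<and>
     (\<exists>w'. continuous_on (closure \<Omega>) w' \<and> (AE x in lebesgue_on \<Omega>. w' x = w x) \<and>
        (\<forall>K\<in>\<T>. \<forall>a. a extreme_point_of K \<longrightarrow> q a = w' a))"
  obtain q where "q \<in> Yh \<Omega> \<T>" "\<And>K a. K \<in> \<T> \<Longrightarrow> a extreme_point_of K \<Longrightarrow> q a = w' a"
    using nodal_interpolant_exists by blast
  then have "?P q" using c ae by (auto simp: AE_lebesgue_on_iff[OF open_domain])
  then have "?P (SOME q. ?P q)" by (rule someI[of ?P])
  then have P: "?P (lagrange_interp \<Omega> \<T> w)" unfolding lagrange_interp_def .
  then show "lagrange_interp \<Omega> \<T> w \<in> Yh \<Omega> \<T>" by blast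
  obtain w2 where w2: "continuous_on (closure \<Omega>) w2" "AE x in lebesgue_on \<Omega>. w2 x = w x"
    "\<forall>K\<in>\<T>. \<forall>a. a extreme_point_of K \<longrightarrow> lagrange_interp \<Omega> \<T> w a = w2 a" using P by blast
  have "AE x in lebesgue. x \<in> \<Omega> \<longrightarrow> w2 x = w' x"
    using w2(2)[unfolded AE_lebesgue_on_iff[OF open_domain]] ae by eventually_elim auto
  then have eq: "x \<in> closure \<Omega> \<Longrightarrow> w2 x = w' x" for x
    by (rule AE_eq_imp_eq_on_closure[OF open_domain w2(1) c])
  show "lagrange_interp \<Omega> \<T> w a = w' a" if K: "K \<in> \<T>" "a extreme_point_of K"
  proof -
    have "a \<in> closure \<Omega>" using K cell(5)[OF K(1)] by (auto simp: extreme_point_of_def)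
    then show ?thesis using w2(3) K eq by auto
  qed
qed

text \<open>A boundary point lies on a face contained in the frontier; the affine piece vanishes at
  the vertices of that face and therefore on their hull.\<close>

lemma Yh_zero_on_frontier:
  assumes q: "q \<in> Yh \<Omega> \<T>" and zero: "\<And>K a. K \<in> \<T> \<Longrightarrow> a extreme_point_of K \<Longrightarrow> a \<in> frontier \<Omega> \<Longrightarrow> q a = 0"
    and x: "x \<in> frontier \<Omega>"
  shows "q x = 0"
proof -
  obtain K where K: "K \<in> \<T>" "x \<in> K" using x Union_mesh by (auto simp: frontier_eq)
  obtain F where F: "F face_of K" "x \<in> F" "F \<subseteq> frontier \<Omega>" "F = convex hull {a. a extreme_point_of F}"
    using boundary_face[OF K x] by blast
  obtain a b where ab: "\<And>x. x \<in> K \<Longrightarrow> q x = a + b \<bullet> x" using Yh_affineE[OF q K(1)] by blast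
  have "a + b \<bullet> x = 0 + 0 \<bullet> x"
  proof (rule affine_eq_on_convex_hull)
    show "x \<in> convex hull {a. a extreme_point_of F}" using F(2,4) by blast
    fix c assume "c \<in> {a. a extreme_point_of F}"
    then have c: "c extreme_point_of K" "c \<in> frontier \<Omega>"
      using extreme_point_boundary_face[OF K(1) F(1,3)] by auto
    then have "c \<in> K" by (simp add: extreme_point_of_def)
    then show "a + b \<bullet> c = 0 + 0 \<bullet> c" using zero[OF K(1) c] ab by simp
  qed
  then show ?thesis using ab[OF K(2)] by simp
qed

subsection \<open>The Poincare inequality\<close>

text \<open>The derivative of \<open>x\<^sub>1 q\<^sup>2\<close> in the direction of the first axis has integral zero.\<close>

lemma poincare_Yh:
  assumes q: "q \<in> Yh \<Omega> \<T>" and zero: "\<And>x. x \<in> frontier \<Omega> \<Longrightarrow> q x = 0"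
    and der: "\<And>K x. K \<in> \<T> \<Longrightarrow> x \<in> interior K \<Longrightarrow> (q has_derivative (\<lambda>v. g x \<bullet> v)) (at x)"
    and g: "g \<in> borel_measurable borel" "\<And>x. norm (g x) \<le> L" "L \<ge> 0"
    and lip: "\<And>K x y. K \<in> \<T> \<Longrightarrow> x \<in> K \<Longrightarrow> y \<in> K \<Longrightarrow> \<bar>q x - q y\<bar> \<le> L * norm (x - y)"
    and R: "R \<ge> 0" "\<And>x. x \<in> closure \<Omega> \<Longrightarrow> norm x \<le> R"
  shows "(LINT x|lebesgue_on \<Omega>. (q x)\<^sup>2) \<le> 4 * R\<^sup>2 * (LINT x|lebesgue_on \<Omega>. (norm (g x))\<^sup>2)"
    and "integrable (lebesgue_on \<Omega>) (\<lambda>x. (q x)\<^sup>2)" "integrable (lebesgue_on \<Omega>) (\<lambda>x. (norm (g x))\<^sup>2)"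
proof -
  let ?e = "axis 1 1 :: plane"
  have s: "\<Omega> \<in> sets lebesgue" using open_domain by auto
  \<comment> \<open>The extension of \<open>q\<close> by zero. It is Lipschitz on the plane with the
    constant \<open>L\<close>: the complement of \<open>\<Omega>\<close> joins the cells as one more
    closed set, and the values match on the frontier.\<close>
  define t where "t = (\<lambda>x. if x \<in> \<Omega> then q x else 0)"
  have tq: "t x = q x" if "x \<in> closure \<Omega>" for x using that zero by (auto simp: t_def frontier_eq)
  have tlip: "\<bar>t x - t y\<bar> \<le> L * norm (x - y)" for x y
  proof (rule lipschitz_on_segment_cover[of "insert (- \<Omega>) \<T>"])
    show "finite (insert (- \<Omega>) \<T>)" using finite_mesh by simp
    show "closed C" if "C \<in> insert (- \<Omega>) \<T>" for C using that cell(4) open_domain by auto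
    show "closed_segment x y \<subseteq> \<Union> (insert (- \<Omega>) \<T>)" using Union_mesh closure_subset by auto
    fix C x y assume C: "C \<in> insert (- \<Omega>) \<T>" "x \<in> C" "y \<in> C"
    show "\<bar>t x - t y\<bar> \<le> L * norm (x - y)"
    proof (cases "C \<in> \<T>")
      case True
      then have "x \<in> closure \<Omega>" "y \<in> closure \<Omega>" using C Union_mesh by blast+
      then show ?thesis using lip[OF True C(2,3)] by (simp add: tq)
    next
      case False
      then show ?thesis using C g(3) by (simp add: t_def)
    qed
  qed (rule g(3))
  have tc: "continuous_on UNIV t"
    by (rule lipschitz_on_continuous_on[of L]) (auto intro!: lipschitz_onI g(3) tlip simp: dist_norm)
  have "bounded (q ` closure \<Omega>)"
    using compact_imp_bounded[OF compact_continuous_image[OF Yh_continuous[OF q]]] bounded_domain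
    by (simp add: compact_closure)
  then obtain B0 where "\<And>x. x \<in> closure \<Omega> \<Longrightarrow> norm (q x) \<le> B0" unfolding bounded_iff by auto
  then have B0: "x \<in> \<Omega> \<Longrightarrow> \<bar>q x\<bar> \<le> B0" for x using closure_subset by (metis real_norm_def subsetD)
  define B where "B = max 0 B0"
  have B: "B \<ge> 0" "\<bar>t x\<bar> \<le> B" for x using B0[of x] by (auto simp: B_def t_def)
  define f where "f = (\<lambda>x. (x $ 1) * (t x)\<^sup>2)"
  let ?f' = "\<lambda>x. indicator \<Omega> x * ((q x)\<^sup>2 + 2 * (x $ 1) * q x * (g x $ 1))"
  have gm: "g \<in> borel_measurable lebesgue" using g(1) by (intro measurable_completion) simp
  have gm': "g \<in> borel_measurable (lebesgue_on \<Omega>)" using gm by (rule measurable_restrict_space1)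
  have qm: "q \<in> borel_measurable (lebesgue_on \<Omega>)" by (rule continuous_on_closure_measurable[OF open_domain Yh_continuous[OF q]])
  have xm: "(\<lambda>x. x $ 1) \<in> borel_measurable (lebesgue_on \<Omega>)"
    by (rule continuous_on_closure_measurable[OF open_domain]) (intro continuous_intros)
  have gm1: "(\<lambda>x. g x $ 1) \<in> borel_measurable (lebesgue_on \<Omega>)"
    using borel_measurable_inner[OF gm' borel_measurable_const[of ?e]] by (simp add: inner_axis)
  have c1: "integrable (lebesgue_on \<Omega>) (\<lambda>x. c)" for c :: real
    by (rule integrable_continuous_bounded_set[OF open_domain bounded_domain]) simp
  have iq: "integrable (lebesgue_on \<Omega>) (\<lambda>x. (q x)\<^sup>2)"
  proof (rule Bochner_Integration.integrable_bound[OF c1[of "B\<^sup>2"]])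
    show "AE x in lebesgue_on \<Omega>. norm ((q x)\<^sup>2) \<le> norm (B\<^sup>2)"
    proof (rule AE_I2)
      fix x assume "x \<in> space (lebesgue_on \<Omega>)"
      then have "\<bar>q x\<bar> \<le> \<bar>B\<bar>" using B(2)[of x] by (simp add: space_restrict_space t_def)
      then show "norm ((q x)\<^sup>2) \<le> norm (B\<^sup>2)" by (simp add: abs_le_square_iff)
    qed
  qed (use qm in simp)
  show "integrable (lebesgue_on \<Omega>) (\<lambda>x. (q x)\<^sup>2)" by (rule iq)
  have ig: "integrable (lebesgue_on \<Omega>) (\<lambda>x. (norm (g x))\<^sup>2)"
  proof (rule Bochner_Integration.integrable_bound[OF c1[of "L\<^sup>2"]])
    show "AE x in lebesgue_on \<Omega>. norm ((norm (g x))\<^sup>2) \<le> norm (L\<^sup>2)"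
      using g by (intro AE_I2) (auto intro: power_mono)
  qed (use gm' in simp)
  show "integrable (lebesgue_on \<Omega>) (\<lambda>x. (norm (g x))\<^sup>2)" by (rule ig)
  \<comment> \<open>Young's inequality together with |x_1| \<le> R. The weight 1/2 allows half of
    the integral of q^2 to be absorbed, which leaves the constant 4 R^2.\<close>
  have bnd: "\<bar>2 * (x $ 1) * q x * (g x $ 1)\<bar> \<le> (q x)\<^sup>2 / 2 + 2 * R\<^sup>2 * (norm (g x))\<^sup>2" if "x \<in> \<Omega>" for x
  proof -
    have "\<bar>x $ 1\<bar> \<le> R" using component_le_norm_cart[of x 1] R(2)[of x] that closure_subset by force
    moreover have "\<bar>g x $ 1\<bar> \<le> norm (g x)" by (rule component_le_norm_cart)
    ultimately have "\<bar>x $ 1\<bar> * \<bar>g x $ 1\<bar> \<le> R * norm (g x)" using R(1) by (intro mult_mono) auto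
    then have "\<bar>q x\<bar> * (\<bar>x $ 1\<bar> * \<bar>g x $ 1\<bar>) \<le> \<bar>q x\<bar> * (R * norm (g x))" by (intro mult_left_mono) auto
    moreover have "0 \<le> (\<bar>q x\<bar> - 2 * (R * norm (g x)))\<^sup>2" by simp
    ultimately show ?thesis by (simp add: abs_mult power2_eq_square algebra_simps)
  qed
  have ix: "integrable (lebesgue_on \<Omega>) (\<lambda>x. 2 * (x $ 1) * q x * (g x $ 1))"
  proof (rule Bochner_Integration.integrable_bound)
    show "integrable (lebesgue_on \<Omega>) (\<lambda>x. (q x)\<^sup>2 / 2 + 2 * R\<^sup>2 * (norm (g x))\<^sup>2)"
      using iq ig by simp
    show "AE x in lebesgue_on \<Omega>. norm (2 * (x $ 1) * q x * (g x $ 1)) \<le> norm ((q x)\<^sup>2 / 2 + 2 * R\<^sup>2 * (norm (g x))\<^sup>2)"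
    proof (rule AE_I2)
      fix x assume "x \<in> space (lebesgue_on \<Omega>)"
      then have "x \<in> \<Omega>" by (simp add: space_restrict_space)
      from bnd[OF this] show "norm (2 * (x $ 1) * q x * (g x $ 1)) \<le> norm ((q x)\<^sup>2 / 2 + 2 * R\<^sup>2 * (norm (g x))\<^sup>2)"
        by simp
    qed
  qed (intro borel_measurable_times borel_measurable_const xm qm gm1)
  have if': "integrable (lebesgue_on \<Omega>) (\<lambda>x. (q x)\<^sup>2 + 2 * (x $ 1) * q x * (g x $ 1))"
    by (rule Bochner_Integration.integrable_add[OF iq ix])
  have "(\<integral>x. ?f' x \<partial>lebesgue) = 0"
  \<comment> \<open>The Lipschitz constant comes from the product rule: B^2 for the change of x_1,
    and (R + 1) (2 B L) for the change of t^2, as |x_1| is at most R + 1 within one step of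
    \<open>\<Omega>\<close>.\<close>
  proof (rule integral_directional_derivative_zero[of f R 1 ?e "B\<^sup>2 + (R + 1) * (2 * B * L)"])
    show "continuous_on UNIV f" unfolding f_def by (intro continuous_intros tc)
    show "f x = 0" if "x \<notin> cball 0 R" for x
    proof -
      have "x \<notin> \<Omega>" using that R(2)[of x] closure_subset by auto
      then show ?thesis by (simp add: f_def t_def)
    qed
    show "(1 :: real) > 0" by simp
    show "?f' \<in> borel_measurable lebesgue"
      using if' s by (auto simp: integrable_restrict_space dest: borel_measurable_integrable)
    show "AE x in lebesgue. ((\<lambda>h. f (x + h *\<^sub>R ?e)) has_real_derivative ?f' x) (at 0)"
      using AE_off_skeleton AE_frontier
    proof eventually_elim
      case (elim x)
      have l: "((\<lambda>h. x + h *\<^sub>R ?e) has_derivative (\<lambda>h. h *\<^sub>R ?e)) (at 0)"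
        by (auto intro!: derivative_eq_intros)
      show ?case
      proof (cases "x \<in> \<Omega>")
        case True
        then have "x \<in> closure \<Omega>" using closure_subset by blast
        then obtain K where K: "K \<in> \<T>" "x \<in> interior K" using off_skeleton[OF _ elim(1)] by blast
        have "(t has_derivative (\<lambda>v. g x \<bullet> v)) (at x)"
          by (rule has_derivative_transform_within_open[OF der[OF K], of \<Omega>]) (use open_domain True in \<open>auto simp: t_def\<close>)
        then have "(t has_derivative (\<lambda>v. g x \<bullet> v)) (at (x + 0 *\<^sub>R ?e))" by simp
        from has_derivative_compose[OF l this]
        have "((\<lambda>h. t (x + h *\<^sub>R ?e)) has_derivative (\<lambda>h. g x \<bullet> (h *\<^sub>R ?e))) (at 0)" .
        moreover have "(\<lambda>h. g x \<bullet> (h *\<^sub>R ?e)) = (*) (g x $ 1)" by (auto simp: fun_eq_iff inner_axis)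
        ultimately have td: "((\<lambda>h. t (x + h *\<^sub>R ?e)) has_real_derivative (g x $ 1)) (at 0)"
          unfolding has_field_derivative_def by (simp only:)
        have "((\<lambda>h. (x $ 1 + h) * (t (x + h *\<^sub>R ?e))\<^sup>2) has_real_derivative
            ((t x)\<^sup>2 + x $ 1 * (2 * (t x * (g x $ 1))))) (at 0)"
          by (rule derivative_eq_intros td refl | simp)+
        then show ?thesis using True by (simp add: f_def t_def axis_def mult_ac)
      next
        case False
        then have x: "x \<in> - closure \<Omega>" using elim(2) by (simp add: frontier_eq)
        have "((\<lambda>h. 0) has_derivative (\<lambda>h. 0)) (at x)" by simp
        then have "(f has_derivative (\<lambda>h. 0)) (at x)"
          by (rule has_derivative_transform_within_open[of _ _ _ UNIV "- closure \<Omega>"])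
            (use x closure_subset in \<open>auto simp: f_def t_def open_Compl\<close>)
        then have "(f has_derivative (\<lambda>v. 0)) (at (x + 0 *\<^sub>R ?e))" by simp
        from has_derivative_compose[OF l this]
        have "((\<lambda>h. f (x + h *\<^sub>R ?e)) has_derivative (\<lambda>h. 0)) (at 0)" .
        moreover have "(\<lambda>h. 0) = (*) (?f' x)" using False by (simp add: fun_eq_iff)
        ultimately show ?thesis unfolding has_field_derivative_def by (simp only:)
      qed
    qed
    fix x :: plane and h :: real assume h: "0 < h" "h \<le> 1"
    let ?y = "x + h *\<^sub>R ?e"
    have dt: "\<bar>t ?y - t x\<bar> \<le> L * h" using tlip[of ?y x] h by (simp add: norm_axis_1)
    have fy: "f ?y - f x = h * (t ?y)\<^sup>2 + (x $ 1) * ((t ?y - t x) * (t ?y + t x))"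
      by (simp add: f_def axis_def power2_eq_square algebra_simps)
    have 1: "\<bar>h * (t ?y)\<^sup>2\<bar> \<le> B\<^sup>2 * h"
    proof -
      have "(t ?y)\<^sup>2 \<le> B\<^sup>2" using B(2)[of ?y] B(1) by (simp add: abs_le_square_iff[symmetric])
      then show ?thesis using h by (simp add: abs_mult mult.commute mult_left_mono)
    qed
    have 2: "\<bar>(x $ 1) * ((t ?y - t x) * (t ?y + t x))\<bar> \<le> (R + 1) * ((L * h) * (2 * B))"
    proof (cases "x \<in> \<Omega> \<or> ?y \<in> \<Omega>")
      case True
      have "\<bar>x $ 1\<bar> \<le> norm x" by (rule component_le_norm_cart)
      also have "norm x \<le> R + 1"
      proof (cases "x \<in> \<Omega>")
        case True
        then show ?thesis using R(2)[of x] closure_subset by force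
      next
        case False
        then have "norm ?y \<le> R" using True R(2)[of ?y] closure_subset by blast
        moreover have "norm x \<le> norm ?y + h"
          using norm_triangle_ineq4[of ?y "h *\<^sub>R ?e"] h by (simp add: norm_axis_1)
        ultimately show ?thesis using h by simp
      qed
      finally have x1: "\<bar>x $ 1\<bar> \<le> R + 1" .
      have "\<bar>t ?y + t x\<bar> \<le> 2 * B" using B(2)[of x] B(2)[of ?y] by linarith
      then show ?thesis unfolding abs_mult
        by (intro mult_mono x1 dt) (use R B g h in auto)
    next
      case False
      then have "t x = 0" "t ?y = 0" by (auto simp: t_def)
      then show ?thesis using R B g h by simp
    qed
    have "\<bar>f ?y - f x\<bar> \<le> B\<^sup>2 * h + (R + 1) * ((L * h) * (2 * B))"
      unfolding fy using abs_triangle_ineq[of "h * (t ?y)\<^sup>2" "(x $ 1) * ((t ?y - t x) * (t ?y + t x))"] 1 2 by linarith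
    then show "\<bar>f ?y - f x\<bar> \<le> (B\<^sup>2 + (R + 1) * (2 * B * L)) * h" by (simp add: algebra_simps)
  qed
  then have z: "(LINT x|lebesgue_on \<Omega>. (q x)\<^sup>2 + 2 * (x $ 1) * q x * (g x $ 1)) = 0"
    using s by (simp add: integral_restrict_space)
  have "(LINT x|lebesgue_on \<Omega>. (q x)\<^sup>2 / 2 - 2 * R\<^sup>2 * (norm (g x))\<^sup>2)
      \<le> (LINT x|lebesgue_on \<Omega>. (q x)\<^sup>2 + 2 * (x $ 1) * q x * (g x $ 1))"
  proof (rule integral_mono)
    show "integrable (lebesgue_on \<Omega>) (\<lambda>x. (q x)\<^sup>2 / 2 - 2 * R\<^sup>2 * (norm (g x))\<^sup>2)" using iq ig by simp
    show "integrable (lebesgue_on \<Omega>) (\<lambda>x. (q x)\<^sup>2 + 2 * (x $ 1) * q x * (g x $ 1))" by (rule if')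
    fix x assume "x \<in> space (lebesgue_on \<Omega>)"
    then have "x \<in> \<Omega>" by (simp add: space_restrict_space)
    from bnd[OF this]
    show "(q x)\<^sup>2 / 2 - 2 * R\<^sup>2 * (norm (g x))\<^sup>2 \<le> (q x)\<^sup>2 + 2 * (x $ 1) * q x * (g x $ 1)" by linarith
  qed
  then have "(LINT x|lebesgue_on \<Omega>. (q x)\<^sup>2) / 2 - 2 * R\<^sup>2 * (LINT x|lebesgue_on \<Omega>. (norm (g x))\<^sup>2) \<le> 0"
    unfolding z using iq ig by simp
  then show "(LINT x|lebesgue_on \<Omega>. (q x)\<^sup>2) \<le> 4 * R\<^sup>2 * (LINT x|lebesgue_on \<Omega>. (norm (g x))\<^sup>2)" by simp
qed

end

section \<open>Square integrable functions\<close>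

definition L2f :: "'a measure \<Rightarrow> ('a \<Rightarrow> 'b::euclidean_space) \<Rightarrow> bool" where
  "L2f M f \<longleftrightarrow> f \<in> borel_measurable M \<and> integrable M (\<lambda>x. (norm (f x))\<^sup>2)"

definition n2 :: "'a measure \<Rightarrow> ('a \<Rightarrow> 'b::euclidean_space) \<Rightarrow> real" where
  "n2 M f = sqrt (\<integral>x. (norm (f x))\<^sup>2 \<partial>M)"

lemma n2_nonneg: "n2 M f \<ge> 0"
  unfolding n2_def by (intro real_sqrt_ge_zero integral_nonneg_AE) auto

lemma n2_power2: "(n2 M f)\<^sup>2 = (\<integral>x. (norm (f x))\<^sup>2 \<partial>M)"
  unfolding n2_def by (intro real_sqrt_pow2 integral_nonneg_AE) auto

lemma L2f_inner_integrable:
  assumes f: "L2f M f" and g: "L2f M g"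
  shows "integrable M (\<lambda>x. f x \<bullet> g x)"
proof (rule Bochner_Integration.integrable_bound)
  show "integrable M (\<lambda>x. (norm (f x))\<^sup>2 + (norm (g x))\<^sup>2)"
    using f g by (auto simp: L2f_def)
  show "(\<lambda>x. f x \<bullet> g x) \<in> borel_measurable M" using f g by (auto simp: L2f_def)
  show "AE x in M. norm (f x \<bullet> g x) \<le> norm ((norm (f x))\<^sup>2 + (norm (g x))\<^sup>2)"
  proof (rule AE_I2)
    fix x
    have "\<bar>f x \<bullet> g x\<bar> \<le> norm (f x) * norm (g x)" by (rule Cauchy_Schwarz_ineq2)
    moreover have "0 \<le> (norm (f x) - norm (g x))\<^sup>2" "0 \<le> norm (f x) * norm (g x)" by auto
    ultimately have "\<bar>f x \<bullet> g x\<bar> \<le> (norm (f x))\<^sup>2 + (norm (g x))\<^sup>2"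
      by (simp add: power2_eq_square algebra_simps)
    then show "norm (f x \<bullet> g x) \<le> norm ((norm (f x))\<^sup>2 + (norm (g x))\<^sup>2)" by simp
  qed
qed

lemma L2f_lincomb:
  assumes f: "L2f M f" and g: "L2f M g"
  shows "L2f M (\<lambda>x. c *\<^sub>R f x + d *\<^sub>R g x)"
    and "(\<integral>x. (norm (c *\<^sub>R f x + d *\<^sub>R g x))\<^sup>2 \<partial>M)
       = c\<^sup>2 * (n2 M f)\<^sup>2 + 2 * c * d * (\<integral>x. f x \<bullet> g x \<partial>M) + d\<^sup>2 * (n2 M g)\<^sup>2"
proof -
  have eq: "(norm (c *\<^sub>R f x + d *\<^sub>R g x))\<^sup>2
      = c\<^sup>2 * (norm (f x))\<^sup>2 + 2 * c * d * (f x \<bullet> g x) + d\<^sup>2 * (norm (g x))\<^sup>2" for x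
    unfolding power2_norm_eq_inner
    by (simp add: inner_add_left inner_add_right inner_commute power2_eq_square algebra_simps)
  have i: "integrable M (\<lambda>x. (norm (f x))\<^sup>2)" "integrable M (\<lambda>x. (norm (g x))\<^sup>2)" "integrable M (\<lambda>x. f x \<bullet> g x)"
    using f g L2f_inner_integrable by (auto simp: L2f_def)
  show "L2f M (\<lambda>x. c *\<^sub>R f x + d *\<^sub>R g x)"
    unfolding L2f_def eq using f g i by (auto simp: L2f_def)
  show "(\<integral>x. (norm (c *\<^sub>R f x + d *\<^sub>R g x))\<^sup>2 \<partial>M)
       = c\<^sup>2 * (n2 M f)\<^sup>2 + 2 * c * d * (\<integral>x. f x \<bullet> g x \<partial>M) + d\<^sup>2 * (n2 M g)\<^sup>2"
    unfolding eq n2_power2 using i by simp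
qed

lemma L2f_diff: "L2f M f \<Longrightarrow> L2f M g \<Longrightarrow> L2f M (\<lambda>x. f x - g x)"
  using L2f_lincomb(1)[of M f g 1 "-1"] by simp

text \<open>The integral of |c f + d g|^2 is a nonnegative quadratic form in c and d; the inequality
  is the statement about its discriminant.\<close>

lemma L2f_Cauchy_Schwarz:
  assumes f: "L2f M f" and g: "L2f M g"
  shows "\<bar>\<integral>x. f x \<bullet> g x \<partial>M\<bar> \<le> n2 M f * n2 M g"
proof -
  define I where "I = (\<integral>x. f x \<bullet> g x \<partial>M)"
  have q: "0 \<le> c\<^sup>2 * (n2 M f)\<^sup>2 + 2 * c * d * I + d\<^sup>2 * (n2 M g)\<^sup>2" for c d
    unfolding I_def L2f_lincomb(2)[OF f g, symmetric] by (intro integral_nonneg_AE) auto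
  have "I\<^sup>2 \<le> (n2 M f)\<^sup>2 * (n2 M g)\<^sup>2"
  proof (cases "n2 M f = 0")
    case True
    have "I = 0"
    proof (rule ccontr)
      assume "I \<noteq> 0"
      \<comment> \<open>At this argument the quadratic form would take the value -1.\<close>
      then show False using q[of "- ((n2 M g)\<^sup>2 + 1) / (2 * I)" 1] True by (simp add: field_simps)
    qed
    then show ?thesis by simp
  next
    case False
    define A where "A = (n2 M f)\<^sup>2"
    have A: "A > 0" using False by (simp add: A_def)
    \<comment> \<open>The minimizer of the form for \<open>d = 1\<close>.\<close>
    have "0 \<le> (- I / A)\<^sup>2 * A + 2 * (- I / A) * 1 * I + 1\<^sup>2 * (n2 M g)\<^sup>2" unfolding A_def by (rule q)
    then show ?thesis using A unfolding A_def[symmetric] by (simp add: field_simps power2_eq_square)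
  qed
  then have "I\<^sup>2 \<le> (n2 M f * n2 M g)\<^sup>2" by (simp add: power_mult_distrib)
  then show ?thesis unfolding I_def[symmetric]
    using n2_nonneg[of M f] n2_nonneg[of M g] by (simp add: abs_le_square_iff[symmetric])
qed

lemma n2_triangle:
  assumes f: "L2f M f" and g: "L2f M g"
  shows "n2 M (\<lambda>x. f x + g x) \<le> n2 M f + n2 M g"
proof -
  have "(n2 M (\<lambda>x. f x + g x))\<^sup>2 = (n2 M f)\<^sup>2 + 2 * (\<integral>x. f x \<bullet> g x \<partial>M) + (n2 M g)\<^sup>2"
    using L2f_lincomb(2)[OF f g, of 1 1] by (simp add: n2_power2)
  also have "\<dots> \<le> (n2 M f + n2 M g)\<^sup>2"
    using L2f_Cauchy_Schwarz[OF f g] by (simp add: power2_sum)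
  finally show ?thesis using n2_nonneg[of M f] n2_nonneg[of M g] by (auto intro: power2_le_imp_le)
qed

lemma n2_cong_AE:
  assumes "f \<in> borel_measurable M" "g \<in> borel_measurable M" "AE x in M. f x = g x"
  shows "n2 M f = n2 M g"
  unfolding n2_def
  by (rule arg_cong[where f=sqrt], rule integral_cong_AE) (use assms in \<open>auto elim: eventually_mono\<close>)

lemma L2f_dominated:
  assumes g: "L2f M g" and f: "f \<in> borel_measurable M" and c: "c \<ge> 0" and ae: "AE x in M. norm (f x) \<le> c * norm (g x)"
  shows "L2f M f" "n2 M f \<le> c * n2 M g"
proof -
  have sq: "AE x in M. (norm (f x))\<^sup>2 \<le> c\<^sup>2 * (norm (g x))\<^sup>2"
    using ae
  proof eventually_elim
    case (elim x)
    then have "(norm (f x))\<^sup>2 \<le> (c * norm (g x))\<^sup>2" by (rule power_mono) simp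
    then show ?case by (simp add: power_mult_distrib)
  qed
  have ig: "integrable M (\<lambda>x. c\<^sup>2 * (norm (g x))\<^sup>2)" using g by (auto simp: L2f_def)
  have i: "integrable M (\<lambda>x. (norm (f x))\<^sup>2)"
    by (rule Bochner_Integration.integrable_bound[OF ig]) (use f sq in auto)
  then show "L2f M f" using f by (simp add: L2f_def)
  have "(n2 M f)\<^sup>2 \<le> (c * n2 M g)\<^sup>2"
    unfolding power_mult_distrib n2_power2 using integral_mono_AE[OF i ig sq] by simp
  then show "n2 M f \<le> c * n2 M g" using c n2_nonneg[of M g] by (auto intro: power2_le_imp_le)
qed

section \<open>The coefficient matrix\<close>

text \<open>This is the derivative of g / sqrt (1 + |g|^2) with respect to g in the direction \<xi>,
  that is, the action of the coefficient matrix written in terms of the value of the gradient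
  alone.\<close>

definition amul :: "plane \<Rightarrow> plane \<Rightarrow> plane" where
  "amul g \<xi> = (let q = sqrt (1 + (norm g)\<^sup>2) in (1 / q) *\<^sub>R \<xi> - ((g \<bullet> \<xi>) / q ^ 3) *\<^sub>R g)"

lemma Amat_mult: "Amat \<Omega> y x *v \<xi> = amul (wgrad \<Omega> y x) \<xi>"
proof -
  let ?g = "wgrad \<Omega> y x" and ?q = "Qf \<Omega> y x"
  have "outer ?g *v \<xi> = (?g \<bullet> \<xi>) *\<^sub>R ?g"
    by (simp add: vec_eq_iff matrix_vector_mult_def outer_def inner_vec_def sum_distrib_left sum_distrib_right mult_ac)
  then have "Amat \<Omega> y x *v \<xi> = (1 / ?q) *\<^sub>R (\<xi> - (1 / ?q\<^sup>2) *\<^sub>R ((?g \<bullet> \<xi>) *\<^sub>R ?g))"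
    by (simp add: Amat_def scaleR_matrix_vector_assoc[symmetric] matrix_vector_mult_diff_rdistrib)
  then show ?thesis
    by (simp add: amul_def Let_def Qf_def scaleR_diff_right power3_eq_cube power2_eq_square)
qed

context
  fixes g \<xi> :: plane
begin

lemma q_facts:
  defines "q \<equiv> sqrt (1 + (norm g)\<^sup>2)"
  shows "q \<ge> 1" "q\<^sup>2 = 1 + (norm g)\<^sup>2" "norm g \<le> q"
proof -
  show "q\<^sup>2 = 1 + (norm g)\<^sup>2" by (simp add: q_def)
  show "q \<ge> 1" by (simp add: q_def)
  show "norm g \<le> q" unfolding q_def by (rule real_le_rsqrt) simp
qed

text \<open>The smallest eigenvalue is 1 / q^3, attained in the direction of \<open>g\<close>;
  Cauchy-Schwarz and q^2 - |g|^2 = 1 reduce the general direction to it. It decays as the gradient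
  grows, which is why a bound \<open>G\<close> is required.\<close>

lemma amul_coercive:
  assumes "norm g \<le> G"
  shows "(norm \<xi>)\<^sup>2 / (sqrt (1 + G\<^sup>2)) ^ 3 \<le> amul g \<xi> \<bullet> \<xi>"
proof -
  define q where "q = sqrt (1 + (norm g)\<^sup>2)"
  have q: "q \<ge> 1" "q\<^sup>2 = 1 + (norm g)\<^sup>2" unfolding q_def by (rule q_facts)+
  have qG: "q \<le> sqrt (1 + G\<^sup>2)" unfolding q_def using assms by (simp add: power_mono)
  have "(norm \<xi>)\<^sup>2 / (sqrt (1 + G\<^sup>2)) ^ 3 \<le> (norm \<xi>)\<^sup>2 / q ^ 3"
    using q(1) qG by (intro divide_left_mono power_mono mult_pos_pos zero_less_power) (auto intro: add_pos_nonneg)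
  also have "\<dots> = ((norm \<xi>)\<^sup>2 * (q\<^sup>2 - (norm g)\<^sup>2)) / q ^ 3" using q(2) by simp
  also have "\<dots> \<le> ((norm \<xi>)\<^sup>2 * q\<^sup>2 - (g \<bullet> \<xi>)\<^sup>2) / q ^ 3"
  proof (rule divide_right_mono)
    have "(g \<bullet> \<xi>)\<^sup>2 \<le> (norm g * norm \<xi>)\<^sup>2"
      using Cauchy_Schwarz_ineq2[of g \<xi>] by (simp add: abs_le_square_iff[symmetric])
    then show "(norm \<xi>)\<^sup>2 * (q\<^sup>2 - (norm g)\<^sup>2) \<le> (norm \<xi>)\<^sup>2 * q\<^sup>2 - (g \<bullet> \<xi>)\<^sup>2"
      by (simp add: power_mult_distrib algebra_simps)
  qed (use q in simp)
  also have "\<dots> = amul g \<xi> \<bullet> \<xi>"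
    using q(1) unfolding amul_def Let_def q_def[symmetric] power2_norm_eq_inner[of \<xi>]
    by (simp add: inner_diff_left power2_eq_square power3_eq_cube field_simps)
  finally show ?thesis .
qed

text \<open>Each of the two terms is at most |\<xi>|, whatever the size of \<open>g\<close>.\<close>

lemma amul_bound: "norm (amul g \<xi>) \<le> 2 * norm \<xi>"
proof -
  define q where "q = sqrt (1 + (norm g)\<^sup>2)"
  have q: "q \<ge> 1" "q\<^sup>2 = 1 + (norm g)\<^sup>2" "norm g \<le> q" unfolding q_def by (rule q_facts)+
  have "norm (amul g \<xi>) \<le> norm ((1 / q) *\<^sub>R \<xi>) + norm (((g \<bullet> \<xi>) / q ^ 3) *\<^sub>R g)"
    unfolding amul_def Let_def q_def[symmetric] by (rule norm_triangle_ineq4)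
  also have "norm ((1 / q) *\<^sub>R \<xi>) \<le> 1 * norm \<xi>"
    unfolding norm_scaleR using q by (intro mult_right_mono) (auto simp: field_simps)
  also have "norm (((g \<bullet> \<xi>) / q ^ 3) *\<^sub>R g) = \<bar>g \<bullet> \<xi>\<bar> * norm g / q ^ 3" using q by simp
  also have "\<dots> \<le> (q * norm \<xi>) * q / q ^ 3"
  proof (intro divide_right_mono mult_mono q(3))
    have "\<bar>g \<bullet> \<xi>\<bar> \<le> norm g * norm \<xi>" by (rule Cauchy_Schwarz_ineq2)
    also have "\<dots> \<le> q * norm \<xi>" by (rule mult_right_mono[OF q(3)]) simp
    finally show "\<bar>g \<bullet> \<xi>\<bar> \<le> q * norm \<xi>" .
  qed (use q in auto)
  also have "\<dots> = norm \<xi> / q" using q by (simp add: power3_eq_cube)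
  also have "\<dots> \<le> norm \<xi>" using q(1) mult_left_mono[of 1 q "norm \<xi>"] by (simp add: field_simps)
  finally show ?thesis by simp
qed

end

text \<open>Telescoping in the factors 1 / q and n = g / q, both of modulus at most 1. The first has
  Lipschitz constant 1 and the second 2 with respect to \<open>g\<close>, so the four terms
  contribute 1 + 1 + 2 + 2.\<close>

lemma amul_lipschitz: "norm (amul g \<xi> - amul g' \<xi>) \<le> 6 * norm (g - g') * norm \<xi>"
proof -
  define q q' where "q = sqrt (1 + (norm g)\<^sup>2)" and "q' = sqrt (1 + (norm g')\<^sup>2)"
  have q: "q \<ge> 1" "q\<^sup>2 = 1 + (norm g)\<^sup>2" "norm g \<le> q" unfolding q_def by (rule q_facts)+
  have q': "q' \<ge> 1" "q'\<^sup>2 = 1 + (norm g')\<^sup>2" "norm g' \<le> q'" unfolding q'_def by (rule q_facts)+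
  define d where "d = norm (g - g')"
  have d0: "d \<ge> 0" by (simp add: d_def)
  have dd: "\<bar>norm g - norm g'\<bar> \<le> d" unfolding d_def by (rule norm_triangle_ineq3)
  \<comment> \<open>From the difference of squares: q^2 - q'^2 = |g|^2 - |g'|^2, and |g| + |g'|
    \<le> q + q'.\<close>
  have qd: "\<bar>q - q'\<bar> \<le> d"
  proof -
    have "(q - q') * (q + q') = (norm g - norm g') * (norm g + norm g')"
      using q(2) q'(2) by (simp add: power2_eq_square algebra_simps)
    then have "\<bar>q - q'\<bar> * (q + q') = \<bar>norm g - norm g'\<bar> * (norm g + norm g')"
      using q q' by (metis abs_mult abs_of_nonneg add_nonneg_nonneg norm_ge_zero order_trans zero_le_one)
    also have "\<dots> \<le> d * (q + q')" using dd q q' d0 by (intro mult_mono add_mono) auto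
    finally show ?thesis using q q' by simp
  qed
  have inv: "\<bar>1 / q - 1 / q'\<bar> \<le> d"
  proof -
    have "1 / q - 1 / q' = (q' - q) / (q * q')" using q q' by (simp add: field_simps)
    then have "\<bar>1 / q - 1 / q'\<bar> = \<bar>q - q'\<bar> / (q * q')" using q q' by (simp add: abs_minus_commute)
    also have "\<dots> \<le> d / 1" using qd q q' d0 mult_mono[of 1 q 1 q'] by (intro frac_le) auto
    finally show ?thesis by simp
  qed
  define n n' where "n = (1 / q) *\<^sub>R g" and "n' = (1 / q') *\<^sub>R g'"
  have nn: "norm n \<le> 1" "norm n' \<le> 1" using q q' by (auto simp: n_def n'_def field_simps)
  have nd: "norm (n - n') \<le> 2 * d"
  proof -
    have "n - n' = (1 / q) *\<^sub>R (g - g') + (1 / q - 1 / q') *\<^sub>R g'"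
      by (simp add: n_def n'_def algebra_simps)
    then have "norm (n - n') \<le> norm ((1 / q) *\<^sub>R (g - g')) + norm ((1 / q - 1 / q') *\<^sub>R g')"
      by (metis norm_triangle_ineq)
    also have "norm ((1 / q) *\<^sub>R (g - g')) \<le> 1 * d"
      unfolding norm_scaleR d_def using q by (intro mult_right_mono) (auto simp: field_simps)
    also have "norm ((1 / q - 1 / q') *\<^sub>R g') \<le> d"
    proof -
      have "1 / q - 1 / q' = (q' - q) / (q * q')" using q q' by (simp add: field_simps)
      then have "norm ((1 / q - 1 / q') *\<^sub>R g') = \<bar>q - q'\<bar> * norm g' / (q * q')"
        using q q' by (simp add: abs_minus_commute)
      also have "\<dots> \<le> d * q' / (q * q')" using qd q q' d0 by (intro divide_right_mono mult_mono) auto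
      also have "\<dots> = d / q" using q' by simp
      also have "\<dots> \<le> d" using q(1) mult_left_mono[of 1 q d] d0 by (simp add: field_simps)
      finally show ?thesis .
    qed
    finally show ?thesis by simp
  qed
  have am: "amul g \<xi> = (1 / q) *\<^sub>R \<xi> - ((n \<bullet> \<xi>) / q) *\<^sub>R n" "amul g' \<xi> = (1 / q') *\<^sub>R \<xi> - ((n' \<bullet> \<xi>) / q') *\<^sub>R n'"
    unfolding amul_def Let_def q_def[symmetric] q'_def[symmetric] n_def n'_def
    by (simp_all add: power3_eq_cube)
  have t4: "norm (e1 + (e2 + (e3 + e4))) \<le> norm e1 + (norm e2 + (norm e3 + norm e4))" for e1 e2 e3 e4 :: plane
    using norm_triangle_ineq[of e1 "e2 + (e3 + e4)"] norm_triangle_ineq[of e2 "e3 + e4"] norm_triangle_ineq[of e3 e4] by linarith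
  have "amul g \<xi> - amul g' \<xi> = (1 / q - 1 / q') *\<^sub>R \<xi> + (- ((n \<bullet> \<xi>) * (1 / q - 1 / q')) *\<^sub>R n
      + (- (((n - n') \<bullet> \<xi>) * (1 / q')) *\<^sub>R n + (- ((n' \<bullet> \<xi>) * (1 / q'))) *\<^sub>R (n - n')))"
    unfolding am by (simp add: inner_diff_left algebra_simps)
  then have "norm (amul g \<xi> - amul g' \<xi>) \<le> norm ((1 / q - 1 / q') *\<^sub>R \<xi>) + (norm (- ((n \<bullet> \<xi>) * (1 / q - 1 / q')) *\<^sub>R n)
      + (norm (- (((n - n') \<bullet> \<xi>) * (1 / q')) *\<^sub>R n) + norm ((- ((n' \<bullet> \<xi>) * (1 / q'))) *\<^sub>R (n - n'))))"
    by (simp only: t4)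
  also have "norm ((1 / q - 1 / q') *\<^sub>R \<xi>) \<le> d * norm \<xi>"
    unfolding norm_scaleR by (rule mult_right_mono[OF inv]) simp
  also have "norm (- ((n \<bullet> \<xi>) * (1 / q - 1 / q')) *\<^sub>R n) \<le> (norm \<xi> * d) * 1"
    unfolding norm_scaleR abs_minus_cancel abs_mult
    using Cauchy_Schwarz_ineq2[of n \<xi>] nn(1) mult_left_le_one_le[of "norm \<xi>" "norm n"]
    by (intro mult_mono inv nn) (auto simp: d0)
  also have "norm (- (((n - n') \<bullet> \<xi>) * (1 / q')) *\<^sub>R n) \<le> ((2 * d * norm \<xi>) * 1) * 1"
    unfolding norm_scaleR abs_minus_cancel abs_mult
    using order_trans[OF Cauchy_Schwarz_ineq2[of "n - n'" \<xi>] mult_right_mono[OF nd norm_ge_zero]] q' d0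
    by (intro mult_mono nn) auto
  also have "norm ((- ((n' \<bullet> \<xi>) * (1 / q'))) *\<^sub>R (n - n')) \<le> (norm \<xi> * 1) * (2 * d)"
    unfolding norm_scaleR abs_minus_cancel abs_mult
    using Cauchy_Schwarz_ineq2[of n' \<xi>] nn(2) mult_left_le_one_le[of "norm \<xi>" "norm n'"] q' d0
    by (intro mult_mono nd) auto
  finally show ?thesis by (simp add: d_def algebra_simps)
qed

lemma amul_diff: "amul g (\<xi> - \<eta>) = amul g \<xi> - amul g \<eta>"
  by (simp add: amul_def Let_def inner_diff_right algebra_simps diff_divide_distrib)

lemma amul_measurable:
  assumes [measurable]: "g \<in> borel_measurable M" "\<xi> \<in> borel_measurable M"
  shows "(\<lambda>x. amul (g x) (\<xi> x)) \<in> borel_measurable M"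
  unfolding amul_def Let_def by measurable

lemma amul_L2f:
  assumes "g \<in> borel_measurable M" "L2f M \<xi>"
  shows "L2f M (\<lambda>x. amul (g x) (\<xi> x))" "n2 M (\<lambda>x. amul (g x) (\<xi> x)) \<le> 2 * n2 M \<xi>"
proof -
  have m: "(\<lambda>x. amul (g x) (\<xi> x)) \<in> borel_measurable M"
    using assms by (intro amul_measurable) (auto simp: L2f_def)
  have ae: "AE x in M. norm (amul (g x) (\<xi> x)) \<le> 2 * norm (\<xi> x)" by (simp add: amul_bound)
  show "L2f M (\<lambda>x. amul (g x) (\<xi> x))" "n2 M (\<lambda>x. amul (g x) (\<xi> x)) \<le> 2 * n2 M \<xi>"
    using L2f_dominated[OF assms(2) m _ ae] by auto
qed

section \<open>The error estimate in terms of gradients\<close>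

text \<open>
  The discrete error \<open>gP - gf\<close>, where \<open>gP\<close> stands for the gradient of the interpolant, is a discrete
  test function. Testing with \<open>gP\<close> itself bounds \<open>g\<phi>\<close> by data, up to the interpolation error.
\<close>

lemma coercive_estimate:
  fixes M :: "'a measure" and gy gh g\<phi> gP gf :: "'a \<Rightarrow> plane" and G W w0 \<epsilon> a b :: real
  defines "\<alpha> \<equiv> 1 / (sqrt (1 + G\<^sup>2)) ^ 3"
  assumes m: "gy \<in> borel_measurable M" "gh \<in> borel_measurable M"
    and L: "L2f M g\<phi>" "L2f M gP" "L2f M gf"
    and G: "AE x in M. norm (gy x) \<le> G" "AE x in M. norm (gh x) \<le> G"
    and W: "AE x in M. norm (gy x - gh x) \<le> W" "0 \<le> W" "W \<le> w0"
    and \<epsilon>: "n2 M (\<lambda>x. g\<phi> x - gP x) \<le> \<epsilon>" and a: "0 \<le> a" and b: "0 \<le> b"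
    and TP: "(\<integral>x. amul (gy x) (g\<phi> x) \<bullet> gP x \<partial>M) \<le> a * n2 M gP"
    and Tz: "(\<integral>x. amul (gy x) (g\<phi> x) \<bullet> (gP x - gf x) \<partial>M) - (\<integral>x. amul (gh x) (gf x) \<bullet> (gP x - gf x) \<partial>M)
       \<le> b * W * n2 M (\<lambda>x. gP x - gf x)"
  shows "n2 M (\<lambda>x. g\<phi> x - gf x) \<le>
    (1 + 2 / \<alpha> + 6 * (1 + 2 / \<alpha>) * w0 / \<alpha>) * \<epsilon> + ((6 * (a / \<alpha>) + b) / \<alpha>) * W"
proof -
  have \<alpha>: "\<alpha> > 0" unfolding \<alpha>_def by (simp add: add_pos_nonneg)
  have \<epsilon>0: "\<epsilon> \<ge> 0" using \<epsilon> n2_nonneg order_trans by blast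
  have coerc: "\<alpha> * (n2 M \<xi>)\<^sup>2 \<le> (\<integral>x. amul (g x) (\<xi> x) \<bullet> \<xi> x \<partial>M)"
    if g: "g \<in> borel_measurable M" "AE x in M. norm (g x) \<le> G" and \<xi>: "L2f M \<xi>" for g \<xi>
  proof -
    have "(\<integral>x. \<alpha> * (norm (\<xi> x))\<^sup>2 \<partial>M) \<le> (\<integral>x. amul (g x) (\<xi> x) \<bullet> \<xi> x \<partial>M)"
    proof (rule integral_mono_AE)
      show "integrable M (\<lambda>x. \<alpha> * (norm (\<xi> x))\<^sup>2)" using \<xi> by (simp add: L2f_def)
      show "integrable M (\<lambda>x. amul (g x) (\<xi> x) \<bullet> \<xi> x)"
        by (rule L2f_inner_integrable[OF amul_L2f(1)[OF g(1) \<xi>] \<xi>])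
      show "AE x in M. \<alpha> * (norm (\<xi> x))\<^sup>2 \<le> amul (g x) (\<xi> x) \<bullet> \<xi> x"
        using g(2)
      proof eventually_elim
        case (elim x)
        from amul_coercive[OF this, of "\<xi> x"] show ?case by (simp add: \<alpha>_def)
      qed
    qed
    then show ?thesis by (simp add: n2_power2)
  qed
  have cancel: "n2 M \<xi> \<le> k / \<alpha>" if "\<alpha> * (n2 M \<xi>)\<^sup>2 \<le> k * n2 M \<xi>" "0 \<le> k" for \<xi> :: "'a \<Rightarrow> plane" and k
  proof (cases "n2 M \<xi> = 0")
    case True
    then show ?thesis using that(2) \<alpha> by simp
  next
    case False
    then have p: "n2 M \<xi> > 0" using n2_nonneg[of M \<xi>] by simp
    have "(\<alpha> * n2 M \<xi>) * n2 M \<xi> \<le> k * n2 M \<xi>" using that(1) by (simp add: power2_eq_square mult.assoc)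
    then have "\<alpha> * n2 M \<xi> \<le> k" using p by simp
    then show ?thesis using \<alpha> by (simp add: field_simps)
  qed
  have LP: "L2f M (\<lambda>x. g\<phi> x - gP x)" by (rule L2f_diff[OF L(1,2)])
  have Lz: "L2f M (\<lambda>x. gP x - gf x)" by (rule L2f_diff[OF L(2,3)])
  let ?z = "\<lambda>x. gP x - gf x"
  have CS: "(\<integral>x. amul (g x) (g\<phi> x - gP x) \<bullet> \<xi> x \<partial>M) \<ge> - (2 * \<epsilon> * n2 M \<xi>)"
    "integrable M (\<lambda>x. amul (g x) (g\<phi> x - gP x) \<bullet> \<xi> x)"
    if g: "g \<in> borel_measurable M" and \<xi>: "L2f M \<xi>" for g \<xi>
  proof -
    note A = amul_L2f[OF g LP]
    have "\<bar>\<integral>x. amul (g x) (g\<phi> x - gP x) \<bullet> \<xi> x \<partial>M\<bar> \<le> n2 M (\<lambda>x. amul (g x) (g\<phi> x - gP x)) * n2 M \<xi>"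
      by (rule L2f_Cauchy_Schwarz[OF A(1) \<xi>])
    also have "\<dots> \<le> (2 * \<epsilon>) * n2 M \<xi>"
      using A(2) \<epsilon> by (intro mult_right_mono n2_nonneg) linarith
    finally show "(\<integral>x. amul (g x) (g\<phi> x - gP x) \<bullet> \<xi> x \<partial>M) \<ge> - (2 * \<epsilon> * n2 M \<xi>)" by linarith
    show "integrable M (\<lambda>x. amul (g x) (g\<phi> x - gP x) \<bullet> \<xi> x)" by (rule L2f_inner_integrable[OF A(1) \<xi>])
  qed
  have I: "integrable M (\<lambda>x. amul (g x) (\<xi> x) \<bullet> \<eta> x)"
    if "g \<in> borel_measurable M" "L2f M \<xi>" "L2f M \<eta>" for g \<xi> \<eta>
    by (rule L2f_inner_integrable[OF amul_L2f(1)[OF that(1,2)] that(3)])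
  \<comment> \<open>Replacing \<open>g\<phi>\<close> by \<open>gP\<close> in the tested equation
    costs \<open>2 * \<epsilon>\<close>, where 2 is the bound of the coefficient matrix.\<close>
  have P: "n2 M gP \<le> (a + 2 * \<epsilon>) / \<alpha>"
  proof (rule cancel)
    have "(\<integral>x. amul (gy x) (gP x) \<bullet> gP x \<partial>M)
        = (\<integral>x. amul (gy x) (g\<phi> x) \<bullet> gP x - amul (gy x) (g\<phi> x - gP x) \<bullet> gP x \<partial>M)"
      by (simp add: amul_diff inner_diff_left)
    also have "\<dots> = (\<integral>x. amul (gy x) (g\<phi> x) \<bullet> gP x \<partial>M) - (\<integral>x. amul (gy x) (g\<phi> x - gP x) \<bullet> gP x \<partial>M)"
      by (rule Bochner_Integration.integral_diff[OF I[OF m(1) L(1,2)] CS(2)[OF m(1) L(2)]])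
    also have "\<dots> \<le> (a + 2 * \<epsilon>) * n2 M gP" using TP CS(1)[OF m(1) L(2)] by (simp add: algebra_simps)
    finally show "\<alpha> * (n2 M gP)\<^sup>2 \<le> (a + 2 * \<epsilon>) * n2 M gP" using coerc[OF m(1) G(1) L(2)] by linarith
  qed (use a \<epsilon>0 in simp)
  have phi: "n2 M g\<phi> \<le> a / \<alpha> + (1 + 2 / \<alpha>) * \<epsilon>"
  proof -
    have "n2 M g\<phi> = n2 M (\<lambda>x. (g\<phi> x - gP x) + gP x)" by simp
    also have "\<dots> \<le> \<epsilon> + n2 M gP" using n2_triangle[OF LP L(2)] \<epsilon> by linarith
    also have "\<dots> \<le> \<epsilon> + (a + 2 * \<epsilon>) / \<alpha>" using P by simp
    finally show ?thesis by (simp add: add_divide_distrib algebra_simps)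
  qed
  let ?d = "\<lambda>x. amul (gh x) (g\<phi> x) - amul (gy x) (g\<phi> x)"
  have "L2f M ?d \<and> n2 M ?d \<le> (6 * W) * n2 M g\<phi>"
  proof -
    have ae: "AE x in M. norm (?d x) \<le> (6 * W) * norm (g\<phi> x)"
      using W(1)
    proof eventually_elim
      case (elim x)
      have "norm (?d x) \<le> 6 * norm (gh x - gy x) * norm (g\<phi> x)" by (rule amul_lipschitz)
      also have "\<dots> \<le> (6 * W) * norm (g\<phi> x)" using elim by (intro mult_right_mono) (auto simp: norm_minus_commute)
      finally show ?case .
    qed
    have dm: "?d \<in> borel_measurable M"
      using m L(1) by (intro borel_measurable_diff amul_measurable) (auto simp: L2f_def)
    show ?thesis using L2f_dominated[OF L(1) dm _ ae] W(2) by auto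
  qed
  then have Ld: "L2f M ?d" "n2 M ?d \<le> (6 * W) * n2 M g\<phi>" by auto
  have z: "n2 M ?z \<le> (2 * \<epsilon> + 6 * W * n2 M g\<phi> + b * W) / \<alpha>"
  proof (rule cancel)
    \<comment> \<open>The energy of the discrete error splits into the coefficient error
      \<open>?d\<close>, the interpolation error, and the difference of the two weak equations that
      \<open>Tz\<close> controls.\<close>
    have "(\<integral>x. amul (gh x) (gP x - gf x) \<bullet> ?z x \<partial>M)
        = (\<integral>x. ((?d x \<bullet> ?z x - amul (gh x) (g\<phi> x - gP x) \<bullet> ?z x)
              + amul (gy x) (g\<phi> x) \<bullet> ?z x) - amul (gh x) (gf x) \<bullet> ?z x \<partial>M)"
      by (intro Bochner_Integration.integral_cong refl) (simp add: amul_diff inner_diff_left)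
    also have "\<dots> = (((\<integral>x. ?d x \<bullet> ?z x \<partial>M) - (\<integral>x. amul (gh x) (g\<phi> x - gP x) \<bullet> ?z x \<partial>M))
          + (\<integral>x. amul (gy x) (g\<phi> x) \<bullet> ?z x \<partial>M)) - (\<integral>x. amul (gh x) (gf x) \<bullet> ?z x \<partial>M)"
      by (subst Bochner_Integration.integral_diff Bochner_Integration.integral_add;
          (intro Bochner_Integration.integrable_diff Bochner_Integration.integrable_add
            L2f_inner_integrable[OF Ld(1) Lz] CS(2)[OF m(2) Lz] I[OF m(1) L(1) Lz] I[OF m(2) L(3) Lz])?)+ simp
    also have "\<dots> \<le> (6 * W * n2 M g\<phi>) * n2 M ?z + 2 * \<epsilon> * n2 M ?z + b * W * n2 M ?z"
    proof -
      have "(\<integral>x. ?d x \<bullet> ?z x \<partial>M) \<le> n2 M ?d * n2 M ?z" using L2f_Cauchy_Schwarz[OF Ld(1) Lz] by linarith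
      also have "\<dots> \<le> (6 * W * n2 M g\<phi>) * n2 M ?z" by (rule mult_right_mono[OF Ld(2) n2_nonneg])
      finally show ?thesis using CS(1)[OF m(2) Lz] Tz by linarith
    qed
    finally show "\<alpha> * (n2 M ?z)\<^sup>2 \<le> (2 * \<epsilon> + 6 * W * n2 M g\<phi> + b * W) * n2 M ?z"
      using coerc[OF m(2) G(2) Lz] by (simp add: algebra_simps)
    show "0 \<le> 2 * \<epsilon> + 6 * W * n2 M g\<phi> + b * W"
      using \<epsilon>0 W(2) b n2_nonneg[of M g\<phi>] by (intro add_nonneg_nonneg mult_nonneg_nonneg) auto
  qed
  \<comment> \<open>The factor \<open>W\<close> is kept next to the data term, but replaced by its
    bound \<open>w0\<close> next to \<epsilon>, so that no product of the two errors
    remains.\<close>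
  have "W * n2 M g\<phi> \<le> (a / \<alpha>) * W + (1 + 2 / \<alpha>) * w0 * \<epsilon>"
  proof -
    have "W * n2 M g\<phi> \<le> W * (a / \<alpha> + (1 + 2 / \<alpha>) * \<epsilon>)" by (rule mult_left_mono[OF phi W(2)])
    also have "\<dots> = (a / \<alpha>) * W + W * ((1 + 2 / \<alpha>) * \<epsilon>)" by (simp add: algebra_simps)
    also have "W * ((1 + 2 / \<alpha>) * \<epsilon>) \<le> w0 * ((1 + 2 / \<alpha>) * \<epsilon>)" using W(3) \<alpha> \<epsilon>0 by (intro mult_right_mono) auto
    finally show ?thesis by (simp add: mult_ac)
  qed
  then have "(2 * \<epsilon> + 6 * W * n2 M g\<phi> + b * W) / \<alpha> \<le>
      (2 * \<epsilon> + 6 * ((a / \<alpha>) * W + (1 + 2 / \<alpha>) * w0 * \<epsilon>) + b * W) / \<alpha>"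
    using \<alpha> by (intro divide_right_mono) auto
  also have "\<dots> = (2 / \<alpha> + 6 * (1 + 2 / \<alpha>) * w0 / \<alpha>) * \<epsilon> + ((6 * (a / \<alpha>) + b) / \<alpha>) * W"
    using \<alpha> by (simp add: divide_simps) (simp add: algebra_simps)
  finally have z2: "n2 M ?z \<le> (2 / \<alpha> + 6 * (1 + 2 / \<alpha>) * w0 / \<alpha>) * \<epsilon> + ((6 * (a / \<alpha>) + b) / \<alpha>) * W"
    using z by linarith
  have "n2 M (\<lambda>x. g\<phi> x - gf x) = n2 M (\<lambda>x. (g\<phi> x - gP x) + ?z x)" by simp
  also have "\<dots> \<le> \<epsilon> + n2 M ?z" using n2_triangle[OF LP Lz] \<epsilon> by linarith
  finally show ?thesis using z2 by (simp add: algebra_simps)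
qed

section \<open>Lebesgue and Sobolev spaces\<close>

lemma Lnorm_2: "Lnorm 2 \<Omega> f = n2 (lebesgue_on \<Omega>) f"
proof -
  have "0 \<le> (LINT x|lebesgue_on \<Omega>. (norm (f x))\<^sup>2)" by (intro integral_nonneg_AE) auto
  then show ?thesis by (simp add: Lnorm_def n2_def powr_half_sqrt)
qed

lemma Lspace_2: "f \<in> Lspace 2 \<Omega> \<longleftrightarrow> L2f (lebesgue_on \<Omega>) f"
  by (simp add: Lspace_def L2f_def)

lemma Lnorm_2_nonneg: "0 \<le> Lnorm 2 \<Omega> f"
  by (simp add: Lnorm_2 n2_nonneg)

lemma Lnorm_2_empty: "Lnorm 2 {} f = 0"
  by (simp add: Lnorm_2 n2_def integral_restrict_space)

text \<open>The infimum is itself an essential bound: the bounds inf + 1 / (n + 1) have countably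
  many exceptional sets, which together are null.\<close>

lemma Lnorm_infinity_AE:
  assumes "f \<in> Lspace \<infinity> \<Omega>"
  shows "AE x in lebesgue_on \<Omega>. norm (f x) \<le> Lnorm \<infinity> \<Omega> f" "0 \<le> Lnorm \<infinity> \<Omega> f"
proof -
  define S where "S = {M. 0 \<le> M \<and> (AE x in lebesgue_on \<Omega>. norm (f x) \<le> M)}"
  have N: "Lnorm \<infinity> \<Omega> f = Inf S" by (simp add: Lnorm_def S_def)
  obtain M where M: "AE x in lebesgue_on \<Omega>. norm (f x) \<le> M" using assms by (auto simp: Lspace_def)
  have "AE x in lebesgue_on \<Omega>. norm (f x) \<le> max M 0" using M by eventually_elim (simp add: le_max_iff_disj)
  then have ne: "S \<noteq> {}" unfolding S_def by (auto intro: exI[of _ "max M 0"])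
  show "0 \<le> Lnorm \<infinity> \<Omega> f" unfolding N by (rule cInf_greatest[OF ne]) (simp add: S_def)
  have "AE x in lebesgue_on \<Omega>. norm (f x) \<le> Inf S + inverse (real (Suc n))" for n
  proof -
    have "Inf S < Inf S + inverse (real (Suc n))" by simp
    from cInf_lessD[OF ne this] obtain m where m: "m \<in> S" "m < Inf S + inverse (real (Suc n))" by blast
    then have "AE x in lebesgue_on \<Omega>. norm (f x) \<le> m" by (simp add: S_def)
    then show ?thesis by eventually_elim (use m in linarith)
  qed
  then have "AE x in lebesgue_on \<Omega>. \<forall>n. norm (f x) \<le> Inf S + inverse (real (Suc n))"
    by (simp add: AE_all_countable)
  then show "AE x in lebesgue_on \<Omega>. norm (f x) \<le> Lnorm \<infinity> \<Omega> f"
  proof eventually_elim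
    case (elim x)
    have "(\<lambda>n. Inf S + inverse (real (Suc n))) \<longlonglongrightarrow> Inf S + 0"
      by (intro tendsto_intros LIMSEQ_inverse_real_of_nat)
    from tendsto_lowerbound[OF this always_eventually[OF elim]]
    show ?case unfolding N by simp
  qed
qed

lemma Lnorm_infinity_le:
  assumes "AE x in lebesgue_on \<Omega>. norm (f x) \<le> K" "0 \<le> K"
  shows "Lnorm \<infinity> \<Omega> f \<le> K"
  unfolding Lnorm_def using assms by (auto intro!: cInf_lower bdd_belowI[of _ 0])

lemma L2f_const:
  fixes \<Omega> :: "plane set"
  assumes "open \<Omega>" "bounded \<Omega>"
  shows "L2f (lebesgue_on \<Omega>) (\<lambda>_. c :: real)"
  using integrable_continuous_bounded_set[OF assms, of "\<lambda>_. c\<^sup>2"] by (simp add: L2f_def)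

text \<open>On a bounded set the constant 1 is integrable, and t^2 \<le> 1 + t^p for p \<ge> 2 takes
  the place of Hoelder's inequality.\<close>

lemma Lspace_L2f:
  assumes \<Omega>: "open \<Omega>" "bounded \<Omega>" and r: "2 \<le> r" and f: "f \<in> Lspace r \<Omega>"
  shows "L2f (lebesgue_on \<Omega>) f"
proof (cases "r = \<infinity>")
  case True
  then obtain M where M: "AE x in lebesgue_on \<Omega>. norm (f x) \<le> M" using f by (auto simp: Lspace_def)
  then have "AE x in lebesgue_on \<Omega>. norm (f x) \<le> \<bar>M\<bar> * norm (1 :: real)"
    by eventually_elim simp
  then show ?thesis
    using f by (intro L2f_dominated(1)[OF L2f_const[OF \<Omega>, of 1]]) (auto simp: Lspace_def)
next
  case False
  define p where "p = enn2real r"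
  have p: "2 \<le> p" unfolding p_def using enn2real_mono[OF r] False by (simp add: less_top)
  have fm: "f \<in> borel_measurable (lebesgue_on \<Omega>)" and fi: "integrable (lebesgue_on \<Omega>) (\<lambda>x. norm (f x) powr p)"
    using f False by (auto simp: Lspace_def p_def)
  have "integrable (lebesgue_on \<Omega>) (\<lambda>x. 1 + norm (f x) powr p)"
    using integrable_continuous_bounded_set[OF \<Omega>, of "\<lambda>_. 1"] fi by simp
  then have "integrable (lebesgue_on \<Omega>) (\<lambda>x. (norm (f x))\<^sup>2)"
  proof (rule Bochner_Integration.integrable_bound)
    have "t\<^sup>2 \<le> 1 + t powr p" if t: "0 \<le> t" for t :: real
    proof (cases "t \<le> 1")
      case True
      then have "t\<^sup>2 \<le> 1" using t by (simp add: power_le_one)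
      then show ?thesis by (smt (verit) powr_ge_zero)
    next
      case False
      then have "t\<^sup>2 = t powr 2" using t by simp
      also have "\<dots> \<le> t powr p" using False p by (intro powr_mono) auto
      finally show ?thesis by simp
    qed
    then show "AE x in lebesgue_on \<Omega>. norm ((norm (f x))\<^sup>2) \<le> norm (1 + norm (f x) powr p)"
      by (intro AE_I2) (simp add: add_nonneg_nonneg)
  qed (use fm in simp)
  then show ?thesis using fm by (simp add: L2f_def)
qed

lemma L2f_integrable:
  fixes f :: "plane \<Rightarrow> 'b::euclidean_space"
  assumes \<Omega>: "open \<Omega>" "bounded \<Omega>" and f: "L2f (lebesgue_on \<Omega>) f"
  shows "integrable (lebesgue_on \<Omega>) f"
proof (rule Bochner_Integration.integrable_bound)
  show "integrable (lebesgue_on \<Omega>) (\<lambda>x. 1 + (norm (f x))\<^sup>2)"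
    using integrable_continuous_bounded_set[OF \<Omega>, of "\<lambda>_. 1"] f by (simp add: L2f_def)
  show "f \<in> borel_measurable (lebesgue_on \<Omega>)" using f by (simp add: L2f_def)
  have "t \<le> 1 + t\<^sup>2" for t :: real
    using zero_le_power2[of "t - 1/2"] by (simp add: power2_eq_square algebra_simps)
  then show "AE x in lebesgue_on \<Omega>. norm (f x) \<le> norm (1 + (norm (f x))\<^sup>2)"
    by (intro AE_I2) (simp add: add_nonneg_nonneg)
qed

lemma W1_weak_grad: "w \<in> W1 r \<Omega> \<Longrightarrow> is_weak_grad \<Omega> w (wgrad \<Omega> w)"
  unfolding W1_def wgrad_def by (auto intro: someI[of "is_weak_grad \<Omega> w"])

lemma is_weak_grad_diff:
  assumes "open \<Omega>" "is_weak_grad \<Omega> w g" "is_weak_grad \<Omega> w' g'"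
  shows "is_weak_grad \<Omega> (\<lambda>x. w x - w' x) (\<lambda>x. g x - g' x)"
  using is_weak_grad_lincomb[OF assms, of 1 "-1"] by simp

lemma is_weak_grad_cong_AE:
  assumes \<Omega>: "open \<Omega>" and w: "is_weak_grad \<Omega> w g" and m: "w' \<in> borel_measurable (lebesgue_on \<Omega>)"
    and ae: "AE x in lebesgue. x \<in> \<Omega> \<longrightarrow> w' x = w x"
  shows "is_weak_grad \<Omega> w' g"
proof -
  have lw: "locally_integrable \<Omega> w" using w by (simp add: is_weak_grad_def)
  have l: "locally_integrable \<Omega> w'"
    unfolding locally_integrable_def
  proof (intro allI impI)
    fix K assume K: "compact K \<and> K \<subseteq> \<Omega>"
    then have s: "K \<in> sets lebesgue" by (auto intro: fmeasurableD lmeasurable_compact)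
    have i: "integrable (lebesgue_on K) w" using lw K by (simp add: locally_integrable_def)
    have "w' \<in> borel_measurable (lebesgue_on K)" using measurable_restrict_mono[OF m] K by blast
    moreover have "AE x in lebesgue_on K. w x = w' x"
      using ae K s by (auto simp: AE_restrict_space_iff elim!: eventually_mono)
    ultimately show "integrable (lebesgue_on K) w'" using i by (rule integrable_cong_AE_imp[rotated])
  qed
  show ?thesis
    unfolding is_weak_grad_def
  proof (intro conjI ballI l)
    show "locally_integrable \<Omega> g" using w by (simp add: is_weak_grad_def)
    fix \<psi> assume \<psi>: "\<psi> \<in> test_functions \<Omega>"
    have "(LINT x|lebesgue_on \<Omega>. w' x *\<^sub>R grad \<psi> x) = (LINT x|lebesgue_on \<Omega>. w x *\<^sub>R grad \<psi> x)"
    proof (rule integral_cong_AE)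
      show "(\<lambda>x. w' x *\<^sub>R grad \<psi> x) \<in> borel_measurable (lebesgue_on \<Omega>)"
        by (rule borel_measurable_integrable[OF test_function_integrable(1)[OF \<Omega> \<psi> l]])
      show "(\<lambda>x. w x *\<^sub>R grad \<psi> x) \<in> borel_measurable (lebesgue_on \<Omega>)"
        by (rule borel_measurable_integrable[OF test_function_integrable(1)[OF \<Omega> \<psi> lw]])
      show "AE x in lebesgue_on \<Omega>. w' x *\<^sub>R grad \<psi> x = w x *\<^sub>R grad \<psi> x"
        unfolding AE_lebesgue_on_iff[OF \<Omega>] using ae by eventually_elim auto
    qed
    then show "(LINT x|lebesgue_on \<Omega>. w' x *\<^sub>R grad \<psi> x) = - (LINT x|lebesgue_on \<Omega>. \<psi> x *\<^sub>R g x)"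
      using w \<psi> by (simp add: is_weak_grad_def)
  qed
qed

lemma W2_continuous_representative:
  assumes \<Omega>: "open \<Omega>" "bounded \<Omega>" and gb: "\<And>x. x \<in> frontier \<Omega> \<Longrightarrow> graph_boundary_at lipschitz_fun \<Omega> x"
    and r: "2 \<le> r" and w: "w \<in> W2 r \<Omega>"
  obtains w' where "continuous_on (closure \<Omega>) w'" "AE x in lebesgue. x \<in> \<Omega> \<longrightarrow> w' x = w x"
proof (rule continuous_representative[OF \<Omega> gb])
  have w1: "w \<in> W1 r \<Omega>" and w2: "(\<lambda>x. wgrad \<Omega> w x $ i) \<in> W1 r \<Omega>" for i using w by (auto simp: W2_def)
  note I = L2f_integrable[OF \<Omega> Lspace_L2f[OF \<Omega> r]]
  show "is_weak_grad \<Omega> w (wgrad \<Omega> w)" by (rule W1_weak_grad[OF w1])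
  show "integrable (lebesgue_on \<Omega>) w" "integrable (lebesgue_on \<Omega>) (wgrad \<Omega> w)"
    using w1 by (auto simp: W1_def intro: I)
  show "is_weak_grad \<Omega> (\<lambda>x. wgrad \<Omega> w x $ i) (wgrad \<Omega> (\<lambda>x. wgrad \<Omega> w x $ i))" for i
    by (rule W1_weak_grad[OF w2])
  show "integrable (lebesgue_on \<Omega>) (wgrad \<Omega> (\<lambda>x. wgrad \<Omega> w x $ i))" for i
    using w2[of i] by (auto simp: W1_def intro: I)
qed (use that in blast)

text \<open>The gradient chosen for a difference is another weak gradient of it, so uniqueness gives
  linearity almost everywhere; completeness of the measure transfers measurability.\<close>

lemma wgrad_diff:
  assumes \<Omega>: "open \<Omega>" and w: "is_weak_grad \<Omega> w g" "is_weak_grad \<Omega> w' g'"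
    and m: "g \<in> borel_measurable (lebesgue_on \<Omega>)" "g' \<in> borel_measurable (lebesgue_on \<Omega>)"
  shows "AE x in lebesgue_on \<Omega>. wgrad \<Omega> (\<lambda>x. w x - w' x) x = g x - g' x"
    "wgrad \<Omega> (\<lambda>x. w x - w' x) \<in> borel_measurable (lebesgue_on \<Omega>)"
proof -
  note d = is_weak_grad_diff[OF \<Omega> w]
  have "is_weak_grad \<Omega> (\<lambda>x. w x - w' x) (wgrad \<Omega> (\<lambda>x. w x - w' x))"
    unfolding wgrad_def using d by (rule someI[of "is_weak_grad \<Omega> (\<lambda>x. w x - w' x)"])
  from weak_grad_unique[OF \<Omega> d this]
  have ae: "AE x in lebesgue. x \<in> \<Omega> \<longrightarrow> g x - g' x = wgrad \<Omega> (\<lambda>x. w x - w' x) x" .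
  show "wgrad \<Omega> (\<lambda>x. w x - w' x) \<in> borel_measurable (lebesgue_on \<Omega>)"
    by (rule borel_measurable_lebesgue_on_AE_cong[OF \<Omega> borel_measurable_diff[OF m] ae])
  show "AE x in lebesgue_on \<Omega>. wgrad \<Omega> (\<lambda>x. w x - w' x) x = g x - g' x"
    unfolding AE_lebesgue_on_iff[OF \<Omega>] using ae by eventually_elim auto
qed

section \<open>The error of the discrete adjoint state\<close>

context triangulated_domain
begin

abbreviation "M\<Omega> \<equiv> lebesgue_on \<Omega>"

lemma Yh_L2f:
  assumes "q \<in> Yh \<Omega> \<T>"
  shows "L2f M\<Omega> q" "L2f M\<Omega> (wgrad \<Omega> q)" "is_weak_grad \<Omega> q (wgrad \<Omega> q)"
  using Yh_W1_infinity[OF assms] W1_weak_grad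
  by (auto simp: W1_def intro: Lspace_L2f[OF open_domain bounded_domain, of \<infinity>])

lemma Yh_0_poincare:
  assumes q: "q \<in> Yh_0 \<Omega> \<T>" and R: "R \<ge> 0" "\<And>x. x \<in> closure \<Omega> \<Longrightarrow> norm x \<le> R"
  shows "n2 M\<Omega> q \<le> 2 * R * n2 M\<Omega> (wgrad \<Omega> q)"
proof -
  have qY: "q \<in> Yh \<Omega> \<T>" and q0: "\<And>x. x \<in> frontier \<Omega> \<Longrightarrow> q x = 0" using q by (auto simp: Yh_0_iff)
  obtain g L where g: "\<And>K x. K \<in> \<T> \<Longrightarrow> x \<in> interior K \<Longrightarrow> (q has_derivative (\<lambda>v. g x \<bullet> v)) (at x)"
    "g \<in> borel_measurable borel" "\<And>x. norm (g x) \<le> L" "L \<ge> 0"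
    "\<And>K x y. K \<in> \<T> \<Longrightarrow> x \<in> K \<Longrightarrow> y \<in> K \<Longrightarrow> \<bar>q x - q y\<bar> \<le> L * norm (x - y)"
    using Yh_gradientE[OF qY] by blast
  have "g \<in> borel_measurable lebesgue" using g(2) by (intro measurable_completion) simp
  then have gm: "g \<in> borel_measurable M\<Omega>" by (rule measurable_restrict_space1)
  have "n2 M\<Omega> (wgrad \<Omega> q) = n2 M\<Omega> g"
    using Yh_L2f(2)[OF qY] gm wgrad_AE[OF Yh_is_weak_grad[OF qY g]]
    by (intro n2_cong_AE) (auto simp: L2f_def AE_lebesgue_on_iff[OF open_domain])
  moreover have "(n2 M\<Omega> q)\<^sup>2 \<le> (2 * R * n2 M\<Omega> g)\<^sup>2"
    using poincare_Yh(1)[OF qY q0 g R] by (simp add: n2_power2 power_mult_distrib)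
  ultimately show ?thesis using R(1) n2_nonneg[of M\<Omega> g] by (auto intro: power2_le_imp_le)
qed

lemma Yh_0_W1_0:
  assumes "q \<in> Yh_0 \<Omega> \<T>"
  shows "q \<in> W1_0 2 \<Omega>"
proof -
  have "q \<in> Yh \<Omega> \<T>" "zero_trace \<Omega> q" using assms by (auto simp: Yh_0_def W1_0_def)
  then show ?thesis using Yh_L2f[of q] by (auto simp: W1_0_def W1_def Lspace_2)
qed

lemma zero_in_Yh: "(\<lambda>_. 0) \<in> Yh \<Omega> \<T>"
  unfolding Yh_def by (auto intro!: exI[of _ 0])

lemma W2_boundary_values:
  assumes r: "2 \<le> r" "w \<in> Lspace r \<Omega>" and c: "continuous_on (closure \<Omega>) w'" "AE x in lebesgue. x \<in> \<Omega> \<longrightarrow> w' x = w x"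
    and z: "zero_trace \<Omega> w" and x: "x \<in> frontier \<Omega>"
  shows "w' x = 0"
  using zero_trace_iff_zero_on_frontier[OF open_domain bounded_domain lipschitz_boundary c] r(2) z x
  by (auto simp: Lspace_def)

text \<open>The states enter through bounds and boundary values. \<open>Y\<close> bounds the state
  and its gradient, \<open>G\<close> the discrete gradient as well, and \<open>m\<close> is the
  square root of the area of \<open>\<Omega>\<close>. The factor 2 R is the Poincare constant of
  discrete functions, and 4 R the factor in the pointwise bound of \<open>y - yh\<close>; with
  \<open>m\<close> they make up 8 R^2 m.\<close>

lemma adjoint_error:
  fixes G :: real
  defines "\<alpha> \<equiv> 1 / (sqrt (1 + G\<^sup>2)) ^ 3" and "m \<equiv> n2 M\<Omega> (\<lambda>_. 1 :: real)"
  assumes R: "R \<ge> 0" "\<And>x. x \<in> closure \<Omega> \<Longrightarrow> norm x \<le> R"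
    and p: "2 < p" and v: "v \<in> W2 (ennreal p) \<Omega>" and yd: "yd \<in> Lspace 2 \<Omega>"
    and y: "y \<in> state_space p \<Omega> v" "AE x in M\<Omega>. \<bar>y x\<bar> \<le> Y" "AE x in M\<Omega>. norm (wgrad \<Omega> y x) \<le> Y" "0 \<le> Y" "Y \<le> G"
    and yh: "(\<lambda>x. yh x - lagrange_interp \<Omega> \<T> v x) \<in> Yh_0 \<Omega> \<T>" "Lnorm \<infinity> \<Omega> (wgrad \<Omega> yh) \<le> G"
    and adj: "adjoint_eq \<Omega> yd y \<phi>" and dadj: "discrete_adjoint_eq \<Omega> \<T> yd yh \<phi>h"
    and \<epsilon>: "seminorm_W1 2 \<Omega> (\<lambda>x. \<phi> x - lagrange_interp \<Omega> \<T> \<phi> x) \<le> \<epsilon>"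
  shows "seminorm_W1 2 \<Omega> (\<lambda>x. \<phi> x - \<phi>h x) \<le>
    (1 + 2 / \<alpha> + 6 * (1 + 2 / \<alpha>) * (Y + G) / \<alpha>) * \<epsilon>
    + ((6 * ((2 * R * (Y * m + n2 M\<Omega> yd)) / \<alpha>) + 8 * R\<^sup>2 * m) / \<alpha>) * seminorm_W1 \<infinity> \<Omega> (\<lambda>x. y x - yh x)"
    (is "_ \<le> ?K1 * \<epsilon> + ?K2 * ?W") and "0 \<le> seminorm_W1 \<infinity> \<Omega> (\<lambda>x. y x - yh x)"
proof -
  note \<Omega> = open_domain bounded_domain
  have p2: "2 \<le> ennreal p" using p by (metis ennreal_leI ennreal_numeral less_imp_le zero_le_numeral)
  have yW: "y \<in> W2 (ennreal p) \<Omega>" and yv: "(\<lambda>x. y x - v x) \<in> W1_0 \<infinity> \<Omega>" using y(1) by (auto simp: state_space_def)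
  obtain y' where y': "continuous_on (closure \<Omega>) y'" "AE x in lebesgue. x \<in> \<Omega> \<longrightarrow> y' x = y x"
    using W2_continuous_representative[OF \<Omega> lipschitz_boundary p2 yW] by blast
  obtain v' where v': "continuous_on (closure \<Omega>) v'" "AE x in lebesgue. x \<in> \<Omega> \<longrightarrow> v' x = v x"
    using W2_continuous_representative[OF \<Omega> lipschitz_boundary p2 v] by blast
  have \<phi>W: "\<phi> \<in> W2 2 \<Omega>" and \<phi>0: "\<phi> \<in> W1_0 2 \<Omega>"
    and adj': "\<And>z. z \<in> W1_0 2 \<Omega> \<Longrightarrow> (LINT x|M\<Omega>. (Amat \<Omega> y x *v wgrad \<Omega> \<phi> x) \<bullet> wgrad \<Omega> z x) = (LINT x|M\<Omega>. (y x - yd x) * z x)"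
    using adj by (auto simp: adjoint_eq_def neg_div_eq_def)
  obtain \<phi>' where \<phi>': "continuous_on (closure \<Omega>) \<phi>'" "AE x in lebesgue. x \<in> \<Omega> \<longrightarrow> \<phi>' x = \<phi> x"
    using W2_continuous_representative[OF \<Omega> lipschitz_boundary order_refl \<phi>W] by blast
  have \<phi>h: "\<phi>h \<in> Yh_0 \<Omega> \<T>"
    and dadj': "\<And>z. z \<in> Yh_0 \<Omega> \<T> \<Longrightarrow> (LINT x|M\<Omega>. wgrad \<Omega> z x \<bullet> (Amat \<Omega> yh x *v wgrad \<Omega> \<phi>h x)) = (LINT x|M\<Omega>. (yh x - yd x) * z x)"
    using dadj by (auto simp: discrete_adjoint_eq_def)
  have \<phi>hY: "\<phi>h \<in> Yh \<Omega> \<T>" using \<phi>h by (simp add: Yh_0_def)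
  define P where "P = lagrange_interp \<Omega> \<T> \<phi>"
  have PY: "P \<in> Yh \<Omega> \<T>" and Pn: "\<And>K a. K \<in> \<T> \<Longrightarrow> a extreme_point_of K \<Longrightarrow> P a = \<phi>' a"
    unfolding P_def using lagrange_interp_spec[OF \<phi>'] by blast+
  have \<phi>z: "\<phi>' x = 0" if "x \<in> frontier \<Omega>" for x
    by (rule W2_boundary_values[OF order_refl _ \<phi>' _ that]) (use \<phi>0 in \<open>auto simp: W1_0_def W1_def\<close>)
  \<comment> \<open>The interpolant is an admissible discrete test function because the trace of
    \<phi> vanishes pointwise, in particular at the boundary vertices.\<close>
  have P0: "P \<in> Yh_0 \<Omega> \<T>"
    unfolding Yh_0_iff using PY Yh_zero_on_frontier[OF PY] Pn \<phi>z by auto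
  have IY: "lagrange_interp \<Omega> \<T> v \<in> Yh \<Omega> \<T>"
    and In: "\<And>K a. K \<in> \<T> \<Longrightarrow> a extreme_point_of K \<Longrightarrow> lagrange_interp \<Omega> \<T> v a = v' a"
    using lagrange_interp_spec[OF v'] by blast+
  \<comment> \<open>\<open>yh\<close> is the difference of \<open>yh - I v\<close> and
    \<open>0 - I v\<close>, with \<open>I v\<close> the interpolant of \<open>v\<close>, so closure
    under differences suffices.\<close>
  have yhY: "yh \<in> Yh \<Omega> \<T>"
    using Yh_diff[OF _ Yh_diff[OF zero_in_Yh IY], of "\<lambda>x. yh x - lagrange_interp \<Omega> \<T> v x"] yh(1)
    by (simp add: Yh_0_def)
  define gy gh g\<phi> gP gf where "gy = wgrad \<Omega> y" and "gh = wgrad \<Omega> yh" and "g\<phi> = wgrad \<Omega> \<phi>"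
    and "gP = wgrad \<Omega> P" and "gf = wgrad \<Omega> \<phi>h"
  have yW1: "y \<in> W1 (ennreal p) \<Omega>" using yW by (simp add: W2_def)
  have Ly: "L2f M\<Omega> y" "L2f M\<Omega> gy"
    using yW1 by (auto simp: W1_def gy_def intro: Lspace_L2f[OF \<Omega> p2])
  have wy: "is_weak_grad \<Omega> y gy" unfolding gy_def by (rule W1_weak_grad[OF yW1])
  have L\<phi>: "L2f M\<Omega> \<phi>" "L2f M\<Omega> g\<phi>" using \<phi>0 by (auto simp: W1_0_def W1_def Lspace_2 g\<phi>_def)
  have w\<phi>: "is_weak_grad \<Omega> \<phi> g\<phi>" unfolding g\<phi>_def using \<phi>0 by (auto simp: W1_0_def intro: W1_weak_grad)
  note Lh = Yh_L2f[OF yhY, folded gh_def] and LP = Yh_L2f[OF PY, folded gP_def] and Lf = Yh_L2f[OF \<phi>hY, folded gf_def]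
  have Lyd: "L2f M\<Omega> yd" using yd by (simp add: Lspace_2)
  have meas: "gy \<in> borel_measurable M\<Omega>" "gh \<in> borel_measurable M\<Omega>" "g\<phi> \<in> borel_measurable M\<Omega>"
    "gP \<in> borel_measurable M\<Omega>" "gf \<in> borel_measurable M\<Omega>"
    using Ly L\<phi> Lh LP Lf by (auto simp: L2f_def)
  have Gy: "AE x in M\<Omega>. norm (gy x) \<le> G" using y(3) by eventually_elim (use y(5) in \<open>simp add: gy_def\<close>)
  have Gh: "AE x in M\<Omega>. norm (gh x) \<le> G"
  proof -
    have "gh \<in> Lspace \<infinity> \<Omega>" using Yh_W1_infinity[OF yhY] by (simp add: W1_def gh_def)
    from Lnorm_infinity_AE(1)[OF this] show ?thesis by eventually_elim (use yh(2) in \<open>simp add: gh_def\<close>)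
  qed
  note dw = wgrad_diff[OF open_domain wy Lh(3) meas(1,2)]
  have dLs: "wgrad \<Omega> (\<lambda>x. y x - yh x) \<in> Lspace \<infinity> \<Omega>"
    and W0: "AE x in M\<Omega>. norm (wgrad \<Omega> (\<lambda>x. y x - yh x) x) \<le> Y + G"
  proof -
    show ae: "AE x in M\<Omega>. norm (wgrad \<Omega> (\<lambda>x. y x - yh x) x) \<le> Y + G"
      using dw(1) y(3) Gh
    proof eventually_elim
      case (elim x)
      have "norm (gy x - gh x) \<le> norm (gy x) + norm (gh x)" by (rule norm_triangle_ineq4)
      then show ?case using elim by (simp add: gy_def)
    qed
    then show "wgrad \<Omega> (\<lambda>x. y x - yh x) \<in> Lspace \<infinity> \<Omega>" unfolding Lspace_def using dw(2) by auto
  qed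
  have W: "AE x in M\<Omega>. norm (gy x - gh x) \<le> ?W" "0 \<le> ?W" "?W \<le> Y + G"
  proof -
    note A = Lnorm_infinity_AE[OF dLs]
    show "AE x in M\<Omega>. norm (gy x - gh x) \<le> ?W"
      unfolding seminorm_W1_def using A(1) dw(1) by eventually_elim simp
    show "0 \<le> ?W" unfolding seminorm_W1_def by (rule A(2))
    show "?W \<le> Y + G" unfolding seminorm_W1_def using y(4,5) by (intro Lnorm_infinity_le[OF W0]) linarith
  qed
  \<comment> \<open>The continuous version of the state error; only for it do values at vertices
    make sense.\<close>
  define w' where "w' = (\<lambda>x. y' x - yh x)"
  have cw: "continuous_on (closure \<Omega>) w'" unfolding w'_def by (intro continuous_intros y' Yh_continuous yhY)
  have w'm: "w' \<in> borel_measurable M\<Omega>" by (rule continuous_on_closure_measurable[OF open_domain cw])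
  have w'ae: "AE x in lebesgue. x \<in> \<Omega> \<longrightarrow> w' x = y x - yh x"
    using y'(2) by eventually_elim (simp add: w'_def)
  have w'g: "is_weak_grad \<Omega> w' (\<lambda>x. gy x - gh x)"
    by (rule is_weak_grad_cong_AE[OF open_domain is_weak_grad_diff[OF open_domain wy Lh(3)] w'm w'ae])
  have Ld: "L2f M\<Omega> (\<lambda>x. y x - yh x)" by (rule L2f_diff[OF Ly(1) Lh(1)])
  have w'i: "integrable M\<Omega> w'"
    by (rule integrable_cong_AE_imp[OF L2f_integrable[OF \<Omega> Ld] w'm])
      (use w'ae in \<open>auto simp: AE_lebesgue_on_iff[OF open_domain] elim: eventually_mono\<close>)
  have gi: "integrable M\<Omega> (\<lambda>x. gy x - gh x)" by (rule L2f_integrable[OF \<Omega> L2f_diff[OF Ly(2) Lh(2)]])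
  \<comment> \<open>On the frontier the continuous versions of \<open>y\<close> and \<open>v\<close>
    agree, and \<open>yh\<close> agrees with the interpolant of \<open>v\<close>; at a vertex this
    interpolant takes the value of \<open>v\<close>. At other boundary points the state error may be
    nonzero.\<close>
  have vert: "w' a = 0" if K: "K \<in> \<T>" "a extreme_point_of K" "a \<in> frontier \<Omega>" for K a
  proof -
    have "y' a - v' a = 0"
    proof (rule W2_boundary_values[of \<infinity> "\<lambda>x. y x - v x" "\<lambda>x. y' x - v' x"])
      show "(\<lambda>x. y x - v x) \<in> Lspace \<infinity> \<Omega>" "zero_trace \<Omega> (\<lambda>x. y x - v x)" using yv by (auto simp: W1_0_def W1_def)
      show "continuous_on (closure \<Omega>) (\<lambda>x. y' x - v' x)" by (intro continuous_intros y' v')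
      show "AE x in lebesgue. x \<in> \<Omega> \<longrightarrow> y' x - v' x = y x - v x" using y'(2) v'(2) by eventually_elim auto
    qed (use K in auto)
    moreover have "yh a - lagrange_interp \<Omega> \<T> v a = 0" using yh(1) K(3) by (simp add: Yh_0_iff)
    ultimately show ?thesis using In[OF K(1,2)] by (simp add: w'_def)
  qed
  have w'b: "\<bar>w' x\<bar> \<le> 4 * R * ?W" if "x \<in> \<Omega>" for x
  proof (rule bound_from_boundary_vertices[OF W(2) _ vert R(2) that])
    show "\<bar>w' x - w' y\<bar> \<le> ?W * norm (x - y)" if "K \<in> \<T>" "x \<in> K" "y \<in> K" for K x y
      using weak_grad_bound_lipschitz_on_cell[OF cw w'i w'g gi _ W(2) that] W(1)
      by (simp add: AE_lebesgue_on_iff[OF open_domain])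
  qed
  have nd: "n2 M\<Omega> (\<lambda>x. y x - yh x) \<le> (4 * R * ?W) * m"
    unfolding m_def
  proof (rule L2f_dominated(2)[OF L2f_const[OF \<Omega>]])
    show "(\<lambda>x. y x - yh x) \<in> borel_measurable M\<Omega>" using Ld by (simp add: L2f_def)
    show "0 \<le> 4 * R * ?W" using R(1) W(2) by simp
    show "AE x in M\<Omega>. norm (y x - yh x) \<le> 4 * R * ?W * norm (1 :: real)"
      unfolding AE_lebesgue_on_iff[OF open_domain] using w'ae by eventually_elim (use w'b in force)
  qed
  have nyd: "n2 M\<Omega> (\<lambda>x. y x - yd x) \<le> Y * m + n2 M\<Omega> yd"
  proof -
    have "n2 M\<Omega> y \<le> Y * m" unfolding m_def
      by (rule L2f_dominated(2)[OF L2f_const[OF \<Omega>]]) (use Ly(1) y(2,4) in \<open>auto simp: L2f_def\<close>)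
    moreover have "n2 M\<Omega> (\<lambda>x. - yd x) = n2 M\<Omega> yd" by (simp add: n2_def)
    moreover have "L2f M\<Omega> (\<lambda>x. - yd x)" using Lyd by (simp add: L2f_def)
    ultimately show ?thesis using n2_triangle[OF Ly(1), of "\<lambda>x. - yd x"] by simp
  qed
  have Lyyd: "L2f M\<Omega> (\<lambda>x. y x - yd x)" by (rule L2f_diff[OF Ly(1) Lyd])
  have Lhyd: "L2f M\<Omega> (\<lambda>x. yh x - yd x)" by (rule L2f_diff[OF Lh(1) Lyd])
  have m0: "0 \<le> m" unfolding m_def by (rule n2_nonneg)
  define a where "a = 2 * R * (Y * m + n2 M\<Omega> yd)"
  have a0: "0 \<le> a" unfolding a_def using R(1) y(4) m0 n2_nonneg[of M\<Omega> yd] by simp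
  have TP: "(LINT x|M\<Omega>. amul (gy x) (g\<phi> x) \<bullet> gP x) \<le> a * n2 M\<Omega> gP"
  proof -
    have "(LINT x|M\<Omega>. amul (gy x) (g\<phi> x) \<bullet> gP x) = (LINT x|M\<Omega>. (y x - yd x) \<bullet> P x)"
      using adj'[OF Yh_0_W1_0[OF P0]] by (simp add: Amat_mult gy_def g\<phi>_def gP_def)
    also have "\<dots> \<le> n2 M\<Omega> (\<lambda>x. y x - yd x) * n2 M\<Omega> P" using L2f_Cauchy_Schwarz[OF Lyyd LP(1)] by linarith
    also have "\<dots> \<le> (Y * m + n2 M\<Omega> yd) * (2 * R * n2 M\<Omega> gP)"
      using Yh_0_poincare[OF P0 R] nyd y(4) m0 n2_nonneg[of M\<Omega> yd]
      by (intro mult_mono) (auto simp: gP_def n2_nonneg)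
    finally show ?thesis by (simp add: a_def algebra_simps)
  qed
  define z where "z = (\<lambda>x. P x - \<phi>h x)"
  have z0: "z \<in> Yh_0 \<Omega> \<T>" unfolding z_def by (rule Yh_0_diff[OF P0 \<phi>h])
  have zY: "z \<in> Yh \<Omega> \<T>" using z0 by (simp add: Yh_0_def)
  note dz = wgrad_diff[OF open_domain LP(3) Lf(3) meas(4,5), folded z_def]
  have nz: "n2 M\<Omega> (wgrad \<Omega> z) = n2 M\<Omega> (\<lambda>x. gP x - gf x)"
    by (rule n2_cong_AE[OF dz(2) borel_measurable_diff[OF meas(4,5)] dz(1)])
  \<comment> \<open>The difference of the two gradients is replaced by the gradient chosen for
    \<open>z\<close>, the function with which both equations are tested.\<close>
  have swap: "(LINT x|M\<Omega>. amul (g x) (\<xi> x) \<bullet> (gP x - gf x)) = (LINT x|M\<Omega>. amul (g x) (\<xi> x) \<bullet> wgrad \<Omega> z x)"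
    if "g \<in> borel_measurable M\<Omega>" "\<xi> \<in> borel_measurable M\<Omega>" for g \<xi>
  proof (rule integral_cong_AE)
    have am: "(\<lambda>x. amul (g x) (\<xi> x)) \<in> borel_measurable M\<Omega>" by (rule amul_measurable[OF that])
    show "(\<lambda>x. amul (g x) (\<xi> x) \<bullet> (gP x - gf x)) \<in> borel_measurable M\<Omega>"
      by (rule borel_measurable_inner[OF am borel_measurable_diff[OF meas(4,5)]])
    show "(\<lambda>x. amul (g x) (\<xi> x) \<bullet> wgrad \<Omega> z x) \<in> borel_measurable M\<Omega>"
      by (rule borel_measurable_inner[OF am dz(2)])
    show "AE x in M\<Omega>. amul (g x) (\<xi> x) \<bullet> (gP x - gf x) = amul (g x) (\<xi> x) \<bullet> wgrad \<Omega> z x"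
      using dz(1) by eventually_elim simp
  qed
  have Tz: "(LINT x|M\<Omega>. amul (gy x) (g\<phi> x) \<bullet> (gP x - gf x)) - (LINT x|M\<Omega>. amul (gh x) (gf x) \<bullet> (gP x - gf x))
      \<le> (8 * R\<^sup>2 * m) * ?W * n2 M\<Omega> (\<lambda>x. gP x - gf x)"
  proof -
    have 1: "(LINT x|M\<Omega>. amul (gy x) (g\<phi> x) \<bullet> (gP x - gf x)) = (LINT x|M\<Omega>. (y x - yd x) \<bullet> z x)"
      unfolding swap[OF meas(1,3)] using adj'[OF Yh_0_W1_0[OF z0]] by (simp add: Amat_mult gy_def g\<phi>_def)
    have 2: "(LINT x|M\<Omega>. amul (gh x) (gf x) \<bullet> (gP x - gf x)) = (LINT x|M\<Omega>. (yh x - yd x) \<bullet> z x)"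
      unfolding swap[OF meas(2,5)] using dadj'[OF z0] by (simp add: Amat_mult gh_def gf_def inner_commute)
    have "(LINT x|M\<Omega>. (y x - yd x) \<bullet> z x) - (LINT x|M\<Omega>. (yh x - yd x) \<bullet> z x)
        = (LINT x|M\<Omega>. (y x - yd x) \<bullet> z x - (yh x - yd x) \<bullet> z x)"
      by (rule Bochner_Integration.integral_diff[symmetric, OF L2f_inner_integrable[OF Lyyd Yh_L2f(1)[OF zY]]
            L2f_inner_integrable[OF Lhyd Yh_L2f(1)[OF zY]]])
    also have "\<dots> = (LINT x|M\<Omega>. (y x - yh x) \<bullet> z x)" by (simp add: algebra_simps)
    also have "\<dots> \<le> n2 M\<Omega> (\<lambda>x. y x - yh x) * n2 M\<Omega> z"
      using L2f_Cauchy_Schwarz[OF Ld Yh_L2f(1)[OF zY]] by linarith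
    also have "\<dots> \<le> ((4 * R * ?W) * m) * (2 * R * n2 M\<Omega> (wgrad \<Omega> z))"
      using nd Yh_0_poincare[OF z0 R] R(1) W(2) m0 by (intro mult_mono) (auto simp: n2_nonneg)
    finally show ?thesis unfolding 1 2 nz by (simp add: power2_eq_square mult_ac)
  qed
  have \<epsilon>': "n2 M\<Omega> (\<lambda>x. g\<phi> x - gP x) \<le> \<epsilon>"
  proof -
    note d = wgrad_diff[OF open_domain w\<phi> LP(3) meas(3,4)]
    have "n2 M\<Omega> (wgrad \<Omega> (\<lambda>x. \<phi> x - P x)) = n2 M\<Omega> (\<lambda>x. g\<phi> x - gP x)"
      by (rule n2_cong_AE[OF d(2) borel_measurable_diff[OF meas(3,4)] d(1)])
    then show ?thesis using \<epsilon> by (simp add: seminorm_W1_def Lnorm_2 P_def)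
  qed
  have "n2 M\<Omega> (\<lambda>x. g\<phi> x - gf x) \<le> ?K1 * \<epsilon> + ?K2 * ?W"
    unfolding \<alpha>_def a_def[symmetric]
    by (rule coercive_estimate[OF meas(1,2) L\<phi>(2) LP(2) Lf(2) Gy Gh W \<epsilon>' a0 _ TP Tz])
      (use R(1) m0 in simp)
  moreover have "n2 M\<Omega> (wgrad \<Omega> (\<lambda>x. \<phi> x - \<phi>h x)) = n2 M\<Omega> (\<lambda>x. g\<phi> x - gf x)"
  proof -
    note d = wgrad_diff[OF open_domain w\<phi> Lf(3) meas(3,5)]
    show ?thesis by (rule n2_cong_AE[OF d(2) borel_measurable_diff[OF meas(3,5)] d(1)])
  qed
  ultimately show "seminorm_W1 2 \<Omega> (\<lambda>x. \<phi> x - \<phi>h x) \<le> ?K1 * \<epsilon> + ?K2 * ?W"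
    by (simp add: seminorm_W1_def Lnorm_2)
  show "0 \<le> ?W" by (rule W(2))
qed

end

section \<open>A constant uniform over meshes and controls\<close>

theorem lemma3p8:
  fixes \<Omega> E :: "plane set" and p B1 B2 B3 C\<^sub>S C\<^sub>\<Omega> \<theta> h\<^sub>0 :: real
    and v yd :: "plane \<Rightarrow> real"
    and U3 :: "(plane \<Rightarrow> real) set" and S :: "(plane \<Rightarrow> real) \<Rightarrow> plane \<Rightarrow> real"
    and \<TT> :: "plane set set set"
  assumes domain: "open \<Omega>" "bounded \<Omega>" "finite E" "C11_boundary_off E \<Omega>"
    and exponent: "2 < p"
    and data: "v \<in> W2 (ennreal p) \<Omega>" "yd \<in> Lspace 2 \<Omega>"
    and embedding: "0 < C\<^sub>S"
      "\<And>w. w \<in> W2 (ennreal p) \<Omega> \<Longrightarrow>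
         w \<in> W1 \<infinity> \<Omega> \<and> norm_W1 \<infinity> \<Omega> w \<le> C\<^sub>S * norm_W2 (ennreal p) \<Omega> w"
    and control_to_state: "open_in_Lspace (ennreal p) \<Omega> U3" "(\<lambda>_. 0) \<in> U3"
      "is_control_to_state_map p \<Omega> v U3 S"
    and constants: "1 < B1" "0 < C\<^sub>\<Omega>" "0 < B2" "0 < B3"
    and fixed_point: "\<And>u. u \<in> small_data p \<Omega> v B1 C\<^sub>\<Omega> B2 B3 \<Longrightarrow>
         is_contraction_on_ball p \<Omega> v u B1 \<and>
         (\<exists>y\<in>state_ball p \<Omega> v B1. state_eq p \<Omega> v u y) \<and>
         (\<forall>y\<in>state_ball p \<Omega> v B1. state_eq p \<Omega> v u y \<longrightarrow>
            C\<^sub>S * norm_W2 (ennreal p) \<Omega> y \<le> 1 / (B1 * sqrt (1 + C\<^sub>S\<^sup>2 * B1\<^sup>2)))"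
    and admissible: "0 < \<theta>"
      "admissible_controls p \<Omega> \<theta> \<subseteq> small_data p \<Omega> v B1 C\<^sub>\<Omega> B2 B3 \<inter> U3"
    and meshes: "\<And>\<T>. \<T> \<in> \<TT> \<Longrightarrow> triangulation_of \<Omega> \<T>" "quasi_uniform \<TT>"
    and interpolation: "\<And>r. 1 \<le> r \<Longrightarrow> \<exists>C. \<forall>\<T>\<in>\<TT>. \<forall>w\<in>W2 r \<Omega>.
         seminorm_W1 r \<Omega> (\<lambda>x. w x - lagrange_interp \<Omega> \<T> w x) \<le> C * mesh_size \<T> * seminorm_W2 r \<Omega> w"
    and discrete_state: "0 < h\<^sub>0"
      "\<And>\<T> u\<^sub>h. \<T> \<in> \<TT> \<Longrightarrow> mesh_size \<T> < h\<^sub>0 \<Longrightarrow> u\<^sub>h \<in> Yh \<Omega> \<T> \<inter> admissible_controls p \<Omega> \<theta> \<Longrightarrow>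
         (\<exists>y\<^sub>h. discrete_state_eq \<Omega> \<T> v u\<^sub>h y\<^sub>h) \<and>
         (\<forall>y\<^sub>h y\<^sub>h'. discrete_state_eq \<Omega> \<T> v u\<^sub>h y\<^sub>h \<and> discrete_state_eq \<Omega> \<T> v u\<^sub>h y\<^sub>h' \<longrightarrow>
            (\<forall>x\<in>closure \<Omega>. y\<^sub>h x = y\<^sub>h' x)) \<and>
         (\<forall>y\<^sub>h. discrete_state_eq \<Omega> \<T> v u\<^sub>h y\<^sub>h \<longrightarrow> Lnorm \<infinity> \<Omega> (wgrad \<Omega> y\<^sub>h) \<le> 3 * C\<^sub>S * B1)"
  shows "\<exists>C>0. \<forall>\<T>\<in>\<TT>. mesh_size \<T> < h\<^sub>0 \<longrightarrow>
     (\<forall>u\<in>admissible_controls p \<Omega> \<theta>. \<forall>u\<^sub>h\<in>Yh \<Omega> \<T> \<inter> admissible_controls p \<Omega> \<theta>.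
      \<forall>y y\<^sub>h \<phi> \<phi>\<^sub>h.
        state_eq p \<Omega> v u y \<longrightarrow> discrete_state_eq \<Omega> \<T> v u\<^sub>h y\<^sub>h \<longrightarrow>
        adjoint_eq \<Omega> yd y \<phi> \<longrightarrow> discrete_adjoint_eq \<Omega> \<T> yd y\<^sub>h \<phi>\<^sub>h \<longrightarrow>
        seminorm_W1 2 \<Omega> (\<lambda>x. \<phi> x - \<phi>\<^sub>h x)
          \<le> C * (mesh_size \<T> * norm_W2 2 \<Omega> \<phi> + seminorm_W1 \<infinity> \<Omega> (\<lambda>x. y x - y\<^sub>h x)))"
proof -
  have \<Omega>: "open \<Omega>" "bounded \<Omega>" by (rule domain)+
  have tri: "triangulated_domain \<Omega> \<T>" if "\<T> \<in> \<TT>" for \<T>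
    using domain meshes(1)[OF that] by unfold_locales (auto simp: C11_boundary_off_def)
  have "(1 :: ennreal) \<le> 2" by simp
  from interpolation[OF this] obtain C1 where C1: "\<forall>\<T>\<in>\<TT>. \<forall>w\<in>W2 2 \<Omega>.
      seminorm_W1 2 \<Omega> (\<lambda>x. w x - lagrange_interp \<Omega> \<T> w x) \<le> C1 * mesh_size \<T> * seminorm_W2 2 \<Omega> w" by blast
  have "bounded (closure \<Omega>)" by (rule bounded_closure[OF domain(2)])
  then obtain R0 where R0: "\<And>x. x \<in> closure \<Omega> \<Longrightarrow> norm x \<le> R0" unfolding bounded_iff by blast
  define R where "R = max R0 0"
  have R: "R \<ge> 0" "\<And>x. x \<in> closure \<Omega> \<Longrightarrow> norm x \<le> R" using R0 by (auto simp: R_def le_max_iff_disj)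
  \<comment> \<open>\<open>Y\<close> is what the embedding gives for states in the ball of radius
    \<open>B1\<close>; \<open>G\<close> is the bound on discrete gradients, and the larger of the
    two.\<close>
  define Y G where "Y = C\<^sub>S * B1" and "G = 3 * C\<^sub>S * B1"
  have Y: "0 \<le> Y" "Y \<le> G" using embedding(1) constants(1) by (auto simp: Y_def G_def)
  define \<alpha> where "\<alpha> = 1 / (sqrt (1 + G\<^sup>2)) ^ 3"
  define m where "m = n2 (lebesgue_on \<Omega>) (\<lambda>_. 1 :: real)"
  define K1 where "K1 = 1 + 2 / \<alpha> + 6 * (1 + 2 / \<alpha>) * (Y + G) / \<alpha>"
  define K2 where "K2 = (6 * ((2 * R * (Y * m + n2 (lebesgue_on \<Omega>) yd)) / \<alpha>) + 8 * R\<^sup>2 * m) / \<alpha>"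
  have \<alpha>: "0 \<le> \<alpha>" by (simp add: \<alpha>_def add_nonneg_nonneg)
  have K1: "0 \<le> K1" unfolding K1_def using \<alpha> Y by simp
  have K2: "0 \<le> K2" unfolding K2_def m_def using \<alpha> Y R(1)
    by (intro divide_nonneg_nonneg add_nonneg_nonneg mult_nonneg_nonneg n2_nonneg) auto
  \<comment> \<open>The interpolation estimate asserts no sign of its constant, but monotonicity
    below needs a nonnegative one.\<close>
  define C1' where "C1' = max C1 0"
  have C1': "C1 \<le> C1'" "0 \<le> C1'" by (auto simp: C1'_def)
  \<comment> \<open>The summand 1 makes the constant strictly positive.\<close>
  define C where "C = K1 * C1' + K2 + 1"
  have "0 \<le> K1 * C1'" by (rule mult_nonneg_nonneg[OF K1 C1'(2)])
  then have C: "0 < C" "K1 * C1' \<le> C" "K2 \<le> C" unfolding C_def using K2 by linarith+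
  show ?thesis
  proof (intro exI[of _ C] conjI C(1) ballI impI allI)
    fix \<T> u u\<^sub>h y y\<^sub>h \<phi> \<phi>\<^sub>h
    assume \<T>: "\<T> \<in> \<TT>" and h: "mesh_size \<T> < h\<^sub>0" and u: "u \<in> admissible_controls p \<Omega> \<theta>"
      and uh: "u\<^sub>h \<in> Yh \<Omega> \<T> \<inter> admissible_controls p \<Omega> \<theta>"
      and sy: "state_eq p \<Omega> v u y" and syh: "discrete_state_eq \<Omega> \<T> v u\<^sub>h y\<^sub>h"
      and adj: "adjoint_eq \<Omega> yd y \<phi>" and dadj: "discrete_adjoint_eq \<Omega> \<T> yd y\<^sub>h \<phi>\<^sub>h"
    interpret triangulated_domain \<Omega> \<T> by (rule tri[OF \<T>])
    have u': "u \<in> small_data p \<Omega> v B1 C\<^sub>\<Omega> B2 B3" "u \<in> U3" using u admissible(2) by auto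
    \<comment> \<open>The given state is not assumed to lie in the ball. Uniqueness for controls in
      \<open>U3\<close> identifies it almost everywhere with a solution in the ball, whose bounds on
      function and gradient it inherits.\<close>
    obtain y0 where y0: "y0 \<in> state_ball p \<Omega> v B1" "state_eq p \<Omega> v u y0" using fixed_point[OF u'(1)] by blast
    have S: "AE x in lebesgue_on \<Omega>. w x = S u x" if "state_eq p \<Omega> v u w" for w
      using control_to_state(3) u'(2) that unfolding is_control_to_state_map_def by blast
    have yy0: "AE x in lebesgue_on \<Omega>. y x = y0 x" using S[OF sy] S[OF y0(2)] by eventually_elim simp
    have y0W: "y0 \<in> W2 (ennreal p) \<Omega>" "norm_W2 (ennreal p) \<Omega> y0 \<le> B1"
      using y0(1) by (auto simp: state_ball_def state_space_def)
    have y0E: "y0 \<in> W1 \<infinity> \<Omega>" "norm_W1 \<infinity> \<Omega> y0 \<le> C\<^sub>S * norm_W2 (ennreal p) \<Omega> y0"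
      using embedding(2)[OF y0W(1)] by auto
    have "C\<^sub>S * norm_W2 (ennreal p) \<Omega> y0 \<le> Y" unfolding Y_def using y0W(2) embedding(1) by simp
    then have sumY: "Lnorm \<infinity> \<Omega> y0 + Lnorm \<infinity> \<Omega> (wgrad \<Omega> y0) \<le> Y"
      using y0E(2) by (simp only: norm_W1_def seminorm_W1_def)
    have Ls: "y0 \<in> Lspace \<infinity> \<Omega>" "wgrad \<Omega> y0 \<in> Lspace \<infinity> \<Omega>" using y0E(1) by (simp_all add: W1_def)
    note L0 = Lnorm_infinity_AE[OF Ls(1)] and L1 = Lnorm_infinity_AE[OF Ls(2)]
    have yW: "y \<in> W1 (ennreal p) \<Omega>" using sy by (auto simp: state_eq_def state_space_def W2_def)
    have ym: "y \<in> borel_measurable (lebesgue_on \<Omega>)" using yW by (auto simp: W1_def Lspace_def)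
    have "is_weak_grad \<Omega> y (wgrad \<Omega> y0)"
      by (rule is_weak_grad_cong_AE[OF domain(1) W1_weak_grad[OF y0E(1)] ym])
        (use yy0 in \<open>simp add: AE_lebesgue_on_iff[OF domain(1)]\<close>)
    then have gy: "AE x in lebesgue_on \<Omega>. wgrad \<Omega> y x = wgrad \<Omega> y0 x"
      using weak_grad_unique[OF domain(1) W1_weak_grad[OF yW]] by (simp add: AE_lebesgue_on_iff[OF domain(1)])
    have By: "AE x in lebesgue_on \<Omega>. \<bar>y x\<bar> \<le> Y"
      using yy0 L0(1) by eventually_elim (use sumY L1(2) in simp)
    have Bg: "AE x in lebesgue_on \<Omega>. norm (wgrad \<Omega> y x) \<le> Y"
      using gy L1(1) by eventually_elim (use sumY L0(2) in simp)
    have yh: "(\<lambda>x. y\<^sub>h x - lagrange_interp \<Omega> \<T> v x) \<in> Yh_0 \<Omega> \<T>" using syh by (simp add: discrete_state_eq_def)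
    have Gh: "Lnorm \<infinity> \<Omega> (wgrad \<Omega> y\<^sub>h) \<le> G" using discrete_state(2)[OF \<T> h uh] syh unfolding G_def by blast
    have \<phi>W: "\<phi> \<in> W2 2 \<Omega>" using adj by (simp add: adjoint_eq_def)
    have hm: "0 \<le> mesh_size \<T> * seminorm_W2 2 \<Omega> \<phi>" 
      "mesh_size \<T> * seminorm_W2 2 \<Omega> \<phi> \<le> mesh_size \<T> * norm_W2 2 \<Omega> \<phi>"
    proof -
      \<comment> \<open>The size of an empty mesh is an unspecified maximum, possibly negative. An
        empty mesh occurs only for empty \<open>\<Omega>\<close>, where the norms of \<phi> vanish
        and the claims hold anyway.\<close>
      have "0 \<le> mesh_size \<T> \<or> \<Omega> = {}"
      proof (cases "\<T> = {}")
        case True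
        then have "closure \<Omega> = {}" using Union_mesh by simp
        then show ?thesis by simp
      next
        case False
        then obtain K where K: "K \<in> \<T>" by blast
        have "0 \<le> diameter K" by (rule diameter_ge_0[OF compact_imp_bounded[OF cell(3)[OF K]]])
        also have "\<dots> \<le> mesh_size \<T>" unfolding mesh_size_def using K finite_mesh by simp
        finally show ?thesis by simp
      qed
      moreover have N: "seminorm_W2 2 \<Omega> \<phi> \<le> norm_W2 2 \<Omega> \<phi>" "0 \<le> seminorm_W2 2 \<Omega> \<phi>"
        by (simp_all add: norm_W2_def norm_W1_def seminorm_W1_def seminorm_W2_def Lnorm_2_nonneg)
      moreover have "seminorm_W2 2 \<Omega> \<phi> = 0" "norm_W2 2 \<Omega> \<phi> = 0" if "\<Omega> = {}"
        using that by (simp_all add: norm_W2_def norm_W1_def seminorm_W1_def seminorm_W2_def Lnorm_2_empty)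
      ultimately show "0 \<le> mesh_size \<T> * seminorm_W2 2 \<Omega> \<phi>"
        "mesh_size \<T> * seminorm_W2 2 \<Omega> \<phi> \<le> mesh_size \<T> * norm_W2 2 \<Omega> \<phi>"
        by (cases "\<Omega> = {}"; simp add: mult_left_mono)+
    qed
    define H where "H = mesh_size \<T> * norm_W2 2 \<Omega> \<phi>"
    define W where "W = seminorm_W1 \<infinity> \<Omega> (\<lambda>x. y x - y\<^sub>h x)"
    have H: "0 \<le> H" using hm by (simp add: H_def)
    have "seminorm_W1 2 \<Omega> (\<lambda>x. \<phi> x - lagrange_interp \<Omega> \<T> \<phi> x) \<le> C1 * (mesh_size \<T> * seminorm_W2 2 \<Omega> \<phi>)"
      using C1 \<T> \<phi>W by (simp add: mult.assoc)
    also have "\<dots> \<le> C1' * (mesh_size \<T> * seminorm_W2 2 \<Omega> \<phi>)" by (rule mult_right_mono[OF C1'(1) hm(1)])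
    also have "\<dots> \<le> C1' * H" unfolding H_def by (rule mult_left_mono[OF hm(2) C1'(2)])
    finally have \<epsilon>: "seminorm_W1 2 \<Omega> (\<lambda>x. \<phi> x - lagrange_interp \<Omega> \<T> \<phi> x) \<le> C1' * H" .
    have ys: "y \<in> state_space p \<Omega> v" using sy by (simp add: state_eq_def)
    have "seminorm_W1 2 \<Omega> (\<lambda>x. \<phi> x - \<phi>\<^sub>h x) \<le> K1 * (C1' * H) + K2 * W" and W0: "0 \<le> W"
      using adjoint_error[OF R exponent data ys By Bg Y yh Gh adj dadj \<epsilon>]
      unfolding K1_def K2_def \<alpha>_def m_def W_def by blast+
    then have "seminorm_W1 2 \<Omega> (\<lambda>x. \<phi> x - \<phi>\<^sub>h x) \<le> K1 * (C1' * H) + K2 * W" by blast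
    also have "\<dots> \<le> C * H + C * W"
      using mult_right_mono[OF C(2) H] mult_right_mono[OF C(3) W0] by (simp add: mult.assoc)
    finally show "seminorm_W1 2 \<Omega> (\<lambda>x. \<phi> x - \<phi>\<^sub>h x)
        \<le> C * (mesh_size \<T> * norm_W2 2 \<Omega> \<phi> + seminorm_W1 \<infinity> \<Omega> (\<lambda>x. y x - y\<^sub>h x))"
      unfolding H_def W_def by (simp add: algebra_simps)
  qed
qed

end
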